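(* Let $k\in\mathbb{Z}_{\ge0}^{S}$ have exactly one nonzero entry, $k_\sigma=k$ for a unique $\sigma\in S$, and write $k=d\cdot q+r$ with $0\le r<q$. Let $a\in\mathcal{O}_C$. Assume that one of the following holds: (i) $k\le\frac{1}{2}q^{2}$, $r<q-d$ and $v_{F}(a)\in[0,1]$; (ii) $k\le\frac{1}{2}q^{2}$, $2v_{F}(a)-1\le r<q-d$ and $v_{F}(a)\in[1,e]$; (iii) $k\le\min\left(p\cdot q-1,\frac{1}{2}q^{2}\right)$, $d-1\le r$ and $v_{F}(a)\ge d$. Then the pair $(k,a)$ is separated.
   Context: $p$ is a prime; $F$ is a finite extension of $\mathbb{Q}_{p}$ with ring of integers $\mathcal{O}_{F}$, fixed uniformizer $\varpi$, residue field $\kappa_F$ of cardinality $q$, ramification index $e$. $C$ is a finite extension of $\mathbb{Q}_{p}$ such that $S=\mathrm{Hom}_{\mathbb{Q}_p\text{-alg}}(F,C)$ has $[F:\mathbb{Q}_{p}]$ elements and $C$ contains a fixed square root of $\sigma(\varpi)$ for each $\sigma\in S$. $v_F$ is the valuation on $\overline{\mathbb{Q}}_p$ with $v_F(\varpi)=1$. In statements about $\mathcal{O}_C$-modules, $\varpi^{n}$ ($n\in\mathbb{Z}$) means $\sigma(\varpi)^{n}$ for a fixed $\sigma\in S$. $G=GL_{2}(F)$, $K=GL_{2}(\mathcal{O}_{F})$, $Z$ the center, $\alpha=\mathrm{diag}(1,\varpi)$, $\chi(g)=\varpi^{-v_{F}(\det g)}$. For $k\in\mathbb{Z}_{\ge0}^{S}$,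 $V_{k}=\bigotimes_{\sigma\in S}V^{\sigma}_{k_\sigma}$ with $V^{\sigma}_{k_\sigma}$ the homogeneous polynomials of degree $k_\sigma$ in $x_\sigma,y_\sigma$ over $C$, where $g=\begin{pmatrix}a&b\\c&d\end{pmatrix}$ acts by $x_\sigma^{k_\sigma-i}y_\sigma^{i}\mapsto \sigma(\chi(g))^{k_\sigma/2}(\sigma(a)x_\sigma+\sigma(c)y_\sigma)^{k_\sigma-i}(\sigma(b)x_\sigma+\sigma(d)y_\sigma)^{i}$, diagonally on the tensor product (representation $\rho_k$); $V_k^0$ is the $\mathcal{O}_C$-span of tensor products of monomials. $U_k$ multiplies $\bigotimes_\sigma x_\sigma^{k_\sigma-i_\sigma}y_\sigma^{i_\sigma}$ by $\prod_\sigma\sigma(\varpi)^{k_\sigma-i_\sigma}$; $\psi:G\to\mathrm{End}_C(V_k)$ is the unique function supported on $KZ\alpha^{-1}KZ$ with $\psi(\kappa_1\alpha^{-1}\kappa_2)=\rho_k(\kappa_1)U_k\rho_k(\kappa_2)$ ($\kappa_i\in KZ$). $\mathrm{ind}_{KZ}^{G}W$ ($W=V_k$ or $V_k^0$) is the module of $f:G\to W$ with $f(\kappa g)=\rho_k(\kappa)f(g)$ for $\kappa\in KZ$, supported on finitely many cosets $KZg$; $[g,v]$ is supported on $KZg^{-1}$ with value $v$ at $g^{-1}$. The Hecke operator is $T([g,v])=\sum_{xKZ\in G/KZ}[gx,\psi(x^{-1})v]$. Supports: $I_0=\{0\}$, $I_{n}=\{\sum_{i=0}^{n-1}\varpi^{i}[\mu_{i}]:\mu_i\in\kappa_F\}$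 ($[\cdot]$ Teichmüller lift); $g_{n,\mu}^{0}=\begin{pmatrix}\varpi^{n}&\mu\\0&1\end{pmatrix}$, $g_{n,\mu}^{1}=\begin{pmatrix}1&0\\\varpi\mu&\varpi^{n+1}\end{pmatrix}$. Every $f$ is uniquely a finite sum $\sum_{n,\mu}([g^0_{n,\mu},v^0_{n,\mu}]+[g^1_{n,\mu},v^1_{n,\mu}])$. $f\in B_N$ means $v^0_{n,\mu}=0$ for $n>N$ and $v^1_{n,\mu}=0$ for $n>N-1$; $f\in B^0$ means all $v^1_{n,\mu}=0$. The pair $(k,a)$ ($a\in\mathcal{O}_C$) is separated if for all sufficiently large $N\in\mathbb{Z}_{>0}$ there is $\epsilon\in\mathbb{Z}_{\ge0}$ depending only on $N,k,a$ such that for all $n\in\mathbb{Z}_{\ge0}$ and all $f\in\mathrm{ind}_{KZ}^GV_k$ with $f\in B^0$: $(T-a)(f)\in B_N+\varpi^n\mathrm{ind}_{KZ}^GV_k^0$ implies $f\in B_{N-1}+\varpi^{n-\epsilon}\mathrm{ind}_{KZ}^GV_k^0$. *)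

theory Defs
  imports
    "HOL-Analysis.Analysis"
    "HOL-Computational_Algebra.Primes"
    "HOL-Library.Poly_Mapping"
begin

definition is_valuation :: "('a::field \<Rightarrow> ereal) \<Rightarrow> bool" where
  "is_valuation v \<longleftrightarrow>
     (\<forall>x. v x = \<infinity> \<longleftrightarrow> x = 0) \<and> (\<forall>x. v x \<noteq> - \<infinity>) \<and>
     (\<forall>x y. v (x * y) = v x + v y) \<and>
     (\<forall>x y. min (v x) (v y) \<le> v (x + y))"

definition padic_val_rat :: "nat \<Rightarrow> rat \<Rightarrow> ereal" where
  "padic_val_rat p x =
     (if x = 0 then \<infinity>
      else ereal (real (multiplicity (int p) (fst (quotient_of x)))
                - real (multiplicity (int p) (snd (quotient_of x)))))"

definition val_Cauchy :: "('a::field \<Rightarrow> ereal) \<Rightarrow> (nat \<Rightarrow> 'a) \<Rightarrow> bool" where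
  "val_Cauchy v X \<longleftrightarrow> (\<forall>B::real. \<exists>M. \<forall>m\<ge>M. \<forall>n\<ge>M. ereal B \<le> v (X m - X n))"

definition val_LIMSEQ :: "('a::field \<Rightarrow> ereal) \<Rightarrow> (nat \<Rightarrow> 'a) \<Rightarrow> 'a \<Rightarrow> bool" where
  "val_LIMSEQ v X L \<longleftrightarrow> (\<forall>B::real. \<exists>M. \<forall>n\<ge>M. ereal B \<le> v (X n - L))"

definition is_ring_hom :: "('a::ring_1 \<Rightarrow> 'b::ring_1) \<Rightarrow> bool" where
  "is_ring_hom h \<longleftrightarrow>
     h 1 = 1 \<and> (\<forall>x y. h (x + y) = h x + h y) \<and> (\<forall>x y. h (x * y) = h x * h y)"

text \<open>The type \<open>'k\<close> is the field of p-adic numbers: the completion of the rational numbers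
  for the p-adic valuation (which determines it up to unique isomorphism of valued fields).\<close>

locale padic_numbers =
  fixes p :: nat and vp :: "'k::field_char_0 \<Rightarrow> ereal"
  assumes p_prime: "prime p"
    and vp_valuation: "is_valuation vp"
    and vp_of_rat: "\<And>x::rat. vp (of_rat x) = padic_val_rat p x"
    and rat_dense: "\<And>(x::'k) (B::real). \<exists>r::rat. ereal B \<le> vp (x - of_rat r)"
    and Qp_complete: "\<And>X. val_Cauchy vp X \<Longrightarrow> \<exists>L. val_LIMSEQ vp X L"

locale finite_extension_Qp = padic_numbers p vp
  for p :: nat and vp :: "'k::field_char_0 \<Rightarrow> ereal" +
  fixes i :: "'k \<Rightarrow> 'l::field"
  assumes structure_hom: "is_ring_hom i"
    and finite_dim: "\<exists>B. finite B \<and> module.span (\<lambda>c x. i c * x) B = UNIV"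

datatype 's xy = X 's | Y 's

type_synonym ('s, 'c) xy_poly = "('s xy \<Rightarrow>\<^sub>0 nat) \<Rightarrow>\<^sub>0 'c"

definition const_poly :: "'c::zero \<Rightarrow> ('s, 'c) xy_poly" where
  "const_poly c = Poly_Mapping.single 0 c"

definition var_poly :: "'s xy \<Rightarrow> ('s, 'c::zero_neq_one) xy_poly" where
  "var_poly z = Poly_Mapping.single (Poly_Mapping.single z 1) 1"

definition mat2 :: "'a \<Rightarrow> 'a \<Rightarrow> 'a \<Rightarrow> 'a \<Rightarrow> 'a::zero^2^2" where
  "mat2 a b c d = vector [vector [a, b], vector [c, d]]"

text \<open>
  \<open>vF\<close> is the valuation of \<open>F\<close> with \<open>vF varpi = 1\<close> for the uniformizer \<open>varpi\<close>, and
  \<open>vC\<close> is the valuation of \<open>C\<close> obtained by restricting the extension of \<open>vF\<close> to an algebraic closure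
  of the p-adic numbers; it is pinned down by its restriction to the p-adic numbers, because
  valuations extend uniquely along algebraic extensions of a complete field.
  The ramification index \<open>e\<close> is \<open>vF p\<close>. \<open>sq \<sigma>\<close> is the chosen square root of \<open>\<sigma> varpi\<close>, and
  \<open>\<sigma>\<^sub>0\<close> is the embedding through which powers of \<open>varpi\<close> act on modules over the integers of \<open>C\<close>.
\<close>

locale hecke_setting =
  F: finite_extension_Qp p vp iF + C: finite_extension_Qp p vp iC
  for p :: nat and vp :: "'k::field_char_0 \<Rightarrow> ereal"
    and iF :: "'k \<Rightarrow> 'f::field" and iC :: "'k \<Rightarrow> 'c::field" +
  fixes vF :: "'f \<Rightarrow> ereal" and varpi :: 'f and e :: nat and vC :: "'c \<Rightarrow> ereal"
    and sq :: "('f \<Rightarrow> 'c) \<Rightarrow> 'c" and \<sigma>\<^sub>0 :: "'f \<Rightarrow> 'c"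
  assumes vF_valuation: "is_valuation vF"
    and vF_int: "\<And>x. x \<noteq> 0 \<Longrightarrow> \<exists>n::int. vF x = ereal (of_int n)"
    and vF_varpi: "vF varpi = 1"
    and vF_extends: "\<And>x. vF (iF x) = ereal (real e) * vp x"
    and vC_valuation: "is_valuation vC"
    and vC_extends: "\<And>x. vC (iC x) = vF (iF x)"
    and card_homs: "card {\<sigma>. is_ring_hom \<sigma> \<and> (\<forall>x. \<sigma> (iF x) = iC x)}
                      = vector_space.dim (\<lambda>c x. iF c * x) (UNIV :: 'f set)"
    and sq_square: "\<And>\<sigma>. is_ring_hom \<sigma> \<Longrightarrow> (\<And>x. \<sigma> (iF x) = iC x) \<Longrightarrow> (sq \<sigma>)\<^sup>2 = \<sigma> varpi"
    and \<sigma>\<^sub>0_hom: "is_ring_hom \<sigma>\<^sub>0" "\<And>x. \<sigma>\<^sub>0 (iF x) = iC x"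
begin

definition S :: "('f \<Rightarrow> 'c) set" where
  "S = {\<sigma>. is_ring_hom \<sigma> \<and> (\<forall>x. \<sigma> (iF x) = iC x)}"

definition OF :: "'f set" where "OF = {x. 0 \<le> vF x}"

definition OC :: "'c set" where "OC = {x. 0 \<le> vC x}"

definition ordF :: "'f \<Rightarrow> int" where
  "ordF x = (THE n. vF x = ereal (of_int n))"

definition residue_field :: "'f set set" where
  "residue_field = OF // {(x, y). x \<in> OF \<and> y \<in> OF \<and> 0 < vF (x - y)}"

definition q :: nat where "q = card residue_field"

definition teichmueller :: "'f set \<Rightarrow> 'f" where
  "teichmueller \<mu> = (THE x. x \<in> \<mu> \<and> x ^ q = x)"

definition GL2 :: "('f^2^2) set" where "GL2 = {g. invertible g}"

definition K :: "('f^2^2) set" where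
  "K = {g \<in> GL2. (\<forall>i j. g $ i $ j \<in> OF) \<and> (\<forall>i j. matrix_inv g $ i $ j \<in> OF)}"

definition Z :: "('f^2^2) set" where "Z = {mat z | z. z \<noteq> 0}"

definition KZ :: "('f^2^2) set" where "KZ = {g ** z | g z. g \<in> K \<and> z \<in> Z}"

definition \<alpha> :: "'f^2^2" where "\<alpha> = mat2 1 0 0 varpi"

text \<open>The tensor product of the spaces of homogeneous polynomials of degree \<open>k \<sigma>\<close> in
  \<open>x\<^sub>\<sigma>, y\<^sub>\<sigma>\<close> is the space of polynomials in all these variables which are homogeneous of degree
  \<open>k \<sigma>\<close> in \<open>x\<^sub>\<sigma>, y\<^sub>\<sigma>\<close> for each \<open>\<sigma> \<in> S\<close>; a tensor product of monomials is their product.\<close>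

definition V :: "(('f \<Rightarrow> 'c) \<Rightarrow> nat) \<Rightarrow> ('f \<Rightarrow> 'c, 'c) xy_poly set" where
  "V k = {P. \<forall>m \<in> Poly_Mapping.keys P. Poly_Mapping.keys m \<subseteq> X ` S \<union> Y ` S \<and>
              (\<forall>\<sigma>\<in>S. Poly_Mapping.lookup m (X \<sigma>) + Poly_Mapping.lookup m (Y \<sigma>) = k \<sigma>)}"

definition V0 :: "(('f \<Rightarrow> 'c) \<Rightarrow> nat) \<Rightarrow> ('f \<Rightarrow> 'c, 'c) xy_poly set" where
  "V0 k = {P \<in> V k. \<forall>m. Poly_Mapping.lookup P m \<in> OC}"

fun var_image :: "'f^2^2 \<Rightarrow> ('f \<Rightarrow> 'c) xy \<Rightarrow> ('f \<Rightarrow> 'c, 'c) xy_poly" where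
  "var_image g (X \<sigma>) = const_poly (\<sigma> (g $ 1 $ 1)) * var_poly (X \<sigma>)
                      + const_poly (\<sigma> (g $ 2 $ 1)) * var_poly (Y \<sigma>)"
| "var_image g (Y \<sigma>) = const_poly (\<sigma> (g $ 1 $ 2)) * var_poly (X \<sigma>)
                      + const_poly (\<sigma> (g $ 2 $ 2)) * var_poly (Y \<sigma>)"

text \<open>With \<open>\<chi> g = varpi powi (- ordF (det g))\<close>, this is the product of the
  \<open>\<sigma> (\<chi> g) ^ (k \<sigma> / 2)\<close>, formed with the chosen square roots.\<close>

definition twist :: "(('f \<Rightarrow> 'c) \<Rightarrow> nat) \<Rightarrow> 'f^2^2 \<Rightarrow> 'c" where
  "twist k g = (\<Prod>\<sigma>\<in>S. (sq \<sigma> powi (- ordF (det g))) ^ k \<sigma>)"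

definition \<rho> :: "(('f \<Rightarrow> 'c) \<Rightarrow> nat) \<Rightarrow> 'f^2^2 \<Rightarrow> ('f \<Rightarrow> 'c, 'c) xy_poly \<Rightarrow> ('f \<Rightarrow> 'c, 'c) xy_poly"
  where
  "\<rho> k g P = (\<Sum>m \<in> Poly_Mapping.keys P. const_poly (twist k g * Poly_Mapping.lookup P m) *
               (\<Prod>z \<in> Poly_Mapping.keys m. var_image g z ^ Poly_Mapping.lookup m z))"

definition U :: "('f \<Rightarrow> 'c, 'c) xy_poly \<Rightarrow> ('f \<Rightarrow> 'c, 'c) xy_poly" where
  "U = Poly_Mapping.mapp (\<lambda>m c. (\<Prod>\<sigma>\<in>S. \<sigma> varpi ^ Poly_Mapping.lookup m (X \<sigma>)) * c)"

definition \<psi> :: "(('f \<Rightarrow> 'c) \<Rightarrow> nat) \<Rightarrow> 'f^2^2 \<Rightarrow> ('f \<Rightarrow> 'c, 'c) xy_poly \<Rightarrow> ('f \<Rightarrow> 'c, 'c) xy_poly"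
  where
  "\<psi> k g v =
     (if \<exists>\<kappa>\<^sub>1\<in>KZ. \<exists>\<kappa>\<^sub>2\<in>KZ. g = \<kappa>\<^sub>1 ** matrix_inv \<alpha> ** \<kappa>\<^sub>2
      then THE w. \<exists>\<kappa>\<^sub>1\<in>KZ. \<exists>\<kappa>\<^sub>2\<in>KZ. g = \<kappa>\<^sub>1 ** matrix_inv \<alpha> ** \<kappa>\<^sub>2 \<and> w = \<rho> k \<kappa>\<^sub>1 (U (\<rho> k \<kappa>\<^sub>2 v))
      else 0)"

text \<open>Functions on \<open>GL2\<close> are extended by 0 to all matrices.\<close>

definition ind :: "(('f \<Rightarrow> 'c) \<Rightarrow> nat) \<Rightarrow> ('f \<Rightarrow> 'c, 'c) xy_poly set
                    \<Rightarrow> ('f^2^2 \<Rightarrow> ('f \<Rightarrow> 'c, 'c) xy_poly) set" where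
  "ind k W = {f. (\<forall>g\<in>GL2. f g \<in> W) \<and> (\<forall>g. g \<notin> GL2 \<longrightarrow> f g = 0) \<and>
                 (\<forall>\<kappa>\<in>KZ. \<forall>g\<in>GL2. f (\<kappa> ** g) = \<rho> k \<kappa> (f g)) \<and>
                 finite ((\<lambda>g. (\<lambda>\<kappa>. \<kappa> ** g) ` KZ) ` {g\<in>GL2. f g \<noteq> 0})}"

text \<open>\<open>elem k g v\<close> is the function \<open>[g, v]\<close>: it sends \<open>\<kappa> g\<^sup>-\<^sup>1\<close> to \<open>\<rho> k \<kappa> v\<close> for \<open>\<kappa>\<close> in \<open>KZ\<close>.\<close>

definition elem :: "(('f \<Rightarrow> 'c) \<Rightarrow> nat) \<Rightarrow> 'f^2^2 \<Rightarrow> ('f \<Rightarrow> 'c, 'c) xy_poly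
                     \<Rightarrow> 'f^2^2 \<Rightarrow> ('f \<Rightarrow> 'c, 'c) xy_poly" where
  "elem k g v = (\<lambda>h. if h ** g \<in> KZ then \<rho> k (h ** g) v else 0)"

definition cosets :: "('f^2^2) set set" where
  "cosets = (\<lambda>g. (\<lambda>\<kappa>. g ** \<kappa>) ` KZ) ` GL2"

definition coset_rep :: "('f^2^2) set \<Rightarrow> 'f^2^2" where
  "coset_rep c = (SOME x. x \<in> c)"

text \<open>The Hecke operator on \<open>[g, v]\<close>. The summand of a coset does not depend on the representative,
  and only the finitely many nonzero summands are added up.\<close>

definition hecke_elem :: "(('f \<Rightarrow> 'c) \<Rightarrow> nat) \<Rightarrow> 'f^2^2 \<Rightarrow> ('f \<Rightarrow> 'c, 'c) xy_poly
                           \<Rightarrow> 'f^2^2 \<Rightarrow> ('f \<Rightarrow> 'c, 'c) xy_poly" where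
  "hecke_elem k g v = (\<lambda>h.
     \<Sum>x \<in> coset_rep ` {c \<in> cosets. \<psi> k (matrix_inv (coset_rep c)) v \<noteq> 0}.
       elem k (g ** x) (\<psi> k (matrix_inv x) v) h)"

text \<open>The linear extension of the above, using that \<open>f\<close> is the sum of the \<open>[g, f (g\<^sup>-\<^sup>1)]\<close> over
  representatives \<open>g\<close> of the left cosets of \<open>KZ\<close>.\<close>

definition T :: "(('f \<Rightarrow> 'c) \<Rightarrow> nat) \<Rightarrow> ('f^2^2 \<Rightarrow> ('f \<Rightarrow> 'c, 'c) xy_poly)
                  \<Rightarrow> 'f^2^2 \<Rightarrow> ('f \<Rightarrow> 'c, 'c) xy_poly" where
  "T k f = (\<lambda>h. \<Sum>g \<in> coset_rep ` {c \<in> cosets. f (matrix_inv (coset_rep c)) \<noteq> 0}.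
              hecke_elem k g (f (matrix_inv g)) h)"

definition I :: "nat \<Rightarrow> 'f set" where
  "I n = {\<Sum>i<n. varpi ^ i * teichmueller (\<mu> i) | \<mu>. \<forall>i<n. \<mu> i \<in> residue_field}"

definition g0 :: "nat \<Rightarrow> 'f \<Rightarrow> 'f^2^2" where "g0 n \<mu> = mat2 (varpi ^ n) \<mu> 0 1"

definition g1 :: "nat \<Rightarrow> 'f \<Rightarrow> 'f^2^2" where "g1 n \<mu> = mat2 1 0 (varpi * \<mu>) (varpi ^ (n + 1))"

definition decomposition :: "(('f \<Rightarrow> 'c) \<Rightarrow> nat) \<Rightarrow> ('f^2^2 \<Rightarrow> ('f \<Rightarrow> 'c, 'c) xy_poly)
    \<Rightarrow> (nat \<Rightarrow> 'f \<Rightarrow> ('f \<Rightarrow> 'c, 'c) xy_poly) \<Rightarrow> (nat \<Rightarrow> 'f \<Rightarrow> ('f \<Rightarrow> 'c, 'c) xy_poly) \<Rightarrow> bool" where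
  "decomposition k f v0 v1 \<longleftrightarrow>
     (\<forall>n \<mu>. v0 n \<mu> \<in> V k \<and> v1 n \<mu> \<in> V k) \<and>
     (\<forall>n \<mu>. \<mu> \<notin> I n \<longrightarrow> v0 n \<mu> = 0 \<and> v1 n \<mu> = 0) \<and>
     finite {(n, \<mu>). v0 n \<mu> \<noteq> 0} \<and> finite {(n, \<mu>). v1 n \<mu> \<noteq> 0} \<and>
     f = (\<lambda>h. (\<Sum>(n, \<mu>) \<in> {(n, \<mu>). v0 n \<mu> \<noteq> 0}. elem k (g0 n \<mu>) (v0 n \<mu>) h)
            + (\<Sum>(n, \<mu>) \<in> {(n, \<mu>). v1 n \<mu> \<noteq> 0}. elem k (g1 n \<mu>) (v1 n \<mu>) h))"

text \<open>In \<open>B\<close>, \<open>n \<ge> N\<close> is \<open>n > N - 1\<close> without truncated subtraction.\<close>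

definition B :: "(('f \<Rightarrow> 'c) \<Rightarrow> nat) \<Rightarrow> nat \<Rightarrow> ('f^2^2 \<Rightarrow> ('f \<Rightarrow> 'c, 'c) xy_poly) set" where
  "B k N = {f \<in> ind k (V k). \<exists>v0 v1. decomposition k f v0 v1 \<and>
              (\<forall>n \<mu>. n > N \<longrightarrow> v0 n \<mu> = 0) \<and> (\<forall>n \<mu>. n \<ge> N \<longrightarrow> v1 n \<mu> = 0)}"

definition B_zero :: "(('f \<Rightarrow> 'c) \<Rightarrow> nat) \<Rightarrow> ('f^2^2 \<Rightarrow> ('f \<Rightarrow> 'c, 'c) xy_poly) set" where
  "B_zero k = {f \<in> ind k (V k). \<exists>v0 v1. decomposition k f v0 v1 \<and> (\<forall>n \<mu>. v1 n \<mu> = 0)}"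

definition B_plus_lattice ::
    "(('f \<Rightarrow> 'c) \<Rightarrow> nat) \<Rightarrow> nat \<Rightarrow> int \<Rightarrow> ('f^2^2 \<Rightarrow> ('f \<Rightarrow> 'c, 'c) xy_poly) set" where
  "B_plus_lattice k N n =
     {(\<lambda>h. f1 h + const_poly (\<sigma>\<^sub>0 varpi powi n) * f2 h) | f1 f2. f1 \<in> B k N \<and> f2 \<in> ind k (V0 k)}"

definition separated :: "(('f \<Rightarrow> 'c) \<Rightarrow> nat) \<Rightarrow> 'c \<Rightarrow> bool" where
  "separated k a \<longleftrightarrow>
     (\<exists>N0. \<forall>N>0. N \<ge> N0 \<longrightarrow>
        (\<exists>\<epsilon>::nat. \<forall>n::nat. \<forall>f \<in> ind k (V k). f \<in> B_zero k \<longrightarrow>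
           (\<lambda>h. T k f h - const_poly a * f h) \<in> B_plus_lattice k N (int n) \<longrightarrow>
           f \<in> B_plus_lattice k (N - 1) (int n - int \<epsilon>)))"

end

end

theory Submission
  imports Defs "HOL-Computational_Algebra.Polynomial"
begin

text \<open>
  Evaluating \<open>f \<in> B_zero ks\<close> at the inverses of the matrices \<open>g0 m \<mu>\<close> gives a finitely supported family of
  vectors on a rooted \<open>q\<close>-ary tree. Write these vectors as polynomials \<open>P(y)\<close> of degree at most \<open>k\<close>
  and \<open>\<pi>\<close>, \<open>\<xi>\<close>, \<open>\<xi>'\<close> for the images of the uniformizer and of Teichmueller digits. At a vertex \<open>w\<close> that is
  the child number \<open>\<xi>\<close> of \<open>v\<close> and has the children \<open>u \<xi>'\<close>, the operator \<open>T - a\<close> is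
  \<open>P\<^sub>v(\<xi> + \<pi> y) + (\<Sum>\<xi>'. \<pi>\<^sup>k P\<^sub>u((y - \<xi>') / \<pi>)) - a P\<^sub>w(y)\<close>.
  If this is divisible by \<open>\<pi>\<^sup>n\<close> at all vertices above some level, a descent from the leaves to the root bounds
  the denominators of all \<open>\<pi>\<^sup>-\<^sup>n P\<close> by \<open>2 k + 2\<close>.

  For cases (i) and (ii) expand \<open>P = (\<Sum>j\<le>d. \<Phi>\<^sup>j R\<^sub>j)\<close> with \<open>\<Phi> = y\<^sup>q - y\<close>. As \<open>\<Phi>(\<xi> + \<pi> y)\<close> is \<open>- \<pi> y\<close> modulo
  \<open>\<pi>\<^sup>2\<close>, the parent's term determines the values of the \<open>R\<^sub>j\<close> at the digits, hence the \<open>R\<^sub>j\<close>, while in the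
  children's terms only the top \<open>r + 1\<close> coefficients matter, and their contributions to the various
  \<open>\<Phi>\<close>-digits are related by binomial identities. The weights \<open>k = d q\<close> need separate steps.
  In case (iii) the power sums of Teichmueller digits are periodic, so that the coefficients of high degree,
  where the parent's term is small, control the sums over the children in low degree.
\<close>

section \<open>Valued fields\<close>

text \<open>The loss must not grow along the tree, although each division by \<open>a\<close> costs
  \<open>v a\<close>. The descent therefore carries an invariant of two consecutive levels that
  every step reproduces with the same constants, and the numerical hypotheses say which terms are
  negligible modulo \<open>\<pi> ^ n\<close>. From \<open>k \<le> q^2 / 2\<close> follows
  \<open>2 d \<le> q\<close>, so that in cases (i) and (ii) the parent's term vanishes in degrees
  \<open>\<ge> q\<close>; there the children are compared with \<open>a P_w\<close> alone.
  \<open>r + d < q\<close> keeps the children's contributions below degree \<open>q\<close>, so that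
  they are genuine \<open>\<Phi>\<close>-digits. The binomial congruences hold modulo
  \<open>p\<close>, whose valuation \<open>e\<close> absorbs the loss \<open>v a \<le> e\<close>.
  \<open>2 v a - 1 \<le> r\<close> removes all but the top \<open>r + 1\<close> coefficients of the
  children of \<open>w\<close>. The general step also needs \<open>v a \<le> r\<close>; when
  \<open>r = 0\<close> this fails for \<open>v a > 0\<close>, and the leading coefficients are then
  controlled by relations across levels. In case (iii) \<open>a P_w\<close> itself is negligible,
  and \<open>d < p\<close> makes the binomial coefficients \<open>d choose l\<close> with
  \<open>l \<le> d\<close> units.\<close>

lemma smult_sum_right: "smult c (sum f A) = (\<Sum>i\<in>A. smult c (f i))"
  by (induction A rule: infinite_finite_induct) (simp_all add: smult_add_right)

locale valued_field =
  fixes v :: "'c::field \<Rightarrow> ereal"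
  assumes valuation: "is_valuation v"
begin

text \<open>Real exponents are used because \<open>v a\<close> may be a fraction; comparing in
  \<open>ereal\<close> lets zero satisfy every bound.\<close>

definition vge :: "real \<Rightarrow> 'c \<Rightarrow> bool" where
  "vge t x \<longleftrightarrow> ereal t \<le> v x"

lemma v_eq_infinity_iff: "v x = \<infinity> \<longleftrightarrow> x = 0"
  and v_not_minf: "v x \<noteq> -\<infinity>"
  and v_mult: "v (x * y) = v x + v y"
  and v_add: "min (v x) (v y) \<le> v (x + y)"
  using valuation unfolding is_valuation_def by blast+

lemma v_finite: "x \<noteq> 0 \<Longrightarrow> \<exists>s. v x = ereal s"
  using v_eq_infinity_iff[of x] v_not_minf[of x] by (cases "v x") auto

lemma v_1 [simp]: "v 1 = 0"
proof -
  obtain s where s: "v 1 = ereal s" using v_finite[of 1] by auto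
  then show ?thesis using v_mult[of 1 1] by (simp add: zero_ereal_def)
qed

lemma v_minus [simp]: "v (- x) = v x"
proof -
  obtain s where s: "v (-1) = ereal s" using v_finite[of "-1"] by auto
  have "v ((-1) * (-1)) = 0" by simp
  then have "s = 0" unfolding v_mult s by (simp add: zero_ereal_def)
  then show ?thesis using v_mult[of "-1" x] s by simp
qed

lemma v_power: "v x = ereal s \<Longrightarrow> v (x ^ n) = ereal (real n * s)"
  by (induction n) (auto simp: v_mult zero_ereal_def distrib_right)

lemma v_inverse: "v x = ereal s \<Longrightarrow> v (inverse x) = ereal (- s)"
proof -
  assume s: "v x = ereal s"
  then have x: "x \<noteq> 0" using v_eq_infinity_iff[of x] by auto
  obtain t where t: "v (inverse x) = ereal t" using v_finite x by (metis inverse_nonzero_iff_nonzero)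
  have "v (x * inverse x) = 0" using x by simp
  then show ?thesis unfolding v_mult s t by (simp add: zero_ereal_def)
qed

lemma vge_0 [simp, intro]: "vge t 0"
  using v_eq_infinity_iff[of 0] by (simp add: vge_def)

lemma vge_1 [simp]: "vge 0 1" by (simp add: vge_def zero_ereal_def)

lemma vge_mono: "vge t x \<Longrightarrow> s \<le> t \<Longrightarrow> vge s x"
  unfolding vge_def by (meson ereal_less_eq(3) order_trans)

lemma vge_add: "vge t x \<Longrightarrow> vge t y \<Longrightarrow> vge t (x + y)"
  using v_add[of x y] unfolding vge_def by (meson min.boundedI order_trans)

lemma vge_minus [simp]: "vge t (- x) \<longleftrightarrow> vge t x"
  by (simp add: vge_def)

lemma vge_diff: "vge t x \<Longrightarrow> vge t y \<Longrightarrow> vge t (x - y)"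
  using vge_add[of t x "- y"] by simp

lemma vge_diff_commute: "vge t (x - y) \<longleftrightarrow> vge t (y - x)"
  by (metis minus_diff_eq vge_minus)

lemma vge_sum: "(\<And>i. i \<in> A \<Longrightarrow> vge t (f i)) \<Longrightarrow> vge t (sum f A)"
  by (induction A rule: infinite_finite_induct) (auto intro: vge_add)

lemma vge_mult: "vge s x \<Longrightarrow> vge t y \<Longrightarrow> vge (s + t) (x * y)"
  unfolding vge_def v_mult by (metis add_mono plus_ereal.simps(1))

lemma vge_mult': "vge s x \<Longrightarrow> vge t y \<Longrightarrow> u \<le> s + t \<Longrightarrow> vge u (x * y)"
  using vge_mult vge_mono by blast

lemma vge_mult_int: "vge 0 x \<Longrightarrow> vge t y \<Longrightarrow> vge t (x * y)"
  using vge_mult[of 0 x t y] by simp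

lemma vge_power_int: "vge 0 x \<Longrightarrow> vge 0 (x ^ n)"
  by (induction n) (auto intro: vge_mult_int)

lemma vge_of_nat [simp]: "vge 0 (of_nat n)"
  by (induction n) (auto intro: vge_add)

lemma vge_of_int [simp]: "vge 0 (of_int n)"
proof (cases n)
  case (neg m)
  then have "(of_int n :: 'c) = - of_nat (Suc m)" by simp
  then show ?thesis by (metis vge_minus vge_of_nat)
qed auto

lemma vge_iff_0: "x = 0 \<longleftrightarrow> (\<forall>t. vge t x)"
proof
  assume *: "\<forall>t. vge t x"
  show "x = 0"
  proof (rule ccontr)
    assume "x \<noteq> 0"
    then obtain s where "v x = ereal s" using v_finite by blast
    then show False using *[rule_format, of "s + 1"] by (simp add: vge_def)
  qed
qed simp

lemma vge_cancel: "v u = ereal s \<Longrightarrow> vge t (u * x) \<longleftrightarrow> vge (t - s) x"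
  by (cases "v x") (auto simp: vge_def v_mult)

lemma v_add_eq: "v x = ereal s \<Longrightarrow> vge t y \<Longrightarrow> s < t \<Longrightarrow> v (x + y) = ereal s"
proof -
  assume a: "v x = ereal s" "vge t y" "s < t"
  have "vge s (x + y)" using a by (intro vge_add vge_mono[OF a(2)]) (auto simp: vge_def)
  \<comment> \<open>If the sum had larger value, so would \<open>x = (x + y) - y\<close>.\<close>
  moreover have "\<not> ereal s < v (x + y)"
  proof
    assume "ereal s < v (x + y)"
    then obtain u where u: "ereal s < ereal u" "ereal u \<le> v (x + y)"
      by (meson ereal_dense2 less_imp_le)
    have "vge (min t u) ((x + y) - y)"
      using u by (intro vge_diff vge_mono[OF a(2)]) (auto simp: vge_def min_le_iff_disj
          intro: order_trans[OF _ u(2)])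
    then show False using a u by (auto simp: vge_def min_def split: if_splits)
  qed
  ultimately show ?thesis by (simp add: vge_def)
qed

lemma ex_vge: "\<exists>t. vge t x"
proof (cases "x = 0")
  case False
  then show ?thesis using v_finite[of x] by (auto simp: vge_def)
qed auto

lemma ex_vge_finite: "finite A \<Longrightarrow> \<exists>t. \<forall>x\<in>A. vge t (f x)"
proof (induction A rule: finite_induct)
  case (insert x A)
  then obtain t where "\<forall>x\<in>A. vge t (f x)" by blast
  moreover obtain s where "vge s (f x)" using ex_vge by blast
  ultimately have "\<forall>y\<in>insert x A. vge (min s t) (f y)" by (auto intro: vge_mono)
  then show ?case by blast
qed simp

section \<open>The Gauss valuation on polynomials\<close>

definition pge :: "real \<Rightarrow> 'c poly \<Rightarrow> bool" where
  "pge t P \<longleftrightarrow> (\<forall>i. vge t (coeff P i))"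

lemma pgeD: "pge t P \<Longrightarrow> vge t (coeff P i)" by (simp add: pge_def)

lemma pge_0 [simp]: "pge t 0" by (simp add: pge_def)

lemma pge_mono: "pge t P \<Longrightarrow> s \<le> t \<Longrightarrow> pge s P"
  by (auto simp: pge_def intro: vge_mono)

lemma pge_add: "pge t P \<Longrightarrow> pge t Q \<Longrightarrow> pge t (P + Q)"
  by (auto simp: pge_def intro: vge_add)

lemma pge_diff: "pge t P \<Longrightarrow> pge t Q \<Longrightarrow> pge t (P - Q)"
  by (auto simp: pge_def intro: vge_diff)

lemma pge_minus [simp]: "pge t (- P) \<longleftrightarrow> pge t P"
  by (auto simp: pge_def)

lemma pge_sum: "(\<And>i. i \<in> A \<Longrightarrow> pge t (f i)) \<Longrightarrow> pge t (sum f A)"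
  by (induction A rule: infinite_finite_induct) (auto intro: pge_add)

lemma pge_smult: "vge s c \<Longrightarrow> pge t P \<Longrightarrow> u \<le> s + t \<Longrightarrow> pge u (smult c P)"
  by (auto simp: pge_def intro: vge_mult')

lemma pge_mult: "pge s P \<Longrightarrow> pge t Q \<Longrightarrow> u \<le> s + t \<Longrightarrow> pge u (P * Q)"
  by (auto simp: pge_def coeff_mult intro!: vge_sum intro: vge_mult')

lemma pge_pCons [simp]: "pge t (pCons c P) \<longleftrightarrow> vge t c \<and> pge t P"
  by (auto simp: pge_def coeff_pCons split: nat.splits)

lemma pge_1 [simp]: "pge 0 1"
  by (simp add: one_pCons)

lemma pge_power: "pge s P \<Longrightarrow> pge (real n * s) (P ^ n)"
  by (induction n) (auto intro!: pge_mult simp: algebra_simps)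

lemma pge_power_int: "pge 0 P \<Longrightarrow> pge 0 (P ^ n)"
  using pge_power[of 0 P n] by simp

lemma pge_monom: "vge t c \<Longrightarrow> pge t (monom c n)"
  by (auto simp: pge_def)

lemma ex_pge: "\<exists>t. pge t P"
proof -
  obtain t where t: "\<forall>i\<in>{..degree P}. vge t (coeff P i)" using ex_vge_finite[of "{..degree P}"] by blast
  have "vge t (coeff P i)" for i using t by (cases "i \<le> degree P") (auto simp: coeff_eq_0)
  then show ?thesis by (auto simp: pge_def)
qed

text \<open>\<open>wge t\<close> describes the lattice of polynomials in \<open>\<pi> y\<close>.\<close>

definition wge :: "real \<Rightarrow> 'c poly \<Rightarrow> bool" where
  "wge t P \<longleftrightarrow> (\<forall>i. vge (t + real i) (coeff P i))"

lemma wgeD: "wge t P \<Longrightarrow> vge (t + real i) (coeff P i)" by (simp add: wge_def)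

lemma wge_0 [simp]: "wge t 0" by (simp add: wge_def)

lemma wge_add: "wge t P \<Longrightarrow> wge t Q \<Longrightarrow> wge t (P + Q)"
  by (auto simp: wge_def intro: vge_add)

lemma wge_mult: "wge s P \<Longrightarrow> wge t Q \<Longrightarrow> wge (s + t) (P * Q)"
  unfolding wge_def coeff_mult
proof (intro allI vge_sum)
  fix i j :: nat assume *: "\<forall>i. vge (s + real i) (coeff P i)" "\<forall>i. vge (t + real i) (coeff Q i)" "j \<in> {..i}"
  then show "vge (s + t + real i) (coeff P j * coeff Q (i - j))"
    by (intro vge_mult'[OF *(1)[rule_format] *(2)[rule_format]]) simp
qed

lemma wge_imp_pge: "wge t P \<Longrightarrow> pge t P"
  by (auto simp: wge_def pge_def intro: vge_mono)

text \<open>Newton interpolation: the differences of the nodes are units, so synthetic division by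
  \<open>x - a\<close> passes the bound on to the values of the quotient without loss.\<close>

lemma pge_lagrange:
  assumes "finite A" "degree R < card A" "\<And>x. x \<in> A \<Longrightarrow> vge t (poly R x)"
    "\<And>x. x \<in> A \<Longrightarrow> vge 0 x" "\<And>x y. x \<in> A \<Longrightarrow> y \<in> A \<Longrightarrow> x \<noteq> y \<Longrightarrow> v (x - y) = 0"
  shows "pge t R"
  using assms
proof (induction A arbitrary: R rule: finite_induct)
  case (insert a A)
  define R' where "R' = synthetic_div R a"
  have R: "R = [:-a, 1:] * R' + [:poly R a:]"
    using synthetic_div_correct'[of a R] by (simp add: R'_def)
  have a: "vge t (poly R a)" "vge 0 a" using insert by auto
  show ?case
  proof (cases "A = {}")
    case True
    then have "degree R = 0" using insert by simp
    then obtain c where "R = [:c:]" by (metis degree_eq_zeroE)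
    then show ?thesis using a by simp
  next
    case False
    then have cA: "0 < card A" using insert by (simp add: card_gt_0_iff)
    have "pge t R'"
    proof (rule insert.IH)
      show "degree R' < card A" using insert cA by (simp add: R'_def degree_synthetic_div)
      fix x assume x: "x \<in> A"
      have "poly R x = (x - a) * poly R' x + poly R a" by (subst R) (simp add: algebra_simps)
      then have "(x - a) * poly R' x = poly R x - poly R a" by simp
      moreover have "vge t (poly R x - poly R a)" using insert x by (intro vge_diff) auto
      moreover have "v (x - a) = ereal 0" using insert x by (metis insert_iff zero_ereal_def)
      ultimately show "vge t (poly R' x)" using vge_cancel[of "x - a" 0 t] by (metis diff_zero)
    qed (use insert in auto)
    then have "pge t ([:-a, 1:] * R' + [:poly R a:])"
      using a by (intro pge_add pge_mult[of 0 _ t]) auto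
    then show ?thesis using R by simp
  qed
qed auto

end

section \<open>Polynomials over a field with Teichmueller digits\<close>

text \<open>\<open>\<pi>\<close> and \<open>\<Lambda>\<close> are the images of the uniformizer and
  of the Teichmueller digits under one embedding. The last two assumptions are instances of
  \<open>u ^ q = u\<close> modulo \<open>\<pi>\<close>; they yield that \<open>p\<close> divides the
  inner binomial coefficients \<open>q choose i\<close>, and that \<open>(- 1) ^ q = - 1\<close>
  modulo \<open>p\<close>.\<close>

locale digit_field = valued_field v
  for v :: "'c::field \<Rightarrow> ereal" +
  fixes p q e :: nat and \<pi> :: 'c and \<Lambda> :: "'c set"
  assumes p_prime: "prime p"
    and v_\<pi>: "v \<pi> = 1"
    and v_p: "v (of_nat p) = ereal (real e)"
    and e_ge_1: "1 \<le> e"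
    and finite_\<Lambda>: "finite \<Lambda>"
    and card_\<Lambda>: "card \<Lambda> = q"
    and q_ge_2: "2 \<le> q"
    and \<Lambda>_power: "\<xi> \<in> \<Lambda> \<Longrightarrow> \<xi> ^ q = \<xi>"
    and \<Lambda>_sep: "\<xi> \<in> \<Lambda> \<Longrightarrow> \<mu> \<in> \<Lambda> \<Longrightarrow> \<xi> \<noteq> \<mu> \<Longrightarrow> v (\<xi> - \<mu>) = 0"
    and \<Lambda>_shift: "\<xi> \<in> \<Lambda> \<Longrightarrow> vge 1 ((\<xi> + 1) ^ q - (\<xi> + 1))"
    and minus_one_power: "vge 1 ((- 1) ^ q + 1)"
begin

lemma \<pi>_nonzero [simp]: "\<pi> \<noteq> 0"
  using v_\<pi> v_eq_infinity_iff[of \<pi>] by auto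

lemma v_\<pi>_power: "v (\<pi> ^ n) = ereal (real n)"
  using v_power[of \<pi> 1 n] v_\<pi> by (simp add: one_ereal_def)

lemma vge_\<pi>_power: "t \<le> real n \<Longrightarrow> vge t (\<pi> ^ n)"
  by (simp add: vge_def v_\<pi>_power)

lemma vge_\<pi>: "t \<le> 1 \<Longrightarrow> vge t \<pi>"
  using vge_\<pi>_power[of t 1] by simp

lemma vge_\<pi>_cancel: "vge t (\<pi> ^ n * x) \<longleftrightarrow> vge (t - real n) x"
  by (rule vge_cancel[OF v_\<pi>_power])

lemma vge_minus_\<pi>_cancel: "vge t ((- \<pi>) ^ n * x) \<longleftrightarrow> vge (t - real n) x"
proof -
  have "v ((- \<pi>) ^ n) = ereal (real n)" using v_power[of "- \<pi>" 1 n] v_\<pi> by (simp add: one_ereal_def)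
  then show ?thesis by (rule vge_cancel)
qed

lemma vge_p: "vge (real e) (of_nat p)"
  by (simp add: vge_def v_p)

lemma \<Lambda>_int: assumes "\<xi> \<in> \<Lambda>" shows "vge 0 \<xi>"
proof (cases "\<xi> = 0")
  case False
  then obtain s where s: "v \<xi> = ereal s" using v_finite by blast
  then have "ereal (real q * s) = ereal s" using v_power[OF s, of q] \<Lambda>_power[OF assms] by simp
  then have "s = 0" using q_ge_2 by (simp add: mult_eq_if)
  then show ?thesis using s by (simp add: vge_def)
qed auto

lemma v_of_nat_unit: assumes "\<not> p dvd n" shows "v (of_nat n) = 0"
proof -
  have "coprime (int p) (int n)" using assms p_prime by (simp add: prime_imp_coprime)
  then obtain a b where ab: "a * int p + b * int n = 1"
    using bezout_int[of "int p" "int n"] by (metis coprime_imp_gcd_eq_1)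
  have "(of_int (a * int p + b * int n) :: 'c) = 1" by (simp only: ab) simp
  then have one: "of_int a * of_nat p + of_int b * of_nat n = (1 :: 'c)" by simp
  have n0: "(of_nat n :: 'c) \<noteq> 0"
  proof
    assume "(of_nat n :: 'c) = 0"
    then have "vge 1 (1 :: 'c)" using one e_ge_1
      by (metis add.right_neutral mult_zero_right v_p vge_def vge_mult_int vge_mono vge_of_int ereal_less_eq(3)
          of_nat_1 of_nat_mono order_refl)
    then show False by (simp add: vge_def one_ereal_def[symmetric])
  qed
  then obtain s where s: "v (of_nat n) = ereal s" using v_finite by blast
  have s0: "0 \<le> s" using vge_of_nat[of n] s by (simp add: vge_def)
  have "vge (min 1 s) (of_int a * of_nat p + of_int b * of_nat n)"
    using s e_ge_1 by (intro vge_add vge_mult_int vge_of_int vge_mono[OF vge_p]) (auto simp: vge_def)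
  then have "s \<le> 0" using one by (auto simp: vge_def min_def zero_ereal_def split: if_splits)
  then show ?thesis using s s0 by (simp add: zero_ereal_def)
qed

lemma dvd_if_vge: "vge 1 (of_nat n) \<Longrightarrow> p dvd n"
  by (rule ccontr) (use v_of_nat_unit[of n] in \<open>simp add: vge_def\<close>)

lemma vge_of_int_dvd: "int p dvd m \<Longrightarrow> vge (real e) (of_int m)"
proof -
  assume "int p dvd m"
  then obtain c where "m = c * int p" by (metis dvdE mult.commute)
  moreover have "vge (real e) (of_int c * of_nat p)" by (intro vge_mult_int vge_p) simp
  ultimately show ?thesis by simp
qed

lemma vge_of_nat_dvd: "p dvd m \<Longrightarrow> vge (real e) (of_nat m)"
  using vge_of_int_dvd[of "int m"] by simp

text \<open>\<open>(x + 1) ^ q - x ^ q - 1\<close> has degree below \<open>q\<close>, and at each of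
  the \<open>q\<close> digits it equals \<open>(x + 1) ^ q - (x + 1)\<close>, which is divisible by
  \<open>\<pi>\<close>. By interpolation its coefficients are divisible by \<open>\<pi>\<close>, and
  being integers also by \<open>p\<close>.\<close>

lemma p_dvd_choose: assumes "0 < i" "i < q" shows "p dvd (q choose i)"
proof -
  define R where "R = (\<Sum>i\<in>{1..<q}. monom (of_nat (q choose i) :: 'c) i)"
  have cR: "coeff R j = (if j \<in> {1..<q} then of_nat (q choose j) else 0)" for j
    by (auto simp: R_def coeff_sum)
  have "degree R \<le> q - 1" by (rule degree_le) (auto simp: cR)
  then have deg: "degree R < card \<Lambda>" using card_\<Lambda> q_ge_2 by linarith
  have "pge 1 R"
  proof (rule pge_lagrange[OF finite_\<Lambda> deg])
    fix x assume x: "x \<in> \<Lambda>"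
    have "{..q} = {0} \<union> {1..<q} \<union> {q}" using q_ge_2 by auto
    then have "(x + 1) ^ q = 1 + (\<Sum>i\<in>{1..<q}. of_nat (q choose i) * x ^ i) + x ^ q"
      using q_ge_2 unfolding binomial_ring by (subst \<open>{..q} = _\<close>, subst sum.union_disjoint) auto
    then have "poly R x = (x + 1) ^ q - (x + 1)"
      using \<Lambda>_power[OF x] by (simp add: R_def poly_sum poly_monom)
    then show "vge 1 (poly R x)" using \<Lambda>_shift[OF x] by simp
  qed (auto intro: \<Lambda>_int \<Lambda>_sep)
  from pgeD[OF this, of i] show ?thesis using assms by (intro dvd_if_vge) (simp add: cR)
qed

lemma p_dvd_q: "p dvd q"
  using p_dvd_choose[of 1] q_ge_2 by simp

lemma p_le_q: "p \<le> q"
  using p_dvd_q q_ge_2 by (intro dvd_imp_le) auto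

lemma vge_q: "vge (real e) (of_nat q)"
  by (rule vge_of_nat_dvd[OF p_dvd_q])

text \<open>For even \<open>q\<close> the assumption says that \<open>\<pi>\<close> divides 2. Then
  \<open>p\<close> divides 2, which sharpens the exponent from 1 to \<open>e\<close>.\<close>

lemma vge_minus_one: "vge (real e) ((- 1) ^ q + 1)"
proof (cases "even q")
  case True
  then have "vge 1 (of_nat 2)" using minus_one_power by simp
  then have "p dvd 2" by (rule dvd_if_vge)
  from vge_of_nat_dvd[OF this] True show ?thesis by simp
qed simp

text \<open>Modulo \<open>p\<close> the polynomial \<open>(1 + x) ^ q\<close> is
  \<open>1 + x ^ q\<close>. The induction multiplies by this factor: only the extreme terms of the
  Vandermonde sum survive.\<close>

lemma lucas:
  assumes "t < q" "i < q"
  shows "int p dvd int ((d * q + t) choose (l * q + i)) - int ((d choose l) * (t choose i))"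
proof (induction d arbitrary: l)
  case 0
  show ?case using assms q_ge_2 by (cases l) (auto simp: binomial_eq_0)
next
  case (Suc d)
  define N where "N = l * q + i"
  let ?C = "\<lambda>j. int (d * q + t choose j)"
  have "Suc d * q + t = q + (d * q + t)" by simp
  then have "int (Suc d * q + t choose N) = (\<Sum>j\<le>N. int (q choose j) * ?C (N - j))"
    using vandermonde[of q "d * q + t" N] by (simp only: flip: of_nat_mult of_nat_sum)
  moreover have "int p dvd (\<Sum>j\<le>N. int (q choose j) * ?C (N - j))
      - (\<Sum>j\<le>N. (if j = 0 \<or> j = q then ?C (N - j) else 0))"
    unfolding sum_subtractf[symmetric]
  proof (rule dvd_sum)
    fix j
    show "int p dvd int (q choose j) * ?C (N - j) - (if j = 0 \<or> j = q then ?C (N - j) else 0)"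
    proof (cases "0 < j \<and> j < q")
      case True
      then show ?thesis using p_dvd_choose[of j] by auto
    next
      case False
      then show ?thesis by (cases "j = 0"; cases "j = q") (auto simp: binomial_eq_0)
    qed
  qed
  moreover have "(\<Sum>j\<le>N. (if j = 0 \<or> j = q then ?C (N - j) else 0)) = ?C N + (if q \<le> N then ?C (N - q) else 0)"
  proof -
    have "(\<Sum>j\<le>N. (if j = 0 \<or> j = q then ?C (N - j) else 0))
       = (\<Sum>j\<le>N. (if j = 0 then ?C (N - j) else 0) + (if j = q then ?C (N - j) else 0))"
      using q_ge_2 by (intro sum.cong) auto
    then show ?thesis by (simp add: sum.distrib)
  qed
  ultimately have 1: "int p dvd int (Suc d * q + t choose N) - (?C N + (if q \<le> N then ?C (N - q) else 0))"
    by simp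
  have 2: "int p dvd ?C N - int ((d choose l) * (t choose i))" unfolding N_def by (rule Suc.IH)
  show ?case
  proof (cases l)
    case 0
    then show ?thesis using dvd_add[OF 1 2] assms by (simp add: N_def)
  next
    case (Suc l')
    have "N - q = l' * q + i" "q \<le> N" using Suc by (auto simp: N_def)
    then have "int p dvd ?C (N - q) - int ((d choose l') * (t choose i))" using Suc.IH[of l'] by simp
    from dvd_add[OF dvd_add[OF 1 2] this] show ?thesis using Suc \<open>q \<le> N\<close>
      by (simp add: N_def algebra_simps)
  qed
qed

lemma coeff_linear_power_le:
  "coeff ([:a, b:] ^ n) i = (of_nat (n choose i) * b ^ i * a ^ (n - i) :: 'c)"
proof (cases "i \<le> n")
  case False
  have "degree ([:a, b:] ^ n) \<le> 1 * n" by (rule order_trans[OF degree_power_le]) simp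
  then show ?thesis using False by (simp add: coeff_eq_0 binomial_eq_0)
qed (simp add: coeff_linear_poly_power)

section \<open>The polynomial \<open>y ^ q - y\<close> and the parent's substitution\<close>

definition \<Phi> :: "'c poly" where "\<Phi> = monom 1 q - monom 1 1"

lemma coeff_\<Phi>: "coeff \<Phi> i = (if i = q then 1 else 0) - (if i = 1 then 1 else 0)"
  by (simp add: \<Phi>_def)

lemma degree_\<Phi>: "degree \<Phi> = q"
  using q_ge_2 by (intro antisym degree_le le_degree) (auto simp: coeff_\<Phi>)

lemma \<Phi>_nonzero [simp]: "\<Phi> \<noteq> 0" using degree_\<Phi> q_ge_2 by auto

lemma monic_\<Phi>: "lead_coeff \<Phi> = 1" using q_ge_2 by (simp add: degree_\<Phi> coeff_\<Phi>)

lemma pge_\<Phi>: "pge 0 \<Phi>" by (auto simp: pge_def coeff_\<Phi>)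

lemma poly_\<Phi>: "\<xi> \<in> \<Lambda> \<Longrightarrow> poly \<Phi> \<xi> = 0" by (simp add: \<Phi>_def poly_monom \<Lambda>_power)

text \<open>Modulo \<open>p\<close> the power is
  \<open>y ^ q + (- \<xi>) ^ q = y ^ q - \<xi>\<close>, and this is
  \<open>\<Phi> + (y - \<xi>)\<close>.\<close>

lemma frobenius_linear: assumes "\<xi> \<in> \<Lambda>"
  shows "pge (real e) ([:-\<xi>, 1:] ^ q - (\<Phi> + [:-\<xi>, 1:]))"
  unfolding pge_def
proof
  fix i
  consider "i = 0" | "0 < i" "i < q" | "i = q" | "i > q" by linarith
  then show "vge (real e) (coeff ([:-\<xi>, 1:] ^ q - (\<Phi> + [:-\<xi>, 1:])) i)"
  proof cases
    case 1
    have "(- \<xi>) ^ q + \<xi> = \<xi> * ((- 1) ^ q + 1)"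
      using \<Lambda>_power[OF assms] by (simp add: power_minus[of \<xi>] algebra_simps)
    moreover have "vge (real e) (\<xi> * ((- 1) ^ q + 1))" by (intro vge_mult_int \<Lambda>_int assms vge_minus_one)
    ultimately show ?thesis using 1 q_ge_2 by (simp add: coeff_linear_power_le coeff_\<Phi>)
  next
    case 2
    have "vge (real e) ((- \<xi>) ^ (q - i) * of_nat (q choose i))"
      using 2 by (intro vge_mult_int vge_power_int vge_of_nat_dvd p_dvd_choose) (auto simp: \<Lambda>_int assms)
    moreover have "coeff (\<Phi> + [:-\<xi>, 1:]) i = 0" using 2 by (auto simp: coeff_\<Phi> coeff_pCons split: nat.splits)
    ultimately show ?thesis by (simp add: coeff_linear_power_le mult.commute)
  next
    case 3
    then show ?thesis using q_ge_2 by (auto simp: coeff_linear_power_le coeff_\<Phi> coeff_pCons split: nat.splits)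
  next
    case 4
    then show ?thesis using q_ge_2 by (auto simp: coeff_linear_power_le coeff_\<Phi> coeff_pCons binomial_eq_0 split: nat.splits)
  qed
qed

definition Tp :: "'c \<Rightarrow> 'c poly \<Rightarrow> 'c poly" where "Tp \<xi> P = pcompose P [:\<xi>, \<pi>:]"

lemma Tp_add: "Tp \<xi> (P + Q) = Tp \<xi> P + Tp \<xi> Q" by (simp add: Tp_def pcompose_add)
lemma Tp_smult: "Tp \<xi> (smult c P) = smult c (Tp \<xi> P)" by (simp add: Tp_def pcompose_smult)
lemma Tp_mult: "Tp \<xi> (P * Q) = Tp \<xi> P * Tp \<xi> Q" by (simp add: Tp_def pcompose_mult)
lemma Tp_power: "Tp \<xi> (P ^ n) = Tp \<xi> P ^ n" by (induction n) (simp_all add: Tp_mult, simp add: Tp_def pcompose_1)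
lemma Tp_sum: "Tp \<xi> (sum f A) = (\<Sum>i\<in>A. Tp \<xi> (f i))" by (simp add: Tp_def pcompose_sum)
lemma coeff_Tp_0: "coeff (Tp \<xi> P) 0 = poly P \<xi>" by (simp add: Tp_def)

text \<open>Horner's rule: \<open>\<xi> + \<pi> y\<close> lies in the lattice \<open>wge 0\<close>
  and these lattices multiply, so the substitution makes the coefficient of \<open>y ^ i\<close>
  gain \<open>\<pi> ^ i\<close>.\<close>

lemma wge_Tp: "pge t P \<Longrightarrow> \<xi> \<in> \<Lambda> \<Longrightarrow> wge t (Tp \<xi> P)"
proof (induction P)
  case (pCons c P)
  have "wge 0 [:\<xi>, \<pi>:]" using \<Lambda>_int[OF pCons.prems(2)] vge_\<pi>[of 1]
    by (auto simp: wge_def coeff_pCons split: nat.splits)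
  then have "wge t ([:\<xi>, \<pi>:] * Tp \<xi> P)" using wge_mult[of 0 "[:\<xi>, \<pi>:]" t "Tp \<xi> P"] pCons by simp
  moreover have "wge t [:c:]" using pCons by (auto simp: wge_def coeff_pCons split: nat.splits)
  ultimately have "wge t ([:c:] + [:\<xi>, \<pi>:] * Tp \<xi> P)" by (intro wge_add)
  then show ?case unfolding Tp_def pcompose_pCons .
qed (simp add: Tp_def)

lemma pge_Tp: "pge t P \<Longrightarrow> \<xi> \<in> \<Lambda> \<Longrightarrow> pge t (Tp \<xi> P)"
  by (rule wge_imp_pge[OF wge_Tp])

text \<open>In \<open>(\<xi> + \<pi> y) ^ q\<close> the linear coefficient carries
  \<open>q \<pi>\<close>, the ones of degree \<open>1 < i < q\<close> carry
  \<open>p \<pi> ^ i\<close>, and the last one is \<open>\<pi> ^ q\<close> with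
  \<open>q \<ge> 2\<close>. What remains is the linear term of
  \<open>- (\<xi> + \<pi> y)\<close>.\<close>

lemma Tp_\<Phi>: assumes "\<xi> \<in> \<Lambda>" shows "pge 2 (Tp \<xi> \<Phi> + monom \<pi> 1)"
proof -
  have eq: "Tp \<xi> \<Phi> = [:\<xi>, \<pi>:] ^ q - [:\<xi>, \<pi>:]"
    using Tp_power[of \<xi> "[:0, 1:]" q] by (simp add: Tp_def \<Phi>_def pcompose_diff monom_altdef pcompose_pCons)
  show ?thesis unfolding pge_def
  proof
    fix i
    consider "i = 0" | "i = 1" | "1 < i" "i < q" | "i = q" | "i > q" by linarith
    then show "vge 2 (coeff (Tp \<xi> \<Phi> + monom \<pi> 1) i)"
    proof cases
      case 1
      then show ?thesis using \<Lambda>_power[OF assms] by (simp add: eq coeff_linear_power_le)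
    next
      case 2
      have "vge 2 (of_nat q * (\<pi> * \<xi> ^ (q - 1)))"
        using e_ge_1 by (intro vge_mult'[OF vge_q vge_mult'[OF vge_\<pi>[of 1] vge_power_int[OF \<Lambda>_int[OF assms]]]]) auto
      then show ?thesis using 2 by (simp add: eq coeff_linear_power_le mult.assoc)
    next
      case 3
      have "vge 2 (of_nat (q choose i) * (\<pi> ^ i * \<xi> ^ (q - i)))"
        using 3 e_ge_1 by (intro vge_mult'[OF vge_of_nat_dvd[OF p_dvd_choose] vge_mult'[OF vge_\<pi>_power[OF order_refl]
              vge_power_int[OF \<Lambda>_int[OF assms]]]]) auto
      moreover have "coeff [:\<xi>, \<pi>:] i = 0" using 3 by (auto simp: coeff_pCons split: nat.splits)
      ultimately show ?thesis using 3 by (simp add: eq coeff_linear_power_le mult.assoc)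
    next
      case 4
      moreover have "coeff [:\<xi>, \<pi>:] i = 0" using 4 q_ge_2 by (auto simp: coeff_pCons split: nat.splits)
      ultimately show ?thesis using q_ge_2 by (simp add: eq coeff_linear_power_le vge_\<pi>_power)
    next
      case 5
      moreover have "coeff [:\<xi>, \<pi>:] i = 0" using 5 q_ge_2 by (auto simp: coeff_pCons split: nat.splits)
      ultimately show ?thesis using q_ge_2 by (simp add: eq coeff_linear_power_le binomial_eq_0)
    qed
  qed
qed

section \<open>Expansion in powers of \<open>\<Phi>\<close>\<close>

definition rr :: "nat \<Rightarrow> 'c poly \<Rightarrow> 'c poly" where "rr j P = (P div \<Phi> ^ j) mod \<Phi>"

lemma rr_add: "rr j (P + Q) = rr j P + rr j Q"
  by (simp add: rr_def poly_div_add_left poly_mod_add_left)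

lemma rr_diff: "rr j (P - Q) = rr j P - rr j Q"
  by (simp add: rr_def poly_div_diff_left poly_mod_diff_left)

lemma rr_0 [simp]: "rr j 0 = 0" by (simp add: rr_def)

lemma rr_sum: "rr j (sum f A) = (\<Sum>i\<in>A. rr j (f i))"
  by (induction A rule: infinite_finite_induct) (auto simp: rr_add)

lemma rr_smult: "rr j (smult c P) = smult c (rr j P)"
  by (simp add: rr_def div_smult_left mod_smult_left)

lemma degree_rr: "degree (rr j P) < q"
  using degree_mod_less[of \<Phi> "P div \<Phi> ^ j"] q_ge_2 by (auto simp: rr_def degree_\<Phi>)

lemma rr_expand: "P = \<Phi> ^ J * (P div \<Phi> ^ J) + (\<Sum>j<J. \<Phi> ^ j * rr j P)"
proof (induction J)
  case (Suc J)
  have "P div \<Phi> ^ J = \<Phi> * (P div \<Phi> ^ Suc J) + rr J P"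
    unfolding rr_def power_Suc2 poly_div_mult_right by simp
  then have "\<Phi> ^ J * (P div \<Phi> ^ J) = \<Phi> ^ Suc J * (P div \<Phi> ^ Suc J) + \<Phi> ^ J * rr J P"
    by (simp add: algebra_simps)
  then show ?case using Suc by (simp add: algebra_simps)
qed simp

lemma rr_expansion: assumes "degree P < (d + 1) * q" shows "P = (\<Sum>j\<le>d. \<Phi> ^ j * rr j P)"
proof -
  have "degree (\<Phi> ^ (d + 1)) = (d + 1) * q" by (simp only: degree_power_eq[OF \<Phi>_nonzero] degree_\<Phi>)
  then have "P div \<Phi> ^ (d + 1) = 0" using assms by (intro div_poly_less) simp
  then show ?thesis using rr_expand[of P "d + 1"] by (simp add: lessThan_Suc_atMost)
qed

lemma rr_mult_power: assumes "degree R < q" shows "rr j (\<Phi> ^ i * R) = (if i = j then R else 0)"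
proof (cases "j \<le> i")
  case True
  have "\<Phi> ^ i * R = \<Phi> ^ j * (\<Phi> ^ (i - j) * R)" using True by (simp flip: power_add mult.assoc)
  then have "rr j (\<Phi> ^ i * R) = (\<Phi> ^ (i - j) * R) mod \<Phi>" unfolding rr_def by (simp only:) simp
  also have "\<dots> = (if i = j then R else 0)"
  proof (cases "i = j")
    case False
    then have "\<Phi> dvd \<Phi> ^ (i - j) * R" using True by (simp add: dvd_power)
    then show ?thesis using False by simp
  qed (use assms in \<open>simp add: mod_poly_less degree_\<Phi>\<close>)
  finally show ?thesis .
next
  case False
  have "degree (\<Phi> ^ i * R) < degree (\<Phi> ^ j)"
  proof -
    have "degree (\<Phi> ^ i * R) \<le> i * q + degree R"
      using degree_mult_le[of "\<Phi> ^ i" R] by (simp add: degree_power_eq degree_\<Phi>)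
    also have "\<dots> < Suc i * q" using assms by simp
    also have "\<dots> \<le> j * q" using False by (intro mult_le_mono1) simp
    finally show ?thesis by (simp add: degree_power_eq degree_\<Phi>)
  qed
  then show ?thesis using False by (simp add: rr_def div_poly_less)
qed

lemma rr_low: "degree R < q \<Longrightarrow> rr j R = (if j = 0 then R else 0)"
  using rr_mult_power[of R j 0] by simp

text \<open>\<open>\<Phi>\<close> is monic with integral coefficients, so long division stays in the
  lattice; the induction removes one leading term at a time.\<close>

lemma pge_div_mod: "pge t P \<Longrightarrow> pge t (P div \<Phi>) \<and> pge t (P mod \<Phi>)"
proof (induction "degree P" arbitrary: P rule: less_induct)
  case less
  show ?case
  proof (cases "degree P < q")
    case True
    then show ?thesis using less by (simp add: div_poly_less mod_poly_less degree_\<Phi>)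
  next
    case False
    define M where "M = monom (lead_coeff P) (degree P - q)"
    define P' where "P' = P - M * \<Phi>"
    have M: "pge t M" using less by (auto simp: M_def intro!: pge_monom pgeD)
    have P': "pge t P'" unfolding P'_def using less M pge_\<Phi> by (intro pge_diff pge_mult[of t M 0]) auto
    have "degree P' < degree P"
    proof -
      have "degree (M * \<Phi>) \<le> degree P" using False
        by (intro order_trans[OF degree_mult_le]) (auto simp: M_def degree_\<Phi> intro: order_trans[OF add_mono[OF degree_monom_le]])
      moreover have "coeff (M * \<Phi>) (degree P) = lead_coeff P"
        using False q_ge_2 by (simp add: M_def coeff_monom_mult coeff_\<Phi>)
      ultimately show ?thesis using False q_ge_2 unfolding P'_def
        by (intro degree_lessI) (auto simp: le_less coeff_eq_0 intro!: disjI2)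
    qed
    from less.hyps[OF this P'] have "pge t (P' div \<Phi>)" "pge t (P' mod \<Phi>)" by auto
    moreover have "P = P' + M * \<Phi>" by (simp add: P'_def)
    then have "P div \<Phi> = P' div \<Phi> + M" "P mod \<Phi> = P' mod \<Phi>"
      by (simp_all add: poly_div_add_left poly_mod_add_left)
    ultimately show ?thesis using M by (auto intro: pge_add)
  qed
qed

lemma pge_rr: "pge t P \<Longrightarrow> pge t (rr j P)"
proof -
  assume *: "pge t P"
  have "pge t (P div \<Phi> ^ j)"
  proof (induction j)
    case (Suc j)
    then show ?case unfolding power_Suc2 poly_div_mult_right using pge_div_mod by blast
  qed (use * in simp)
  then show ?thesis using pge_div_mod by (simp add: rr_def)
qed

lemma pge_from_rr: assumes "degree P < (d + 1) * q" "\<And>j. j \<le> d \<Longrightarrow> pge t (rr j P)" shows "pge t P"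
  by (subst rr_expansion[OF assms(1)], intro pge_sum pge_mult[of 0 _ t] pge_power_int pge_\<Phi> assms(2)) auto

lemma rr_eq_0: assumes "degree P < (d + 1) * q" "d < j" shows "rr j P = 0"
proof -
  have "rr j P = (\<Sum>i\<le>d. rr j (\<Phi> ^ i * rr i P))" by (subst rr_expansion[OF assms(1)]) (simp add: rr_sum)
  also have "\<dots> = 0" using assms by (intro sum.neutral) (auto simp: rr_mult_power degree_rr)
  finally show ?thesis .
qed

end

section \<open>The parent's term determines the digits\<close>

context digit_field begin

lemma pge_Tp_\<Phi>: assumes "\<xi> \<in> \<Lambda>" shows "pge 1 (Tp \<xi> \<Phi>)"
proof -
  have "pge 1 ((Tp \<xi> \<Phi> + monom \<pi> 1) - monom \<pi> 1)"
    by (intro pge_diff pge_mono[OF Tp_\<Phi>[OF assms]] pge_monom vge_\<pi>) auto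
  then show ?thesis by simp
qed

lemma Tp_\<Phi>_power: assumes "\<xi> \<in> \<Lambda>"
  shows "pge (real j + 1) (Tp \<xi> \<Phi> ^ j - monom ((- \<pi>) ^ j) j)"
proof (induction j)
  case 0
  then show ?case by (simp add: one_pCons)
next
  case (Suc j)
  let ?A = "Tp \<xi> \<Phi>" and ?m = "monom ((- \<pi>) ^ j) j"
  have "monom ((- \<pi>) ^ Suc j) (Suc j) = - (monom \<pi> 1 * ?m)" by (simp add: mult_monom minus_monom)
  then have eq: "?A ^ Suc j - monom ((- \<pi>) ^ Suc j) (Suc j) = ?A * (?A ^ j - ?m) + (?A + monom \<pi> 1) * ?m"
    by (simp add: algebra_simps)
  have "pge (real j) ?m" by (intro pge_monom) (use vge_minus_\<pi>_cancel[of "real j" j 1] in simp)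
  then have "pge (real (Suc j) + 1) ((?A + monom \<pi> 1) * ?m)"
    by (intro pge_mult[OF Tp_\<Phi>[OF assms]]) auto
  moreover have "pge (real (Suc j) + 1) (?A * (?A ^ j - ?m))"
    by (intro pge_mult[OF pge_Tp_\<Phi>[OF assms] Suc]) auto
  ultimately show ?case unfolding eq by (intro pge_add)
qed

lemma Tp_minus_const: assumes "pge t R" "\<xi> \<in> \<Lambda>" shows "pge (t + 1) (Tp \<xi> R - [:poly R \<xi>:])"
  unfolding pge_def
proof
  fix i
  show "vge (t + 1) (coeff (Tp \<xi> R - [:poly R \<xi>:]) i)"
  proof (cases i)
    case 0
    then show ?thesis by (simp add: coeff_Tp_0)
  next
    case (Suc j)
    then show ?thesis using wgeD[OF wge_Tp[OF assms], of i] by (auto elim: vge_mono)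
  qed
qed

lemma pge_Tp_\<Phi>_mult: assumes "pge t R" "\<xi> \<in> \<Lambda>" shows "pge (t + real j) (Tp \<xi> (\<Phi> ^ j * R))"
  unfolding Tp_mult Tp_power
  by (rule pge_mult[OF pge_power[OF pge_Tp_\<Phi>[OF assms(2)]] pge_Tp[OF assms]]) simp

lemma Tp_\<Phi>_mult_approx: assumes "pge t R" "\<xi> \<in> \<Lambda>"
  shows "pge (t + real j + 1) (Tp \<xi> (\<Phi> ^ j * R) - monom ((- \<pi>) ^ j * poly R \<xi>) j)"
proof -
  let ?m = "monom ((- \<pi>) ^ j) j"
  have eq: "Tp \<xi> (\<Phi> ^ j * R) - monom ((- \<pi>) ^ j * poly R \<xi>) j
      = (Tp \<xi> \<Phi> ^ j - ?m) * Tp \<xi> R + ?m * (Tp \<xi> R - [:poly R \<xi>:])"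
    by (simp add: Tp_mult Tp_power algebra_simps smult_monom)
  have "pge (real j) ?m" by (intro pge_monom) (use vge_minus_\<pi>_cancel[of "real j" j 1] in simp)
  then have "pge (t + real j + 1) (?m * (Tp \<xi> R - [:poly R \<xi>:]))"
    by (rule pge_mult[OF _ Tp_minus_const[OF assms]]) simp
  moreover have "pge (t + real j + 1) ((Tp \<xi> \<Phi> ^ j - ?m) * Tp \<xi> R)"
    by (rule pge_mult[OF Tp_\<Phi>_power[OF assms(2)] pge_Tp[OF assms]]) simp
  ultimately show ?thesis unfolding eq by (intro pge_add)
qed

text \<open>The digit \<open>j\<close> contributes
  \<open>(- \<pi>) ^ j * poly (rr j P) \<xi>\<close> in degree \<open>j\<close>, up to one more
  power of \<open>\<pi>\<close>. The weights \<open>t - j\<close> put the contributions of all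
  digits at the same order \<open>t\<close>.\<close>

lemma Tp_approx:
  assumes "degree P < (d + 1) * q" "\<And>j. j \<le> d \<Longrightarrow> pge (t - real j) (rr j P)" "\<xi> \<in> \<Lambda>"
  shows "pge (t + 1) (Tp \<xi> P - (\<Sum>j\<le>d. monom ((- \<pi>) ^ j * poly (rr j P) \<xi>) j))"
proof -
  have "Tp \<xi> P = (\<Sum>j\<le>d. Tp \<xi> (\<Phi> ^ j * rr j P))"
    by (subst rr_expansion[OF assms(1)]) (rule Tp_sum)
  then have eq: "Tp \<xi> P - (\<Sum>j\<le>d. monom ((- \<pi>) ^ j * poly (rr j P) \<xi>) j)
      = (\<Sum>j\<le>d. Tp \<xi> (\<Phi> ^ j * rr j P) - monom ((- \<pi>) ^ j * poly (rr j P) \<xi>) j)"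
    by (simp add: sum_subtractf)
  show ?thesis unfolding eq
    by (intro pge_sum pge_mono[OF Tp_\<Phi>_mult_approx[OF assms(2,3)]]) auto
qed

lemma coeff_Tp_approx:
  assumes "degree P < (d + 1) * q" "\<And>j. j \<le> d \<Longrightarrow> pge (t - real j) (rr j P)" "\<xi> \<in> \<Lambda>" "j \<le> d"
  shows "vge (t + 1) (coeff (Tp \<xi> P) j - (- \<pi>) ^ j * poly (rr j P) \<xi>)"
  using pgeD[OF Tp_approx[OF assms(1-3)], of j] assms(4) by (simp add: coeff_sum)

lemma pge_rr_lagrange:
  assumes "\<And>\<xi>. \<xi> \<in> \<Lambda> \<Longrightarrow> vge t (poly (rr j P) \<xi>)"
  shows "pge t (rr j P)"
  using degree_rr[of j P] by (intro pge_lagrange[OF finite_\<Lambda>]) (auto simp: card_\<Lambda> intro: \<Lambda>_int \<Lambda>_sep assms)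

text \<open>Bootstrapping from an arbitrary bound for \<open>P\<close>: the coefficient of
  \<open>y ^ j\<close> in \<open>Tp \<xi> P\<close> gives the value of digit \<open>j\<close> at
  every \<open>\<xi>\<close> with one power of \<open>\<pi>\<close> more than was known, and
  interpolation passes from the values to the digit. Finitely many rounds reach
  \<open>t\<close>.\<close>

lemma Tp_inverse:
  assumes deg: "degree P < (d + 1) * q" and T: "\<And>\<xi>. \<xi> \<in> \<Lambda> \<Longrightarrow> pge t (Tp \<xi> P)" and j: "j \<le> d"
  shows "pge (t - real j) (rr j P)"
proof -
  obtain t0 where t0: "pge t0 P" using ex_pge by blast
  have main: "\<forall>j\<le>d. pge (min t (t0 + real i) - real j) (rr j P)" for i
  proof (induction i)
    case 0
    then show ?case by (auto intro: pge_mono[OF pge_rr[OF t0]])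
  next
    case (Suc i)
    show ?case
    proof (intro allI impI pge_rr_lagrange)
      fix j \<xi> assume j: "j \<le> d" and \<xi>: "\<xi> \<in> \<Lambda>"
      let ?u = "min t (t0 + real (Suc i))"
      have "vge ?u (coeff (Tp \<xi> P) j - (- \<pi>) ^ j * poly (rr j P) \<xi>)"
        by (rule vge_mono[OF coeff_Tp_approx[OF deg Suc.IH[rule_format] \<xi> j]]) auto
      moreover have "vge ?u (coeff (Tp \<xi> P) j)" by (rule vge_mono[OF pgeD[OF T[OF \<xi>]]]) simp
      ultimately have "vge ?u ((- \<pi>) ^ j * poly (rr j P) \<xi>)"
        using vge_diff[of ?u "coeff (Tp \<xi> P) j"] by fastforce
      then show "vge (?u - real j) (poly (rr j P) \<xi>)" by (simp add: vge_minus_\<pi>_cancel)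
    qed
  qed
  obtain i :: nat where "t - t0 \<le> real i" using real_arch_simple by blast
  then have "min t (t0 + real i) = t" by linarith
  then show ?thesis using main[of i] j by simp
qed

text \<open>\<open>P\<close> as a whole has Gauss valuation at least \<open>t - d\<close>, and the
  substitution gains \<open>\<pi> ^ i\<close> in degree \<open>i\<close>.\<close>

lemma coeff_Tp_high:
  assumes "degree P < (d + 1) * q" "\<And>j. j \<le> d \<Longrightarrow> pge (t - real j) (rr j P)" "\<xi> \<in> \<Lambda>"
  shows "vge (t + real i - real d) (coeff (Tp \<xi> P) i)"
proof -
  have "Tp \<xi> P = (\<Sum>j\<le>d. Tp \<xi> (\<Phi> ^ j * rr j P))"
    by (subst rr_expansion[OF assms(1)]) (rule Tp_sum)
  moreover have "vge (t + real i - real d) (\<Sum>j\<le>d. coeff (Tp \<xi> (\<Phi> ^ j * rr j P)) i)"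
  proof (rule vge_sum)
    fix j assume j: "j \<in> {..d}"
    have "pge (t - real j) (\<Phi> ^ j * rr j P)"
      using j by (intro pge_mult[OF pge_power_int[OF pge_\<Phi>] assms(2)]) auto
    from wgeD[OF wge_Tp[OF this assms(3)], of i]
    show "vge (t + real i - real d) (coeff (Tp \<xi> (\<Phi> ^ j * rr j P)) i)" using j by (auto elim: vge_mono)
  qed
  ultimately show ?thesis by (simp add: coeff_sum)
qed

lemma pge_power_cong:
  assumes "pge 0 A" "pge 0 B" "pge t (A - B)"
  shows "pge t (A ^ n - B ^ n)"
proof (induction n)
  case (Suc n)
  have "A ^ Suc n - B ^ Suc n = A * (A ^ n - B ^ n) + (A - B) * B ^ n" by (simp add: algebra_simps)
  moreover have "pge t (A * (A ^ n - B ^ n))" by (rule pge_mult[OF assms(1) Suc]) simp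
  moreover have "pge t ((A - B) * B ^ n)" by (rule pge_mult[OF assms(3) pge_power_int[OF assms(2)]]) simp
  ultimately show ?case by (simp add: pge_add)
qed simp

lemma pge_linear: "\<xi> \<in> \<Lambda> \<Longrightarrow> pge 0 ([:-\<xi>, 1:] ^ n)"
  by (intro pge_power_int) (simp add: \<Lambda>_int)

text \<open>Modulo \<open>p\<close> the power \<open>[:-\<xi>, 1:] ^ q\<close> is
  \<open>\<Phi> + [:-\<xi>, 1:]\<close>, whose \<open>d\<close>-th power is expanded by the binomial
  theorem.\<close>

lemma frobenius_expand: assumes "\<xi> \<in> \<Lambda>"
  shows "pge (real e) ([:-\<xi>, 1:] ^ (d * q + t)
           - (\<Sum>j\<le>d. \<Phi> ^ j * smult (of_nat (d choose j)) ([:-\<xi>, 1:] ^ (d - j + t))))"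
proof -
  let ?l = "[:-\<xi>, 1:]"
  have l: "pge 0 ?l" using pge_linear[OF assms, of 1] by simp
  have "(\<Sum>j\<le>d. \<Phi> ^ j * smult (of_nat (d choose j)) (?l ^ (d - j + t))) = (\<Phi> + ?l) ^ d * ?l ^ t"
    unfolding binomial_ring sum_distrib_right
    by (intro sum.cong refl) (simp add: of_nat_poly mult.assoc flip: power_add)
  then have eq: "?l ^ (d * q + t) - (\<Sum>j\<le>d. \<Phi> ^ j * smult (of_nat (d choose j)) (?l ^ (d - j + t)))
      = ((?l ^ q) ^ d - (\<Phi> + ?l) ^ d) * ?l ^ t"
    by (simp only:) (simp add: power_add power_mult[symmetric] algebra_simps)
  have "pge (real e) ((?l ^ q) ^ d - (\<Phi> + ?l) ^ d)"
    by (intro pge_power_cong frobenius_linear[OF assms] pge_add pge_\<Phi> l pge_linear assms)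
  then show ?thesis unfolding eq by (rule pge_mult[OF _ pge_linear[OF assms]]) simp
qed

text \<open>Modulo \<open>\<pi> ^ n\<close> the polynomial has degree below \<open>q\<close>, so it
  is its own digit 0.\<close>

lemma rr_high:
  assumes "\<And>i. q \<le> i \<Longrightarrow> vge n (coeff P i)"
  shows "pge n (rr j P - (if j = 0 then P else 0))"
proof -
  define L where "L = (\<Sum>i<q. monom (coeff P i) i)"
  have cL: "coeff L i = (if i < q then coeff P i else 0)" for i by (simp add: L_def coeff_sum)
  have "degree L \<le> q - 1" by (rule degree_le) (auto simp: cL)
  then have "degree L < q" using q_ge_2 by linarith
  then have "rr j L = (if j = 0 then L else 0)" by (rule rr_low)
  moreover have H: "pge n (P - L)" using assms by (auto simp: pge_def cL)
  moreover have "rr j P = rr j L + rr j (P - L)" by (simp flip: rr_add)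
  ultimately have "rr j P - (if j = 0 then P else 0) = rr j (P - L) - (if j = 0 then P - L else 0)"
    by auto
  then show ?thesis using pge_rr[OF H, of j] H by (auto intro: pge_diff)
qed

lemma v_scaled_cancel: "v a = ereal s \<Longrightarrow> pge t (smult a P) \<Longrightarrow> pge (t - s) P"
  by (auto simp: pge_def vge_cancel)

end

section \<open>The equation at one vertex\<close>

locale hecke_digits = digit_field v p q e \<pi> \<Lambda>
  for v :: "'c::field \<Rightarrow> ereal" and p q e :: nat and \<pi> :: 'c and \<Lambda> :: "'c set" +
  fixes k d r :: nat and a :: 'c
  assumes k_eq: "k = d * q + r" and r_less: "r < q"
begin

text \<open>This is \<open>\<pi> ^ k * P ((y - \<xi>) / \<pi>)\<close> written without division. The
  index \<open>s\<close> counts from the top, since the coefficient of degree \<open>k - s\<close>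
  is damped by \<open>\<pi> ^ s\<close>.\<close>

definition Tm :: "'c \<Rightarrow> 'c poly \<Rightarrow> 'c poly" where
  "Tm \<xi> P = (\<Sum>s\<le>k. smult (\<pi> ^ s * coeff P (k - s)) ([:-\<xi>, 1:] ^ (k - s)))"

definition node_eq :: "real \<Rightarrow> 'c \<Rightarrow> 'c poly \<Rightarrow> 'c poly \<Rightarrow> ('c \<Rightarrow> 'c poly) \<Rightarrow> bool" where
  "node_eq n \<xi> Pv Pw Pu \<longleftrightarrow> pge n (Tp \<xi> Pv + (\<Sum>\<xi>'\<in>\<Lambda>. Tm \<xi>' (Pu \<xi>')) - smult a Pw)"

lemma degree_less: "degree P \<le> k \<Longrightarrow> degree P < (d + 1) * q"
  using k_eq r_less by simp

lemma Tm_approx: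
  assumes "A \<subseteq> {..k}" "\<And>s. s \<le> k \<Longrightarrow> s \<notin> A \<Longrightarrow> vge (n - real s) (coeff P (k - s))" "\<xi> \<in> \<Lambda>"
  shows "pge n (Tm \<xi> P - (\<Sum>s\<in>A. smult (\<pi> ^ s * coeff P (k - s)) ([:-\<xi>, 1:] ^ (k - s))))"
proof -
  have "Tm \<xi> P = (\<Sum>s\<in>A. smult (\<pi> ^ s * coeff P (k - s)) ([:-\<xi>, 1:] ^ (k - s)))
     + (\<Sum>s\<in>{..k} - A. smult (\<pi> ^ s * coeff P (k - s)) ([:-\<xi>, 1:] ^ (k - s)))"
    unfolding Tm_def using sum.subset_diff[OF assms(1)] by (simp add: add.commute)
  moreover have "pge n (\<Sum>s\<in>{..k} - A. smult (\<pi> ^ s * coeff P (k - s)) ([:-\<xi>, 1:] ^ (k - s)))"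
  proof (rule pge_sum)
    fix s assume "s \<in> {..k} - A"
    then have "vge n (\<pi> ^ s * coeff P (k - s))" using assms(2) by (simp add: vge_\<pi>_cancel)
    then show "pge n (smult (\<pi> ^ s * coeff P (k - s)) ([:-\<xi>, 1:] ^ (k - s)))"
      by (rule pge_smult[OF _ pge_linear[OF assms(3)]]) simp
  qed
  ultimately show ?thesis by simp
qed

text \<open>\<open>D\<close> is the loss known so far for the parent's term. Recovering
  \<open>P\<close> from it costs at most \<open>d\<close> more, and a degree
  \<open>i \<ge> q\<close> gains \<open>\<pi> ^ i\<close>, which outweighs
  \<open>D + d\<close>.\<close>

lemma coeff_Tp_above_q:
  assumes "degree P \<le> k" "\<And>\<xi>. \<xi> \<in> \<Lambda> \<Longrightarrow> pge (n - D) (Tp \<xi> P)" "D + real d \<le> real q" "\<xi> \<in> \<Lambda>" "q \<le> i"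
  shows "vge n (coeff (Tp \<xi> P) i)"
proof -
  have "vge (n - D + real i - real d) (coeff (Tp \<xi> P) i)"
    by (rule coeff_Tp_high[OF degree_less[OF assms(1)] Tp_inverse[OF degree_less[OF assms(1)] assms(2)] assms(4)])
  then show ?thesis using assms by (auto elim!: vge_mono)
qed

text \<open>Up to the factor \<open>d choose j\<close> this is what all children together contribute
  to digit \<open>j\<close>. In the applications \<open>\<omega> s \<xi>\<close> is
  \<open>\<pi> ^ s\<close> times the coefficient of degree \<open>k - s\<close> of the child
  \<open>\<xi>\<close>.\<close>

definition Q :: "(nat \<Rightarrow> 'c \<Rightarrow> 'c) \<Rightarrow> nat \<Rightarrow> 'c poly" where
  "Q \<omega> j = (\<Sum>\<xi>\<in>\<Lambda>. \<Sum>s\<le>r. smult (\<omega> s \<xi>) ([:-\<xi>, 1:] ^ (r + d - j - s)))"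

lemma pge_Q: "(\<And>s \<xi>. s \<le> r \<Longrightarrow> \<xi> \<in> \<Lambda> \<Longrightarrow> vge t (\<omega> s \<xi>)) \<Longrightarrow> pge t (Q \<omega> j)"
  unfolding Q_def by (intro pge_sum pge_smult[OF _ pge_linear]) auto

lemma coeff_Q:
  assumes "j \<le> d" "s \<le> r"
  shows "coeff (Q \<omega> j) (r + d - j - s)
    = (\<Sum>s'\<le>s. of_nat ((r + d - j - s') choose (s - s')) * (\<Sum>\<xi>\<in>\<Lambda>. \<omega> s' \<xi> * (- \<xi>) ^ (s - s')))"
proof -
  have "coeff (Q \<omega> j) (r + d - j - s)
    = (\<Sum>s'\<le>r. \<Sum>\<xi>\<in>\<Lambda>. \<omega> s' \<xi> * (of_nat ((r + d - j - s') choose (r + d - j - s)) * (- \<xi>) ^ (r + d - j - s' - (r + d - j - s))))"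
    unfolding Q_def by (subst sum.swap) (simp add: coeff_sum coeff_linear_power_le)
  also have "\<dots> = (\<Sum>s'\<le>s. \<Sum>\<xi>\<in>\<Lambda>. \<omega> s' \<xi> * (of_nat ((r + d - j - s') choose (r + d - j - s)) * (- \<xi>) ^ (r + d - j - s' - (r + d - j - s))))"
  proof (rule sum.mono_neutral_right)
    show "\<forall>i\<in>{..r} - {..s}. (\<Sum>\<xi>\<in>\<Lambda>. \<omega> i \<xi> * (of_nat ((r + d - j - i) choose (r + d - j - s)) * (- \<xi>) ^ (r + d - j - i - (r + d - j - s)))) = 0"
    proof
      fix i assume "i \<in> {..r} - {..s}"
      then have "(r + d - j - i) choose (r + d - j - s) = 0" using assms by (intro binomial_eq_0) auto
      then show "(\<Sum>\<xi>\<in>\<Lambda>. \<omega> i \<xi> * (of_nat ((r + d - j - i) choose (r + d - j - s)) * (- \<xi>) ^ (r + d - j - i - (r + d - j - s)))) = 0"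
        by (simp only:) simp
    qed
  qed (use assms in auto)
  also have "\<dots> = (\<Sum>s'\<le>s. of_nat ((r + d - j - s') choose (s - s')) * (\<Sum>\<xi>\<in>\<Lambda>. \<omega> s' \<xi> * (- \<xi>) ^ (s - s')))"
  proof (intro sum.cong refl)
    fix s' assume "s' \<in> {..s}"
    then have "r + d - j - s' - (r + d - j - s) = s - s'" using assms by simp
    moreover have "(r + d - j - s') choose (r + d - j - s) = (r + d - j - s') choose (s - s')"
      using assms \<open>s' \<in> {..s}\<close> by (subst binomial_symmetric) auto
    ultimately show "(\<Sum>\<xi>\<in>\<Lambda>. \<omega> s' \<xi> * (of_nat ((r + d - j - s') choose (r + d - j - s)) * (- \<xi>) ^ (r + d - j - s' - (r + d - j - s))))
      = of_nat ((r + d - j - s') choose (s - s')) * (\<Sum>\<xi>\<in>\<Lambda>. \<omega> s' \<xi> * (- \<xi>) ^ (s - s'))"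
      by (simp add: sum_distrib_left algebra_simps)
  qed
  finally show ?thesis .
qed

text \<open>For \<open>s \<le> r\<close> the exponent \<open>k - s\<close> is
  \<open>d q + (r - s)\<close>, so \<open>frobenius_expand\<close> applies; its error, a multiple of
  \<open>p\<close>, absorbs the loss \<open>\<delta> \<le> e\<close> of \<open>\<omega>\<close>. As
  \<open>r + d < q\<close>, the \<open>Q \<omega> j\<close> have degree below \<open>q\<close> and
  can be read off as digits, while \<open>T\<close> enters digit 0 only.\<close>

lemma compare_digits:
  assumes small: "r + d < q" and \<delta>: "\<delta> \<le> real e"
    and high: "\<And>i. q \<le> i \<Longrightarrow> vge n (coeff T i)"
    and \<omega>: "\<And>s \<xi>. s \<le> r \<Longrightarrow> \<xi> \<in> \<Lambda> \<Longrightarrow> vge (n - \<delta>) (\<omega> s \<xi>)"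
    and eq: "pge n (T + (\<Sum>\<xi>\<in>\<Lambda>. \<Sum>s\<le>r. smult (\<omega> s \<xi>) ([:-\<xi>, 1:] ^ (k - s))) - smult a P)"
    and j: "j \<le> d"
  shows "pge n ((if j = 0 then T else 0) + smult (of_nat (d choose j)) (Q \<omega> j) - smult a (rr j P))"
proof -
  define W where "W = (\<Sum>i\<le>d. \<Phi> ^ i * smult (of_nat (d choose i)) (Q \<omega> i))"
  have degQ: "degree (smult (of_nat (d choose i)) (Q \<omega> i)) < q" for i
  proof -
    have "degree (Q \<omega> i) \<le> r + d"
      unfolding Q_def
      by (intro degree_sum_le finite_\<Lambda> order_trans[OF degree_smult_le] order_trans[OF degree_power_le]) auto
    then show ?thesis using small degree_smult_le[of "of_nat (d choose i)" "Q \<omega> i"] by linarith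
  qed
  have rrW: "rr j W = smult (of_nat (d choose j)) (Q \<omega> j)"
  proof -
    have "rr j W = (\<Sum>i\<le>d. if i = j then smult (of_nat (d choose i)) (Q \<omega> i) else 0)"
      unfolding W_def rr_sum by (intro sum.cong refl rr_mult_power degQ)
    then show ?thesis using j by simp
  qed
  have "W = (\<Sum>\<xi>\<in>\<Lambda>. \<Sum>s\<le>r. smult (\<omega> s \<xi>)
           (\<Sum>i\<le>d. \<Phi> ^ i * smult (of_nat (d choose i)) ([:-\<xi>, 1:] ^ (d - i + (r - s)))))"
  proof -
    have "W = (\<Sum>i\<le>d. \<Sum>\<xi>\<in>\<Lambda>. \<Sum>s\<le>r. smult (\<omega> s \<xi>) (\<Phi> ^ i * smult (of_nat (d choose i)) ([:-\<xi>, 1:] ^ (d - i + (r - s)))))"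
      unfolding W_def Q_def
    proof (intro sum.cong refl)
      fix i assume i: "i \<in> {..d}"
      have *: "r + d - (i + s) = d - i + (r - s)" if "s \<le> r" for s using i that by simp
      show "\<Phi> ^ i * smult (of_nat (d choose i)) (\<Sum>\<xi>\<in>\<Lambda>. \<Sum>s\<le>r. smult (\<omega> s \<xi>) ([:- \<xi>, 1:] ^ (r + d - i - s)))
        = (\<Sum>\<xi>\<in>\<Lambda>. \<Sum>s\<le>r. smult (\<omega> s \<xi>) (\<Phi> ^ i * smult (of_nat (d choose i)) ([:- \<xi>, 1:] ^ (d - i + (r - s)))))"
        by (simp add: smult_sum_right sum_distrib_left mult.commute, intro sum.cong refl) (simp add: *)
    qed
    also have "\<dots> = (\<Sum>\<xi>\<in>\<Lambda>. \<Sum>i\<le>d. \<Sum>s\<le>r. smult (\<omega> s \<xi>) (\<Phi> ^ i * smult (of_nat (d choose i)) ([:-\<xi>, 1:] ^ (d - i + (r - s)))))"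
      by (rule sum.swap)
    also have "\<dots> = (\<Sum>\<xi>\<in>\<Lambda>. \<Sum>s\<le>r. \<Sum>i\<le>d. smult (\<omega> s \<xi>) (\<Phi> ^ i * smult (of_nat (d choose i)) ([:-\<xi>, 1:] ^ (d - i + (r - s)))))"
      by (intro sum.cong refl sum.swap)
    finally show ?thesis by (simp only: smult_sum_right)
  qed
  moreover have "(\<Sum>\<xi>\<in>\<Lambda>. \<Sum>s\<le>r. smult (\<omega> s \<xi>) ([:-\<xi>, 1:] ^ (k - s)))
      = (\<Sum>\<xi>\<in>\<Lambda>. \<Sum>s\<le>r. smult (\<omega> s \<xi>) ([:-\<xi>, 1:] ^ (d * q + (r - s))))"
    by (intro sum.cong refl) (simp add: k_eq)
  ultimately have eqW: "(\<Sum>\<xi>\<in>\<Lambda>. \<Sum>s\<le>r. smult (\<omega> s \<xi>) ([:-\<xi>, 1:] ^ (k - s))) - W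
      = (\<Sum>\<xi>\<in>\<Lambda>. \<Sum>s\<le>r. smult (\<omega> s \<xi>) ([:-\<xi>, 1:] ^ (d * q + (r - s))
           - (\<Sum>i\<le>d. \<Phi> ^ i * smult (of_nat (d choose i)) ([:-\<xi>, 1:] ^ (d - i + (r - s))))))"
    by (simp only: sum_subtractf smult_diff_right)
  have "pge n ((\<Sum>\<xi>\<in>\<Lambda>. \<Sum>s\<le>r. smult (\<omega> s \<xi>) ([:-\<xi>, 1:] ^ (k - s))) - W)"
    unfolding eqW using \<delta> by (intro pge_sum pge_smult[OF \<omega> frobenius_expand]) auto
  from pge_diff[OF eq this] have "pge n (T + W - smult a P)" by (simp add: algebra_simps)
  from pge_rr[OF this, of j] have 1: "pge n (rr j T + smult (of_nat (d choose j)) (Q \<omega> j) - smult a (rr j P))"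
    by (simp add: rr_add rr_diff rr_smult rrW)
  from pge_diff[OF this rr_high[OF high, of j]] show ?thesis by (simp add: algebra_simps)
qed

end

section \<open>Descent steps\<close>

lemma gchoose_of_nat_negative: "(of_int (- int N) :: rat) gchoose i = (- 1) ^ i * of_nat (N + i - 1 choose i)"
proof (cases "N + i = 0")
  case False
  have "(of_int (- int N) :: rat) gchoose i = (- 1) ^ i * ((of_nat N + of_nat i - 1) gchoose i)"
    using gbinomial_negated_upper[of "of_int (- int N) :: rat" i] by (simp add: algebra_simps)
  also have "(of_nat N + of_nat i - 1 :: rat) = of_nat (N + i - 1)" using False by (cases "N + i") (auto simp flip: of_nat_add)
  finally show ?thesis by (simp add: binomial_gbinomial)
qed simp

text \<open>Lagrange extrapolation from \<open>0, \<dots>, s\<close> to \<open>d\<close> of the polynomial function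
  \<open>j \<mapsto> (m + d - j choose i)\<close> of degree \<open>i \<le> s\<close>.\<close>

lemma binomial_extrapolation:
  assumes "i \<le> s" "s < d"
  shows "(\<Sum>j\<le>s. (- 1) ^ (s - j) * int (d - 1 - j choose (s - j)) * (int (d choose j) * int (m + d - j choose i)))
    = int (m choose i)"
proof -
  let ?u = "\<lambda>j. (- 1) ^ (s - j) * int (d - 1 - j choose (s - j))"
  \<comment> \<open>The weights are the generalized binomial coefficients of
    \<open>- (d - s)\<close> over \<open>s - j\<close>. The sum is therefore a Vandermonde
    convolution with total upper index \<open>(d - i') - (d - s) = s - i'\<close>, and
    \<open>s - i' choose s\<close> vanishes unless \<open>i' = 0\<close>.\<close>
  have inner: "(\<Sum>j\<le>s. ?u j * int (d - i' choose j)) = (if i' = 0 then 1 else 0)" if "i' \<le> s" for i'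
  proof -
    have "(of_int (\<Sum>j\<le>s. ?u j * int (d - i' choose j)) :: rat)
      = (\<Sum>j\<in>{0..s}. (of_nat (d - i') gchoose j) * (of_int (- int (d - s)) gchoose (s - j)))"
      unfolding of_int_sum atLeast0AtMost
    proof (intro sum.cong refl)
      fix j assume j: "j \<in> {..s}"
      have "d - s + (s - j) - 1 = d - 1 - j" using j assms by auto
      then show "of_int (?u j * int (d - i' choose j))
          = ((of_nat (d - i') :: rat) gchoose j) * (of_int (- int (d - s)) gchoose (s - j))"
        by (simp only: gchoose_of_nat_negative) (simp add: binomial_gbinomial)
    qed
    also have "\<dots> = ((of_nat (d - i') + of_int (- int (d - s))) gchoose s :: rat)"
      by (rule gbinomial_Vandermonde)
    also have "(of_nat (d - i') + of_int (- int (d - s)) :: rat) = of_nat (s - i')"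
      using that assms by (simp add: of_nat_diff)
    also have "(of_nat (s - i') gchoose s :: rat) = of_nat (s - i' choose s)" by (simp add: binomial_gbinomial)
    also have "\<dots> = of_int (if i' = 0 then 1 else 0)" using that by (auto simp: binomial_eq_0)
    finally show ?thesis by (simp only: of_int_eq_iff)
  qed
  have "(\<Sum>j\<le>s. ?u j * (int (d choose j) * int (m + d - j choose i)))
     = (\<Sum>j\<le>s. \<Sum>i'\<le>i. (int (m choose (i - i')) * int (d choose i')) * (?u j * int (d - i' choose j)))"
  proof (intro sum.cong refl)
    fix j assume j: "j \<in> {..s}"
    have "m + d - j = (d - j) + m" using j assms by simp
    then have V: "int (m + d - j choose i) = (\<Sum>i'\<le>i. int (d - j choose i') * int (m choose (i - i')))"
      using vandermonde[of "d - j" m i] by (simp only: flip: of_nat_mult of_nat_sum)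
    \<comment> \<open>Both sides count the pairs of disjoint subsets with \<open>j\<close> and
      \<open>i'\<close> elements in a set of \<open>d\<close> elements.\<close>
    have C: "int (d choose j) * int (d - j choose i') = int (d choose i') * int (d - i' choose j)" if "i' \<le> i" for i'
    proof (cases "i' + j \<le> d")
      case True
      have "(d choose (i' + j)) * (i' + j choose i') = (d choose i') * (d - i' choose j)"
        using choose_mult[of i' "i' + j" d] True by simp
      moreover have "(d choose (i' + j)) * (i' + j choose j) = (d choose j) * (d - j choose i')"
        using choose_mult[of j "i' + j" d] True by simp
      moreover have "(i' + j choose i') = (i' + j choose j)" using binomial_symmetric[of i' "i' + j"] by simp
      ultimately show ?thesis by (metis of_nat_mult)
    next
      case False
      then show ?thesis using j assms that by (simp add: binomial_eq_0)
    qed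
    show "?u j * (int (d choose j) * int (m + d - j choose i))
      = (\<Sum>i'\<le>i. (int (m choose (i - i')) * int (d choose i')) * (?u j * int (d - i' choose j)))"
      unfolding V sum_distrib_left
    proof (intro sum.cong refl)
      fix i' assume "i' \<in> {..i}"
      then have "i' \<le> i" by simp
      have "?u j * (int (d choose j) * (int (d - j choose i') * int (m choose (i - i'))))
          = ?u j * int (m choose (i - i')) * (int (d choose j) * int (d - j choose i'))" by (simp only: ac_simps)
      also have "\<dots> = (int (m choose (i - i')) * int (d choose i')) * (?u j * int (d - i' choose j))"
        unfolding C[OF \<open>i' \<le> i\<close>] by (simp only: ac_simps)
      finally show "?u j * (int (d choose j) * (int (d - j choose i') * int (m choose (i - i'))))
          = (int (m choose (i - i')) * int (d choose i')) * (?u j * int (d - i' choose j))" .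
    qed
  qed
  also have "\<dots> = (\<Sum>i'\<le>i. (int (m choose (i - i')) * int (d choose i')) * (\<Sum>j\<le>s. ?u j * int (d - i' choose j)))"
    by (subst sum.swap) (simp add: sum_distrib_left)
  also have "\<dots> = (\<Sum>i'\<le>i. if i' = 0 then int (m choose i) else 0)"
  proof (intro sum.cong refl)
    fix i' assume "i' \<in> {..i}"
    then have "i' \<le> s" using assms by simp
    show "(int (m choose (i - i')) * int (d choose i')) * (\<Sum>j\<le>s. ?u j * int (d - i' choose j))
        = (if i' = 0 then int (m choose i) else 0)"
      unfolding inner[OF \<open>i' \<le> s\<close>] by simp
  qed
  finally show ?thesis by simp
qed

context hecke_digits begin

text \<open>The hypotheses on \<open>Pw\<close> and \<open>Pu\<close> are the conclusions one level
  further down. Digit 0 of the equation expresses the parent's term by the children of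
  \<open>w\<close> and gives the first bound; the digits \<open>j \<ge> 1\<close> contain no
  parent's term, so that dividing by \<open>a\<close> gives the second. The third one concerns
  degrees \<open>k - s \<ge> q\<close> when \<open>s < d\<close>; the parent is negligible there,
  and the binomial extrapolation bounds the children.\<close>

lemma step_general:
  assumes small: "r + d < q" and dq: "2 * d \<le> q"
    and va: "v a = ereal \<delta>" and \<delta>: "0 \<le> \<delta>" "\<delta> \<le> real e" "\<delta> \<le> real r" "2 * \<delta> \<le> real r + 1"
    and deg: "degree Pv \<le> k" "\<And>\<xi>. \<xi> \<in> \<Lambda> \<Longrightarrow> degree (Pw \<xi>) \<le> k"
    and w: "\<And>\<xi> j. \<xi> \<in> \<Lambda> \<Longrightarrow> j \<le> d \<Longrightarrow> pge (n - \<delta> - real j) (rr j (Pw \<xi>))"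
    and u: "\<And>\<xi> \<xi>'. \<xi> \<in> \<Lambda> \<Longrightarrow> \<xi>' \<in> \<Lambda> \<Longrightarrow> pge (n - 2 * \<delta>) (Pu \<xi> \<xi>')"
      "\<And>\<xi> \<xi>' s. \<xi> \<in> \<Lambda> \<Longrightarrow> \<xi>' \<in> \<Lambda> \<Longrightarrow> s \<le> r \<Longrightarrow> vge (n - \<delta> - real s) (coeff (Pu \<xi> \<xi>') (k - s))"
    and eq: "\<And>\<xi>. \<xi> \<in> \<Lambda> \<Longrightarrow> node_eq n \<xi> Pv (Pw \<xi>) (Pu \<xi>)"
  shows "\<And>j. j \<le> d \<Longrightarrow> pge (n - \<delta> - real j) (rr j Pv)"
    and "\<And>\<xi>. \<xi> \<in> \<Lambda> \<Longrightarrow> pge (n - 2 * \<delta>) (Pw \<xi>)"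
    and "\<And>\<xi> s. \<xi> \<in> \<Lambda> \<Longrightarrow> s \<le> r \<Longrightarrow> vge (n - \<delta> - real s) (coeff (Pw \<xi>) (k - s))"
proof -
  have a\<delta>: "vge \<delta> a" using va by (simp add: vge_def)
  define \<omega> where "\<omega> \<xi> s \<xi>' = \<pi> ^ s * coeff (Pu \<xi> \<xi>') (k - s)" for \<xi> \<xi>' s
  have \<omega>: "vge (n - \<delta>) (\<omega> \<xi> s \<xi>')" if "\<xi> \<in> \<Lambda>" "\<xi>' \<in> \<Lambda>" "s \<le> r" for \<xi> \<xi>' s
    unfolding \<omega>_def using u(2)[OF that] by (simp add: vge_\<pi>_cancel)
  define W where "W \<xi> = (\<Sum>\<xi>'\<in>\<Lambda>. \<Sum>s\<le>r. smult (\<omega> \<xi> s \<xi>') ([:-\<xi>', 1:] ^ (k - s)))" for \<xi>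
  \<comment> \<open>The coefficients of the children of \<open>w\<close> with
    \<open>s \<ge> r + 1\<close> have loss at most \<open>2 * \<delta>\<close> and are damped by
    \<open>\<pi> ^ s\<close>; this is where \<open>2 * \<delta> \<le> r + 1\<close> enters.\<close>
  have E: "pge n (Tp \<xi> Pv + W \<xi> - smult a (Pw \<xi>))" if \<xi>: "\<xi> \<in> \<Lambda>" for \<xi>
  proof -
    have "pge n ((\<Sum>\<xi>'\<in>\<Lambda>. Tm \<xi>' (Pu \<xi> \<xi>')) - W \<xi>)"
      unfolding W_def \<omega>_def sum_subtractf[symmetric]
    proof (intro pge_sum Tm_approx)
      fix \<xi>' s assume *: "\<xi>' \<in> \<Lambda>" "s \<notin> {..r}"
      then have "real r + 1 \<le> real s" by simp
      then show "vge (n - real s) (coeff (Pu \<xi> \<xi>') (k - s))"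
        using \<delta> by (intro vge_mono[OF pgeD[OF u(1)[OF \<xi> *(1)]]]) auto
    qed (use k_eq in auto)
    from pge_diff[OF eq[OF \<xi>, unfolded node_eq_def] this] show ?thesis by (simp add: algebra_simps)
  qed
  have pW: "pge (n - \<delta>) (W \<xi>)" if "\<xi> \<in> \<Lambda>" for \<xi>
    unfolding W_def by (intro pge_sum pge_smult[OF \<omega>[OF that] pge_linear]) auto
  have pPw: "pge (n - \<delta> - real d) (Pw \<xi>)" if "\<xi> \<in> \<Lambda>" for \<xi>
    by (rule pge_from_rr[OF degree_less[OF deg(2)[OF that]]]) (auto intro: pge_mono[OF w[OF that]])
  have high: "vge n (coeff (Tp \<xi> Pv) i)" if "\<xi> \<in> \<Lambda>" "q \<le> i" for \<xi> i
  proof (rule coeff_Tp_above_q[OF deg(1) _ _ that, where D = "max (real d) \<delta>"])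
    fix \<xi> assume \<xi>: "\<xi> \<in> \<Lambda>"
    have 1: "pge (n - max (real d) \<delta>) (smult a (Pw \<xi>))" by (rule pge_smult[OF a\<delta> pPw[OF \<xi>]]) auto
    have 2: "pge (n - max (real d) \<delta>) (W \<xi>)" by (rule pge_mono[OF pW[OF \<xi>]]) auto
    have 3: "pge (n - max (real d) \<delta>) (Tp \<xi> Pv + W \<xi> - smult a (Pw \<xi>))"
      by (rule pge_mono[OF E[OF \<xi>]]) (use \<delta> in auto)
    show "pge (n - max (real d) \<delta>) (Tp \<xi> Pv)"
      using pge_add[OF pge_diff[OF 3 2] 1] by (simp add: algebra_simps)
  next
    have "real r + real d \<le> real q" "2 * real d \<le> real q" using small dq by linarith+
    then show "max (real d) \<delta> + real d \<le> real q" using \<delta> by linarith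
  qed
  note cmp = compare_digits[OF small \<delta>(2) high \<omega> E[unfolded W_def]]
  have G: "pge n (Tp \<xi> Pv + Q (\<omega> \<xi>) 0)" if \<xi>: "\<xi> \<in> \<Lambda>" for \<xi>
  proof -
    have "pge n (smult a (rr 0 (Pw \<xi>)))" by (rule pge_smult[OF a\<delta> w[OF \<xi>]]) auto
    from pge_add[OF cmp[OF \<xi> _ \<xi> _ _ \<xi>, of 0] this] show ?thesis by simp
  qed
  have digit: "pge n (smult (of_nat (d choose j)) (Q (\<omega> \<xi>) j) - smult a (rr j (Pw \<xi>)))"
    if "\<xi> \<in> \<Lambda>" "1 \<le> j" "j \<le> d" for \<xi> j
    using cmp[OF that(1) _ that(1) _ _ that(1,3)] that by simp
  have pQ: "pge (n - \<delta>) (Q (\<omega> \<xi>) j)" if "\<xi> \<in> \<Lambda>" for \<xi> j by (rule pge_Q[OF \<omega>[OF that]])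
  have TpA: "pge (n - \<delta>) (Tp \<xi> Pv)" if "\<xi> \<in> \<Lambda>" for \<xi>
  proof -
    have "pge (n - \<delta>) ((Tp \<xi> Pv + Q (\<omega> \<xi>) 0) - Q (\<omega> \<xi>) 0)"
      by (rule pge_diff[OF pge_mono[OF G[OF that]] pQ[OF that]]) (use \<delta> in simp)
    then show ?thesis by simp
  qed
  show A: "pge (n - \<delta> - real j) (rr j Pv)" if "j \<le> d" for j
    by (rule Tp_inverse[OF degree_less[OF deg(1)] TpA that])
  show B: "pge (n - 2 * \<delta>) (Pw \<xi>)" if \<xi>: "\<xi> \<in> \<Lambda>" for \<xi>
  proof (rule pge_from_rr[OF degree_less[OF deg(2)[OF \<xi>]]])
    fix j assume j: "j \<le> d"
    show "pge (n - 2 * \<delta>) (rr j (Pw \<xi>))"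
    proof (cases "j = 0")
      case True
      then show ?thesis using w[OF \<xi> j] \<delta> by (auto elim!: pge_mono)
    next
      case False
      have "pge (n - \<delta>) (smult (of_nat (d choose j)) (Q (\<omega> \<xi>) j))"
        by (rule pge_smult[OF vge_of_nat pQ[OF \<xi>]]) simp
      moreover have "pge (n - \<delta>) (smult (of_nat (d choose j)) (Q (\<omega> \<xi>) j) - smult a (rr j (Pw \<xi>)))"
        by (rule pge_mono[OF digit[OF \<xi> _ j]]) (use False \<delta> in auto)
      ultimately have "pge (n - \<delta>) (smult (of_nat (d choose j)) (Q (\<omega> \<xi>) j)
          - (smult (of_nat (d choose j)) (Q (\<omega> \<xi>) j) - smult a (rr j (Pw \<xi>))))" by (rule pge_diff)
      then have "pge (n - \<delta>) (smult a (rr j (Pw \<xi>)))" by simp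
      from v_scaled_cancel[OF va this] show ?thesis by (auto elim!: pge_mono)
    qed
  qed
  show "vge (n - \<delta> - real s) (coeff (Pw \<xi>) (k - s))" if \<xi>: "\<xi> \<in> \<Lambda>" and s: "s \<le> r" for \<xi> s
  proof (cases "d \<le> s")
    case True
    then show ?thesis by (intro vge_mono[OF pgeD[OF pPw[OF \<xi>]]]) auto
  next
    case False
    define m where "m s' = (\<Sum>\<xi>'\<in>\<Lambda>. \<omega> \<xi> s' \<xi>' * (- \<xi>') ^ (s - s'))" for s'
    have vm: "vge (n - \<delta>) (m s')" if "s' \<le> s" for s'
      unfolding m_def
    proof (rule vge_sum)
      fix \<xi>' assume "\<xi>' \<in> \<Lambda>"
      then show "vge (n - \<delta>) (\<omega> \<xi> s' \<xi>' * (- \<xi>') ^ (s - s'))"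
        using that s by (intro vge_mult'[OF \<omega>[OF \<xi>] vge_power_int]) (auto simp: \<Lambda>_int)
    qed
    \<comment> \<open>\<open>g j\<close> is a coefficient of \<open>Q (\<omega> \<xi>) j\<close>,
      and \<open>h\<close> is the same expression at \<open>j = d\<close>. Up to multiples of
      \<open>p\<close>, \<open>h\<close> is also the coefficient of degree \<open>k - s\<close> in
      \<open>W \<xi>\<close>. For \<open>j \<le> s\<close> the digit equations make
      \<open>(d choose j) * g j\<close> small, and these values are extrapolated to
      \<open>j = d\<close>.\<close>
    define g where "g j = (\<Sum>s'\<le>s. of_nat ((r + d - j - s') choose (s - s')) * m s')" for j
    define h where "h = (\<Sum>s'\<le>s. of_nat ((r - s') choose (s - s')) * m s')"
    have gQ: "coeff (Q (\<omega> \<xi>) j) (r + d - j - s) = g j" if "j \<le> d" for j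
      using coeff_Q[OF that s] by (simp add: g_def m_def)
    have g: "vge (n - real s) (of_nat (d choose j) * g j)" if j: "j \<le> s" for j
    proof (cases "j = 0")
      case True
      \<comment> \<open>In degree \<open>r + d - s\<close> the parent's term is small because
        \<open>\<delta> \<le> r\<close>.\<close>
      have "vge (n - \<delta> + real (r + d - s) - real d) (coeff (Tp \<xi> Pv) (r + d - s))"
        by (rule coeff_Tp_high[OF degree_less[OF deg(1)] A \<xi>])
      then have "vge (n - real s) (coeff (Tp \<xi> Pv) (r + d - s))" using s \<delta> by (auto elim!: vge_mono simp: of_nat_diff)
      moreover have "vge (n - real s) (coeff (Tp \<xi> Pv + Q (\<omega> \<xi>) 0) (r + d - s))"
        by (rule vge_mono[OF pgeD[OF G[OF \<xi>]]]) simp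
      ultimately have "vge (n - real s) (coeff (Tp \<xi> Pv + Q (\<omega> \<xi>) 0) (r + d - s) - coeff (Tp \<xi> Pv) (r + d - s))"
        by (rule vge_diff[rotated])
      then show ?thesis using True gQ[of 0] by simp
    next
      case j0: False
      have jd: "j \<le> d" using j False by simp
      have "vge (n - real s) (a * coeff (rr j (Pw \<xi>)) (r + d - j - s))"
        by (rule vge_mult'[OF a\<delta> pgeD[OF w[OF \<xi> jd]]]) (use j in simp)
      moreover have "vge (n - real s) (coeff (smult (of_nat (d choose j)) (Q (\<omega> \<xi>) j) - smult a (rr j (Pw \<xi>))) (r + d - j - s))"
        by (rule vge_mono[OF pgeD[OF digit[OF \<xi> _ jd]]]) (use j0 in auto)
      ultimately have "vge (n - real s) (coeff (smult (of_nat (d choose j)) (Q (\<omega> \<xi>) j) - smult a (rr j (Pw \<xi>))) (r + d - j - s)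
          + a * coeff (rr j (Pw \<xi>)) (r + d - j - s))" by (rule vge_add[rotated])
      then show ?thesis using gQ[OF jd] by simp
    qed
    have "h = (\<Sum>j\<le>s. of_int ((- 1) ^ (s - j) * int (d - 1 - j choose (s - j))) * (of_nat (d choose j) * g j))"
    proof -
      have "of_nat ((r - s') choose (s - s')) * m s' = (\<Sum>j\<le>s. of_int ((- 1) ^ (s - j) * int (d - 1 - j choose (s - j))) *
            (of_nat (d choose j) * (of_nat ((r + d - j - s') choose (s - s')) * m s')))" if "s' \<le> s" for s'
      proof -
        have "int ((r - s') choose (s - s')) = (\<Sum>j\<le>s. (- 1) ^ (s - j) * int (d - 1 - j choose (s - j))
             * (int (d choose j) * int (r + d - j - s' choose (s - s'))))"
          using binomial_extrapolation[of "s - s'" s d "r - s'"] False that s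
          by (simp add: algebra_simps)
        then have "(of_int (int ((r - s') choose (s - s'))) :: 'c) = of_int (\<Sum>j\<le>s. (- 1) ^ (s - j) * int (d - 1 - j choose (s - j))
             * (int (d choose j) * int (r + d - j - s' choose (s - s'))))" by (rule arg_cong)
        then show ?thesis by (simp add: sum_distrib_right mult.assoc)
      qed
      then have "h = (\<Sum>s'\<le>s. \<Sum>j\<le>s. of_int ((- 1) ^ (s - j) * int (d - 1 - j choose (s - j))) *
            (of_nat (d choose j) * (of_nat ((r + d - j - s') choose (s - s')) * m s')))"
        unfolding h_def by (intro sum.cong) auto
      also have "\<dots> = (\<Sum>j\<le>s. \<Sum>s'\<le>s. of_int ((- 1) ^ (s - j) * int (d - 1 - j choose (s - j))) *
            (of_nat (d choose j) * (of_nat ((r + d - j - s') choose (s - s')) * m s')))" by (rule sum.swap)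
      finally show ?thesis by (simp only: g_def sum_distrib_left)
    qed
    then have vh: "vge (n - real s) h"
      by (simp only:) (intro vge_sum vge_mult_int[OF vge_of_int] g, simp)
    have ks: "q \<le> k - s" using False s k_eq r_less by (cases d) auto
    have "coeff (W \<xi>) (k - s) = (\<Sum>s'\<le>s. of_nat ((k - s') choose (s - s')) * m s')"
    proof -
      have "coeff (W \<xi>) (k - s) = (\<Sum>s'\<le>r. \<Sum>\<xi>'\<in>\<Lambda>. \<omega> \<xi> s' \<xi>' * (of_nat ((k - s') choose (k - s)) * (- \<xi>') ^ (k - s' - (k - s))))"
        unfolding W_def by (subst sum.swap) (simp add: coeff_sum coeff_linear_power_le)
      also have "\<dots> = (\<Sum>s'\<le>s. \<Sum>\<xi>'\<in>\<Lambda>. \<omega> \<xi> s' \<xi>' * (of_nat ((k - s') choose (k - s)) * (- \<xi>') ^ (k - s' - (k - s))))"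
      proof (rule sum.mono_neutral_right)
        show "\<forall>i\<in>{..r} - {..s}. (\<Sum>\<xi>'\<in>\<Lambda>. \<omega> \<xi> i \<xi>' * (of_nat ((k - i) choose (k - s)) * (- \<xi>') ^ (k - i - (k - s)))) = 0"
        proof
          fix i assume "i \<in> {..r} - {..s}"
          then have "(k - i) choose (k - s) = 0" using k_eq s by (intro binomial_eq_0) auto
          then show "(\<Sum>\<xi>'\<in>\<Lambda>. \<omega> \<xi> i \<xi>' * (of_nat ((k - i) choose (k - s)) * (- \<xi>') ^ (k - i - (k - s)))) = 0"
            by (simp only:) simp
        qed
      qed (use s in auto)
      also have "\<dots> = (\<Sum>s'\<le>s. of_nat ((k - s') choose (s - s')) * m s')"
      proof (intro sum.cong refl)
        fix s' assume "s' \<in> {..s}"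
        then have 1: "k - s' - (k - s) = s - s'" and "k - s \<le> k - s'" using s k_eq by auto
        then have "(k - s') choose (k - s) = (k - s') choose (s - s')" by (metis binomial_symmetric)
        note 1 this
        then show "(\<Sum>\<xi>'\<in>\<Lambda>. \<omega> \<xi> s' \<xi>' * (of_nat ((k - s') choose (k - s)) * (- \<xi>') ^ (k - s' - (k - s))))
          = of_nat ((k - s') choose (s - s')) * m s'"
          by (simp add: m_def sum_distrib_left algebra_simps)
      qed
      finally show ?thesis .
    qed
    then have "coeff (W \<xi>) (k - s) - h = (\<Sum>s'\<le>s. (of_nat ((k - s') choose (s - s')) - of_nat ((r - s') choose (s - s'))) * m s')"
      by (simp add: h_def sum_subtractf left_diff_distrib)
    moreover have "vge n (\<Sum>s'\<le>s. (of_nat ((k - s') choose (s - s')) - of_nat ((r - s') choose (s - s'))) * m s')"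
    proof (rule vge_sum)
      fix s' assume s': "s' \<in> {..s}"
      \<comment> \<open>\<open>k - s'\<close> and \<open>r - s'\<close> have the same last digit in
        base \<open>q\<close>, and \<open>s - s' < q\<close>. The resulting factor \<open>p\<close>
        absorbs the loss of \<open>m s'\<close>.\<close>
      have "int p dvd int ((k - s') choose (s - s')) - int ((r - s') choose (s - s'))"
        using lucas[of "r - s'" "s - s'" d 0] s s' r_less k_eq by simp
      from vge_of_int_dvd[OF this] have "vge (real e) (of_nat ((k - s') choose (s - s')) - of_nat ((r - s') choose (s - s')))" by simp
      then show "vge n ((of_nat ((k - s') choose (s - s')) - of_nat ((r - s') choose (s - s'))) * m s')"
        by (rule vge_mult'[OF _ vm]) (use s' \<delta> in auto)
    qed
    ultimately have "vge n (coeff (W \<xi>) (k - s) - h)" by simp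
    then have "vge (n - real s) ((coeff (W \<xi>) (k - s) - h) + h)"
      by (intro vge_add[OF _ vh]) (auto elim: vge_mono)
    then have 1: "vge (n - real s) (coeff (W \<xi>) (k - s))" by simp
    have 2: "vge (n - real s) (coeff (Tp \<xi> Pv) (k - s))" by (rule vge_mono[OF high[OF \<xi> ks]]) simp
    have 3: "vge (n - real s) (coeff (Tp \<xi> Pv + W \<xi> - smult a (Pw \<xi>)) (k - s))" by (rule vge_mono[OF pgeD[OF E[OF \<xi>]]]) simp
    have "vge (n - real s) (a * coeff (Pw \<xi>) (k - s))"
      using vge_diff[OF vge_add[OF 2 1] 3] by simp
    then show ?thesis by (simp add: vge_cancel[OF va] algebra_simps)
  qed
qed

end

section \<open>Weights divisible by \<open>q\<close>\<close>

context digit_field begin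

text \<open>Subtracting the leading multiple of \<open>\<Phi> ^ d\<close> leaves degree below
  \<open>d * q\<close>, hence no digit \<open>d\<close>.\<close>

lemma rr_top: assumes "degree P \<le> d * q" "1 \<le> d" shows "rr d P = [:coeff P (d * q):]"
proof -
  define c where "c = coeff P (d * q)"
  have deg\<Phi>: "degree (\<Phi> ^ d) = d * q" by (simp add: degree_power_eq degree_\<Phi>)
  have lead: "coeff (\<Phi> ^ d) (d * q) = 1"
    using deg\<Phi> monic_\<Phi> by (metis lead_coeff_power power_one)
  define P' where "P' = P - smult c (\<Phi> ^ d)"
  have "coeff P' i = 0" if "d * q \<le> i" for i
  proof (cases "i = d * q")
    case False
    then have "d * q < i" using that by simp
    then show ?thesis using assms deg\<Phi> by (simp add: P'_def coeff_eq_0)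
  qed (simp add: P'_def c_def lead)
  then have "degree P' \<le> d * q - 1" by (intro degree_le) auto
  moreover have "0 < d * q" using assms q_ge_2 by simp
  ultimately have "degree P' < d * q" by linarith
  then have "degree P' < (d - 1 + 1) * q" using assms by simp
  then have "rr d P' = 0" using assms by (intro rr_eq_0[of P' "d - 1"]) auto
  moreover have "rr d (\<Phi> ^ d) = 1" using rr_mult_power[of 1 d d] q_ge_2 by simp
  moreover have "P = P' + smult c (\<Phi> ^ d)" by (simp add: P'_def)
  ultimately show ?thesis unfolding c_def by (metis add_0 rr_add rr_smult smult_1_left smult_one)
qed

end

context hecke_digits begin

text \<open>Only the leading coefficients of the children of \<open>w\<close> enter the equation,
  and their bound \<open>n - 2 * \<delta>\<close> must be improved to \<open>n - \<delta>\<close>.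
  This is done by \<open>rel\<close>, which ties the leading coefficient of \<open>w\<close> to that
  of each child and which the last conclusion reestablishes one level up. The bound in degree
  \<open>k - 1\<close> is kept for \<open>s = 1\<close>, where the single factor
  \<open>\<pi>\<close> need not outweigh \<open>2 * \<delta>\<close>.\<close>

lemma step_r_zero:
  assumes r0: "r = 0" and d2: "2 \<le> d" and dq: "2 * d \<le> q"
    and va: "v a = ereal \<delta>" and \<delta>: "0 \<le> \<delta>" "\<delta> \<le> 1"
    and deg: "degree Pv \<le> k" "\<And>\<xi>. \<xi> \<in> \<Lambda> \<Longrightarrow> degree (Pw \<xi>) \<le> k"
    and w: "\<And>\<xi> j. \<xi> \<in> \<Lambda> \<Longrightarrow> j \<le> d \<Longrightarrow> pge (n - \<delta> - real j) (rr j (Pw \<xi>))"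
    and u: "\<And>\<xi> \<xi>'. \<xi> \<in> \<Lambda> \<Longrightarrow> \<xi>' \<in> \<Lambda> \<Longrightarrow> pge (n - 2 * \<delta>) (Pu \<xi> \<xi>')"
      "\<And>\<xi> \<xi>'. \<xi> \<in> \<Lambda> \<Longrightarrow> \<xi>' \<in> \<Lambda> \<Longrightarrow> vge (n - 1) (coeff (Pu \<xi> \<xi>') (k - 1))"
    and rel: "\<And>\<xi> \<xi>'. \<xi> \<in> \<Lambda> \<Longrightarrow> \<xi>' \<in> \<Lambda> \<Longrightarrow> vge n ((- \<pi>) ^ d * coeff (Pw \<xi>) k + a * coeff (Pu \<xi> \<xi>') k)"
    and eq: "\<And>\<xi>. \<xi> \<in> \<Lambda> \<Longrightarrow> node_eq n \<xi> Pv (Pw \<xi>) (Pu \<xi>)"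
  shows "\<And>j. j \<le> d \<Longrightarrow> pge (n - \<delta> - real j) (rr j Pv)"
    and "\<And>\<xi>. \<xi> \<in> \<Lambda> \<Longrightarrow> pge (n - 2 * \<delta>) (Pw \<xi>)"
    and "\<And>\<xi>. \<xi> \<in> \<Lambda> \<Longrightarrow> vge (n - 1) (coeff (Pw \<xi>) (k - 1))"
    and "\<And>\<xi>. \<xi> \<in> \<Lambda> \<Longrightarrow> vge n ((- \<pi>) ^ d * coeff Pv k + a * coeff (Pw \<xi>) k)"
proof -
  have a\<delta>: "vge \<delta> a" using va by (simp add: vge_def)
  have k: "k = d * q" using k_eq r0 by simp
  have kq: "q \<le> k - 1" "q \<le> k"
  proof -
    have "2 * q \<le> k" using d2 by (simp add: k)
    then show "q \<le> k - 1" "q \<le> k" using q_ge_2 by linarith+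
  qed
  have small: "r + d < q" using r0 d2 dq by simp
  have e1: "1 \<le> real e" using e_ge_1 by simp
  define \<omega> where "\<omega> \<xi> s \<xi>' = coeff (Pu \<xi> \<xi>') k" for \<xi> \<xi>' and s :: nat
  define W where "W \<xi> = (\<Sum>\<xi>'\<in>\<Lambda>. \<Sum>s\<le>r. smult (\<omega> \<xi> s \<xi>') ([:-\<xi>', 1:] ^ (k - s)))" for \<xi>
  have W: "W \<xi> = (\<Sum>\<xi>'\<in>\<Lambda>. smult (coeff (Pu \<xi> \<xi>') k) ([:-\<xi>', 1:] ^ k))" for \<xi>
    by (simp add: W_def r0 \<omega>_def)
  have E: "pge n (Tp \<xi> Pv + W \<xi> - smult a (Pw \<xi>))" if \<xi>: "\<xi> \<in> \<Lambda>" for \<xi>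
  proof -
    have "pge n (Tm \<xi>' (Pu \<xi> \<xi>') - (\<Sum>s\<in>{0}. smult (\<pi> ^ s * coeff (Pu \<xi> \<xi>') (k - s)) ([:-\<xi>', 1:] ^ (k - s))))"
      if \<xi>': "\<xi>' \<in> \<Lambda>" for \<xi>'
    proof (rule Tm_approx[OF _ _ \<xi>'])
      fix s :: nat assume s: "s \<notin> {0}"
      show "vge (n - real s) (coeff (Pu \<xi> \<xi>') (k - s))"
      proof (cases "s = 1")
        case True
        then show ?thesis using u(2)[OF \<xi> \<xi>'] by simp
      next
        case False
        then have "2 \<le> real s" using s by simp
        then show ?thesis using \<delta> by (intro vge_mono[OF pgeD[OF u(1)[OF \<xi> \<xi>']]]) auto
      qed
    qed simp
    then have "pge n ((\<Sum>\<xi>'\<in>\<Lambda>. Tm \<xi>' (Pu \<xi> \<xi>')) - W \<xi>)"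
      unfolding W sum_subtractf[symmetric] by (intro pge_sum) simp
    from pge_diff[OF eq[OF \<xi>, unfolded node_eq_def] this] show ?thesis by (simp add: algebra_simps)
  qed
  have pPw: "pge (n - \<delta> - real d) (Pw \<xi>)" if "\<xi> \<in> \<Lambda>" for \<xi>
    by (rule pge_from_rr[OF degree_less[OF deg(2)[OF that]]]) (auto intro: pge_mono[OF w[OF that]])
  have high: "vge n (coeff (Tp \<xi> Pv) i)" if "\<xi> \<in> \<Lambda>" "q \<le> i" for \<xi> i
  proof (rule coeff_Tp_above_q[OF deg(1) _ _ that, where D = "real d"])
    fix \<xi> assume \<xi>: "\<xi> \<in> \<Lambda>"
    have 1: "pge (n - real d) (smult a (Pw \<xi>))" by (rule pge_smult[OF a\<delta> pPw[OF \<xi>]]) auto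
    have 2: "pge (n - real d) (W \<xi>)" unfolding W
    proof (intro pge_sum)
      fix \<xi>' assume \<xi>': "\<xi>' \<in> \<Lambda>"
      show "pge (n - real d) (smult (coeff (Pu \<xi> \<xi>') k) ([:- \<xi>', 1:] ^ k))"
        by (rule pge_smult[OF pgeD[OF u(1)[OF \<xi> \<xi>']] pge_linear[OF \<xi>']]) (use \<delta> d2 in simp)
    qed
    have 3: "pge (n - real d) (Tp \<xi> Pv + W \<xi> - smult a (Pw \<xi>))"
      by (rule pge_mono[OF E[OF \<xi>]]) auto
    show "pge (n - real d) (Tp \<xi> Pv)"
      using pge_add[OF pge_diff[OF 3 2] 1] by (simp add: algebra_simps)
  next
    show "real d + real d \<le> real q" using dq by linarith
  qed
  have lead: "vge n ((\<Sum>\<xi>'\<in>\<Lambda>. coeff (Pu \<xi> \<xi>') k) - a * coeff (Pw \<xi>) k)" if \<xi>: "\<xi> \<in> \<Lambda>" for \<xi>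
    using vge_diff[OF pgeD[OF E[OF \<xi>], of k] high[OF \<xi> kq(2)]]
    by (simp add: W coeff_sum coeff_linear_power_le)
  \<comment> \<open>Summing \<open>rel\<close> over the \<open>q\<close> children and inserting
    \<open>lead\<close> gives \<open>(a ^ 2 + q * (- \<pi>) ^ d) * c = 0\<close> modulo
    \<open>\<pi> ^ n\<close>. As \<open>c\<close> is known to \<open>n - 3 * \<delta>\<close>, the
    second term drops out by \<open>3 * \<delta> \<le> e + d\<close>; so \<open>c\<close> is known
    to \<open>n - 2 * \<delta>\<close>, which makes \<open>(- \<pi>) ^ d * c\<close> negligible, and
    \<open>rel\<close> bounds each child separately.\<close>
  have cu: "vge (n - \<delta>) (coeff (Pu \<xi> \<xi>') k)" if \<xi>: "\<xi> \<in> \<Lambda>" and \<xi>': "\<xi>' \<in> \<Lambda>" for \<xi> \<xi>'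
  proof -
    define c where "c = coeff (Pw \<xi>) k"
    define \<Sigma> where "\<Sigma> = (\<Sum>\<xi>'\<in>\<Lambda>. coeff (Pu \<xi> \<xi>') k)"
    have L: "vge n (\<Sigma> - a * c)" using lead[OF \<xi>] by (simp add: \<Sigma>_def c_def)
    have "vge (n - 2 * \<delta>) \<Sigma>" unfolding \<Sigma>_def by (intro vge_sum pgeD u(1) \<xi>)
    then have "vge (n - 2 * \<delta>) (\<Sigma> - (\<Sigma> - a * c))" by (rule vge_diff[OF _ vge_mono[OF L]]) (use \<delta> in simp)
    then have c3: "vge (n - 3 * \<delta>) c" by (simp add: vge_cancel[OF va] algebra_simps)
    have "vge n (\<Sum>\<xi>'\<in>\<Lambda>. (- \<pi>) ^ d * c + a * coeff (Pu \<xi> \<xi>') k)"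
      unfolding c_def by (intro vge_sum rel \<xi>)
    then have 1: "vge n (of_nat q * ((- \<pi>) ^ d * c) + a * \<Sigma>)"
      by (simp add: sum.distrib card_\<Lambda> \<Sigma>_def sum_distrib_left)
    have 2: "vge n (of_nat q * ((- \<pi>) ^ d * c))"
    proof (rule vge_mult'[OF vge_q])
      show "vge (n - 3 * \<delta> + real d) ((- \<pi>) ^ d * c)" using c3 by (simp add: vge_minus_\<pi>_cancel)
      show "n \<le> real e + (n - 3 * \<delta> + real d)" using \<delta> e1 d2 by linarith
    qed
    have 3: "vge n (a * (\<Sigma> - a * c))" by (rule vge_mult'[OF a\<delta> L]) (use \<delta> in simp)
    have "vge n (a * (a * c))" using vge_diff[OF vge_diff[OF 1 2] 3] by (simp add: algebra_simps)
    then have "vge (n - 2 * \<delta>) c" by (simp add: vge_cancel[OF va] algebra_simps)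
    then have "vge (n - 2 * \<delta> + real d) ((- \<pi>) ^ d * c)" by (simp add: vge_minus_\<pi>_cancel)
    then have "vge n ((- \<pi>) ^ d * c)" by (rule vge_mono) (use \<delta> d2 in linarith)
    from vge_diff[OF rel[OF \<xi> \<xi>'] this] have "vge n (a * coeff (Pu \<xi> \<xi>') k)" by (simp add: c_def)
    then show ?thesis by (simp add: vge_cancel[OF va])
  qed
  have \<omega>: "vge (n - \<delta>) (\<omega> \<xi> s \<xi>')" if "\<xi> \<in> \<Lambda>" "s \<le> r" "\<xi>' \<in> \<Lambda>" for \<xi> \<xi>' s
    using cu that by (simp add: \<omega>_def)
  have \<delta>e: "\<delta> \<le> real e" using \<delta> e1 by simp
  note cmp = compare_digits[OF small \<delta>e high \<omega> E[unfolded W_def]]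
  have G: "pge n (Tp \<xi> Pv + Q (\<omega> \<xi>) 0)" if \<xi>: "\<xi> \<in> \<Lambda>" for \<xi>
  proof -
    have "pge n (smult a (rr 0 (Pw \<xi>)))" by (rule pge_smult[OF a\<delta> w[OF \<xi>]]) auto
    from pge_add[OF cmp[OF \<xi> _ \<xi> _ _ \<xi>, of 0] this] show ?thesis by simp
  qed
  have pQ: "pge (n - \<delta>) (Q (\<omega> \<xi>) j)" if "\<xi> \<in> \<Lambda>" for \<xi> j by (rule pge_Q[OF \<omega>[OF that]])
  have TpA: "pge (n - \<delta>) (Tp \<xi> Pv)" if "\<xi> \<in> \<Lambda>" for \<xi>
  proof -
    have "pge (n - \<delta>) ((Tp \<xi> Pv + Q (\<omega> \<xi>) 0) - Q (\<omega> \<xi>) 0)"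
      by (rule pge_diff[OF pge_mono[OF G[OF that]] pQ[OF that]]) (use \<delta> in simp)
    then show ?thesis by simp
  qed
  show A: "pge (n - \<delta> - real j) (rr j Pv)" if "j \<le> d" for j
    by (rule Tp_inverse[OF degree_less[OF deg(1)] TpA that])
  show "pge (n - 2 * \<delta>) (Pw \<xi>)" if \<xi>: "\<xi> \<in> \<Lambda>" for \<xi>
  proof (rule pge_from_rr[OF degree_less[OF deg(2)[OF \<xi>]]])
    fix j assume j: "j \<le> d"
    show "pge (n - 2 * \<delta>) (rr j (Pw \<xi>))"
    proof (cases "j = 0")
      case True
      then show ?thesis using w[OF \<xi> j] \<delta> by (auto elim!: pge_mono)
    next
      case False
      have 1: "pge (n - \<delta>) (smult (of_nat (d choose j)) (Q (\<omega> \<xi>) j))"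
        by (rule pge_smult[OF vge_of_nat pQ[OF \<xi>]]) simp
      have "pge n (smult (of_nat (d choose j)) (Q (\<omega> \<xi>) j) - smult a (rr j (Pw \<xi>)))"
        using cmp[OF \<xi> _ \<xi> _ _ \<xi> j] False by simp
      then have 2: "pge (n - \<delta>) (smult (of_nat (d choose j)) (Q (\<omega> \<xi>) j) - smult a (rr j (Pw \<xi>)))"
        by (rule pge_mono) (use \<delta> in simp)
      have "pge (n - \<delta>) (smult a (rr j (Pw \<xi>)))" using pge_diff[OF 1 2] by simp
      from v_scaled_cancel[OF va this] show ?thesis by (auto elim!: pge_mono)
    qed
  qed
  show "vge (n - 1) (coeff (Pw \<xi>) (k - 1))" if \<xi>: "\<xi> \<in> \<Lambda>" for \<xi>
  proof -
    \<comment> \<open>The coefficient of degree \<open>k - 1\<close> in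
      \<open>[:-\<xi>', 1:] ^ k\<close> is \<open>- k * \<xi>'\<close>, a multiple of
      \<open>p\<close>.\<close>
    have "p dvd k" using p_dvd_q by (simp add: k)
    then have "vge (real e) (of_nat k)" by (rule vge_of_nat_dvd)
    have "vge n (\<Sum>\<xi>'\<in>\<Lambda>. coeff (Pu \<xi> \<xi>') k * (of_nat k * (- \<xi>')))"
    proof (rule vge_sum)
      fix \<xi>' assume \<xi>': "\<xi>' \<in> \<Lambda>"
      have "vge (real e) (of_nat k * (- \<xi>'))"
        by (rule vge_mult'[OF \<open>vge (real e) (of_nat k)\<close>, of 0]) (auto simp: \<Lambda>_int[OF \<xi>'])
      then show "vge n (coeff (Pu \<xi> \<xi>') k * (of_nat k * (- \<xi>')))"
        by (rule vge_mult'[OF cu[OF \<xi> \<xi>']]) (use \<delta>e in simp)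
    qed
    moreover have "coeff (W \<xi>) (k - 1) = (\<Sum>\<xi>'\<in>\<Lambda>. coeff (Pu \<xi> \<xi>') k * (of_nat k * (- \<xi>')))"
      unfolding W coeff_sum
    proof (intro sum.cong refl)
      fix \<xi>'
      have "k choose (k - 1) = k" "k - (k - 1) = 1" using kq q_ge_2 binomial_symmetric[of 1 k] by auto
      then show "coeff (smult (coeff (Pu \<xi> \<xi>') k) ([:- \<xi>', 1:] ^ k)) (k - 1) = coeff (Pu \<xi> \<xi>') k * (of_nat k * (- \<xi>'))"
        by (simp add: coeff_linear_power_le del: One_nat_def)
    qed
    ultimately have "vge n (coeff (W \<xi>) (k - 1))" by simp
    from vge_diff[OF vge_add[OF high[OF \<xi> kq(1)] this] pgeD[OF E[OF \<xi>], of "k - 1"]]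
    have "vge n (a * coeff (Pw \<xi>) (k - 1))" by simp
    then have "vge (n - \<delta>) (coeff (Pw \<xi>) (k - 1))" by (simp add: vge_cancel[OF va])
    then show ?thesis by (rule vge_mono) (use \<delta> in simp)
  qed
  show "vge n ((- \<pi>) ^ d * coeff Pv k + a * coeff (Pw \<xi>) k)" if \<xi>: "\<xi> \<in> \<Lambda>" for \<xi>
  proof -
    \<comment> \<open>Degree \<open>d\<close> of the digit 0 equation: the parent contributes
      \<open>(- \<pi>) ^ d\<close> times its constant digit \<open>d\<close>, which is its leading
      coefficient, with an error that is harmless by \<open>\<delta> \<le> 1\<close>. The children
      contribute the sum of their leading coefficients, and \<open>lead\<close> replaces it by
      \<open>a\<close> times that of \<open>Pw \<xi>\<close>.\<close>
    have "vge (n - \<delta> + 1) (coeff (Tp \<xi> Pv) d - (- \<pi>) ^ d * poly (rr d Pv) \<xi>)"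
      by (rule coeff_Tp_approx[OF degree_less[OF deg(1)] A \<xi>]) auto
    moreover have "rr d Pv = [:coeff Pv k:]" using rr_top[of Pv d] deg(1) d2 by (simp add: k)
    ultimately have 1: "vge n (coeff (Tp \<xi> Pv) d - (- \<pi>) ^ d * coeff Pv k)"
      using \<delta> by (auto elim!: vge_mono)
    have "coeff (Q (\<omega> \<xi>) 0) d = (\<Sum>\<xi>'\<in>\<Lambda>. coeff (Pu \<xi> \<xi>') k)"
      using coeff_Q[of 0 0 "\<omega> \<xi>"] by (simp add: r0 \<omega>_def)
    then have 2: "vge n (coeff (Tp \<xi> Pv) d + (\<Sum>\<xi>'\<in>\<Lambda>. coeff (Pu \<xi> \<xi>') k))"
      using pgeD[OF G[OF \<xi>], of d] by simp
    show ?thesis using vge_diff[OF vge_diff[OF 2 1] lead[OF \<xi>]] by simp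
  qed
qed

lemma Tm_add: "Tm \<xi> (P + R) = Tm \<xi> P + Tm \<xi> R"
  by (simp add: Tm_def sum.distrib smult_add_left algebra_simps)

lemma Tm_smult: "Tm \<xi> (smult c P) = smult c (Tm \<xi> P)"
  by (simp add: Tm_def smult_sum_right algebra_simps)

text \<open>This is \<open>\<pi> ^ q * \<Phi> ((y - \<xi>) / \<pi>)\<close>, the children's term of
  \<open>\<Phi>\<close> in weight \<open>q\<close>.\<close>

definition B :: "'c \<Rightarrow> 'c poly" where
  "B \<xi> = [:-\<xi>, 1:] ^ q - smult (\<pi> ^ (q - 1)) [:-\<xi>, 1:]"

lemma Tm_\<Phi>: assumes "k = q" shows "Tm \<xi> \<Phi> = B \<xi>"
proof -
  have "Tm \<xi> \<Phi> = (\<Sum>s\<le>q. smult (\<pi> ^ s * coeff \<Phi> (q - s)) ([:- \<xi>, 1:] ^ (q - s)))"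
    unfolding Tm_def by (simp add: assms)
  also have "\<dots> = (\<Sum>s\<le>q. (if s = 0 then [:-\<xi>, 1:] ^ q else 0)
      + (if s = q - 1 then - smult (\<pi> ^ (q - 1)) [:-\<xi>, 1:] else 0))"
  proof (intro sum.cong refl)
    fix s assume "s \<in> {..q}"
    then have "coeff \<Phi> (q - s) = (if s = 0 then 1 else 0) - (if s = q - 1 then 1 else 0)"
      using q_ge_2 by (auto simp: coeff_\<Phi>)
    then show "smult (\<pi> ^ s * coeff \<Phi> (q - s)) ([:- \<xi>, 1:] ^ (q - s)) =
         (if s = 0 then [:- \<xi>, 1:] ^ q else 0) + (if s = q - 1 then - smult (\<pi> ^ (q - 1)) [:- \<xi>, 1:] else 0)"
      using q_ge_2 by auto
  qed
  finally show ?thesis using q_ge_2 by (simp add: sum.distrib B_def)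
qed

lemma pge_B: "\<xi> \<in> \<Lambda> \<Longrightarrow> pge 0 (B \<xi>)"
  unfolding B_def using pge_linear[of \<xi> q] pge_linear[of \<xi> 1] vge_\<pi>_power[of 0 "q - 1"]
  by (intro pge_diff pge_smult[of 0 _ 0]) auto

lemma coeff_B_q: "coeff (B \<xi>) q = 1"
  using q_ge_2 by (auto simp: B_def coeff_linear_power_le coeff_pCons split: nat.splits)

lemma coeff_B_1: assumes "\<xi> \<in> \<Lambda>" shows "vge 1 (coeff (B \<xi>) 1)"
proof -
  have "vge 1 (of_nat q * (- \<xi>) ^ (q - 1))"
    by (rule vge_mult'[OF vge_q vge_power_int]) (use e_ge_1 in \<open>auto simp: \<Lambda>_int[OF assms]\<close>)
  moreover have "vge 1 (\<pi> ^ (q - 1))" using q_ge_2 by (intro vge_\<pi>_power) auto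
  ultimately show ?thesis using vge_diff by (simp add: B_def coeff_linear_power_le)
qed

text \<open>The coefficient of \<open>y\<close> in the equation reads
  \<open>(a + \<kappa> * \<beta>1) * c_w = \<pi> * c_v\<close> for the leading coefficients, where
  \<open>\<beta>1\<close> is the sum of the linear coefficients of the \<open>B \<xi>\<close> and
  \<open>\<kappa>\<close> is the ratio \<open>c_u / c_w\<close> one level down.
  \<open>next_\<kappa>\<close> is the ratio \<open>c_w / c_v\<close>.\<close>

definition next_\<kappa> :: "'c \<Rightarrow> 'c" where
  "next_\<kappa> \<kappa> = \<pi> / (a + \<kappa> * (\<Sum>\<xi>\<in>\<Lambda>. coeff (B \<xi>) 1))"

text \<open>\<open>\<eta>\<close> expresses that digit 0 of a vertex is nearly the constant
  \<open>\<eta>\<close> times its leading coefficient. By the constant coefficient of the equation,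
  digit 0 of the parent takes the value \<open>(a * \<eta> - \<kappa> * \<beta>0) * c_w\<close>,
  with \<open>\<beta>0\<close> the sum of the constant coefficients of the \<open>B \<xi>\<close>;
  then \<open>c_w\<close> is replaced by \<open>next_\<kappa> \<kappa> * c_v\<close>.\<close>

definition next_\<eta> :: "'c \<Rightarrow> 'c \<Rightarrow> 'c" where
  "next_\<eta> \<kappa> \<eta> = (a * \<eta> - \<kappa> * (\<Sum>\<xi>\<in>\<Lambda>. coeff (B \<xi>) 0)) * next_\<kappa> \<kappa>"

lemma v_a_plus:
  assumes "v a = ereal \<delta>" "\<delta> < 1" "v \<kappa> = ereal (1 - \<delta>)"
  shows "v (a + \<kappa> * (\<Sum>\<xi>\<in>\<Lambda>. coeff (B \<xi>) 1)) = ereal \<delta>"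
proof (rule v_add_eq[OF assms(1)])
  have "vge 1 (\<Sum>\<xi>\<in>\<Lambda>. coeff (B \<xi>) 1)" by (intro vge_sum coeff_B_1)
  then show "vge (2 - \<delta>) (\<kappa> * (\<Sum>\<xi>\<in>\<Lambda>. coeff (B \<xi>) 1))"
    using assms(3) by (intro vge_mult'[of "1 - \<delta>" \<kappa> 1]) (auto simp: vge_def)
qed (use assms in simp)

lemma v_next_\<kappa>:
  assumes "v a = ereal \<delta>" "\<delta> < 1" "v \<kappa> = ereal (1 - \<delta>)"
  shows "v (next_\<kappa> \<kappa>) = ereal (1 - \<delta>)"
  using v_inverse[OF v_a_plus[OF assms]] v_\<pi>
  by (simp add: next_\<kappa>_def divide_inverse v_mult one_ereal_def)

lemma vge_next_\<eta>_factor: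
  assumes "v a = ereal \<delta>" "v \<kappa> = ereal (1 - \<delta>)" "vge 0 \<eta>"
  shows "vge (min \<delta> (1 - \<delta>)) (a * \<eta> - \<kappa> * (\<Sum>\<xi>\<in>\<Lambda>. coeff (B \<xi>) 0))"
proof (rule vge_diff)
  show "vge (min \<delta> (1 - \<delta>)) (a * \<eta>)"
    using assms by (intro vge_mult'[of \<delta> a 0]) (auto simp: vge_def)
  have "vge 0 (\<Sum>\<xi>\<in>\<Lambda>. coeff (B \<xi>) 0)" by (intro vge_sum pgeD[OF pge_B])
  then show "vge (min \<delta> (1 - \<delta>)) (\<kappa> * (\<Sum>\<xi>\<in>\<Lambda>. coeff (B \<xi>) 0))"
    using assms by (intro vge_mult'[of "1 - \<delta>" \<kappa> 0]) (auto simp: vge_def)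
qed

text \<open>For \<open>k = q\<close> the leading coefficients of siblings agree up to \<open>\<pi> ^ n / a\<close>: modulo that, each is
  \<open>\<kappa>\<close> times the leading coefficient of the parent, with \<open>\<kappa> \<approx> \<pi> / a\<close> depending only on the level.
  Summing over siblings then gives \<open>(a - q \<kappa>) c \<approx> 0\<close>.\<close>

lemma step_q:
  assumes d1: "d = 1" and r0: "r = 0"
    and va: "v a = ereal \<delta>" and \<delta>: "0 \<le> \<delta>" "\<delta> < 1"
    and \<kappa>: "v \<kappa> = ereal (1 - \<delta>)" and \<eta>: "vge 0 \<eta>" "vge 0 \<eta>'"
    and deg: "degree Pv \<le> k" "\<And>\<xi>. \<xi> \<in> \<Lambda> \<Longrightarrow> degree (Pw \<xi>) \<le> k"
      "\<And>\<xi> \<xi>'. \<xi> \<in> \<Lambda> \<Longrightarrow> \<xi>' \<in> \<Lambda> \<Longrightarrow> degree (Pu \<xi> \<xi>') \<le> k"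
    and w: "\<And>\<xi>. \<xi> \<in> \<Lambda> \<Longrightarrow> vge (n - \<delta> - 1) (coeff (Pw \<xi>) q)"
      "\<And>\<xi>. \<xi> \<in> \<Lambda> \<Longrightarrow> pge (n - \<delta>) (rr 0 (Pw \<xi>) - [:\<eta> * coeff (Pw \<xi>) q:])"
    and u: "\<And>\<xi> \<xi>'. \<xi> \<in> \<Lambda> \<Longrightarrow> \<xi>' \<in> \<Lambda> \<Longrightarrow> vge (n - \<delta>) (coeff (Pu \<xi> \<xi>') q - \<kappa> * coeff (Pw \<xi>) q)"
      "\<And>\<xi> \<xi>'. \<xi> \<in> \<Lambda> \<Longrightarrow> \<xi>' \<in> \<Lambda> \<Longrightarrow> vge (n - 2 * \<delta>) (coeff (Pu \<xi> \<xi>') q)"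
      "\<And>\<xi> \<xi>'. \<xi> \<in> \<Lambda> \<Longrightarrow> \<xi>' \<in> \<Lambda> \<Longrightarrow> pge (n - \<delta>) (rr 0 (Pu \<xi> \<xi>') - [:\<eta>' * coeff (Pu \<xi> \<xi>') q:])"
    and eq: "\<And>\<xi>. \<xi> \<in> \<Lambda> \<Longrightarrow> node_eq n \<xi> Pv (Pw \<xi>) (Pu \<xi>)"
  shows "vge (n - \<delta> - 1) (coeff Pv q)"
    and "pge (n - \<delta>) (rr 0 Pv - [:next_\<eta> \<kappa> \<eta> * coeff Pv q:])"
    and "\<And>\<xi>. \<xi> \<in> \<Lambda> \<Longrightarrow> vge (n - \<delta>) (coeff (Pw \<xi>) q - next_\<kappa> \<kappa> * coeff Pv q)"
    and "\<And>\<xi>. \<xi> \<in> \<Lambda> \<Longrightarrow> vge (n - 2 * \<delta>) (coeff (Pw \<xi>) q)"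
proof -
  have kq: "k = q" using k_eq d1 r0 by simp
  have a\<delta>: "vge \<delta> a" using va by (simp add: vge_def)
  have \<kappa>\<delta>: "vge (1 - \<delta>) \<kappa>" using \<kappa> by (simp add: vge_def)
  have e1: "1 \<le> real e" using e_ge_1 by simp
  have split: "P = rr 0 P + smult (coeff P q) \<Phi>" if "degree P \<le> k" for P
  proof -
    have "P = smult (coeff P q) \<Phi> + rr 0 P"
      using rr_expansion[OF degree_less[OF that]] rr_top[of P 1] that d1 kq by (simp add: atMost_Suc)
    then show ?thesis by (simp only: add.commute)
  qed
  define cw where "cw \<xi> = coeff (Pw \<xi>) q" for \<xi>
  define cu where "cu \<xi> \<xi>' = coeff (Pu \<xi> \<xi>') q" for \<xi> \<xi>'
  define cv where "cv = coeff Pv q"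
  define W where "W \<xi> = (\<Sum>\<xi>'\<in>\<Lambda>. smult (cu \<xi> \<xi>') (B \<xi>'))" for \<xi>
  have E: "pge n (Tp \<xi> Pv + W \<xi> - smult a (Pw \<xi>))" if \<xi>: "\<xi> \<in> \<Lambda>" for \<xi>
  proof -
    have "pge n ((\<Sum>\<xi>'\<in>\<Lambda>. Tm \<xi>' (Pu \<xi> \<xi>')) - W \<xi>)"
      unfolding W_def sum_subtractf[symmetric]
    proof (rule pge_sum)
      fix \<xi>' assume \<xi>': "\<xi>' \<in> \<Lambda>"
      \<comment> \<open>Digit 0 of a child contributes nothing: it has no coefficient of degree
        \<open>q\<close>, its middle coefficients have loss \<open>\<delta> < 1\<close> against a
        factor \<open>\<pi>\<close>, and its constant coefficient has loss
        \<open>2 * \<delta>\<close> against \<open>\<pi> ^ q\<close>.\<close>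
      define R where "R = rr 0 (Pu \<xi> \<xi>')"
      have "Tm \<xi>' (Pu \<xi> \<xi>') = Tm \<xi>' R + smult (cu \<xi> \<xi>') (B \<xi>')"
        using split[OF deg(3)[OF \<xi> \<xi>']] by (metis R_def Tm_add Tm_smult Tm_\<Phi>[OF kq] cu_def)
      moreover have "pge n (Tm \<xi>' R - (\<Sum>s\<in>{}. smult (\<pi> ^ s * coeff R (k - s)) ([:-\<xi>', 1:] ^ (k - s))))"
      proof (rule Tm_approx[OF _ _ \<xi>'])
        fix s assume s: "s \<le> k"
        have Y: "vge (n - \<delta>) (coeff (R - [:\<eta>' * cu \<xi> \<xi>':]) i)" for i
          unfolding R_def cu_def by (rule pgeD[OF u(3)[OF \<xi> \<xi>']])
        consider "s = 0" | "0 < s" "s < q" | "s = q" using s kq by linarith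
        then show "vge (n - real s) (coeff R (k - s))"
        proof cases
          case 1
          then show ?thesis using degree_rr[of 0 "Pu \<xi> \<xi>'"] kq by (simp add: R_def coeff_eq_0)
        next
          case 2
          then have "coeff [:\<eta>' * cu \<xi> \<xi>':] (k - s) = 0" using kq by (auto simp: coeff_pCons split: nat.splits)
          then have "vge (n - \<delta>) (coeff R (k - s))" using Y[of "k - s"] by simp
          then show ?thesis by (rule vge_mono) (use 2 \<delta> in linarith)
        next
          case 3
          have "vge (n - 2 * \<delta>) (\<eta>' * cu \<xi> \<xi>')" unfolding cu_def by (rule vge_mult_int[OF \<eta>(2) u(2)[OF \<xi> \<xi>']])
          moreover have "vge (n - 2 * \<delta>) (coeff (R - [:\<eta>' * cu \<xi> \<xi>':]) 0)" by (rule vge_mono[OF Y]) (use \<delta> in simp)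
          ultimately have "vge (n - 2 * \<delta>) (coeff R 0)" using vge_add by fastforce
          then have "vge (n - real s) (coeff R 0)" by (rule vge_mono) (use 3 \<delta> q_ge_2 in linarith)
          then show ?thesis using 3 kq by simp
        qed
      qed simp
      ultimately show "pge n (Tm \<xi>' (Pu \<xi> \<xi>') - smult (cu \<xi> \<xi>') (B \<xi>'))" by simp
    qed
    from pge_diff[OF eq[OF \<xi>, unfolded node_eq_def] this] show ?thesis by (simp add: algebra_simps)
  qed
  have Rw: "pge (n - \<delta> - 1) (rr 0 (Pw \<xi>))" if \<xi>: "\<xi> \<in> \<Lambda>" for \<xi>
  proof -
    have "pge (n - \<delta> - 1) ([:\<eta> * coeff (Pw \<xi>) q:])" using vge_mult_int[OF \<eta>(1) w(1)[OF \<xi>]] by simp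
    from pge_add[OF pge_mono[OF w(2)[OF \<xi>]] this] show ?thesis by simp
  qed
  have pPw: "pge (n - \<delta> - 1) (Pw \<xi>)" if \<xi>: "\<xi> \<in> \<Lambda>" for \<xi>
    by (subst split[OF deg(2)[OF \<xi>]], rule pge_add[OF Rw[OF \<xi>] pge_smult[OF w(1)[OF \<xi>] pge_\<Phi>]]) simp
  have aPw: "pge (n - 1) (smult a (Pw \<xi>))" if \<xi>: "\<xi> \<in> \<Lambda>" for \<xi>
    by (rule pge_smult[OF a\<delta> pPw[OF \<xi>]]) simp
  have pW: "pge (n - 2) (W \<xi>)" if \<xi>: "\<xi> \<in> \<Lambda>" for \<xi>
    unfolding W_def cu_def using \<delta> by (intro pge_sum pge_smult[OF u(2)[OF \<xi>] pge_B]) auto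
  have T2: "pge (n - 2) (Tp \<xi> Pv)" if \<xi>: "\<xi> \<in> \<Lambda>" for \<xi>
    using pge_add[OF pge_diff[OF pge_mono[OF E[OF \<xi>], of "n - 2"] pW[OF \<xi>]] pge_mono[OF aPw[OF \<xi>], of "n - 2"]] by simp
  have Rv2: "pge (n - 2) (rr 0 Pv)"
    using Tp_inverse[OF degree_less[OF deg(1)] T2, of 0] by simp
  have cv3: "vge (n - 3) cv"
    using Tp_inverse[OF degree_less[OF deg(1)] T2, of 1] rr_top[of Pv 1] deg(1) d1 kq by (simp add: cv_def algebra_simps)
  have T: "Tp \<xi> Pv = Tp \<xi> (rr 0 Pv) + smult cv (Tp \<xi> \<Phi>)" for \<xi>
    using split[OF deg(1)] by (metis Tp_add Tp_smult cv_def)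
  have T\<Phi>: "vge 2 (coeff (Tp \<xi> \<Phi>) 1 + \<pi>)" if \<xi>: "\<xi> \<in> \<Lambda>" for \<xi>
    using pgeD[OF Tp_\<Phi>[OF \<xi>], of 1] by simp
  obtain \<xi>0 where \<xi>0: "\<xi>0 \<in> \<Lambda>" using card_\<Lambda> q_ge_2 by fastforce
  \<comment> \<open>The coefficient of \<open>y\<close> improves the bound \<open>n - 3\<close> by
    one: \<open>cv\<close> occurs there with the factor \<open>- \<pi>\<close>, and
    \<open>coeff_B_1\<close> gives the children an extra factor \<open>\<pi>\<close>.\<close>
  have cv2: "vge (n - 2) cv"
  proof -
    have 1: "vge (n - 1) (coeff (Tp \<xi>0 (rr 0 Pv)) 1)" using wgeD[OF wge_Tp[OF Rv2 \<xi>0], of 1] by (simp add: algebra_simps)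
    have 2: "vge (n - 1) (coeff (W \<xi>0) 1)"
      unfolding W_def coeff_sum coeff_smult cu_def
      using \<delta> by (intro vge_sum vge_mult'[OF u(2)[OF \<xi>0] coeff_B_1]) auto
    have 3: "vge (n - 1) (coeff (Tp \<xi>0 Pv + W \<xi>0 - smult a (Pw \<xi>0)) 1)" by (rule vge_mono[OF pgeD[OF E[OF \<xi>0]]]) simp
    have 4: "vge (n - 1) (cv * (coeff (Tp \<xi>0 \<Phi>) 1 + \<pi>))" by (rule vge_mult'[OF cv3 T\<Phi>[OF \<xi>0]]) simp
    have "vge (n - 1) (\<pi> ^ 1 * cv)"
      using vge_diff[OF 4 vge_diff[OF vge_add[OF 3 pgeD[OF aPw[OF \<xi>0], of 1]] vge_add[OF 1 2]]]
      by (simp add: T algebra_simps)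
    then show ?thesis unfolding vge_\<pi>_cancel by simp
  qed
  have pPv: "pge (n - 2) Pv"
    by (subst split[OF deg(1)], rule pge_add[OF Rv2 pge_smult[OF _ pge_\<Phi>]]) (use cv2 in \<open>auto simp: cv_def\<close>)
  \<comment> \<open>Degree \<open>q\<close> of the equation is used, where the parent is negligible;
    \<open>a - q * \<kappa>\<close> has the same value as \<open>a\<close> because \<open>p\<close>
    divides \<open>q\<close>.\<close>
  show cw2: "vge (n - 2 * \<delta>) (coeff (Pw \<xi>) q)" if \<xi>: "\<xi> \<in> \<Lambda>" for \<xi>
  proof -
    have 1: "vge n (coeff (Tp \<xi> Pv) q)" by (rule vge_mono[OF wgeD[OF wge_Tp[OF pPv \<xi>]]]) (use q_ge_2 in simp)
    have "coeff (W \<xi>) q = (\<Sum>\<xi>'\<in>\<Lambda>. cu \<xi> \<xi>')" by (simp add: W_def coeff_sum coeff_B_q)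
    then have "vge n ((\<Sum>\<xi>'\<in>\<Lambda>. cu \<xi> \<xi>') - a * cw \<xi>)"
      using vge_diff[OF pgeD[OF E[OF \<xi>], of q] 1] by (simp add: cw_def)
    then have 2: "vge (n - \<delta>) ((\<Sum>\<xi>'\<in>\<Lambda>. cu \<xi> \<xi>') - a * cw \<xi>)" by (rule vge_mono) (use \<delta> in simp)
    have "vge (n - \<delta>) (\<Sum>\<xi>'\<in>\<Lambda>. cu \<xi> \<xi>' - \<kappa> * cw \<xi>)" unfolding cu_def cw_def by (intro vge_sum u(1) \<xi>)
    then have 3: "vge (n - \<delta>) ((\<Sum>\<xi>'\<in>\<Lambda>. cu \<xi> \<xi>') - of_nat q * (\<kappa> * cw \<xi>))" by (simp add: sum_subtractf card_\<Lambda>)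
    have "vge (n - \<delta>) ((a + - (of_nat q * \<kappa>)) * cw \<xi>)" using vge_diff[OF 3 2] by (simp add: algebra_simps)
    moreover have "v (a + - (of_nat q * \<kappa>)) = ereal \<delta>"
    proof (rule v_add_eq[OF va, of "2 - \<delta>"])
      show "vge (2 - \<delta>) (- (of_nat q * \<kappa>))" unfolding vge_minus by (rule vge_mult'[OF vge_q \<kappa>\<delta>]) (use e1 in simp)
    qed (use \<delta> in simp)
    ultimately have "vge (n - \<delta> - \<delta>) (cw \<xi>)" by (simp add: vge_cancel)
    then show ?thesis by (simp add: cw_def algebra_simps)
  qed
  define \<beta>0 where "\<beta>0 = (\<Sum>\<xi>\<in>\<Lambda>. coeff (B \<xi>) 0)"
  define \<beta>1 where "\<beta>1 = (\<Sum>\<xi>\<in>\<Lambda>. coeff (B \<xi>) 1)"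
  define \<mu> where "\<mu> = a + \<kappa> * \<beta>1"
  have v\<mu>: "v \<mu> = ereal \<delta>" unfolding \<mu>_def \<beta>1_def by (rule v_a_plus[OF va \<delta>(2) \<kappa>])
  have \<mu>0: "\<mu> \<noteq> 0" using v\<mu> v_eq_infinity_iff[of \<mu>] by auto
  define \<kappa>2 where "\<kappa>2 = next_\<kappa> \<kappa>"
  define \<eta>2 where "\<eta>2 = next_\<eta> \<kappa> \<eta>"
  have \<kappa>2: "\<mu> * \<kappa>2 = \<pi>" using \<mu>0 by (simp add: \<kappa>2_def next_\<kappa>_def \<mu>_def \<beta>1_def)
  have \<eta>2: "\<eta>2 = (a * \<eta> - \<kappa> * \<beta>0) * \<kappa>2" by (simp add: \<eta>2_def next_\<eta>_def \<kappa>2_def \<beta>0_def)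
  have v\<eta>: "vge (min \<delta> (1 - \<delta>)) (a * \<eta> - \<kappa> * \<beta>0)" unfolding \<beta>0_def by (rule vge_next_\<eta>_factor[OF va \<kappa> \<eta>(1)])
  have v\<kappa>2: "vge (1 - \<delta>) \<kappa>2" using v_next_\<kappa>[OF va \<delta>(2) \<kappa>] by (simp add: \<kappa>2_def vge_def)
  have v\<eta>2: "vge 0 \<eta>2" unfolding \<eta>2 by (rule vge_mult'[OF v\<eta> v\<kappa>2]) (use \<delta> in auto)
  have eq0: "vge (n - \<delta>) (poly (rr 0 Pv) \<xi> - (a * \<eta> - \<kappa> * \<beta>0) * cw \<xi>)" if \<xi>: "\<xi> \<in> \<Lambda>" for \<xi>
  proof -
    have 1: "vge (n - \<delta>) (coeff (Tp \<xi> Pv + W \<xi> - smult a (Pw \<xi>)) 0)" by (rule vge_mono[OF pgeD[OF E[OF \<xi>]]]) (use \<delta> in simp)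
    have "poly Pv \<xi> = poly (rr 0 Pv) \<xi>" by (subst split[OF deg(1)]) (simp add: poly_\<Phi>[OF \<xi>])
    then have T0: "coeff (Tp \<xi> Pv) 0 = poly (rr 0 Pv) \<xi>" by (simp add: coeff_Tp_0)
    have "vge (n - \<delta>) (\<Sum>\<xi>'\<in>\<Lambda>. (cu \<xi> \<xi>' - \<kappa> * cw \<xi>) * coeff (B \<xi>') 0)"
      unfolding cu_def cw_def by (intro vge_sum vge_mult'[OF u(1)[OF \<xi>] pgeD[OF pge_B]]) auto
    then have 2: "vge (n - \<delta>) (coeff (W \<xi>) 0 - \<kappa> * cw \<xi> * \<beta>0)"
      by (simp add: W_def coeff_sum \<beta>0_def sum_distrib_left sum_subtractf left_diff_distrib)
    have "vge (n - \<delta>) (coeff (rr 0 (Pw \<xi>)) 0 - \<eta> * cw \<xi>)" using pgeD[OF w(2)[OF \<xi>], of 0] by (simp add: cw_def)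
    then have 3: "vge (n - \<delta>) (a * (coeff (rr 0 (Pw \<xi>)) 0 - \<eta> * cw \<xi>))" by (rule vge_mult'[OF a\<delta>]) (use \<delta> in simp)
    have "coeff (Pw \<xi>) 0 = coeff (rr 0 (Pw \<xi>)) 0"
      using q_ge_2 by (subst split[OF deg(2)[OF \<xi>]]) (simp add: coeff_\<Phi>)
    then show ?thesis using vge_add[OF vge_diff[OF 1 2] 3] by (simp add: T0 algebra_simps)
  qed
  have eq1: "vge n (coeff (Tp \<xi> (rr 0 Pv)) 1 - \<pi> * cv + \<mu> * cw \<xi>)" if \<xi>: "\<xi> \<in> \<Lambda>" for \<xi>
  proof -
    have 1: "vge n (coeff (Tp \<xi> Pv + W \<xi> - smult a (Pw \<xi>)) 1)" by (rule pgeD[OF E[OF \<xi>]])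
    have "vge n (\<Sum>\<xi>'\<in>\<Lambda>. (cu \<xi> \<xi>' - \<kappa> * cw \<xi>) * coeff (B \<xi>') 1)"
      unfolding cu_def cw_def using \<delta> by (intro vge_sum vge_mult'[OF u(1)[OF \<xi>] coeff_B_1]) auto
    then have 2: "vge n (coeff (W \<xi>) 1 - \<kappa> * cw \<xi> * \<beta>1)"
      by (simp add: W_def coeff_sum \<beta>1_def sum_distrib_left sum_subtractf left_diff_distrib)
    have "vge (n - \<delta>) (coeff (rr 0 (Pw \<xi>)) 1)" using pgeD[OF w(2)[OF \<xi>], of 1] by simp
    then have 3: "vge n (a * coeff (rr 0 (Pw \<xi>)) 1)" by (rule vge_mult'[OF a\<delta>]) simp
    have 4: "vge n (cv * (coeff (Tp \<xi> \<Phi>) 1 + \<pi>))" by (rule vge_mult'[OF cv2 T\<Phi>[OF \<xi>]]) simp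
    have 5: "coeff (Pw \<xi>) 1 = coeff (rr 0 (Pw \<xi>)) 1 - cw \<xi>"
    proof -
      have "coeff (Pw \<xi>) 1 = coeff (rr 0 (Pw \<xi>) + smult (coeff (Pw \<xi>) q) \<Phi>) 1" using split[OF deg(2)[OF \<xi>]] by simp
      then show ?thesis using q_ge_2 by (simp add: coeff_\<Phi> cw_def)
    qed
    have "coeff (Tp \<xi> (rr 0 Pv)) 1 - \<pi> * cv + \<mu> * cw \<xi> =
        coeff (Tp \<xi> Pv + W \<xi> - smult a (Pw \<xi>)) 1 - (coeff (W \<xi>) 1 - \<kappa> * cw \<xi> * \<beta>1)
        + a * coeff (rr 0 (Pw \<xi>)) 1 - cv * (coeff (Tp \<xi> \<Phi>) 1 + \<pi>)"
      unfolding coeff_diff coeff_add coeff_smult 5 T \<mu>_def by (simp add: algebra_simps)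
    then show ?thesis using vge_diff[OF vge_add[OF vge_diff[OF 1 2] 3] 4] by simp
  qed
  have cw\<kappa>: "vge (min n (t + 1) - \<delta>) (cw \<xi> - \<kappa>2 * cv)" if \<xi>: "\<xi> \<in> \<Lambda>" and t: "pge t (rr 0 Pv - [:\<eta>2 * cv:])" for \<xi> t
  proof -
    have "Tp \<xi> (rr 0 Pv) = Tp \<xi> (rr 0 Pv - [:\<eta>2 * cv:]) + [:\<eta>2 * cv:]"
      by (simp add: Tp_def pcompose_diff)
    then have "coeff (Tp \<xi> (rr 0 Pv)) 1 = coeff (Tp \<xi> (rr 0 Pv - [:\<eta>2 * cv:])) 1" by simp
    then have "vge (t + 1) (coeff (Tp \<xi> (rr 0 Pv)) 1)" using wgeD[OF wge_Tp[OF t \<xi>], of 1] by simp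
    then have "vge (min n (t + 1)) (coeff (Tp \<xi> (rr 0 Pv)) 1)" by (rule vge_mono) simp
    from vge_diff[OF vge_mono[OF eq1[OF \<xi>]] this]
    have "vge (min n (t + 1)) (\<mu> * (cw \<xi> - \<kappa>2 * cv))" using \<kappa>2 by (simp add: algebra_simps flip: mult.assoc)
    then show ?thesis by (simp add: vge_cancel[OF v\<mu>])
  qed
  \<comment> \<open>The gain of one round: a bound \<open>t\<close> for the deviation of digit 0
    from its constant gives \<open>t + 1 - \<delta>\<close> for
    \<open>cw \<xi> - \<kappa>2 * cv\<close>, and the factor bounded in \<open>v\<eta>\<close> adds
    \<open>min \<delta> (1 - \<delta>)\<close>. It is positive because
    \<open>\<delta> < 1\<close>.\<close>
  define s where "s = min 1 (2 - 2 * \<delta>)"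
  have main: "pge (min (n - \<delta>) (n - 2 + real i * s)) (rr 0 Pv - [:\<eta>2 * cv:])" for i
  proof (induction i)
    case 0
    have "pge (n - 2) (rr 0 Pv - [:\<eta>2 * cv:])"
      by (rule pge_diff[OF Rv2]) (use vge_mult_int[OF v\<eta>2 cv2] in simp)
    then show ?case by (rule pge_mono) simp
  next
    case (Suc i)
    define t where "t = min (n - \<delta>) (n - 2 + real i * s)"
    have "pge (min (n - \<delta>) (t + s)) (rr 0 Pv - [:\<eta>2 * cv:])"
    proof (rule pge_lagrange[OF finite_\<Lambda>])
      show "degree (rr 0 Pv - [:\<eta>2 * cv:]) < card \<Lambda>"
        using degree_diff_less[of "rr 0 Pv" q "[:\<eta>2 * cv:]"] degree_rr[of 0 Pv] q_ge_2 card_\<Lambda> by simp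
      fix \<xi> assume \<xi>: "\<xi> \<in> \<Lambda>"
      have "vge (min (n - \<delta>) (t + s)) ((a * \<eta> - \<kappa> * \<beta>0) * (cw \<xi> - \<kappa>2 * cv))"
        by (rule vge_mult'[OF v\<eta> cw\<kappa>[OF \<xi> Suc.IH]]) (use \<delta> in \<open>auto simp: t_def s_def min_def\<close>)
      from vge_add[OF vge_mono[OF eq0[OF \<xi>]] this]
      show "vge (min (n - \<delta>) (t + s)) (poly (rr 0 Pv - [:\<eta>2 * cv:]) \<xi>)" by (simp add: \<eta>2 algebra_simps)
    qed (auto intro: \<Lambda>_int \<Lambda>_sep)
    then show ?case by (rule pge_mono) (use \<delta> in \<open>auto simp: t_def s_def min_def algebra_simps\<close>)
  qed
  obtain i :: nat where i: "2 / s \<le> real i" using real_arch_simple by blast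
  have "0 < s" using \<delta> by (simp add: s_def)
  then have "2 \<le> real i * s" using i by (simp add: field_simps)
  then have "min (n - \<delta>) (n - 2 + real i * s) = n - \<delta>" using \<delta> by linarith
  then have fin: "pge (n - \<delta>) (rr 0 Pv - [:\<eta>2 * cv:])" using main[of i] by simp
  then show "pge (n - \<delta>) (rr 0 Pv - [:next_\<eta> \<kappa> \<eta> * coeff Pv q:])" by (simp add: \<eta>2_def cv_def)
  have cw\<kappa>': "vge (n - \<delta>) (cw \<xi> - \<kappa>2 * cv)" if "\<xi> \<in> \<Lambda>" for \<xi>
    by (rule vge_mono[OF cw\<kappa>[OF that fin]]) (use \<delta> in simp)
  then show "vge (n - \<delta>) (coeff (Pw \<xi>) q - next_\<kappa> \<kappa> * coeff Pv q)" if "\<xi> \<in> \<Lambda>" for \<xi>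
    using that by (simp add: cw_def cv_def \<kappa>2_def)
  have "vge (n - 2 * \<delta>) (cw \<xi>0 - (cw \<xi>0 - \<kappa>2 * cv))"
    by (rule vge_diff[OF _ vge_mono[OF cw\<kappa>'[OF \<xi>0]]]) (use cw2[OF \<xi>0] \<delta> in \<open>auto simp: cw_def\<close>)
  then have "vge (n - 2 * \<delta>) (\<kappa>2 * cv)" by simp
  then have "vge (n - 2 * \<delta> - (1 - \<delta>)) cv" using v_next_\<kappa>[OF va \<delta>(2) \<kappa>] by (simp add: vge_cancel \<kappa>2_def)
  then show "vge (n - \<delta> - 1) (coeff Pv q)" by (simp add: cv_def algebra_simps)
qed

end

section \<open>Large slope: systems of binomial coefficients and periodic power sums\<close>

context digit_field begin

text \<open>The matrix \<open>s choose i\<close> is triangular with diagonal 1, so the unknowns are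
  found from the largest index downwards; rows from \<open>lo\<close> on involve only unknowns from
  \<open>lo\<close> on.\<close>

lemma binomial_system_0:
  assumes "\<And>i. lo \<le> i \<Longrightarrow> i < j \<Longrightarrow> vge t (\<Sum>s<j. of_nat (s choose i) * m s)" "lo \<le> s" "s < j"
  shows "vge t (m s)"
  using assms(2,3)
proof (induction "j - s" arbitrary: s rule: less_induct)
  case less
  have "{..<j} = {..<s} \<union> {s} \<union> {s<..<j}" using less.prems by auto
  then have "(\<Sum>i<j. of_nat (i choose s) * m i) = m s + (\<Sum>i\<in>{s<..<j}. of_nat (i choose s) * m i)"
    by (simp add: sum.union_disjoint disjoint_iff binomial_eq_0)
  moreover have "vge t (\<Sum>i\<in>{s<..<j}. of_nat (i choose s) * m i)"
    using less by (intro vge_sum vge_mult_int[OF vge_of_nat]) auto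
  ultimately have "vge t ((m s + (\<Sum>i\<in>{s<..<j}. of_nat (i choose s) * m i)) - (\<Sum>i\<in>{s<..<j}. of_nat (i choose s) * m i))"
    using assms(1)[OF less.prems] by (metis vge_diff)
  then show ?case by simp
qed

text \<open>By Pascal's rule, subtracting from each row the already reduced previous one lowers
  \<open>b\<close> by one, which leads back to the triangular matrix.\<close>

lemma binomial_system:
  assumes "\<And>i. i < j \<Longrightarrow> vge t (\<Sum>s<j. of_nat ((b + s) choose i) * m s)" "s < j"
  shows "vge t (m s)"
proof -
  have "\<forall>i<j. vge t (\<Sum>s<j. of_nat (s choose i) * m s)"
    using assms(1)
  proof (induction b)
    case (Suc b)
    note H = Suc.prems
    have "vge t (\<Sum>s<j. of_nat ((b + s) choose i) * m s)" if "i < j" for i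
      using that
    proof (induction i)
      case 0
      then show ?case using H[of 0] by simp
    next
      case (Suc i)
      have "(\<Sum>s<j. of_nat ((Suc b + s) choose Suc i) * m s)
          = (\<Sum>s<j. of_nat ((b + s) choose i) * m s) + (\<Sum>s<j. of_nat ((b + s) choose Suc i) * m s)"
        by (simp add: sum.distrib distrib_right)
      then have "(\<Sum>s<j. of_nat ((b + s) choose Suc i) * m s)
          = (\<Sum>s<j. of_nat ((Suc b + s) choose Suc i) * m s) - (\<Sum>s<j. of_nat ((b + s) choose i) * m s)" by simp
      moreover have "vge t (\<Sum>s<j. of_nat ((b + s) choose i) * m s)" using Suc by simp
      ultimately show ?case using vge_diff[OF H[OF Suc.prems]] by simp
    qed
    then show ?case by (rule Suc.IH)
  qed simp
  then show ?thesis using binomial_system_0[of 0 j t m s] assms(2) by simp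
qed

lemma \<Lambda>_periodic: assumes "\<xi> \<in> \<Lambda>" "1 \<le> h" shows "(- \<xi>) ^ (h + (q - 1) * l) = (- 1) ^ ((q - 1) * l) * (- \<xi>) ^ h"
proof -
  have "\<xi> ^ (h + (q - 1) * l) = \<xi> ^ h"
  proof (induction l)
    case (Suc l)
    have "h + (q - 1) * Suc l = (h + (q - 1) * l) + (q - 1)" by (simp only: mult_Suc_right)
    then have "\<xi> ^ (h + (q - 1) * Suc l) = \<xi> ^ (h + (q - 1) * l) * \<xi> ^ (q - 1)" by (simp only: power_add)
    also have "\<dots> = \<xi> ^ (h - 1) * (\<xi> * \<xi> ^ (q - 1))" using Suc assms(2) by (cases h) (auto simp: algebra_simps)
    also have "\<xi> * \<xi> ^ (q - 1) = \<xi>" using \<Lambda>_power[OF assms(1)] q_ge_2 by (metis Suc_1 Suc_le_lessD gr_implies_not0 power_eq_if)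
    also have "\<xi> ^ (h - 1) * \<xi> = \<xi> ^ h" using assms(2) by (cases h) auto
    finally show ?case .
  qed simp
  then show ?thesis by (simp add: power_minus[of \<xi>] power_add)
qed

end

context hecke_digits begin

text \<open>The power sums of the digits are periodic, so that the coefficients of \<open>y ^ (j + (q - 1) * l)\<close> for
  \<open>1 \<le> l \<le> j\<close>, which are small on the left, form a linear system for the power sums that occur in the
  coefficient of \<open>y ^ j\<close>. By Lucas' congruence its matrix is invertible modulo \<open>p\<close>.\<close>

lemma coeff_bound_by_periodicity:
  assumes dp: "d < p" and dr: "d \<le> r + 1" and j: "1 \<le> j" "j \<le> d"
    and \<omega>: "\<And>s \<xi>. s < d \<Longrightarrow> \<xi> \<in> \<Lambda> \<Longrightarrow> vge (N + real s) (\<omega> s \<xi>)"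
    and T: "wge \<tau> T"
    and eq: "pge (N + real d) (T + (\<Sum>\<xi>\<in>\<Lambda>. \<Sum>s<d. smult (\<omega> s \<xi>) ([:-\<xi>, 1:] ^ (k - s))))"
  shows "vge (min (\<tau> + 1) N + real j) (coeff T j)"
proof -
  define \<eta> where "\<eta> = min (\<tau> + 1) N + real j"
  have e1: "1 \<le> real e" using e_ge_1 by simp
  define W where "W = (\<Sum>\<xi>\<in>\<Lambda>. \<Sum>s<d. smult (\<omega> s \<xi>) ([:-\<xi>, 1:] ^ (k - s)))"
  define M where "M s = (\<Sum>\<xi>\<in>\<Lambda>. \<omega> s \<xi> * (- \<xi>) ^ (k - s - j))" for s
  define b where "b = r + 1 - j"
  have jq: "j < q" using j dp p_le_q by simp
  have jr: "j \<le> r + 1" using j dr by simp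
  have cW: "coeff W i = (\<Sum>s<d. of_nat ((k - s) choose i) * (\<Sum>\<xi>\<in>\<Lambda>. \<omega> s \<xi> * (- \<xi>) ^ (k - s - i)))" for i
    unfolding W_def by (subst sum.swap) (simp add: coeff_sum coeff_linear_power_le sum_distrib_left algebra_simps)
  have vsum: "vge (N + real s) (\<Sum>\<xi>\<in>\<Lambda>. \<omega> s \<xi> * (- \<xi>) ^ i)" if "s < d" for s i
    using that by (intro vge_sum vge_mult'[OF \<omega> vge_power_int]) (auto simp: \<Lambda>_int)
  have vM: "vge (N + real s) (M s)" if "s < d" for s unfolding M_def by (rule vsum[OF that])
  have split: "(\<Sum>s<d. f s) = (\<Sum>s<j. f s) + (\<Sum>s\<in>{j..<d}. f s)" for f :: "nat \<Rightarrow> 'c"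
  proof -
    have "{..<d} = {..<j} \<union> {j..<d}" using j by auto
    then show ?thesis by (simp add: sum.union_disjoint disjoint_iff)
  qed
  \<comment> \<open>In degree \<open>i = j + (q - 1) * l\<close> the power sums agree up to sign
    with the \<open>M s\<close>, as long as the exponent \<open>k - s - i\<close> is at least 1:
    exponent 0 breaks the periodicity at the digit 0. The condition \<open>l < j \<or> 0 < b\<close>
    excludes the row where this can happen.\<close>
  have sys: "vge \<eta> (\<Sum>s<j. of_nat ((k - s) choose (l * q + (j - l))) * M s)"
    if l: "1 \<le> l" "l \<le> j" "l < j \<or> 0 < b" for l
  proof -
    define i where "i = j + (q - 1) * l"
    have i: "i = l * q + (j - l)" using l q_ge_2 unfolding i_def by (cases q) auto
    \<comment> \<open>This extra factor \<open>\<pi>\<close> is the gain from \<open>\<tau>\<close>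
      to \<open>\<tau> + 1\<close>.\<close>
    have "real i \<ge> real j + 1"
    proof -
      have "1 * 1 \<le> (q - 1) * l" using l q_ge_2 by (intro mult_le_mono) auto
      then have "j + 1 \<le> i" unfolding i_def by linarith
      then show ?thesis by linarith
    qed
    then have "vge \<eta> (coeff T i)" by (intro vge_mono[OF wgeD[OF T]]) (simp add: \<eta>_def)
    moreover have "vge \<eta> (coeff (T + W) i)"
      unfolding W_def by (rule vge_mono[OF pgeD[OF eq]]) (use j in \<open>simp add: \<eta>_def\<close>)
    ultimately have "vge \<eta> (coeff (T + W) i - coeff T i)" by (rule vge_diff[rotated])
    then have 1: "vge \<eta> (coeff W i)" by simp
    have 2: "vge \<eta> (\<Sum>s\<in>{j..<d}. of_nat ((k - s) choose i) * (\<Sum>\<xi>\<in>\<Lambda>. \<omega> s \<xi> * (- \<xi>) ^ (k - s - i)))"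
    proof (rule vge_sum, rule vge_mult_int[OF vge_of_nat])
      fix s assume s: "s \<in> {j..<d}"
      show "vge \<eta> (\<Sum>\<xi>\<in>\<Lambda>. \<omega> s \<xi> * (- \<xi>) ^ (k - s - i))"
        by (rule vge_mono[OF vsum]) (use s in \<open>auto simp: \<eta>_def\<close>)
    qed
    have "(\<Sum>\<xi>\<in>\<Lambda>. \<omega> s \<xi> * (- \<xi>) ^ (k - s - j)) = (- 1) ^ ((q - 1) * l) * (\<Sum>\<xi>\<in>\<Lambda>. \<omega> s \<xi> * (- \<xi>) ^ (k - s - i))"
      if s: "s < j" for s
    proof -
      have "i + s + 1 \<le> k"
      proof (cases "l < d")
        case True
        then have "(l + 1) * q \<le> d * q" by (intro mult_le_mono1) simp
        moreover have "j - l + s + 1 \<le> q + r" using s j jq jr l by linarith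
        ultimately show ?thesis by (simp add: i k_eq)
      next
        case False
        then have "l = d" "j = d" using l j by auto
        then show ?thesis using l s by (simp add: i k_eq b_def)
      qed
      then have *: "k - s - j = (k - s - i) + (q - 1) * l" "1 \<le> k - s - i" by (auto simp: i_def)
      show ?thesis unfolding *(1) sum_distrib_left
      proof (intro sum.cong refl)
        fix \<xi> assume "\<xi> \<in> \<Lambda>"
        then show "\<omega> s \<xi> * (- \<xi>) ^ (k - s - i + (q - 1) * l) = (- 1) ^ ((q - 1) * l) * (\<omega> s \<xi> * (- \<xi>) ^ (k - s - i))"
          unfolding \<Lambda>_periodic[OF \<open>\<xi> \<in> \<Lambda>\<close> *(2)] by (simp only: ac_simps)
      qed
    qed
    then have "(\<Sum>s<j. of_nat ((k - s) choose i) * M s)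
        = (- 1) ^ ((q - 1) * l) * (\<Sum>s<j. of_nat ((k - s) choose i) * (\<Sum>\<xi>\<in>\<Lambda>. \<omega> s \<xi> * (- \<xi>) ^ (k - s - i)))"
      unfolding M_def by (simp add: sum_distrib_left[of _ _ "{..<j}"] algebra_simps)
    also have "(\<Sum>s<j. of_nat ((k - s) choose i) * (\<Sum>\<xi>\<in>\<Lambda>. \<omega> s \<xi> * (- \<xi>) ^ (k - s - i)))
       = coeff W i - (\<Sum>s\<in>{j..<d}. of_nat ((k - s) choose i) * (\<Sum>\<xi>\<in>\<Lambda>. \<omega> s \<xi> * (- \<xi>) ^ (k - s - i)))"
      unfolding cW split by simp
    finally show ?thesis using vge_diff[OF 1 2] vge_power_int[of "- 1" "(q - 1) * l"]
      unfolding i[symmetric] by (simp add: vge_mult_int)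
  qed
  \<comment> \<open>In reversed order \<open>k - s\<close> becomes \<open>d * q + (b + t)\<close>
    with \<open>b + t < q\<close>, the shape to which Lucas' congruence applies.\<close>
  define m where "m t = M (j - 1 - t)" for t
  have reindex: "(\<Sum>s<j. f s) = (\<Sum>t<j. f (j - 1 - t))" for f :: "nat \<Rightarrow> 'c"
    by (subst sum.nat_diff_reindex[symmetric]) simp
  have kt: "k - (j - 1 - t) = d * q + (b + t)" and bt: "b + t < q" if "t < j" for t
    using that j jr r_less by (auto simp: k_eq b_def)
  \<comment> \<open>For \<open>b = 0\<close>, that is \<open>j = r + 1\<close>, the row
    \<open>i = 0\<close> is missing and the system does not reach \<open>m 0\<close>; this unknown
    is treated through a factor \<open>p\<close> in front of it.\<close>
  define lo :: nat where "lo = (if b = 0 then 1 else 0)"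
  \<comment> \<open>The matrix is replaced by its reduction modulo \<open>p\<close>, so each round
    multiplies the known bound by \<open>p\<close> in the error and gains at least one power of
    \<open>\<pi>\<close>.\<close>
  have main: "\<forall>t. lo \<le> t \<longrightarrow> t < j \<longrightarrow> vge (min \<eta> (N + real h)) (m t)" for h
  proof (induction h)
    case 0
    show ?case
    proof (intro allI impI)
      fix t assume "t < j"
      then have "vge (N + real (j - 1 - t)) (m t)" unfolding m_def using j by (intro vM) auto
      then show "vge (min \<eta> (N + real 0)) (m t)" by (rule vge_mono) simp
    qed
  next
    case (Suc h)
    define x where "x = min \<eta> (N + real (Suc h))"
    have S: "vge x (\<Sum>t<j. of_nat ((b + t) choose i) * m t)" if i: "lo \<le> i" "i < j" for i
    proof -
      define l where "l = j - i"
      have l: "1 \<le> l" "l \<le> j" "l < j \<or> 0 < b" "j - l = i" "l \<le> d" using i j by (auto simp: l_def lo_def split: if_splits)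
      have "(\<Sum>s<j. of_nat ((k - s) choose (l * q + i)) * M s) = (\<Sum>t<j. of_nat ((d * q + (b + t)) choose (l * q + i)) * m t)"
        unfolding reindex[of "\<lambda>s. of_nat ((k - s) choose (l * q + i)) * M s"] m_def by (intro sum.cong refl) (simp only: kt lessThan_iff)
      moreover have "vge \<eta> (\<Sum>s<j. of_nat ((k - s) choose (l * q + i)) * M s)" using sys[OF l(1-3)] unfolding l(4) .
      ultimately have "vge \<eta> (\<Sum>t<j. of_nat ((d * q + (b + t)) choose (l * q + i)) * m t)" by (simp only:)
      then have 1: "vge x (\<Sum>t<j. of_nat ((d * q + (b + t)) choose (l * q + i)) * m t)"
        by (rule vge_mono) (simp add: x_def)
      have 2: "vge x (\<Sum>t<j. (of_nat ((d * q + (b + t)) choose (l * q + i)) - of_nat ((d choose l) * ((b + t) choose i))) * m t)"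
      proof (rule vge_sum)
        fix t assume t: "t \<in> {..<j}"
        have "int p dvd int ((d * q + (b + t)) choose (l * q + i)) - int ((d choose l) * ((b + t) choose i))"
          using t i jq by (intro lucas bt) auto
        from vge_of_int_dvd[OF this]
        have 3: "vge (real e) (of_nat ((d * q + (b + t)) choose (l * q + i)) - of_nat ((d choose l) * ((b + t) choose i)))" by simp
        show "vge x ((of_nat ((d * q + (b + t)) choose (l * q + i)) - of_nat ((d choose l) * ((b + t) choose i))) * m t)"
        proof (cases "lo \<le> t")
          case True
          then show ?thesis using t Suc.IH e1 by (intro vge_mult'[OF 3]) (auto simp: x_def)
        next
          case False
          then have "t = 0" by (auto simp: lo_def split: if_splits)
          then have "vge (N + real (j - 1)) (m t)" unfolding m_def using j by (intro vM[THEN vge_mono]) auto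
          then show ?thesis using e1 j by (intro vge_mult'[OF 3]) (auto simp: x_def \<eta>_def)
        qed
      qed
      have "of_nat (d choose l) * (\<Sum>t<j. of_nat ((b + t) choose i) * m t)
         = (\<Sum>t<j. of_nat ((d * q + (b + t)) choose (l * q + i)) * m t)
          - (\<Sum>t<j. (of_nat ((d * q + (b + t)) choose (l * q + i)) - of_nat ((d choose l) * ((b + t) choose i))) * m t)"
        by (simp add: sum_distrib_left algebra_simps sum_subtractf)
      then have "vge x (of_nat (d choose l) * (\<Sum>t<j. of_nat ((b + t) choose i) * m t))"
        using vge_diff[OF 1 2] by simp
      moreover have "\<not> p dvd (d choose l)"
      proof
        assume "p dvd (d choose l)"
        moreover have "(d choose l) dvd fact d" using binomial_fact_lemma[OF l(5)] by (metis dvd_triv_right)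
        ultimately have "p dvd fact d" by (rule dvd_trans)
        then show False using dp p_prime by (simp add: prime_dvd_fact_iff)
      qed
      ultimately show ?thesis using vge_cancel[of "of_nat (d choose l)" 0 x] v_of_nat_unit by (simp add: zero_ereal_def)
    qed
    show ?case
    proof (intro allI impI)
      fix t assume t: "lo \<le> t" "t < j"
      show "vge (min \<eta> (N + real (Suc h))) (m t)"
      proof (cases "b = 0")
        case True
        then show ?thesis using binomial_system_0[of lo j x m t] S t by (simp add: x_def)
      next
        case False
        then show ?thesis using binomial_system[of j x b m t] S t by (simp add: x_def lo_def)
      qed
    qed
  qed
  obtain h :: nat where "\<eta> - N \<le> real h" using real_arch_simple by blast
  then have "min \<eta> (N + real h) = \<eta>" by linarith
  then have m: "vge \<eta> (m t)" if "lo \<le> t" "t < j" for t using main[of h] that by simp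
  have "vge \<eta> (\<Sum>s<d. of_nat ((k - s) choose j) * M s)"
    unfolding split
  proof (rule vge_add)
    show "vge \<eta> (\<Sum>s<j. of_nat ((k - s) choose j) * M s)"
      unfolding reindex[of "\<lambda>s. of_nat ((k - s) choose j) * M s"]
    proof (rule vge_sum)
      fix t assume t: "t \<in> {..<j}"
      show "vge \<eta> (of_nat ((k - (j - 1 - t)) choose j) * M (j - 1 - t))"
      proof (cases "lo \<le> t")
        case True
        then show ?thesis using m[of t] t by (intro vge_mult_int[OF vge_of_nat]) (simp add: m_def)
      next
        case False
        then have t0: "t = 0" and b0: "b = 0" by (auto simp: lo_def split: if_splits)
        \<comment> \<open>\<open>m 0\<close> occurs with the coefficient
          \<open>d * q choose j\<close> where \<open>0 < j < q\<close>, a multiple of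
          \<open>p\<close>; this supplies the one power of \<open>\<pi>\<close> missing in
          \<open>vM\<close>.\<close>
        have "int p dvd int ((d * q + 0) choose (0 * q + j)) - int ((d choose 0) * (0 choose j))"
          by (rule lucas) (use jq in auto)
        moreover have "(0 :: nat) choose j = 0" using j by (simp add: binomial_eq_0)
        ultimately have "p dvd (k - (j - 1 - t)) choose j" using kt[of t] t t0 b0 j by simp
        from vge_of_nat_dvd[OF this] show ?thesis
          by (rule vge_mult'[OF _ vM]) (use j t0 e1 in \<open>auto simp: \<eta>_def\<close>)
      qed
    qed
    show "vge \<eta> (\<Sum>s\<in>{j..<d}. of_nat ((k - s) choose j) * M s)"
    proof (intro vge_sum vge_mult_int[OF vge_of_nat])
      fix s assume s: "s \<in> {j..<d}"
      show "vge \<eta> (M s)" by (rule vge_mono[OF vM]) (use s in \<open>auto simp: \<eta>_def\<close>)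
    qed
  qed
  then have 1: "vge \<eta> (coeff W j)" by (simp add: cW M_def)
  have 2: "vge \<eta> (coeff (T + W) j)"
    unfolding W_def by (rule vge_mono[OF pgeD[OF eq]]) (use j in \<open>simp add: \<eta>_def\<close>)
  show ?thesis using vge_diff[OF 2 1] by (simp add: \<eta>_def)
qed

text \<open>As \<open>\<pi> ^ d\<close> divides \<open>a\<close>, the term \<open>a * Pw\<close> is
  negligible. Each round improves a bound \<open>\<tau>\<close> for \<open>Pv\<close> by one, up to
  \<open>n - d\<close>: periodicity bounds the coefficient \<open>j\<close> of
  \<open>Tp \<xi> Pv\<close> better than the substitution does, and the digits follow by induction
  on \<open>j\<close>.\<close>

lemma step_large_slope:
  assumes dp: "d < p" and dr: "d \<le> r + 1" and a: "vge (real d) a"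
    and deg: "degree Pv \<le> k"
    and w: "\<And>\<xi>. \<xi> \<in> \<Lambda> \<Longrightarrow> pge (n - real d) (Pw \<xi>)"
    and u: "\<And>\<xi> \<xi>'. \<xi> \<in> \<Lambda> \<Longrightarrow> \<xi>' \<in> \<Lambda> \<Longrightarrow> pge (n - real d) (Pu \<xi> \<xi>')"
    and eq: "\<And>\<xi>. \<xi> \<in> \<Lambda> \<Longrightarrow> node_eq n \<xi> Pv (Pw \<xi>) (Pu \<xi>)"
  shows "pge (n - real d) Pv"
proof -
  define N where "N = n - real d"
  define \<omega> where "\<omega> \<xi> s \<xi>' = \<pi> ^ s * coeff (Pu \<xi> \<xi>') (k - s)" for \<xi> \<xi>' s
  have \<omega>: "vge (N + real s) (\<omega> \<xi> s \<xi>')" if "\<xi> \<in> \<Lambda>" "\<xi>' \<in> \<Lambda>" for \<xi> \<xi>' s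
    unfolding \<omega>_def using pgeD[OF u[OF that]] by (simp add: vge_\<pi>_cancel N_def)
  define W where "W \<xi> = (\<Sum>\<xi>'\<in>\<Lambda>. \<Sum>s<d. smult (\<omega> \<xi> s \<xi>') ([:-\<xi>', 1:] ^ (k - s)))" for \<xi>
  have E: "pge n (Tp \<xi> Pv + W \<xi>)" if \<xi>: "\<xi> \<in> \<Lambda>" for \<xi>
  proof -
    have "pge n ((\<Sum>\<xi>'\<in>\<Lambda>. Tm \<xi>' (Pu \<xi> \<xi>')) - W \<xi>)"
      unfolding W_def \<omega>_def sum_subtractf[symmetric]
    proof (intro pge_sum Tm_approx)
      fix \<xi>' s assume *: "\<xi>' \<in> \<Lambda>" "s \<notin> {..<d}"
      then show "vge (n - real s) (coeff (Pu \<xi> \<xi>') (k - s))"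
        by (intro vge_mono[OF pgeD[OF u[OF \<xi> *(1)]]]) auto
    next
      have "d * 1 \<le> d * q" using q_ge_2 by (intro mult_le_mono) auto
      then have "d \<le> k" unfolding k_eq by linarith
      then show "{..<d} \<subseteq> {..k}" by auto
    qed
    moreover have "pge n (smult a (Pw \<xi>))" by (rule pge_smult[OF a w[OF \<xi>]]) simp
    ultimately show ?thesis
      using pge_add[OF pge_diff[OF eq[OF \<xi>, unfolded node_eq_def]]] by (fastforce simp: algebra_simps)
  qed
  have pW: "pge N (W \<xi>)" if "\<xi> \<in> \<Lambda>" for \<xi>
    unfolding W_def by (intro pge_sum pge_smult[OF \<omega>[OF that] pge_linear]) auto
  obtain t0 where t0: "pge t0 Pv" using ex_pge by blast
  have main: "pge (min N (t0 + real i)) Pv" for i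
  proof (induction i)
    case 0
    then show ?case using t0 by (auto elim: pge_mono)
  next
    case (Suc i)
    define \<tau> where "\<tau> = min N (t0 + real i)"
    define \<tau>' where "\<tau>' = min (\<tau> + 1) N"
    have \<tau>: "pge \<tau> Pv" using Suc by (simp add: \<tau>_def)
    have cT: "vge (\<tau>' + real j) (coeff (Tp \<xi> Pv) j)" if \<xi>: "\<xi> \<in> \<Lambda>" and j: "j \<le> d" for \<xi> j
    proof (cases "j = 0")
      case True
      have "pge N (Tp \<xi> Pv)" using pge_diff[OF pge_mono[OF E[OF \<xi>]] pW[OF \<xi>]] by (simp add: N_def)
      then show ?thesis using True by (intro vge_mono[OF pgeD]) (auto simp: \<tau>'_def)
    next
      case False
      show ?thesis unfolding \<tau>'_def
      proof (rule coeff_bound_by_periodicity[OF dp dr _ j])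
        show "wge \<tau> (Tp \<xi> Pv)" by (rule wge_Tp[OF \<tau> \<xi>])
        show "pge (N + real d) (Tp \<xi> Pv + (\<Sum>\<xi>'\<in>\<Lambda>. \<Sum>s<d. smult (\<omega> \<xi> s \<xi>') ([:- \<xi>', 1:] ^ (k - s))))"
          using E[OF \<xi>] by (simp add: N_def W_def)
      qed (use False \<omega>[OF \<xi>] in auto)
    qed
    have dig: "j \<le> d \<Longrightarrow> pge \<tau>' (rr j Pv)" for j
    proof (induction j rule: less_induct)
      case (less j)
      show ?case
      proof (rule pge_rr_lagrange)
        fix \<xi> assume \<xi>: "\<xi> \<in> \<Lambda>"
        let ?f = "\<lambda>i. coeff (Tp \<xi> (\<Phi> ^ i * rr i Pv)) j"
        have T: "Tp \<xi> Pv = (\<Sum>i\<le>d. Tp \<xi> (\<Phi> ^ i * rr i Pv))"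
          by (subst rr_expansion[OF degree_less[OF deg]]) (rule Tp_sum)
        have "coeff (Tp \<xi> Pv) j = (\<Sum>i\<le>d. ?f i)" unfolding T by (rule coeff_sum)
        then have "coeff (Tp \<xi> Pv) j = ?f j + (\<Sum>i\<in>{..d} - {j}. ?f i)"
          using less.prems by (simp add: sum.remove[of _ j])
        \<comment> \<open>Lower digits already have the improved bound and gain
          \<open>\<pi> ^ j\<close> in degree \<open>j\<close>; higher digits \<open>i\<close> have
          the old bound but gain \<open>\<pi> ^ i\<close> with \<open>i > j\<close>.\<close>
        moreover have "vge (\<tau>' + real j) (\<Sum>i\<in>{..d} - {j}. ?f i)"
        proof (rule vge_sum)
          fix i assume i: "i \<in> {..d} - {j}"
          show "vge (\<tau>' + real j) (?f i)"
          proof (cases "i < j")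
            case True
            have "pge \<tau>' (\<Phi> ^ i * rr i Pv)"
              using i True by (intro pge_mult[OF pge_power_int[OF pge_\<Phi>] less.IH]) auto
            then show ?thesis by (rule wgeD[OF wge_Tp[OF _ \<xi>]])
          next
            case False
            then have "real j + 1 \<le> real i" using i by simp
            then show ?thesis
              by (intro vge_mono[OF pgeD[OF pge_Tp_\<Phi>_mult[OF pge_rr[OF \<tau>] \<xi>]]]) (simp add: \<tau>'_def)
          qed
        qed
        ultimately have "vge (\<tau>' + real j) (?f j)" using vge_diff[OF cT[OF \<xi> less.prems]] by fastforce
        moreover have "vge (\<tau>' + real j) (?f j - (- \<pi>) ^ j * poly (rr j Pv) \<xi>)"
          using pgeD[OF Tp_\<Phi>_mult_approx[OF pge_rr[OF \<tau>] \<xi>, of j j], of j]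
          by (auto simp: \<tau>'_def elim!: vge_mono)
        ultimately have "vge (\<tau>' + real j) (?f j - (?f j - (- \<pi>) ^ j * poly (rr j Pv) \<xi>))" by (rule vge_diff)
        then show "vge \<tau>' (poly (rr j Pv) \<xi>)" by (simp add: vge_minus_\<pi>_cancel)
      qed
    qed
    have "pge \<tau>' Pv" by (rule pge_from_rr[OF degree_less[OF deg] dig])
    then show ?case by (rule pge_mono) (simp add: \<tau>'_def \<tau>_def)
  qed
  obtain i :: nat where "N - t0 \<le> real i" using real_arch_simple by blast
  then have "min N (t0 + real i) = N" by linarith
  then show ?thesis using main[of i] by (simp add: N_def)
qed

end

section \<open>Solutions on the tree\<close>

context hecke_digits begin

text \<open>A vertex of the tree is the list of its digits, the most recent one first.\<close>

definition tree_solution :: "real \<Rightarrow> ('c list \<Rightarrow> 'c poly) \<Rightarrow> bool" where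
  "tree_solution n x \<longleftrightarrow>
     (\<forall>w\<in>lists \<Lambda>. degree (x w) \<le> k) \<and>
     (\<exists>M. \<forall>w\<in>lists \<Lambda>. M \<le> length w \<longrightarrow> x w = 0) \<and>
     (\<forall>w\<in>lists \<Lambda>. \<forall>\<xi>\<in>\<Lambda>. node_eq n \<xi> (x w) (x (\<xi> # w)) (\<lambda>\<xi>'. x (\<xi>' # \<xi> # w)))"

lemma level_descent:
  assumes "\<And>m. M \<le> m \<Longrightarrow> H m" "\<And>m. H (Suc m) \<Longrightarrow> H m"
  shows "H (m :: nat)"
proof (induction "M - m" arbitrary: m)
  case (Suc j)
  then have "H (Suc m)" by simp
  then show ?case by (rule assms(2))
qed (use assms(1) in simp)

text \<open>A step involves three consecutive levels, so \<open>H m\<close> combines the digit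
  bounds at level \<open>m\<close> with the two coefficient bounds at level
  \<open>m + 1\<close>.\<close>

lemma tree_bound_general:
  assumes x: "tree_solution n x"
    and small: "r + d < q" and dq: "2 * d \<le> q"
    and va: "v a = ereal \<delta>" and \<delta>: "0 \<le> \<delta>" "\<delta> \<le> real e" "\<delta> \<le> real r" "2 * \<delta> \<le> real r + 1"
    and w: "w \<in> lists \<Lambda>"
  shows "pge (n - \<delta> - real (r + d)) (x w)"
proof -
  from x obtain M where deg: "\<And>w. w \<in> lists \<Lambda> \<Longrightarrow> degree (x w) \<le> k"
    and M: "\<And>w. w \<in> lists \<Lambda> \<Longrightarrow> M \<le> length w \<Longrightarrow> x w = 0"
    and eq: "\<And>w \<xi>. w \<in> lists \<Lambda> \<Longrightarrow> \<xi> \<in> \<Lambda> \<Longrightarrow> node_eq n \<xi> (x w) (x (\<xi> # w)) (\<lambda>\<xi>'. x (\<xi>' # \<xi> # w))"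
    unfolding tree_solution_def by blast
  define H where "H m \<longleftrightarrow> (\<forall>w\<in>lists \<Lambda>. length w = m \<longrightarrow> (\<forall>j\<le>d. pge (n - \<delta> - real j) (rr j (x w))) \<and>
      (\<forall>\<xi>\<in>\<Lambda>. pge (n - 2 * \<delta>) (x (\<xi> # w)) \<and> (\<forall>s\<le>r. vge (n - \<delta> - real s) (coeff (x (\<xi> # w)) (k - s)))))" for m
  have "H m" for m
  proof (rule level_descent[of M])
    fix m assume "M \<le> m"
    then show "H m" unfolding H_def using M by simp
  next
    fix m assume IH: "H (Suc m)"
    show "H m" unfolding H_def
    proof (intro ballI impI)
      fix w assume w: "w \<in> lists \<Lambda>" "length w = m"
      have w': "\<xi> # w \<in> lists \<Lambda>" "length (\<xi> # w) = Suc m" if "\<xi> \<in> \<Lambda>" for \<xi> using w that by auto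
      note h = IH[unfolded H_def, rule_format, OF w']
      note st = step_general[where Pv = "x w" and Pw = "\<lambda>\<xi>. x (\<xi> # w)" and Pu = "\<lambda>\<xi> \<xi>'. x (\<xi>' # \<xi> # w)"
          and n = n, OF small dq va \<delta> deg[OF w(1)] deg[OF w'(1)]]
      show "(\<forall>j\<le>d. pge (n - \<delta> - real j) (rr j (x w))) \<and>
          (\<forall>\<xi>\<in>\<Lambda>. pge (n - 2 * \<delta>) (x (\<xi> # w)) \<and> (\<forall>s\<le>r. vge (n - \<delta> - real s) (coeff (x (\<xi> # w)) (k - s))))"
        using st h eq[OF w(1)] by simp
    qed
  qed
  then have "\<forall>j\<le>d. pge (n - \<delta> - real j) (rr j (x w))" using w unfolding H_def by blast
  then show ?thesis
    by (intro pge_from_rr[OF degree_less[OF deg[OF w]]]) (auto elim!: pge_mono)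
qed

lemma tree_bound_r_zero:
  assumes x: "tree_solution n x"
    and r0: "r = 0" and d2: "2 \<le> d" and dq: "2 * d \<le> q"
    and va: "v a = ereal \<delta>" and \<delta>: "0 \<le> \<delta>" "\<delta> \<le> 1"
    and w: "w \<in> lists \<Lambda>"
  shows "pge (n - \<delta> - real d) (x w)"
proof -
  from x obtain M where deg: "\<And>w. w \<in> lists \<Lambda> \<Longrightarrow> degree (x w) \<le> k"
    and M: "\<And>w. w \<in> lists \<Lambda> \<Longrightarrow> M \<le> length w \<Longrightarrow> x w = 0"
    and eq: "\<And>w \<xi>. w \<in> lists \<Lambda> \<Longrightarrow> \<xi> \<in> \<Lambda> \<Longrightarrow> node_eq n \<xi> (x w) (x (\<xi> # w)) (\<lambda>\<xi>'. x (\<xi>' # \<xi> # w))"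
    unfolding tree_solution_def by blast
  define H where "H m \<longleftrightarrow> (\<forall>w\<in>lists \<Lambda>. length w = m \<longrightarrow> (\<forall>j\<le>d. pge (n - \<delta> - real j) (rr j (x w))) \<and>
      (\<forall>\<xi>\<in>\<Lambda>. pge (n - 2 * \<delta>) (x (\<xi> # w)) \<and> vge (n - 1) (coeff (x (\<xi> # w)) (k - 1)) \<and>
          vge n ((- \<pi>) ^ d * coeff (x w) k + a * coeff (x (\<xi> # w)) k)))" for m
  have "H m" for m
  proof (rule level_descent[of M])
    fix m assume "M \<le> m"
    then show "H m" unfolding H_def using M by simp
  next
    fix m assume IH: "H (Suc m)"
    show "H m" unfolding H_def
    proof (intro ballI impI)
      fix w assume w: "w \<in> lists \<Lambda>" "length w = m"
      have w': "\<xi> # w \<in> lists \<Lambda>" "length (\<xi> # w) = Suc m" if "\<xi> \<in> \<Lambda>" for \<xi> using w that by auto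
      note h = IH[unfolded H_def, rule_format, OF w']
      note st = step_r_zero[where Pv = "x w" and Pw = "\<lambda>\<xi>. x (\<xi> # w)" and Pu = "\<lambda>\<xi> \<xi>'. x (\<xi>' # \<xi> # w)"
          and n = n, OF r0 d2 dq va \<delta> deg[OF w(1)] deg[OF w'(1)]]
      show "(\<forall>j\<le>d. pge (n - \<delta> - real j) (rr j (x w))) \<and>
          (\<forall>\<xi>\<in>\<Lambda>. pge (n - 2 * \<delta>) (x (\<xi> # w)) \<and> vge (n - 1) (coeff (x (\<xi> # w)) (k - 1)) \<and>
          vge n ((- \<pi>) ^ d * coeff (x w) k + a * coeff (x (\<xi> # w)) k))"
        using st h eq[OF w(1)] by simp
    qed
  qed
  then have "\<forall>j\<le>d. pge (n - \<delta> - real j) (rr j (x w))" using w unfolding H_def by blast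
  then show ?thesis
    by (intro pge_from_rr[OF degree_less[OF deg[OF w]]]) (auto elim!: pge_mono)
qed

lemma tree_bound_q:
  assumes x: "tree_solution n x"
    and d1: "d = 1" and r0: "r = 0"
    and va: "v a = ereal \<delta>" and \<delta>: "0 \<le> \<delta>" "\<delta> < 1"
    and w: "w \<in> lists \<Lambda>"
  shows "pge (n - \<delta> - 1) (x w)"
proof -
  from x obtain M where deg: "\<And>w. w \<in> lists \<Lambda> \<Longrightarrow> degree (x w) \<le> k"
    and M: "\<And>w. w \<in> lists \<Lambda> \<Longrightarrow> M \<le> length w \<Longrightarrow> x w = 0"
    and eq: "\<And>w \<xi>. w \<in> lists \<Lambda> \<Longrightarrow> \<xi> \<in> \<Lambda> \<Longrightarrow> node_eq n \<xi> (x w) (x (\<xi> # w)) (\<lambda>\<xi>'. x (\<xi>' # \<xi> # w))"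
    unfolding tree_solution_def by blast
  define h where "h m \<kappa> \<eta> \<eta>' \<longleftrightarrow> v \<kappa> = ereal (1 - \<delta>) \<and> vge 0 \<eta> \<and> vge 0 \<eta>' \<and>
     (\<forall>w\<in>lists \<Lambda>. length w = m \<longrightarrow> vge (n - \<delta> - 1) (coeff (x w) q) \<and>
        pge (n - \<delta>) (rr 0 (x w) - [:\<eta> * coeff (x w) q:]) \<and>
        (\<forall>\<xi>\<in>\<Lambda>. vge (n - \<delta>) (coeff (x (\<xi> # w)) q - \<kappa> * coeff (x w) q) \<and> vge (n - 2 * \<delta>) (coeff (x (\<xi> # w)) q) \<and>
           pge (n - \<delta>) (rr 0 (x (\<xi> # w)) - [:\<eta>' * coeff (x (\<xi> # w)) q:])))" for m \<kappa> \<eta> \<eta>'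
  have "\<exists>\<kappa> \<eta> \<eta>'. h m \<kappa> \<eta> \<eta>'" for m
  proof (rule level_descent[of M])
    fix m assume "M \<le> m"
    \<comment> \<open>Where everything vanishes, any \<open>\<kappa>\<close> of valuation
      \<open>1 - \<delta>\<close> is admissible.\<close>
    then have "h m (\<pi> / a) 0 0" unfolding h_def using M v_inverse[OF va] v_\<pi>
      by (auto simp: divide_inverse v_mult one_ereal_def)
    then show "\<exists>\<kappa> \<eta> \<eta>'. h m \<kappa> \<eta> \<eta>'" by blast
  next
    fix m assume "\<exists>\<kappa> \<eta> \<eta>'. h (Suc m) \<kappa> \<eta> \<eta>'"
    then obtain \<kappa> \<eta> \<eta>' where IH: "h (Suc m) \<kappa> \<eta> \<eta>'" by blast
    then have \<kappa>: "v \<kappa> = ereal (1 - \<delta>)" and \<eta>: "vge 0 \<eta>" "vge 0 \<eta>'" unfolding h_def by auto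
    have "vge 0 (next_\<eta> \<kappa> \<eta>)"
      unfolding next_\<eta>_def using \<delta> v_next_\<kappa>[OF va \<delta>(2) \<kappa>]
      by (intro vge_mult'[OF vge_next_\<eta>_factor[OF va \<kappa> \<eta>(1)], of "1 - \<delta>"]) (auto simp: vge_def)
    moreover have "vge (n - \<delta> - 1) (coeff (x w) q) \<and>
        pge (n - \<delta>) (rr 0 (x w) - [:next_\<eta> \<kappa> \<eta> * coeff (x w) q:]) \<and>
        (\<forall>\<xi>\<in>\<Lambda>. vge (n - \<delta>) (coeff (x (\<xi> # w)) q - next_\<kappa> \<kappa> * coeff (x w) q) \<and> vge (n - 2 * \<delta>) (coeff (x (\<xi> # w)) q) \<and>
           pge (n - \<delta>) (rr 0 (x (\<xi> # w)) - [:\<eta> * coeff (x (\<xi> # w)) q:]))"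
      if w: "w \<in> lists \<Lambda>" "length w = m" for w
    proof -
      have w': "\<xi> # w \<in> lists \<Lambda>" "length (\<xi> # w) = Suc m" if "\<xi> \<in> \<Lambda>" for \<xi> using w that by auto
      have h': "vge (n - \<delta> - 1) (coeff (x (\<xi> # w)) q)" "pge (n - \<delta>) (rr 0 (x (\<xi> # w)) - [:\<eta> * coeff (x (\<xi> # w)) q:])"
        "\<And>\<xi>'. \<xi>' \<in> \<Lambda> \<Longrightarrow> vge (n - \<delta>) (coeff (x (\<xi>' # \<xi> # w)) q - \<kappa> * coeff (x (\<xi> # w)) q)"
        "\<And>\<xi>'. \<xi>' \<in> \<Lambda> \<Longrightarrow> vge (n - 2 * \<delta>) (coeff (x (\<xi>' # \<xi> # w)) q)"
        "\<And>\<xi>'. \<xi>' \<in> \<Lambda> \<Longrightarrow> pge (n - \<delta>) (rr 0 (x (\<xi>' # \<xi> # w)) - [:\<eta>' * coeff (x (\<xi>' # \<xi> # w)) q:])"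
        if "\<xi> \<in> \<Lambda>" for \<xi>
        using IH w'[OF that] unfolding h_def by blast+
      have deg'': "degree (x (\<xi>' # \<xi> # w)) \<le> k" if "\<xi> \<in> \<Lambda>" "\<xi>' \<in> \<Lambda>" for \<xi> \<xi>' using w that by (intro deg) auto
      note st = step_q[OF d1 r0 va \<delta> \<kappa> \<eta> deg[OF w(1)] deg[OF w'(1)] deg'' h' eq[OF w(1)]]
      show ?thesis using st h'(2) by simp
    qed
    \<comment> \<open>The constant \<open>\<eta>\<close> of one level becomes \<open>\<eta>'\<close>
      for the level above.\<close>
    ultimately have "h m (next_\<kappa> \<kappa>) (next_\<eta> \<kappa> \<eta>) \<eta>"
      unfolding h_def using v_next_\<kappa>[OF va \<delta>(2) \<kappa>] \<eta> by blast
    then show "\<exists>\<kappa> \<eta> \<eta>'. h m \<kappa> \<eta> \<eta>'" by blast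
  qed
  then obtain \<kappa> \<eta> \<eta>' where hh: "h (length w) \<kappa> \<eta> \<eta>'" by blast
  then have 1: "vge (n - \<delta> - 1) (coeff (x w) q)" and 2: "pge (n - \<delta>) (rr 0 (x w) - [:\<eta> * coeff (x w) q:])" and \<eta>: "vge 0 \<eta>"
    using w unfolding h_def by blast+
  have kq: "k = q" using k_eq d1 r0 by simp
  have 3: "pge (n - \<delta> - 1) ([:\<eta> * coeff (x w) q:])" using vge_mult_int[OF \<eta> 1] by simp
  have R0: "pge (n - \<delta> - 1) (rr 0 (x w))" using pge_add[OF pge_mono[OF 2] 3] by simp
  show ?thesis
  proof (rule pge_from_rr[OF degree_less[OF deg[OF w]]])
    fix j assume "j \<le> d"
    then consider "j = 0" | "j = 1" using d1 by linarith
    then show "pge (n - \<delta> - 1) (rr j (x w))"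
    proof cases
      case 2
      then show ?thesis using rr_top[of "x w" 1] deg[OF w] kq 1 by simp
    qed (use R0 in simp)
  qed
qed

lemma tree_bound_large_slope:
  assumes x: "tree_solution n x"
    and dp: "d < p" and dr: "d \<le> r + 1" and a: "vge (real d) a"
    and w: "w \<in> lists \<Lambda>"
  shows "pge (n - real d) (x w)"
proof -
  from x obtain M where deg: "\<And>w. w \<in> lists \<Lambda> \<Longrightarrow> degree (x w) \<le> k"
    and M: "\<And>w. w \<in> lists \<Lambda> \<Longrightarrow> M \<le> length w \<Longrightarrow> x w = 0"
    and eq: "\<And>w \<xi>. w \<in> lists \<Lambda> \<Longrightarrow> \<xi> \<in> \<Lambda> \<Longrightarrow> node_eq n \<xi> (x w) (x (\<xi> # w)) (\<lambda>\<xi>'. x (\<xi>' # \<xi> # w))"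
    unfolding tree_solution_def by blast
  define H where "H m \<longleftrightarrow> (\<forall>w\<in>lists \<Lambda>. length w = m \<longrightarrow> pge (n - real d) (x w) \<and>
      (\<forall>\<xi>\<in>\<Lambda>. pge (n - real d) (x (\<xi> # w))))" for m
  have "H m" for m
  proof (rule level_descent[of M])
    fix m assume "M \<le> m"
    then show "H m" unfolding H_def using M by simp
  next
    fix m assume IH: "H (Suc m)"
    show "H m" unfolding H_def
    proof (intro ballI impI)
      fix w assume w: "w \<in> lists \<Lambda>" "length w = m"
      have w': "\<xi> # w \<in> lists \<Lambda>" "length (\<xi> # w) = Suc m" if "\<xi> \<in> \<Lambda>" for \<xi> using w that by auto
      note h = IH[unfolded H_def, rule_format, OF w']
      show "pge (n - real d) (x w) \<and> (\<forall>\<xi>\<in>\<Lambda>. pge (n - real d) (x (\<xi> # w)))"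
        using step_large_slope[OF dp dr a deg[OF w(1)] _ _ eq[OF w(1)]] h by simp
    qed
  qed
  then show ?thesis using w unfolding H_def by blast
qed

text \<open>\<open>2 * k + 2\<close> dominates the losses of all methods, by
  \<open>d + r \<le> k\<close>. Case (i) uses the general step unless \<open>r = 0\<close> and
  \<open>\<delta> > 0\<close>; then it splits into \<open>d \<ge> 2\<close>, \<open>k = q\<close>
  with \<open>\<delta> < 1\<close>, and \<open>k = q\<close> with \<open>\<delta> = 1\<close>. In
  the last one \<open>v a = d\<close>, so that the method of case (iii) applies.\<close>

theorem tree_bound:
  assumes x: "tree_solution n x" and w: "w \<in> lists \<Lambda>" and k0: "k \<noteq> 0"
    and cases: "(real k \<le> 1 / 2 * real q ^ 2 \<and> int r < int q - int d \<and> 0 \<le> v a \<and> v a \<le> 1)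
       \<or> (real k \<le> 1 / 2 * real q ^ 2 \<and> 2 * v a - 1 \<le> ereal (real r) \<and> int r < int q - int d
            \<and> 1 \<le> v a \<and> v a \<le> ereal (real e))
       \<or> (real k \<le> min (real p * real q - 1) (1 / 2 * real q ^ 2) \<and> int d - 1 \<le> int r
            \<and> ereal (real d) \<le> v a)"
  shows "pge (n - real (2 * k + 2)) (x w)"
proof -
  have e1: "1 \<le> real e" using e_ge_1 by simp
  have "d * 1 \<le> d * q" using q_ge_2 by (intro mult_le_mono) auto
  then have dk: "d + r \<le> k" unfolding k_eq by linarith
  have dq: "2 * d \<le> q" if "real k \<le> 1 / 2 * real q ^ 2"
  proof -
    have "real (2 * d) * real q \<le> real q * real q" using that by (simp add: k_eq power2_eq_square)
    then have "real (2 * d) \<le> real q" using q_ge_2 by (simp only: mult_le_cancel_right)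
    then show ?thesis by linarith
  qed
  have large: ?thesis if "d < p" "d \<le> r + 1" "vge (real d) a"
    by (rule pge_mono[OF tree_bound_large_slope[OF x that w]]) (use dk in simp)
  have gen: ?thesis if "real k \<le> 1 / 2 * real q ^ 2" "r + d < q" "v a = ereal \<delta>" "0 \<le> \<delta>" "\<delta> \<le> real e" "\<delta> \<le> real r" "2 * \<delta> \<le> real r + 1" for \<delta>
    by (rule pge_mono[OF tree_bound_general[OF x that(2) dq[OF that(1)] that(3-7) w]]) (use dk that in simp)
  from cases consider (i) "real k \<le> 1 / 2 * real q ^ 2" "r + d < q" "0 \<le> v a" "v a \<le> 1"
    | (ii) "real k \<le> 1 / 2 * real q ^ 2" "2 * v a - 1 \<le> ereal (real r)" "r + d < q" "1 \<le> v a" "v a \<le> ereal (real e)"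
    | (iii) "real k \<le> real p * real q - 1" "d \<le> r + 1" "ereal (real d) \<le> v a"
    by (auto simp: algebra_simps)
  then show ?thesis
  proof cases
    case i
    obtain \<delta> where va: "v a = ereal \<delta>" using i by (cases "v a") auto
    then have \<delta>: "0 \<le> \<delta>" "\<delta> \<le> 1" using i by (auto simp: one_ereal_def)
    show ?thesis
    proof (cases "1 \<le> r \<or> \<delta> = 0")
      case True
      then show ?thesis using i va \<delta> e1 by (intro gen[of \<delta>]) auto
    next
      case False
      then have r0: "r = 0" by simp
      consider "2 \<le> d" | "d = 1" "\<delta> < 1" | "d = 1" "\<delta> = 1" using k0 k_eq r0 \<delta> by (cases "d \<ge> 2"; cases "\<delta> < 1"; cases d) auto
      then show ?thesis
      proof cases
        case 1
        show ?thesis by (rule pge_mono[OF tree_bound_r_zero[OF x r0 1 dq[OF i(1)] va \<delta> w]]) (use \<delta> dk in simp)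
      next
        case 2
        show ?thesis by (rule pge_mono[OF tree_bound_q[OF x 2(1) r0 va \<delta>(1) 2(2) w]]) (use \<delta> dk in simp)
      next
        case 3
        then show ?thesis using va prime_gt_1_nat[OF p_prime] by (intro large) (auto simp: vge_def)
      qed
    qed
  next
    case ii
    obtain \<delta> where va: "v a = ereal \<delta>" using ii by (cases "v a") auto
    then have \<delta>: "1 \<le> \<delta>" "\<delta> \<le> real e" "2 * \<delta> - 1 \<le> real r" using ii by (auto simp: one_ereal_def numeral_eq_ereal)
    \<comment> \<open>\<open>1 \<le> \<delta>\<close> and \<open>2 * \<delta> - 1 \<le> r\<close>
      give \<open>\<delta> \<le> r\<close>.\<close>
    then show ?thesis using ii va by (intro gen[of \<delta>]) auto
  next
    case iii
    have "real d * real q + real r < real p * real q" using iii(1) by (simp add: k_eq)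
    then have "real d * real q < real p * real q" by linarith
    then have "d < p" by (simp add: mult_less_cancel_right)
    then show ?thesis using iii by (intro large) (auto simp: vge_def)
  qed
qed

end

section \<open>The valuations of \<open>F\<close> and \<open>C\<close>\<close>

context valued_field begin

lemma vge_prod_cong:
  assumes "\<And>i. i \<in> A \<Longrightarrow> vge 0 (f i)" "\<And>i. i \<in> A \<Longrightarrow> vge 0 (g i)" "\<And>i. i \<in> A \<Longrightarrow> vge t (f i - g i)"
  shows "vge 0 (prod f A) \<and> vge 0 (prod g A) \<and> vge t (prod f A - prod g A)"
  using assms
proof (induction A rule: infinite_finite_induct)
  case (insert x A)
  have IH: "vge 0 (prod f A)" "vge 0 (prod g A)" "vge t (prod f A - prod g A)" using insert by auto
  have "prod f (insert x A) - prod g (insert x A) = f x * (prod f A - prod g A) + prod g A * (f x - g x)"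
    using insert by (simp add: algebra_simps)
  moreover have "vge t (f x * (prod f A - prod g A) + prod g A * (f x - g x))"
    using insert IH by (intro vge_add vge_mult_int) auto
  ultimately show ?case using insert IH by (auto intro: vge_mult_int)
qed auto

text \<open>In the expansion of \<open>(y + z) ^ q\<close> with \<open>z = x - y\<close>, the term
  linear in \<open>z\<close> carries \<open>q\<close>, hence one more unit of valuation, and the
  others carry \<open>z ^ 2\<close>, of value at least \<open>2 * m \<ge> m + 1\<close>.\<close>

lemma vge_power_lift:
  assumes "vge 0 x" "vge 0 y" "vge 1 (of_nat q)" "vge (real m) (x - y)" "1 \<le> m"
  shows "vge (real (Suc m)) (x ^ q - y ^ q)"
proof -
  define z where "z = x - y"
  have z: "vge (real m) z" using assms by (simp add: z_def)
  have z0: "vge 0 z" using z by (rule vge_mono) simp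
  have "x = z + y" by (simp add: z_def)
  then have "x ^ q = (\<Sum>i\<le>q. of_nat (q choose i) * z ^ i * y ^ (q - i))" by (simp add: binomial_ring)
  also have "\<dots> = y ^ q + (\<Sum>i\<in>{1..q}. of_nat (q choose i) * z ^ i * y ^ (q - i))"
    by (simp add: atMost_atLeast0 sum.atLeast_Suc_atMost)
  finally have "x ^ q - y ^ q = (\<Sum>i\<in>{1..q}. of_nat (q choose i) * z ^ i * y ^ (q - i))" by simp
  moreover have "vge (real (Suc m)) (\<Sum>i\<in>{1..q}. of_nat (q choose i) * z ^ i * y ^ (q - i))"
  proof (rule vge_sum)
    fix i assume i: "i \<in> {1..q}"
    have "vge (real (Suc m)) (of_nat (q choose i) * z ^ i)"
    proof (cases "i = 1")
      case True
      then show ?thesis using vge_mult[OF assms(3) z] by (simp add: algebra_simps)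
    next
      case False
      then obtain j where j: "i = Suc (Suc j)" using i by (cases i; cases "i - 1") auto
      have "vge (real (Suc m)) (z * z)" by (rule vge_mult'[OF z z]) (use assms(5) in simp)
      then have "vge (real (Suc m)) (z ^ j * (z * z))" by (rule vge_mult_int[OF vge_power_int[OF z0]])
      then have "vge (real (Suc m)) (z ^ i)" by (simp add: j algebra_simps)
      then show ?thesis by (rule vge_mult_int[OF vge_of_nat])
    qed
    then show "vge (real (Suc m)) (of_nat (q choose i) * z ^ i * y ^ (q - i))"
      by (rule vge_mult'[OF _ vge_power_int[OF assms(2)]]) simp
  qed
  ultimately show ?thesis by simp
qed

end

lemma ring_hom_facts:
  fixes h :: "'a::field \<Rightarrow> 'b::field"
  assumes "is_ring_hom h"
  shows "h 0 = 0" "h 1 = 1" "h (x + y) = h x + h y" "h (x * y) = h x * h y"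
    "h (- x) = - h x" "h (x - y) = h x - h y" "h (x ^ n) = h x ^ n" "h (of_nat n) = of_nat n"
    "h (sum f A) = (\<Sum>i\<in>A. h (f i))"
proof -
  show add: "h (x + y) = h x + h y" for x y using assms by (simp add: is_ring_hom_def)
  show mult: "h (x * y) = h x * h y" for x y using assms by (simp add: is_ring_hom_def)
  show one: "h 1 = 1" using assms by (simp add: is_ring_hom_def)
  show zero: "h 0 = 0" using add[of 0 0] by (metis add_cancel_right_right)
  show minus: "h (- x) = - h x" for x using add[of x "- x"] zero by (simp add: eq_neg_iff_add_eq_0 add.commute)
  show "h (x - y) = h x - h y" using add[of x "- y"] minus by simp
  show "h (x ^ n) = h x ^ n" by (induction n) (simp_all add: one mult)
  show "h (of_nat n) = of_nat n" by (induction n) (simp_all add: one add zero)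
  show "h (sum f A) = (\<Sum>i\<in>A. h (f i))" by (induction A rule: infinite_finite_induct) (simp_all add: zero add)
qed

lemma ring_hom_inverse:
  fixes h :: "'a::field \<Rightarrow> 'b::field"
  assumes "is_ring_hom h"
  shows "h (inverse x) = inverse (h x)" "h x = 0 \<longleftrightarrow> x = 0"
proof -
  show 0: "h x = 0 \<longleftrightarrow> x = 0" for x
  proof (cases "x = 0")
    case False
    have "h x * h (inverse x) = 1" using False by (simp flip: ring_hom_facts(4)[OF assms] add: ring_hom_facts(2)[OF assms])
    then show ?thesis using False by auto
  qed (simp add: ring_hom_facts[OF assms])
  show "h (inverse x) = inverse (h x)"
  proof (cases "x = 0")
    case False
    have "h x * h (inverse x) = 1" using False by (simp flip: ring_hom_facts(4)[OF assms] add: ring_hom_facts(2)[OF assms])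
    then show ?thesis by (rule inverse_unique[symmetric])
  qed (simp add: ring_hom_facts[OF assms])
qed

context hecke_setting begin

sublocale VF: valued_field vF by unfold_locales (rule vF_valuation)
sublocale VC: valued_field vC by unfold_locales (rule vC_valuation)
sublocale VP: valued_field vp by unfold_locales (rule F.vp_valuation)

lemmas iF_hom = ring_hom_facts[OF F.structure_hom]

lemma vp_p: "vp (of_nat p) = 1"
proof -
  have "prime (int p)" using F.p_prime by simp
  then have "padic_val_rat p (of_nat p) = 1"
    using quotient_of_int[of "int p"] by (simp add: padic_val_rat_def one_ereal_def)
  then show ?thesis using F.vp_of_rat[of "of_nat p"] by simp
qed

text \<open>In \<open>ereal\<close> the product of 0 and infinity is 0, so \<open>e = 0\<close>
  would give \<open>iF 0\<close> the value 0 instead of infinity.\<close>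

lemma e_pos: "1 \<le> e"
proof (rule ccontr)
  assume "\<not> 1 \<le> e"
  then have "e = 0" by simp
  then have "vF (iF 0) = 0" using vF_extends[of 0] by (simp add: zero_ereal_def[symmetric])
  then show False using VF.v_eq_infinity_iff[of 0] by (simp add: iF_hom)
qed

lemma vF_p: "vF (of_nat p) = ereal (real e)"
  using vF_extends[of "of_nat p"] by (simp add: iF_hom vp_p)

lemma p_nonzero: "(of_nat p :: 'f) \<noteq> 0"
  using vF_p VF.v_eq_infinity_iff[of "of_nat p"] by auto

lemma vge_iF: "VP.vge t x \<Longrightarrow> VF.vge (real e * t) (iF x)"
proof -
  assume "VP.vge t x"
  then have "ereal (real e) * ereal t \<le> ereal (real e) * vp x"
    unfolding VP.vge_def by (intro ereal_mult_left_mono) auto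
  then show ?thesis by (simp add: VF.vge_def vF_extends)
qed

lemma OF_iff: "x \<in> OF \<longleftrightarrow> VF.vge 0 x" by (simp add: OF_def VF.vge_def zero_ereal_def)

lemma OC_iff: "x \<in> OC \<longleftrightarrow> VC.vge 0 x" by (simp add: OC_def VC.vge_def zero_ereal_def)

lemma vF_pos_iff: "0 < vF x \<longleftrightarrow> VF.vge 1 x"
proof (cases "x = 0")
  case True
  then show ?thesis using VF.v_eq_infinity_iff[of 0] by simp
next
  case False
  then obtain n :: int where "vF x = ereal (of_int n)" using vF_int by blast
  then show ?thesis by (auto simp: VF.vge_def zero_ereal_def)
qed

lemma vF_varpi_power: "vF (varpi ^ n) = ereal (real n)"
  using VF.v_power[of varpi 1 n] vF_varpi by (simp add: one_ereal_def)

lemma varpi_nonzero [simp]: "varpi \<noteq> 0"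
  using vF_varpi VF.v_eq_infinity_iff[of varpi] by auto

lemma vge_varpi_cancel: "VF.vge t (varpi ^ n * x) \<longleftrightarrow> VF.vge (t - real n) x"
  by (rule VF.vge_cancel[OF vF_varpi_power])

end

text \<open>The final theorem derives finiteness of the residue field from \<open>r < q\<close>,
  since an infinite set has \<open>card\<close> 0.\<close>

locale hecke_finite = hecke_setting p vp iF iC vF varpi e vC sq \<sigma>\<^sub>0
  for p :: nat and vp :: "'k::field_char_0 \<Rightarrow> ereal"
    and iF :: "'k \<Rightarrow> 'f::field" and iC :: "'k \<Rightarrow> 'c::field"
    and vF :: "'f \<Rightarrow> ereal" and varpi :: 'f and e :: nat and vC :: "'c \<Rightarrow> ereal"
    and sq :: "('f \<Rightarrow> 'c) \<Rightarrow> 'c" and \<sigma>\<^sub>0 :: "'f \<Rightarrow> 'c" +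
  assumes finite_residue: "finite residue_field"
begin

definition residue_eq :: "('f \<times> 'f) set" where
  "residue_eq = {(x, y). x \<in> OF \<and> y \<in> OF \<and> 0 < vF (x - y)}"

lemma residue_eq_iff: "(x, y) \<in> residue_eq \<longleftrightarrow> VF.vge 0 x \<and> VF.vge 0 y \<and> VF.vge 1 (x - y)"
  by (simp add: residue_eq_def OF_iff vF_pos_iff)

lemma residue_field_eq: "residue_field = OF // residue_eq"
  by (simp add: residue_field_def residue_eq_def)

lemma equiv_residue: "equiv OF residue_eq"
proof (rule equivI)
  show "residue_eq \<subseteq> OF \<times> OF" by (auto simp: residue_eq_def)
  show "refl_on OF residue_eq" by (auto simp: refl_on_def residue_eq_iff OF_iff)
  show "sym residue_eq" by (auto simp: sym_def residue_eq_iff VF.vge_diff_commute)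
  show "trans residue_eq"
  proof (rule transI)
    fix x y z assume "(x, y) \<in> residue_eq" "(y, z) \<in> residue_eq"
    then show "(x, z) \<in> residue_eq" using VF.vge_add[of 1 "x - y" "y - z"] by (simp add: residue_eq_iff)
  qed
qed

lemma class_rep: "c \<in> residue_field \<Longrightarrow> \<exists>x. VF.vge 0 x \<and> c = residue_eq `` {x}"
  unfolding residue_field_eq by (metis OF_iff quotientE)

lemma class_in: "VF.vge 0 x \<Longrightarrow> residue_eq `` {x} \<in> residue_field"
  unfolding residue_field_eq by (auto intro: quotientI simp: OF_iff)

lemma class_eq_iff: "VF.vge 0 x \<Longrightarrow> VF.vge 0 y \<Longrightarrow> residue_eq `` {x} = residue_eq `` {y} \<longleftrightarrow> VF.vge 1 (x - y)"
  using eq_equiv_class_iff[OF equiv_residue, of x y] by (simp add: OF_iff residue_eq_iff)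

lemma ex_reps: "\<exists>R. finite R \<and> R \<subseteq> OF \<and> (\<forall>x\<in>OF. \<exists>r\<in>R. VF.vge (real m) (x - r))"
proof (induction m)
  case 0
  show ?case by (rule exI[of _ "{0}"]) (auto simp: OF_iff)
next
  case (Suc m)
  then obtain R where R: "finite R" "R \<subseteq> OF" "\<And>x. x \<in> OF \<Longrightarrow> \<exists>r\<in>R. VF.vge (real m) (x - r)" by blast
  define pick where "pick c = (SOME x. VF.vge 0 x \<and> c = residue_eq `` {x})" for c
  have pick: "VF.vge 0 (pick c) \<and> c = residue_eq `` {pick c}" if "c \<in> residue_field" for c
    unfolding pick_def using class_rep[OF that] by (rule someI_ex)
  define R' where "R' = (\<lambda>(r, c). r + varpi ^ m * pick c) ` (R \<times> residue_field)"
  have "finite R'" unfolding R'_def using R finite_residue by auto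
  moreover have "R' \<subseteq> OF"
  proof
    fix y assume "y \<in> R'"
    then obtain r c where rc: "r \<in> R" "c \<in> residue_field" "y = r + varpi ^ m * pick c" by (auto simp: R'_def)
    have "VF.vge 0 (varpi ^ m * pick c)" using pick[OF rc(2)] by (auto simp: vge_varpi_cancel intro: VF.vge_mono)
    moreover have "VF.vge 0 r" using rc R(2) OF_iff by blast
    ultimately show "y \<in> OF" unfolding rc(3) OF_iff by (rule VF.vge_add[rotated])
  qed
  moreover have "\<exists>r\<in>R'. VF.vge (real (Suc m)) (x - r)" if x: "x \<in> OF" for x
  proof -
    obtain r where r: "r \<in> R" "VF.vge (real m) (x - r)" using R(3)[OF x] by blast
    define y where "y = (x - r) / varpi ^ m"
    have xy: "x - r = varpi ^ m * y" by (simp add: y_def)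
    have y0: "VF.vge 0 y" using r(2) unfolding xy vge_varpi_cancel by simp
    define c where "c = residue_eq `` {y}"
    have c: "c \<in> residue_field" unfolding c_def by (rule class_in[OF y0])
    have "VF.vge 1 (y - pick c)" using pick[OF c] class_eq_iff[OF y0, of "pick c"] by (simp add: c_def)
    then have "VF.vge (real (Suc m)) (varpi ^ m * (y - pick c))" by (simp add: vge_varpi_cancel)
    moreover have "varpi ^ m * (y - pick c) = x - (r + varpi ^ m * pick c)"
      using xy by (simp add: algebra_simps)
    ultimately show ?thesis using r c unfolding R'_def by (intro bexI[of _ "r + varpi ^ m * pick c"]) auto
  qed
  ultimately show ?case by blast
qed

text \<open>Completeness of \<open>F\<close>: collecting equal digits, a series of digits times powers of \<open>p\<close> becomes a
  finite sum with coefficients in the p-adic integers, where completeness is given.\<close>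

lemma ex_digit_series:
  "\<exists>R. finite R \<and> R \<subseteq> OF \<and> (\<forall>t. (\<forall>n. t n \<in> OF) \<longrightarrow>
     (\<exists>c. (\<forall>b\<in>R. VP.vge 0 (c b)) \<and>
       (\<forall>J. VF.vge (real e * real J) ((\<Sum>b\<in>R. iF (c b) * b) - (\<Sum>n<J. of_nat p ^ n * t n)))))"
proof -
  obtain R where R: "finite R" "R \<subseteq> OF" "\<And>x. x \<in> OF \<Longrightarrow> \<exists>r\<in>R. VF.vge (real e) (x - r)"
    using ex_reps[of e] by blast
  define \<rho> where "\<rho> x = (SOME r. r \<in> R \<and> VF.vge (real e) (x - r))" for x
  have \<rho>: "\<rho> x \<in> R" "VF.vge (real e) (x - \<rho> x)" if "x \<in> OF" for x
    using someI_ex[of "\<lambda>r. r \<in> R \<and> VF.vge (real e) (x - r)"] R(3)[OF that] unfolding \<rho>_def by blast+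
  have vpn: "vp (of_nat p ^ n) = ereal (real n)" for n
    using VP.v_power[of "of_nat p" 1 n] vp_p by (simp add: one_ereal_def)
  have vFn: "vF (of_nat p ^ n) = ereal (real e * real n)" for n
    using VF.v_power[OF vF_p, of n] by (simp add: mult.commute)
  have "\<exists>c. (\<forall>b\<in>R. VP.vge 0 (c b)) \<and>
       (\<forall>J. VF.vge (real e * real J) ((\<Sum>b\<in>R. iF (c b) * b) - (\<Sum>n<J. of_nat p ^ n * t n)))"
    if t: "\<And>n. t n \<in> OF" for t
  proof -
    \<comment> \<open>\<open>s J\<close> is the carry into position \<open>J\<close>: what is left
      of the previous position after its representative modulo \<open>p\<close> is taken off,
      divided by \<open>p\<close>.\<close>
    define s where "s = rec_nat 0 (\<lambda>J s. (s + t J - \<rho> (s + t J)) / of_nat p)"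
    have s0: "s 0 = 0" and sS: "s (Suc J) = (s J + t J - \<rho> (s J + t J)) / of_nat p" for J
      by (simp_all add: s_def)
    have sO: "s J \<in> OF" for J
    proof (induction J)
      case (Suc J)
      have "s J + t J \<in> OF" using Suc t by (auto simp: OF_iff intro: VF.vge_add)
      from \<rho>(2)[OF this] have "VF.vge (real e) (of_nat p * s (Suc J))" using p_nonzero by (simp add: sS)
      then show ?case by (simp add: VF.vge_cancel[OF vF_p] OF_iff)
    qed (simp add: s0 OF_iff)
    define d where "d J = \<rho> (s J + t J)" for J
    have dR: "d J \<in> R" for J unfolding d_def using sO t by (intro \<rho>) (auto simp: OF_iff intro: VF.vge_add)
    have digits: "(\<Sum>n<J. of_nat p ^ n * t n) = (\<Sum>n<J. of_nat p ^ n * d n) + of_nat p ^ J * s J" for J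
    proof (induction J)
      case (Suc J)
      have "s J + t J = d J + of_nat p * s (Suc J)" using p_nonzero by (simp add: sS d_def)
      then have "of_nat p ^ J * (s J + t J) = of_nat p ^ J * (d J + of_nat p * s (Suc J))" by (simp only:)
      then have "of_nat p ^ J * s J + of_nat p ^ J * t J = of_nat p ^ J * d J + of_nat p ^ Suc J * s (Suc J)"
        by (simp add: algebra_simps)
      then show ?case using Suc by simp
    qed (simp add: s0)
    \<comment> \<open>\<open>C b J\<close> is a partial sum of the p-adic series that marks the
      positions at which the representative \<open>b\<close> occurs; its limit is the coefficient of
      \<open>b\<close>.\<close>
    define C where "C b J = (\<Sum>n<J. of_nat p ^ n * (if d n = b then 1 else 0 :: 'k))" for b J
    have Cdiff: "VP.vge (real J) (C b J' - C b J)" if "J \<le> J'" for b J J'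
    proof -
      have "{..<J'} = {..<J} \<union> {J..<J'}" using that by auto
      then have diff: "C b J' - C b J = (\<Sum>n\<in>{J..<J'}. of_nat p ^ n * (if d n = b then 1 else 0))"
        unfolding C_def by (simp add: sum.union_disjoint disjoint_iff)
      have "VP.vge (real J) (of_nat p ^ n * (if d n = b then 1 else 0))" if "J \<le> n" for n
      proof (cases "d n = b")
        case True
        then show ?thesis using that by (simp add: VP.vge_def vpn)
      qed simp
      then show ?thesis unfolding diff by (intro VP.vge_sum) simp
    qed
    have "\<exists>L. val_LIMSEQ vp (C b) L" for b
    proof (rule F.Qp_complete, unfold val_Cauchy_def, intro allI)
      fix B :: real
      obtain M :: nat where M: "B \<le> real M" using real_arch_simple by blast
      have "ereal B \<le> vp (C b m - C b n)" if "M \<le> m" "M \<le> n" for m n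
      proof -
        have "VP.vge (real M) ((C b m - C b M) - (C b n - C b M))" using that by (intro VP.vge_diff[OF Cdiff Cdiff])
        then show ?thesis using M VP.vge_mono[of "real M" _ B] by (simp add: VP.vge_def)
      qed
      then show "\<exists>M. \<forall>m\<ge>M. \<forall>n\<ge>M. ereal B \<le> vp (C b m - C b n)" by blast
    qed
    then obtain c where c: "\<And>b. val_LIMSEQ vp (C b) (c b)" by metis
    have cC: "VP.vge (real J) (c b - C b J)" for b J
    proof -
      obtain M where M: "\<And>n. M \<le> n \<Longrightarrow> ereal (real J) \<le> vp (C b n - c b)"
        using c[of b] unfolding val_LIMSEQ_def by blast
      have "VP.vge (real J) ((C b (max M J) - C b J) - (C b (max M J) - c b))"
        using M[of "max M J"] by (intro VP.vge_diff[OF Cdiff]) (auto simp: VP.vge_def)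
      then show ?thesis by simp
    qed
    have "VF.vge (real e * real J) ((\<Sum>b\<in>R. iF (c b) * b) - (\<Sum>n<J. of_nat p ^ n * t n))" for J
    proof -
      have "iF (C b J) * b = (\<Sum>n<J. if d n = b then of_nat p ^ n * b else 0)" for b
        unfolding C_def by (auto simp: iF_hom sum_distrib_right intro!: sum.cong)
      then have "(\<Sum>b\<in>R. iF (C b J) * b) = (\<Sum>n<J. \<Sum>b\<in>R. if d n = b then of_nat p ^ n * b else 0)"
        by (simp add: sum.swap[of _ R])
      also have "\<dots> = (\<Sum>n<J. of_nat p ^ n * d n)"
        using R(1) dR by (intro sum.cong refl) simp
      finally have eq: "(\<Sum>b\<in>R. iF (c b) * b) - (\<Sum>n<J. of_nat p ^ n * t n)
          = (\<Sum>b\<in>R. iF (c b - C b J) * b) - of_nat p ^ J * s J"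
        unfolding digits by (simp add: iF_hom left_diff_distrib sum_subtractf)
      have "VF.vge (real e * real J) (\<Sum>b\<in>R. iF (c b - C b J) * b)"
        using R(2) by (intro VF.vge_sum VF.vge_mult'[OF vge_iF[OF cC], of 0]) (auto simp: OF_iff)
      moreover have "VF.vge (real e * real J) (of_nat p ^ J * s J)"
        using sO[of J] by (simp add: VF.vge_cancel[OF vFn] OF_iff)
      ultimately show ?thesis unfolding eq by (rule VF.vge_diff)
    qed
    moreover have "VP.vge 0 (c b)" for b using cC[of 0 b] by (simp add: C_def)
    ultimately show ?thesis by blast
  qed
  then show ?thesis using R by blast
qed

lemma ex_series_limit:
  assumes "\<And>n. t n \<in> OF"
  shows "\<exists>L. \<forall>J. VF.vge (real e * real J) (L - (\<Sum>n<J. of_nat p ^ n * t n))"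
proof -
  obtain R :: "'f set" where R: "\<And>t. (\<And>n. t n \<in> OF) \<Longrightarrow> \<exists>c. (\<forall>b\<in>R. VP.vge 0 (c b)) \<and>
       (\<forall>J. VF.vge (real e * real J) ((\<Sum>b\<in>R. iF (c b) * b) - (\<Sum>n<J. of_nat p ^ n * t n)))"
    using ex_digit_series by blast
  show ?thesis using R[of t, OF assms] by blast
qed

text \<open>The integers of \<open>F\<close> are a finitely generated module over the p-adic integers, so that \<open>vC \<circ> \<sigma>\<close> is bounded
  below on them; as they are closed under powers, the bound is 0.\<close>

lemma vC_hom:
  assumes \<sigma>: "is_ring_hom \<sigma>" "\<And>x. \<sigma> (iF x) = iC x"
  shows "vC (\<sigma> x) = vF x"
proof -
  note hom = ring_hom_facts[OF \<sigma>(1)] ring_hom_inverse[OF \<sigma>(1)]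
  obtain R where R: "finite R" "R \<subseteq> OF" and S: "\<And>t. (\<And>n. t n \<in> OF) \<Longrightarrow> \<exists>c. (\<forall>b\<in>R. VP.vge 0 (c b)) \<and>
       (\<forall>J. VF.vge (real e * real J) ((\<Sum>b\<in>R. iF (c b) * b) - (\<Sum>n<J. of_nat p ^ n * t n)))"
    using ex_digit_series by blast
  obtain A where A: "\<And>b. b \<in> R \<Longrightarrow> VC.vge A (\<sigma> b)" using VC.ex_vge_finite[OF R(1), of \<sigma>] by blast
  have bound: "VC.vge A (\<sigma> x)" if "VF.vge 0 x" for x
  proof -
    \<comment> \<open>For the series \<open>x, 0, 0, ...\<close> every nonempty partial sum is
      \<open>x\<close>, so the limit formula becomes an exact expression of \<open>x\<close> by the
      generators in \<open>R\<close>.\<close>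
    define t where "t n = (if n = 0 then x else 0)" for n :: nat
    have "t n \<in> OF" for n using that by (simp add: t_def OF_iff)
    then obtain c where c: "\<And>b. b \<in> R \<Longrightarrow> VP.vge 0 (c b)"
      and lim: "\<And>J. VF.vge (real e * real J) ((\<Sum>b\<in>R. iF (c b) * b) - (\<Sum>n<J. of_nat p ^ n * t n))"
      using S[of t] by blast
    have sum_t: "(\<Sum>n<J. of_nat p ^ n * t n) = x" if "1 \<le> J" for J
    proof -
      have "(\<Sum>n<J. of_nat p ^ n * t n) = (\<Sum>n<J. if n = 0 then x else 0)" by (intro sum.cong) (auto simp: t_def)
      then show ?thesis using that by simp
    qed
    have "VF.vge u ((\<Sum>b\<in>R. iF (c b) * b) - x)" for u
    proof -
      obtain J :: nat where J: "u \<le> real J" using real_arch_simple by blast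
      have "VF.vge (real e * real (Suc J)) ((\<Sum>b\<in>R. iF (c b) * b) - x)" using lim[of "Suc J"] sum_t[of "Suc J"] by simp
      moreover have "real (Suc J) \<le> real e * real (Suc J)" using e_pos by (simp add: mult_le_cancel_right1)
      ultimately show ?thesis using J by (elim VF.vge_mono) linarith
    qed
    then have x: "x = (\<Sum>b\<in>R. iF (c b) * b)" using VF.vge_iff_0[of "(\<Sum>b\<in>R. iF (c b) * b) - x"] by simp
    have "VC.vge 0 (iC (c b))" if "b \<in> R" for b
      using vge_iF[OF c[OF that]] by (simp add: VC.vge_def VF.vge_def vC_extends)
    then have "VC.vge A (\<Sum>b\<in>R. iC (c b) * \<sigma> b)" using A by (intro VC.vge_sum VC.vge_mult_int) auto
    moreover have "\<sigma> x = (\<Sum>b\<in>R. iC (c b) * \<sigma> b)" by (subst x) (simp add: hom \<sigma>(2))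
    ultimately show ?thesis by simp
  qed
  have nonneg: "VC.vge 0 (\<sigma> x)" if "VF.vge 0 x" for x
  proof (cases "x = 0")
    case False
    then obtain s where s: "vC (\<sigma> x) = ereal s" using VC.v_finite hom by blast
    have "0 \<le> s"
    proof (rule ccontr)
      assume "\<not> 0 \<le> s"
      obtain n :: nat where n: "A / s < real n" using reals_Archimedean2 by blast
      have "VC.vge A (\<sigma> (x ^ n))" by (rule bound[OF VF.vge_power_int[OF that]])
      then have "A \<le> real n * s" by (simp add: hom VC.vge_def VC.v_power[OF s])
      then show False using n \<open>\<not> 0 \<le> s\<close> by (simp add: field_simps)
    qed
    then show ?thesis using s by (simp add: VC.vge_def)
  qed (simp add: hom)
  have unit: "vC (\<sigma> x) = 0" if "vF x = 0" for x
  proof -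
    have x0: "x \<noteq> 0" using that VF.v_eq_infinity_iff[of x] by auto
    obtain s where s: "vC (\<sigma> x) = ereal s" using VC.v_finite x0 hom by blast
    have "vF (inverse x) = 0" using VF.v_inverse[of x 0] that by (simp add: zero_ereal_def)
    then have "VC.vge 0 (\<sigma> (inverse x))" by (intro nonneg) (simp add: VF.vge_def zero_ereal_def)
    then have "s \<le> 0" using VC.v_inverse[OF s] by (simp add: hom VC.vge_def)
    moreover have "0 \<le> s" using nonneg[of x] that s by (simp add: VC.vge_def VF.vge_def zero_ereal_def)
    ultimately show ?thesis using s by (simp add: zero_ereal_def)
  qed
  have \<sigma>p: "vC (\<sigma> (of_nat p)) = ereal (real e)"
    using \<sigma>(2)[of "of_nat p"] vC_extends[of "of_nat p"] vF_p by (simp add: iF_hom)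
  show ?thesis
  proof (cases "x = 0")
    case True
    then show ?thesis using VC.v_eq_infinity_iff[of 0] VF.v_eq_infinity_iff[of 0] by (simp add: hom)
  next
    case False
    then obtain m :: int where m: "vF x = ereal (of_int m)" using vF_int by blast
    obtain s where s: "vC (\<sigma> x) = ereal s" using VC.v_finite False hom by blast
    \<comment> \<open>\<open>x ^ e\<close> and \<open>p ^ m\<close> have the same valuation, so
      their quotient is a unit, and \<open>\<sigma>\<close> maps units to units. The cases only keep
      the exponent of \<open>p\<close> natural.\<close>
    have pos: "real e * s = real e * of_int m"
    proof (cases "0 \<le> m")
      case True
      define y where "y = x ^ e * inverse (of_nat p ^ nat m)"
      have "vF y = 0" unfolding y_def VF.v_mult VF.v_power[OF m] VF.v_inverse[OF VF.v_power[OF vF_p]]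
        using True by (simp add: zero_ereal_def)
      have "\<sigma> y = \<sigma> x ^ e * inverse (\<sigma> (of_nat p) ^ nat m)" unfolding y_def by (simp only: hom(4,7,10))
      with unit[OF \<open>vF y = 0\<close>] have "real e * s - real (nat m) * real e = 0"
        by (simp add: VC.v_mult VC.v_power[OF s] VC.v_inverse[OF VC.v_power[OF \<sigma>p]] zero_ereal_def del: of_nat_nat)
      then show ?thesis using True by (simp add: algebra_simps)
    next
      case F: False
      define y where "y = x ^ e * of_nat p ^ nat (- m)"
      have "vF y = 0" unfolding y_def VF.v_mult VF.v_power[OF m] VF.v_power[OF vF_p]
        using F by (simp add: zero_ereal_def)
      have "\<sigma> y = \<sigma> x ^ e * \<sigma> (of_nat p) ^ nat (- m)" unfolding y_def by (simp only: hom(4,7))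
      with unit[OF \<open>vF y = 0\<close>] have "real e * s + real (nat (- m)) * real e = 0"
        by (simp add: VC.v_mult VC.v_power[OF s] VC.v_power[OF \<sigma>p] zero_ereal_def del: of_nat_nat)
      then show ?thesis using F by (simp add: algebra_simps)
    qed
    then show ?thesis using s m e_pos by simp
  qed
qed

end

section \<open>Teichmueller digits\<close>

context hecke_finite begin

definition class_pick :: "'f set \<Rightarrow> 'f" where
  "class_pick c = (SOME x. VF.vge 0 x \<and> c = residue_eq `` {x})"

lemma class_pick: "c \<in> residue_field \<Longrightarrow> VF.vge 0 (class_pick c)"
  "c \<in> residue_field \<Longrightarrow> residue_eq `` {class_pick c} = c"
  using someI_ex[OF class_rep, of c] unfolding class_pick_def by auto

definition residue_of :: "'f \<Rightarrow> 'f set" where "residue_of x = residue_eq `` {x}"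

lemma residue_of_in: "VF.vge 0 x \<Longrightarrow> residue_of x \<in> residue_field"
  unfolding residue_of_def by (rule class_in)

lemma vge_pick: "VF.vge 0 x \<Longrightarrow> VF.vge 1 (class_pick (residue_of x) - x)"
  using class_eq_iff[of "class_pick (residue_of x)" x] class_pick[OF residue_of_in, of x]
  by (simp add: residue_of_def)

lemma residue_permutation:
  assumes f: "\<And>c. c \<in> A \<Longrightarrow> VF.vge 0 (f c)" "\<And>c. c \<in> A \<Longrightarrow> residue_of (f c) \<in> A" "A \<subseteq> residue_field"
    and inj: "\<And>c c'. c \<in> A \<Longrightarrow> c' \<in> A \<Longrightarrow> VF.vge 1 (f c - f c') \<Longrightarrow> c = c'"
  shows "bij_betw (\<lambda>c. residue_of (f c)) A A"
proof -
  have "finite A" using finite_residue f(3) by (rule finite_subset[rotated])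
  moreover have "inj_on (\<lambda>c. residue_of (f c)) A"
  proof (rule inj_onI)
    fix c c' assume c: "c \<in> A" "c' \<in> A" "residue_of (f c) = residue_of (f c')"
    then show "c = c'" using class_eq_iff[OF f(1)[OF c(1)] f(1)[OF c(2)]] inj by (simp add: residue_of_def)
  qed
  ultimately show ?thesis using f(2) by (simp add: bij_betw_def image_subsetI endo_inj_surj)
qed

lemma q_pos: "0 < q"
  unfolding q_def using class_in[of 0] finite_residue by (auto simp: card_gt_0_iff)

text \<open>Adding 1 permutes the residue classes: it changes the sum of the representatives by
  \<open>q\<close> and at the same time leaves it fixed modulo \<open>varpi\<close>.\<close>

lemma vge_q: "VF.vge 1 (of_nat q)"
proof -
  have inj: "c = c'" if c: "c \<in> residue_field" "c' \<in> residue_field" "VF.vge 1 (class_pick c - class_pick c')" for c c'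
    using class_eq_iff[OF class_pick(1)[OF c(1)] class_pick(1)[OF c(2)]] class_pick(2) c by simp
  have bij: "bij_betw (\<lambda>c. residue_of (class_pick c + 1)) residue_field residue_field"
  proof (rule residue_permutation)
    fix c assume c: "c \<in> residue_field"
    show "VF.vge 0 (class_pick c + 1)" by (rule VF.vge_add[OF class_pick(1)[OF c] VF.vge_1])
    then show "residue_of (class_pick c + 1) \<in> residue_field" by (rule residue_of_in)
    fix c' assume "c' \<in> residue_field" "VF.vge 1 (class_pick c + 1 - (class_pick c' + 1))"
    then show "c = c'" using inj[OF c] by simp
  qed simp
  have "(\<Sum>c\<in>residue_field. class_pick (residue_of (class_pick c + 1))) = (\<Sum>c\<in>residue_field. class_pick c)"
    by (rule sum.reindex_bij_betw[OF bij])
  then have "(\<Sum>c\<in>residue_field. class_pick (residue_of (class_pick c + 1)) - (class_pick c + 1)) = - of_nat q"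
    by (simp add: sum_subtractf sum.distrib q_def)
  moreover have "VF.vge 1 (\<Sum>c\<in>residue_field. class_pick (residue_of (class_pick c + 1)) - (class_pick c + 1))"
    by (intro VF.vge_sum vge_pick VF.vge_add class_pick VF.vge_1)
  ultimately show ?thesis by simp
qed

lemma not_vge_1_one: "\<not> VF.vge 1 1" by (simp add: VF.vge_def one_ereal_def[symmetric])

lemma v_unit_iff: "VF.vge 0 u \<Longrightarrow> vF u = 0 \<longleftrightarrow> \<not> VF.vge 1 u"
  using vF_pos_iff[of u] by (auto simp: VF.vge_def zero_ereal_def[symmetric])

text \<open>Multiplication by a unit \<open>u\<close> permutes the nonzero classes. Comparing the
  products of their representatives and cancelling this unit gives \<open>u ^ (q - 1) = 1\<close>
  modulo \<open>varpi\<close>.\<close>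

lemma fermat: assumes "VF.vge 0 u" shows "VF.vge 1 (u ^ q - u)"
proof (cases "VF.vge 1 u")
  case True
  have "VF.vge 1 (u ^ q)"
  proof -
    have "u ^ q = u ^ (q - 1) * u" using q_pos by (metis Suc_diff_1 power_Suc2)
    then show ?thesis using VF.vge_mult_int[OF VF.vge_power_int[OF assms] True] by simp
  qed
  then show ?thesis using True by (rule VF.vge_diff)
next
  case False
  define A where "A = residue_field - {residue_of 0}"
  have A: "c \<in> A \<longleftrightarrow> c \<in> residue_field \<and> \<not> VF.vge 1 (class_pick c)" for c
    using class_eq_iff[of "class_pick c" 0] class_pick[of c] by (auto simp: A_def residue_of_def)
  have unit: "vF x = ereal 0" if "VF.vge 0 x" "\<not> VF.vge 1 x" for x
    using v_unit_iff[OF that(1)] that(2) by (simp add: zero_ereal_def)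
  have u: "vF u = ereal 0" by (rule unit[OF assms False])
  have up: "VF.vge 0 (u * class_pick c)" if "c \<in> A" for c using that by (intro VF.vge_mult_int assms class_pick) (simp add: A)
  have uA: "residue_of (u * class_pick c) \<in> A" if "c \<in> A" for c
  proof -
    have "\<not> VF.vge 1 (u * class_pick c)" using that VF.vge_cancel[OF u, of 1] by (simp add: A)
    then have "\<not> VF.vge 1 (class_pick (residue_of (u * class_pick c)))"
      using VF.vge_diff[OF _ vge_pick[OF up[OF that]]] by fastforce
    then show ?thesis using residue_of_in[OF up[OF that]] by (simp add: A)
  qed
  have bij: "bij_betw (\<lambda>c. residue_of (u * class_pick c)) A A"
  proof (rule residue_permutation[OF up uA])
    fix c c' assume c: "c \<in> A" "c' \<in> A" "VF.vge 1 (u * class_pick c - u * class_pick c')"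
    then have "VF.vge 1 (u * (class_pick c - class_pick c'))" by (simp add: right_diff_distrib)
    then have "VF.vge 1 (class_pick c - class_pick c')" by (simp add: VF.vge_cancel[OF u])
    then show "c = c'" using c class_eq_iff[of "class_pick c" "class_pick c'"] class_pick by (simp add: A)
  qed (auto simp: A_def)
  define X where "X = (\<Prod>c\<in>A. class_pick c)"
  have finA: "finite A" using finite_residue by (simp add: A_def)
  have "residue_of 0 \<in> residue_field" by (rule residue_of_in) simp
  then have card: "card A = q - 1" using finite_residue by (simp add: A_def q_def)
  have "VF.vge 1 ((\<Prod>c\<in>A. class_pick (residue_of (u * class_pick c))) - (\<Prod>c\<in>A. u * class_pick c))"
    using VF.vge_prod_cong[of A "\<lambda>c. class_pick (residue_of (u * class_pick c))" "\<lambda>c. u * class_pick c" 1]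
      up vge_pick class_pick(1)[OF residue_of_in[OF up]] by blast
  moreover have "(\<Prod>c\<in>A. class_pick (residue_of (u * class_pick c))) = X"
    unfolding X_def by (rule prod.reindex_bij_betw[OF bij])
  moreover have "(\<Prod>c\<in>A. u * class_pick c) = u ^ (q - 1) * X" by (simp add: X_def prod.distrib card)
  ultimately have "VF.vge 1 (X * (1 - u ^ (q - 1)))" by (simp add: algebra_simps)
  moreover have "vF X = ereal 0"
  proof -
    have "vF (\<Prod>c\<in>B. class_pick c) = ereal 0" if "finite B" "B \<subseteq> A" for B
      using that
    proof (induction B rule: finite_induct)
      case (insert c B)
      then have "vF (class_pick c) = ereal 0" using A class_pick(1) by (intro unit) auto
      then show ?case using insert by (simp add: VF.v_mult)
    qed (simp add: zero_ereal_def)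
    then show ?thesis using finA by (simp add: X_def)
  qed
  ultimately have "VF.vge 1 (1 - u ^ (q - 1))" by (simp add: VF.vge_cancel)
  then have "VF.vge 1 (u * (1 - u ^ (q - 1)))" by (rule VF.vge_mult_int[OF assms])
  moreover have "u * u ^ (q - 1) = u ^ q" using q_pos by (metis Suc_diff_1 power_Suc)
  ultimately show ?thesis using VF.vge_diff_commute by (simp add: right_diff_distrib)
qed

text \<open>The \<open>q\<close>-th power fixes both elements, yet by \<open>vge_power_lift\<close>
  it brings them closer together each time.\<close>

lemma teichmueller_unique:
  assumes "x ^ q = x" "y ^ q = y" "VF.vge 0 x" "VF.vge 0 y" "VF.vge 1 (x - y)"
  shows "x = y"
proof -
  have "VF.vge (real (Suc m)) (x - y)" for m
  proof (induction m)
    case (Suc m)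
    then show ?case using VF.vge_power_lift[OF assms(3,4) vge_q Suc] assms(1,2) by simp
  qed (use assms in simp)
  then have "VF.vge t (x - y)" for t
  proof -
    obtain m :: nat where "t \<le> real m" using real_arch_simple by blast
    then show ?thesis by (intro VF.vge_mono[OF \<open>\<And>m. VF.vge (real (Suc m)) (x - y)\<close>[of m]]) simp
  qed
  then show ?thesis using VF.vge_iff_0[of "x - y"] by simp
qed

text \<open>The root is the limit of \<open>u ^ (q ^ m)\<close>. Completeness is available for
  series in powers of \<open>p\<close>, so \<open>e\<close> consecutive steps are grouped into one
  term of the series.\<close>

lemma ex_teichmueller:
  assumes u: "VF.vge 0 u"
  shows "\<exists>x. x ^ q = x \<and> VF.vge 0 x \<and> VF.vge 1 (u - x)"
proof -
  define y where "y m = u ^ (q ^ m)" for m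
  have y0: "VF.vge 0 (y m)" for m unfolding y_def by (rule VF.vge_power_int[OF u])
  have yS: "y (Suc m) = y m ^ q" for m by (simp add: y_def power_mult[symmetric] mult.commute)
  have step: "VF.vge (real (Suc m)) (y (Suc m) - y m)" for m
  proof (induction m)
    case 0
    then show ?case using fermat[OF u] by (simp add: y_def)
  next
    case (Suc m)
    then show ?case using VF.vge_power_lift[OF y0 y0 vge_q Suc] by (simp add: yS)
  qed
  have far: "VF.vge (real (Suc m)) (y (m + j) - y m)" for m j
  proof (induction j)
    case (Suc j)
    have "VF.vge (real (Suc m)) (y (Suc (m + j)) - y (m + j))" by (rule VF.vge_mono[OF step]) simp
    from VF.vge_add[OF this Suc] show ?case by simp
  qed simp
  define t where "t n = (y (e * Suc n) - y (e * n)) / of_nat p ^ n" for n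
  have vFn: "vF (of_nat p ^ n) = ereal (real e * real n)" for n
    using VF.v_power[OF vF_p, of n] by (simp add: mult.commute)
  have pt: "of_nat p ^ n * t n = y (e * Suc n) - y (e * n)" for n using p_nonzero by (simp add: t_def)
  have "t n \<in> OF" for n
  proof -
    have "VF.vge (real e * real n) (of_nat p ^ n * t n)"
      using far[of "e * n" e] unfolding pt by (auto simp: add.commute elim!: VF.vge_mono)
    then show ?thesis by (simp add: VF.vge_cancel[OF vFn] OF_iff)
  qed
  then obtain L where L: "\<And>J. VF.vge (real e * real J) (L - (\<Sum>n<J. of_nat p ^ n * t n))"
    using ex_series_limit[of t] by blast
  have tele: "(\<Sum>n<J. of_nat p ^ n * t n) = y (e * J) - u" for J
  proof (induction J)
    case (Suc J)
    then show ?case by (simp add: pt)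
  qed (simp add: y_def)
  define x where "x = L + u"
  have xJ: "VF.vge (real e * real J) (x - y (e * J))" for J using L[of J] unfolding tele by (simp add: x_def algebra_simps)
  have x0: "VF.vge 0 x"
    using VF.vge_add[OF xJ[of 0, simplified] y0[of 0]] by simp
  have "VF.vge s (x ^ q - x)" for s
  proof -
    obtain J :: nat where J: "s \<le> real J" using real_arch_simple by blast
    define m where "m = e * Suc J"
    have "1 * Suc J \<le> m" unfolding m_def by (rule mult_le_mono1[OF e_pos])
    then have "J \<le> m" "1 \<le> m" by auto
    have xm: "VF.vge (real m) (x - y m)" using xJ[of "Suc J"] by (simp add: m_def algebra_simps)
    have 1: "VF.vge (real m) (x ^ q - y m ^ q)"
      by (rule VF.vge_mono[OF VF.vge_power_lift[OF x0 y0 vge_q xm \<open>1 \<le> m\<close>]]) simp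
    have 2: "VF.vge (real m) (y (Suc m) - y m)" by (rule VF.vge_mono[OF step]) simp
    have "VF.vge (real m) (x ^ q - x)" using VF.vge_diff[OF VF.vge_add[OF 1 2] xm] by (simp add: yS)
    then show ?thesis by (rule VF.vge_mono) (use J \<open>J \<le> m\<close> in linarith)
  qed
  then have "x ^ q = x" using VF.vge_iff_0[of "x ^ q - x"] by simp
  moreover have "VF.vge 1 (u - x)"
  proof -
    have 1: "VF.vge 1 (y (0 + e) - y 0)" by (rule VF.vge_mono[OF far]) simp
    have 2: "VF.vge 1 (x - y e)" by (rule VF.vge_mono[OF xJ[of 1, simplified]]) (use e_pos in simp)
    show ?thesis using VF.vge_add[OF 1 2] VF.vge_diff_commute[of 1 x u] by (simp add: y_def)
  qed
  ultimately show ?thesis using x0 by blast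
qed

lemma teichmueller_props:
  assumes "VF.vge 0 u"
  shows "teichmueller (residue_of u) ^ q = teichmueller (residue_of u)"
    and "VF.vge 0 (teichmueller (residue_of u))" and "VF.vge 1 (u - teichmueller (residue_of u))"
proof -
  have mem: "x \<in> residue_of u \<longleftrightarrow> VF.vge 0 x \<and> VF.vge 1 (u - x)" for x
    using assms by (auto simp: residue_of_def residue_eq_iff)
  obtain x where x: "x ^ q = x" "VF.vge 0 x" "VF.vge 1 (u - x)" using ex_teichmueller[OF assms] by blast
  have "teichmueller (residue_of u) = x"
    unfolding teichmueller_def
  proof (rule the_equality)
    fix z assume z: "z \<in> residue_of u \<and> z ^ q = z"
    then have "VF.vge 1 (u - z)" using mem by simp
    from VF.vge_diff[OF x(3) this] show "z = x" using teichmueller_unique[of z x] x z mem by simp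
  qed (use x mem in auto)
  then show "teichmueller (residue_of u) ^ q = teichmueller (residue_of u)"
    "VF.vge 0 (teichmueller (residue_of u))" "VF.vge 1 (u - teichmueller (residue_of u))" using x by auto
qed

definition digits :: "'f set" where "digits = teichmueller ` residue_field"

lemma residue_fieldE: "c \<in> residue_field \<Longrightarrow> (\<And>u. VF.vge 0 u \<Longrightarrow> c = residue_of u \<Longrightarrow> P) \<Longrightarrow> P"
  using class_rep[of c] by (auto simp: residue_of_def)

lemma digits_power: "x \<in> digits \<Longrightarrow> x ^ q = x"
  and digits_int: "x \<in> digits \<Longrightarrow> VF.vge 0 x"
  by (auto simp: digits_def teichmueller_props elim: residue_fieldE)

lemma digits_unique: "x \<in> digits \<Longrightarrow> y \<in> digits \<Longrightarrow> VF.vge 1 (x - y) \<Longrightarrow> x = y"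
  by (rule teichmueller_unique) (auto intro: digits_power digits_int)

lemma digits_sep: "x \<in> digits \<Longrightarrow> y \<in> digits \<Longrightarrow> x \<noteq> y \<Longrightarrow> vF (x - y) = 0"
  using v_unit_iff[of "x - y"] digits_unique[of x y] VF.vge_diff[OF digits_int digits_int] by blast

lemma ex_digit: "VF.vge 0 u \<Longrightarrow> \<exists>x\<in>digits. VF.vge 1 (u - x)"
  using teichmueller_props[of u] residue_of_in[of u] unfolding digits_def by blast

lemma finite_digits: "finite digits" using finite_residue by (simp add: digits_def)

lemma card_digits: "card digits = q"
  unfolding digits_def q_def
proof (rule card_image, rule inj_onI)
  fix c c' assume c: "c \<in> residue_field" "c' \<in> residue_field" "teichmueller c = teichmueller c'"
  obtain u u' where u: "VF.vge 0 u" "c = residue_of u" "VF.vge 0 u'" "c' = residue_of u'" using c residue_fieldE by metis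
  from VF.vge_diff[OF teichmueller_props(3)[OF u(1)] teichmueller_props(3)[OF u(3)]]
  have "VF.vge 1 ((u - teichmueller c) - (u' - teichmueller c'))" using u by simp
  then show "c = c'" using c(3) u class_eq_iff[of u u'] by (simp add: residue_of_def)
qed

lemma q_ge_2: "2 \<le> q"
proof (rule ccontr)
  assume "\<not> 2 \<le> q"
  then have "card digits = 1" using q_pos card_digits by linarith
  then obtain x where "digits = {x}" by (rule card_1_singletonE)
  then have "VF.vge 1 (0 - x)" "VF.vge 1 (1 - x)" using ex_digit[of 0] ex_digit[of 1] by auto
  from VF.vge_diff[OF this(2,1)] show False using not_vge_1_one by simp
qed

lemma I_Suc: "I (Suc m) = {\<mu> + varpi ^ m * x | \<mu> x. \<mu> \<in> I m \<and> x \<in> digits}"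
proof (intro set_eqI iffI)
  fix z assume "z \<in> I (Suc m)"
  then obtain f where "z = (\<Sum>i<Suc m. varpi ^ i * teichmueller (f i))" "\<forall>i<Suc m. f i \<in> residue_field" by (auto simp: I_def)
  then show "z \<in> {\<mu> + varpi ^ m * x | \<mu> x. \<mu> \<in> I m \<and> x \<in> digits}" by (fastforce simp: I_def digits_def)
next
  fix z assume "z \<in> {\<mu> + varpi ^ m * x | \<mu> x. \<mu> \<in> I m \<and> x \<in> digits}"
  then obtain f c where z: "z = (\<Sum>i<m. varpi ^ i * teichmueller (f i)) + varpi ^ m * teichmueller c"
    and f: "\<forall>i<m. f i \<in> residue_field" and c: "c \<in> residue_field" by (auto simp: I_def digits_def)
  have "z = (\<Sum>i<Suc m. varpi ^ i * teichmueller ((f(m := c)) i))" by (simp add: z)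
  moreover have "\<forall>i<Suc m. (f(m := c)) i \<in> residue_field" using f c by (auto simp: less_Suc_eq)
  ultimately show "z \<in> I (Suc m)" unfolding I_def by blast
qed

lemma I_0: "I 0 = {0}" by (auto simp: I_def)

lemma I_int: "\<mu> \<in> I m \<Longrightarrow> VF.vge 0 \<mu>"
proof (induction m arbitrary: \<mu>)
  case (Suc m)
  then obtain \<nu> x where x: "\<mu> = \<nu> + varpi ^ m * x" "\<nu> \<in> I m" "x \<in> digits" by (auto simp: I_Suc)
  have "VF.vge 0 (varpi ^ m * x)"
    using VF.vge_mono[OF digits_int[OF x(3)], of "0 - real m"] by (simp add: vge_varpi_cancel)
  then show ?case using x Suc.IH[OF x(2)] by (simp add: VF.vge_add)
qed (simp add: I_0)

lemma I_unique: "\<mu> \<in> I m \<Longrightarrow> \<nu> \<in> I m \<Longrightarrow> VF.vge (real m) (\<mu> - \<nu>) \<Longrightarrow> \<mu> = \<nu>"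
proof (induction m arbitrary: \<mu> \<nu>)
  case (Suc m)
  obtain \<mu>' x where x: "\<mu> = \<mu>' + varpi ^ m * x" "\<mu>' \<in> I m" "x \<in> digits" using Suc.prems(1) by (auto simp: I_Suc)
  obtain \<nu>' y where y: "\<nu> = \<nu>' + varpi ^ m * y" "\<nu>' \<in> I m" "y \<in> digits" using Suc.prems(2) by (auto simp: I_Suc)
  have xy: "VF.vge 0 (x - y)" using x y by (intro VF.vge_diff digits_int)
  then have "VF.vge (real m) (varpi ^ m * (x - y))" by (simp add: vge_varpi_cancel)
  moreover have "VF.vge (real m) (\<mu> - \<nu>)" by (rule VF.vge_mono[OF Suc.prems(3)]) simp
  ultimately have "VF.vge (real m) ((\<mu> - \<nu>) - varpi ^ m * (x - y))" by (rule VF.vge_diff[rotated])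
  then have "VF.vge (real m) (\<mu>' - \<nu>')" by (simp add: x y algebra_simps)
  then have eq: "\<mu>' = \<nu>'" using Suc.IH x y by blast
  then have "VF.vge (real (Suc m)) (varpi ^ m * (x - y))" using Suc.prems(3) by (simp add: x y algebra_simps)
  then have "VF.vge 1 (x - y)" by (simp add: vge_varpi_cancel)
  then show ?case using digits_unique x y eq by simp
qed (simp add: I_0)

lemma S_hom: "\<sigma> \<in> S \<Longrightarrow> is_ring_hom \<sigma>" "\<sigma> \<in> S \<Longrightarrow> \<sigma> (iF x) = iC x"
  by (auto simp: S_def)

lemma vC_S: "\<sigma> \<in> S \<Longrightarrow> vC (\<sigma> x) = vF x"
  by (rule vC_hom) (auto dest: S_hom)

lemma vge_S: "\<sigma> \<in> S \<Longrightarrow> VC.vge t (\<sigma> x) \<longleftrightarrow> VF.vge t x"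
  by (simp add: VC.vge_def VF.vge_def vC_S)

text \<open>\<open>card S\<close> is the dimension of \<open>F\<close>, which is positive, whereas
  an infinite set has \<open>card\<close> 0.\<close>

lemma finite_S: "finite S"
proof -
  interpret vector_space "\<lambda>c x. iF c * x"
    by unfold_locales (auto simp: iF_hom algebra_simps)
  obtain B where B: "finite B" "span B = UNIV" using F.finite_dim by blast
  obtain B' where B': "B' \<subseteq> UNIV" "independent B'" "UNIV \<subseteq> span B'" "card B' = dim (UNIV :: 'f set)"
    using basis_exists[of UNIV] by metis
  have "finite B'" using independent_span_bound[OF B(1) B'(2)] B by auto
  moreover have "B' \<noteq> {}" using B'(3) by (auto dest: subsetD[of _ _ 1])
  ultimately have "0 < card B'" by (simp add: card_gt_0_iff)
  then have "0 < card S" using card_homs B'(4) by (simp add: S_def)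
  then show ?thesis by (simp add: card_gt_0_iff)
qed

lemma digit_field_S:
  assumes "\<sigma> \<in> S"
  shows "digit_field vC p q e (\<sigma> varpi) (\<sigma> ` digits)"
proof -
  note hom = ring_hom_facts[OF S_hom(1)[OF assms]]
  have inj: "inj_on \<sigma> digits"
    using ring_hom_inverse(2)[OF S_hom(1)[OF assms]] hom(6) by (metis inj_onI right_minus_eq)
  have "(\<sigma> x + 1) ^ q - (\<sigma> x + 1) = \<sigma> ((x + 1) ^ q - (x + 1))" for x by (simp only: hom)
  then have shift: "VC.vge 1 ((\<sigma> x + 1) ^ q - (\<sigma> x + 1))" if "x \<in> digits" for x
    using fermat[OF VF.vge_add[OF digits_int[OF that] VF.vge_1]] vge_S[OF assms] by simp
  have "(- 1) ^ q + 1 = \<sigma> ((- 1) ^ q - (- 1))" by (simp only: hom) simp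
  then have minus: "VC.vge 1 ((- 1) ^ q + 1)"
    using fermat[of "- 1"] vge_S[OF assms] by simp
  have "vC (of_nat p) = ereal (real e)" using vC_S[OF assms, of "of_nat p"] by (simp add: hom vF_p)
  moreover have "\<sigma> x ^ q = \<sigma> x" if "x \<in> digits" for x using digits_power[OF that] by (metis hom(7))
  moreover have "vC (\<sigma> x - \<sigma> y) = 0" if "x \<in> digits" "y \<in> digits" "\<sigma> x \<noteq> \<sigma> y" for x y
    using digits_sep[of x y] that vC_S[OF assms, of "x - y"] by (auto simp: hom)
  ultimately show ?thesis
    using F.p_prime e_pos q_ge_2 finite_digits card_image[OF inj] card_digits vC_S[OF assms] vF_varpi shift minus
    by unfold_locales auto
qed

end

section \<open>The representations \<open>V k\<close>\<close>

abbreviation "coef \<equiv> Poly_Mapping.lookup"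

definition monev :: "('x \<Rightarrow> 'r::comm_ring_1) \<Rightarrow> ('x \<Rightarrow>\<^sub>0 nat) \<Rightarrow> 'r" where
  "monev h m = (\<Prod>z\<in>Poly_Mapping.keys m. h z ^ coef m z)"

text \<open>The evaluation that maps coefficients by \<open>\<kappa>\<close> and variables by
  \<open>h\<close>. Matrix substitution and dehomogenization are both instances, so
  \<open>insertion_insertion\<close> handles their compositions.\<close>

definition insertion :: "('c::comm_ring_1 \<Rightarrow> 'r::comm_ring_1) \<Rightarrow> ('x \<Rightarrow> 'r) \<Rightarrow> (('x \<Rightarrow>\<^sub>0 nat) \<Rightarrow>\<^sub>0 'c) \<Rightarrow> 'r" where
  "insertion \<kappa> h P = (\<Sum>m\<in>Poly_Mapping.keys P. \<kappa> (coef P m) * monev h m)"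

lemma monev_superset:
  assumes "finite A" "Poly_Mapping.keys m \<subseteq> A"
  shows "monev h m = (\<Prod>z\<in>A. h z ^ coef m z)"
  unfolding monev_def using assms by (intro prod.mono_neutral_left) (auto simp: in_keys_iff)

lemma monev_add: "monev h (m + m') = monev h m * monev h m'"
proof -
  define A where "A = Poly_Mapping.keys m \<union> Poly_Mapping.keys m'"
  have A: "finite A" "Poly_Mapping.keys m \<subseteq> A" "Poly_Mapping.keys m' \<subseteq> A" "Poly_Mapping.keys (m + m') \<subseteq> A"
    using keys_add[of m m'] by (auto simp: A_def)
  show ?thesis
    unfolding monev_superset[OF A(1,2)] monev_superset[OF A(1,3)] monev_superset[OF A(1,4)]
    by (simp add: lookup_add power_add prod.distrib)
qed

lemma monev_0 [simp]: "monev h 0 = 1" by (simp add: monev_def)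

lemma monev_single: "monev h (Poly_Mapping.single z n) = h z ^ n"
  by (cases "n = 0") (simp_all add: monev_def)

lemma poly_mapping_sum_single: "P = (\<Sum>m\<in>Poly_Mapping.keys P. Poly_Mapping.single m (coef P m))"
proof (rule poly_mapping_eqI)
  fix n
  have "coef (\<Sum>m\<in>Poly_Mapping.keys P. Poly_Mapping.single m (coef P m)) n
      = (\<Sum>m\<in>Poly_Mapping.keys P. if m = n then coef P m else 0)"
    by (simp add: lookup_sum lookup_single when_def)
  then show "coef P n = coef (\<Sum>m\<in>Poly_Mapping.keys P. Poly_Mapping.single m (coef P m)) n"
    by (simp add: in_keys_iff)
qed

lemma poly_mapping_mult_sum:
  "P * R = (\<Sum>m\<in>Poly_Mapping.keys P. \<Sum>n\<in>Poly_Mapping.keys R. Poly_Mapping.single (m + n) (coef P m * coef R n))"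
  for P R :: "'a::comm_monoid_add \<Rightarrow>\<^sub>0 'c::comm_ring_1"
proof -
  have "P * R = (\<Sum>m\<in>Poly_Mapping.keys P. Poly_Mapping.single m (coef P m))
      * (\<Sum>n\<in>Poly_Mapping.keys R. Poly_Mapping.single n (coef R n))"
    using poly_mapping_sum_single[of P] poly_mapping_sum_single[of R] by simp
  then show ?thesis by (simp add: sum_product mult_single)
qed

context
  fixes \<kappa> :: "'c::comm_ring_1 \<Rightarrow> 'r::comm_ring_1" and h :: "'x \<Rightarrow> 'r"
  assumes \<kappa>: "is_ring_hom \<kappa>"
begin

lemma hom_0: "\<kappa> 0 = 0" and hom_add: "\<kappa> (x + y) = \<kappa> x + \<kappa> y" and hom_mult: "\<kappa> (x * y) = \<kappa> x * \<kappa> y" and hom_1: "\<kappa> 1 = 1"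
  using \<kappa> unfolding is_ring_hom_def by (auto dest: spec2[of _ 0 0])

lemma insertion_superset:
  assumes "finite A" "Poly_Mapping.keys P \<subseteq> A"
  shows "insertion \<kappa> h P = (\<Sum>m\<in>A. \<kappa> (coef P m) * monev h m)"
  unfolding insertion_def using assms by (intro sum.mono_neutral_left) (auto simp: in_keys_iff hom_0)

lemma insertion_add: "insertion \<kappa> h (P + R) = insertion \<kappa> h P + insertion \<kappa> h R"
proof -
  define A where "A = Poly_Mapping.keys P \<union> Poly_Mapping.keys R"
  have A: "finite A" "Poly_Mapping.keys P \<subseteq> A" "Poly_Mapping.keys R \<subseteq> A" "Poly_Mapping.keys (P + R) \<subseteq> A"
    using keys_add[of P R] by (auto simp: A_def)
  show ?thesis
    unfolding insertion_superset[OF A(1,2)] insertion_superset[OF A(1,3)] insertion_superset[OF A(1,4)]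
    by (simp add: lookup_add hom_add sum.distrib distrib_right)
qed

lemma insertion_0 [simp]: "insertion \<kappa> h 0 = 0" by (simp add: insertion_def)

lemma insertion_sum: "insertion \<kappa> h (sum f A) = (\<Sum>i\<in>A. insertion \<kappa> h (f i))"
  by (induction A rule: infinite_finite_induct) (simp_all add: insertion_add)

lemma insertion_single: "insertion \<kappa> h (Poly_Mapping.single m c) = \<kappa> c * monev h m"
  by (cases "c = 0") (simp_all add: insertion_def hom_0)

lemma insertion_mult: "insertion \<kappa> h (P * R) = insertion \<kappa> h P * insertion \<kappa> h R"
proof -
  have "insertion \<kappa> h (P * R) = (\<Sum>m\<in>Poly_Mapping.keys P. \<Sum>n\<in>Poly_Mapping.keys R. \<kappa> (coef P m * coef R n) * monev h (m + n))"
    unfolding poly_mapping_mult_sum[of P R] by (simp add: insertion_sum insertion_single)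
  also have "\<dots> = insertion \<kappa> h P * insertion \<kappa> h R"
    unfolding insertion_def sum_product by (intro sum.cong refl) (simp add: hom_mult monev_add algebra_simps)
  finally show ?thesis .
qed

lemma insertion_1: "insertion \<kappa> h 1 = 1"
  using insertion_single[of 0 1] by (simp add: hom_1)

lemma insertion_power: "insertion \<kappa> h (P ^ n) = insertion \<kappa> h P ^ n"
  by (induction n) (simp_all add: insertion_mult insertion_1)

lemma insertion_prod: "insertion \<kappa> h (prod f A) = (\<Prod>i\<in>A. insertion \<kappa> h (f i))"
  by (induction A rule: infinite_finite_induct) (simp_all add: insertion_mult insertion_1)

end

lemma const_poly_hom: "is_ring_hom (const_poly :: 'c::comm_ring_1 \<Rightarrow> ('s, 'c) xy_poly)"
  by (auto simp: is_ring_hom_def const_poly_def single_add mult_single)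

lemmas const_poly_simps = hom_0[OF const_poly_hom] hom_add[OF const_poly_hom] hom_mult[OF const_poly_hom] hom_1[OF const_poly_hom]

lemma insertion_const: "is_ring_hom \<kappa> \<Longrightarrow> insertion \<kappa> h (const_poly c) = \<kappa> c"
  unfolding const_poly_def by (simp add: insertion_single)

lemma insertion_var: "is_ring_hom \<kappa> \<Longrightarrow> insertion \<kappa> h (var_poly z) = h z"
  for \<kappa> :: "'c::comm_ring_1 \<Rightarrow> 'r::comm_ring_1"
  unfolding var_poly_def by (simp add: insertion_single monev_single hom_1)

lemma insertion_insertion:
  assumes "is_ring_hom \<kappa>"
  shows "insertion \<kappa> h (insertion const_poly f P) = insertion \<kappa> (\<lambda>z. insertion \<kappa> h (f z)) P"
  unfolding insertion_def[of const_poly f P] insertion_def[of \<kappa> "\<lambda>z. insertion \<kappa> h (f z)" P] monev_def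
  by (simp add: insertion_sum[OF assms] insertion_mult[OF assms] insertion_const[OF assms]
      insertion_prod[OF assms] insertion_power[OF assms])

lemma coef_const_mult: "coef (const_poly c * P) m = c * coef P m" for c :: "'c::comm_ring_1"
proof -
  have "const_poly c * P = (\<Sum>n\<in>Poly_Mapping.keys P. Poly_Mapping.single n (c * coef P n))"
    by (subst poly_mapping_sum_single[of P]) (simp add: const_poly_def sum_distrib_left mult_single)
  then have "coef (const_poly c * P) m = (\<Sum>n\<in>Poly_Mapping.keys P. if n = m then c * coef P n else 0)"
    by (simp add: lookup_sum lookup_single when_def)
  then show ?thesis by (auto simp: in_keys_iff)
qed

text \<open>Scaling each variable acts diagonally on monomials; this serves the identity matrix and
  \<open>matrix_inv \<alpha>\<close>.\<close>

lemma monev_scaled_var: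
  "monev (\<lambda>z. const_poly (s z) * var_poly z) m = Poly_Mapping.single m (monev s m)"
  for s :: "'s xy \<Rightarrow> 'c::comm_ring_1"
proof -
  have pow: "(const_poly (s z) * var_poly z) ^ n = Poly_Mapping.single (Poly_Mapping.single z n) (s z ^ n)" for z n
  proof (induction n)
    case (Suc n)
    have "Poly_Mapping.single z (Suc n) = Poly_Mapping.single z 1 + Poly_Mapping.single z n"
      by (simp flip: single_add)
    then show ?case using Suc by (simp add: const_poly_def var_poly_def mult_single)
  qed (simp)
  have "(\<Prod>z\<in>A. Poly_Mapping.single (Poly_Mapping.single z (n z)) (c z))
      = Poly_Mapping.single (\<Sum>z\<in>A. Poly_Mapping.single z (n z)) (\<Prod>z\<in>A. c z)"
    if "finite A" for A and n :: "'s xy \<Rightarrow> nat" and c :: "'s xy \<Rightarrow> 'c"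
    using that by (induction A rule: finite_induct) (simp_all add: mult_single)
  then show ?thesis
    using poly_mapping_sum_single[of m] by (simp add: monev_def pow)
qed

lemma mat2_simps [simp]: "mat2 a b c d $ 1 $ 1 = a" "mat2 a b c d $ 1 $ 2 = b" "mat2 a b c d $ 2 $ 1 = c" "mat2 a b c d $ 2 $ 2 = d"
  by (simp_all add: mat2_def)

lemma mat2_eq_iff: "A = B \<longleftrightarrow> A $ 1 $ 1 = B $ 1 $ 1 \<and> A $ 1 $ 2 = B $ 1 $ 2 \<and> A $ 2 $ 1 = B $ 2 $ 1 \<and> A $ 2 $ 2 = B $ 2 $ 2"
  for A B :: "'a^2^2"
  by (auto simp: vec_eq_iff forall_2)

lemma mat2_mult_nth: "(A ** B) $ i $ j = A $ i $ 1 * B $ 1 $ j + A $ i $ 2 * B $ 2 $ j"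
  for A B :: "'a::comm_ring_1^2^2"
  by (simp add: matrix_matrix_mult_def sum_2)

context hecke_finite begin

definition \<rho>0 :: "'f^2^2 \<Rightarrow> ('f \<Rightarrow> 'c, 'c) xy_poly \<Rightarrow> ('f \<Rightarrow> 'c, 'c) xy_poly" where
  "\<rho>0 g = insertion const_poly (var_image g)"

lemma \<rho>_eq: "\<rho> k g P = const_poly (twist k g) * \<rho>0 g P"
  unfolding \<rho>_def \<rho>0_def insertion_def monev_def
  by (simp add: const_poly_simps sum_distrib_left mult.assoc)

lemmas \<rho>0_simps = insertion_add[OF const_poly_hom] insertion_mult[OF const_poly_hom] insertion_const[OF const_poly_hom]
  insertion_var[OF const_poly_hom]

lemma \<rho>0_const_mult: "\<rho>0 g (const_poly c * P) = const_poly c * \<rho>0 g P"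
  by (simp add: \<rho>0_def \<rho>0_simps)

lemma \<rho>_const_mult: "\<rho> k g (const_poly c * P) = const_poly c * \<rho> k g P"
  by (simp add: \<rho>_eq \<rho>0_const_mult mult.left_commute)

lemma \<rho>_add: "\<rho> k g (P + R) = \<rho> k g P + \<rho> k g R"
  by (simp add: \<rho>_eq \<rho>0_def \<rho>0_simps distrib_left)

lemma \<rho>_0 [simp]: "\<rho> k g 0 = 0" by (simp add: \<rho>_def)

definition vars :: "('f \<Rightarrow> 'c) xy set" where "vars = X ` S \<union> Y ` S"

lemma finite_vars: "finite vars" using finite_S by (simp add: vars_def)

lemma var_image_mult: "z \<in> vars \<Longrightarrow> \<rho>0 g (var_image g' z) = var_image (g ** g') z"
  by (auto simp: vars_def \<rho>0_def \<rho>0_simps mat2_mult_nth ring_hom_facts[OF S_hom(1)] const_poly_simps algebra_simps)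

lemma V_keys: "P \<in> V k \<Longrightarrow> m \<in> Poly_Mapping.keys P \<Longrightarrow> Poly_Mapping.keys m \<subseteq> vars"
  and V_degree: "P \<in> V k \<Longrightarrow> m \<in> Poly_Mapping.keys P \<Longrightarrow> \<sigma> \<in> S \<Longrightarrow> coef m (X \<sigma>) + coef m (Y \<sigma>) = k \<sigma>"
  unfolding V_def vars_def by auto

lemma insertion_cong_V:
  assumes "P \<in> V k" "\<And>z. z \<in> vars \<Longrightarrow> f z = f' z"
  shows "insertion \<kappa> f P = insertion \<kappa> f' P"
  unfolding insertion_def monev_def
  by (intro sum.cong refl arg_cong2[where f = "(*)"] prod.cong arg_cong2[where f = power])
    (use assms V_keys in blast)

lemma \<rho>0_mult: "P \<in> V k \<Longrightarrow> \<rho>0 (g ** g') P = \<rho>0 g (\<rho>0 g' P)"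
  unfolding \<rho>0_def insertion_insertion[OF const_poly_hom]
  by (rule insertion_cong_V) (use var_image_mult in \<open>auto simp: \<rho>0_def\<close>)

lemma V_0 [simp]: "0 \<in> V k" by (simp add: V_def)

lemma V_add: "P \<in> V k \<Longrightarrow> R \<in> V k \<Longrightarrow> P + R \<in> V k"
  unfolding V_def using keys_add[of P R] by blast

lemma V_sum: "(\<And>i. i \<in> A \<Longrightarrow> f i \<in> V k) \<Longrightarrow> sum f A \<in> V k"
  by (induction A rule: infinite_finite_induct) (auto intro: V_add)

lemma V_mult: assumes "P \<in> V k" "R \<in> V l" shows "P * R \<in> V (\<lambda>\<sigma>. k \<sigma> + l \<sigma>)"
  unfolding V_def
proof (safe)
  fix m assume "m \<in> Poly_Mapping.keys (P * R)"
  then obtain a b where ab: "m = a + b" "a \<in> Poly_Mapping.keys P" "b \<in> Poly_Mapping.keys R"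
    using keys_mult[of P R] by blast
  { fix z assume z: "z \<in> Poly_Mapping.keys m" "z \<notin> Y ` S"
    then have "z \<in> vars" using ab keys_add[of a b] V_keys[OF assms(1) ab(2)] V_keys[OF assms(2) ab(3)] by blast
    then show "z \<in> X ` S" using z by (auto simp: vars_def) }
  fix \<sigma> assume "\<sigma> \<in> S"
  then show "coef m (X \<sigma>) + coef m (Y \<sigma>) = k \<sigma> + l \<sigma>"
    using V_degree[OF assms(1) ab(2), of \<sigma>] V_degree[OF assms(2) ab(3), of \<sigma>] by (simp add: ab(1) lookup_add)
qed

lemma V_const: "const_poly c \<in> V (\<lambda>_. 0)"
  by (auto simp: V_def const_poly_def split: if_splits)

lemma V_const_mult: "P \<in> V k \<Longrightarrow> const_poly c * P \<in> V k"
  using V_mult[OF V_const, of P k c] by simp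

lemma V_power: "P \<in> V k \<Longrightarrow> P ^ n \<in> V (\<lambda>\<sigma>. n * k \<sigma>)"
proof (induction n)
  case 0
  then show ?case using V_const[of 1] by (simp add: const_poly_simps)
qed (use V_mult in auto)

lemma V_prod: "finite A \<Longrightarrow> (\<And>i. i \<in> A \<Longrightarrow> f i \<in> V (k i)) \<Longrightarrow> prod f A \<in> V (\<lambda>\<sigma>. \<Sum>i\<in>A. k i \<sigma>)"
proof (induction A rule: finite_induct)
  case empty
  then show ?case using V_const[of 1] by (simp add: const_poly_simps)
qed (use V_mult in auto)

definition var_degree :: "('f \<Rightarrow> 'c) xy \<Rightarrow> ('f \<Rightarrow> 'c) \<Rightarrow> nat" where
  "var_degree z \<sigma> = (if z = X \<sigma> \<or> z = Y \<sigma> then 1 else 0)"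

lemma V_var_image: "z \<in> vars \<Longrightarrow> var_image g z \<in> V (var_degree z)"
proof -
  have var: "var_poly z \<in> V (var_degree z)" if "z \<in> vars" for z
    using that by (auto simp: V_def var_poly_def vars_def var_degree_def lookup_single when_def)
  have deg: "var_degree (X \<sigma>) = var_degree (Y \<sigma>)" for \<sigma> by (rule ext) (simp add: var_degree_def)
  assume "z \<in> vars"
  then obtain \<sigma> where \<sigma>: "\<sigma> \<in> S" "z = X \<sigma> \<or> z = Y \<sigma>" by (auto simp: vars_def)
  have "X \<sigma> \<in> vars" "Y \<sigma> \<in> vars" using \<sigma> by (auto simp: vars_def)
  then have "const_poly c * var_poly (X \<sigma>) + const_poly c' * var_poly (Y \<sigma>) \<in> V (var_degree (Y \<sigma>))" for c c'
    using var[of "X \<sigma>"] var[of "Y \<sigma>"] deg by (auto intro!: V_add V_const_mult)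
  then show ?thesis using \<sigma> deg by auto
qed

lemma sum_var_degree:
  "(\<Sum>z\<in>Poly_Mapping.keys m. coef m z * var_degree z \<sigma>) = coef m (X \<sigma>) + coef m (Y \<sigma>)"
proof -
  have "(\<Sum>z\<in>Poly_Mapping.keys m. coef m z * var_degree z \<sigma>)
    = (\<Sum>z\<in>Poly_Mapping.keys m. (if z = X \<sigma> then coef m z else 0) + (if z = Y \<sigma> then coef m z else 0))"
    by (intro sum.cong) (auto simp: var_degree_def)
  then show ?thesis by (simp add: sum.distrib in_keys_iff)
qed

lemma V_monev: assumes "P \<in> V k" "m \<in> Poly_Mapping.keys P" shows "monev (var_image g) m \<in> V (\<lambda>\<sigma>. coef m (X \<sigma>) + coef m (Y \<sigma>))"
proof -
  have "monev (var_image g) m \<in> V (\<lambda>\<sigma>. \<Sum>z\<in>Poly_Mapping.keys m. coef m z * var_degree z \<sigma>)"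
    unfolding monev_def
  proof (rule V_prod)
    fix z assume "z \<in> Poly_Mapping.keys m"
    then have "z \<in> vars" using V_keys[OF assms] by blast
    then show "var_image g z ^ coef m z \<in> V (\<lambda>\<sigma>. coef m z * var_degree z \<sigma>)" by (intro V_power V_var_image)
  qed simp
  then show ?thesis by (simp add: sum_var_degree)
qed

lemma V_cong: "(\<And>\<sigma>. \<sigma> \<in> S \<Longrightarrow> k \<sigma> = l \<sigma>) \<Longrightarrow> V k = V l"
  unfolding V_def by (intro Collect_cong ball_cong conj_cong refl) auto

lemma V_\<rho>0: assumes "P \<in> V k" shows "\<rho>0 g P \<in> V k"
  unfolding \<rho>0_def insertion_def
proof (intro V_sum V_const_mult)
  fix m assume m: "m \<in> Poly_Mapping.keys P"
  show "monev (var_image g) m \<in> V k"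
    using V_monev[OF assms m, of g] V_cong[of "\<lambda>\<sigma>. coef m (X \<sigma>) + coef m (Y \<sigma>)" k] V_degree[OF assms m] by simp
qed

lemma V_\<rho>: "P \<in> V k \<Longrightarrow> \<rho> k g P \<in> V k"
  unfolding \<rho>_eq by (intro V_const_mult V_\<rho>0)

section \<open>Integral lattices in \<open>V k\<close>\<close>

definition cge :: "real \<Rightarrow> ('f \<Rightarrow> 'c, 'c) xy_poly \<Rightarrow> bool" where
  "cge t P \<longleftrightarrow> (\<forall>m. VC.vge t (coef P m))"

lemma V0_iff: "P \<in> V0 k \<longleftrightarrow> P \<in> V k \<and> cge 0 P"
  by (simp add: V0_def cge_def OC_iff)

lemma cge_add: "cge t P \<Longrightarrow> cge t R \<Longrightarrow> cge t (P + R)"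
  by (auto simp: cge_def lookup_add intro: VC.vge_add)

lemma cge_0 [simp]: "cge t 0" by (simp add: cge_def)

lemma cge_sum: "(\<And>i. i \<in> A \<Longrightarrow> cge t (f i)) \<Longrightarrow> cge t (sum f A)"
  by (induction A rule: infinite_finite_induct) (auto intro: cge_add)

lemma cge_single: "VC.vge t c \<Longrightarrow> cge t (Poly_Mapping.single m c)"
  by (auto simp: cge_def lookup_single when_def)

lemma cge_mult: "cge s P \<Longrightarrow> cge t R \<Longrightarrow> cge (s + t) (P * R)"
  unfolding poly_mapping_mult_sum[of P R]
  by (intro cge_sum cge_single VC.vge_mult) (auto simp: cge_def)

lemma cge_const_mult: "VC.vge s c \<Longrightarrow> cge t P \<Longrightarrow> cge (s + t) (const_poly c * P)"
  by (auto simp: cge_def coef_const_mult intro: VC.vge_mult)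

lemma cge_1: "cge 0 1" using cge_single[of 0 1 0] by simp

lemma cge_power: "cge t P \<Longrightarrow> cge (real n * t) (P ^ n)"
proof (induction n)
  case (Suc n)
  then show ?case using cge_mult[of t P "real n * t" "P ^ n"] by (simp add: algebra_simps)
qed (simp add: cge_1)

lemma cge_prod: "finite A \<Longrightarrow> (\<And>i. i \<in> A \<Longrightarrow> cge (t i) (f i)) \<Longrightarrow> cge (\<Sum>i\<in>A. t i) (prod f A)"
proof (induction A rule: finite_induct)
  case (insert x A)
  then show ?case using cge_mult[of "t x" "f x" "\<Sum>i\<in>A. t i" "prod f A"] by simp
qed (simp add: cge_1)

definition mge :: "real \<Rightarrow> 'f^2^2 \<Rightarrow> bool" where
  "mge t g \<longleftrightarrow> (\<forall>i j. VF.vge t (g $ i $ j))"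

lemma mge_iff: "mge t g \<longleftrightarrow> VF.vge t (g $ 1 $ 1) \<and> VF.vge t (g $ 1 $ 2) \<and> VF.vge t (g $ 2 $ 1) \<and> VF.vge t (g $ 2 $ 2)"
  by (auto simp: mge_def forall_2)

lemma cge_var_image: assumes "mge c g" "z \<in> vars" shows "cge c (var_image g z)"
proof -
  obtain \<sigma> where \<sigma>: "\<sigma> \<in> S" "z = X \<sigma> \<or> z = Y \<sigma>" using assms by (auto simp: vars_def)
  have "cge 0 (var_poly z :: ('f \<Rightarrow> 'c, 'c) xy_poly)" for z unfolding var_poly_def by (rule cge_single) simp
  then have "cge c (const_poly x * var_poly z)" if "VC.vge c x" for x z using cge_const_mult[OF that, of 0] by simp
  then show ?thesis using \<sigma> assms(1) by (auto simp: mge_def vge_S intro!: cge_add)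
qed

text \<open>Every monomial is a product of \<open>\<Sum>\<sigma>\<in>S. k \<sigma>\<close>
  variables, and the image of each variable gains \<open>c\<close>.\<close>

lemma cge_\<rho>0:
  assumes "mge c g" "P \<in> V k" "cge t P"
  shows "cge (t + c * real (\<Sum>\<sigma>\<in>S. k \<sigma>)) (\<rho>0 g P)"
  unfolding \<rho>0_def insertion_def
proof (rule cge_sum)
  fix m assume m: "m \<in> Poly_Mapping.keys P"
  have "cge (\<Sum>z\<in>Poly_Mapping.keys m. real (coef m z) * c) (monev (var_image g) m)"
    unfolding monev_def using V_keys[OF assms(2) m] by (intro cge_prod cge_power cge_var_image[OF assms(1)]) auto
  moreover have "(\<Sum>z\<in>Poly_Mapping.keys m. real (coef m z) * c) = c * real (\<Sum>\<sigma>\<in>S. k \<sigma>)"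
  proof -
    have "(\<Sum>z\<in>Poly_Mapping.keys m. coef m z) = (\<Sum>z\<in>vars. coef m z)"
      using V_keys[OF assms(2) m] finite_vars by (intro sum.mono_neutral_left) (auto simp: in_keys_iff)
    also have "\<dots> = (\<Sum>\<sigma>\<in>S. coef m (X \<sigma>)) + (\<Sum>\<sigma>\<in>S. coef m (Y \<sigma>))"
      unfolding vars_def using finite_S by (subst sum.union_disjoint) (auto simp: sum.reindex inj_on_def)
    also have "\<dots> = (\<Sum>\<sigma>\<in>S. k \<sigma>)" unfolding sum.distrib[symmetric] using V_degree[OF assms(2) m] by (intro sum.cong) auto
    finally show ?thesis by (metis (no_types) mult.commute of_nat_sum sum_distrib_right)
  qed
  ultimately have "cge (c * real (\<Sum>\<sigma>\<in>S. k \<sigma>)) (monev (var_image g) m)" by simp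
  then show "cge (t + c * real (\<Sum>\<sigma>\<in>S. k \<sigma>)) (const_poly (coef P m) * monev (var_image g) m)"
    using assms(3) by (intro cge_const_mult) (auto simp: cge_def)
qed

end

section \<open>Double cosets and the kernel of the Hecke operator\<close>

lemma matrix_inv_unique:
  fixes A B :: "'a::field^2^2"
  assumes "A ** B = mat 1" "B ** A = mat 1"
  shows "matrix_inv A = B"
proof -
  have "\<exists>A'. A ** A' = mat 1 \<and> A' ** A = mat 1" using assms by blast
  then have "A ** matrix_inv A = mat 1" unfolding matrix_inv_def by (rule someI2_ex) blast
  then have "B ** (A ** matrix_inv A) = B" by simp
  then show ?thesis using assms by (simp add: matrix_mul_assoc)
qed

lemma mat_nth_2: "(mat x :: 'a::zero^2^2) $ 1 $ 1 = x" "(mat x :: 'a^2^2) $ 1 $ 2 = 0"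
  "(mat x :: 'a^2^2) $ 2 $ 1 = 0" "(mat x :: 'a^2^2) $ 2 $ 2 = x"
  by (simp_all add: mat_def)

lemmas mat2_calc = mat2_eq_iff mat2_mult_nth mat_nth_2

lemma GL2_inverse:
  fixes A :: "'a::field^2^2"
  assumes "invertible A"
  shows "A ** matrix_inv A = mat 1" "matrix_inv A ** A = mat 1" "invertible (matrix_inv A)"
    "matrix_inv (matrix_inv A) = A"
proof -
  obtain B where B: "A ** B = mat 1" "B ** A = mat 1" using assms unfolding invertible_def by blast
  then have eq: "matrix_inv A = B" by (rule matrix_inv_unique)
  then show "A ** matrix_inv A = mat 1" "matrix_inv A ** A = mat 1" "invertible (matrix_inv A)"
    using B by (auto simp: invertible_def)
  show "matrix_inv (matrix_inv A) = A" unfolding eq by (rule matrix_inv_unique[OF B(2,1)])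
qed

lemma matrix_inv_mult:
  fixes A B :: "'a::field^2^2"
  assumes "invertible A" "invertible B"
  shows "matrix_inv (A ** B) = matrix_inv B ** matrix_inv A"
proof (rule matrix_inv_unique)
  have "A ** B ** (matrix_inv B ** matrix_inv A) = A ** (B ** matrix_inv B) ** matrix_inv A" by (simp only: matrix_mul_assoc)
  then show "A ** B ** (matrix_inv B ** matrix_inv A) = mat 1" using GL2_inverse[OF assms(1)] GL2_inverse[OF assms(2)] by simp
  have "matrix_inv B ** matrix_inv A ** (A ** B) = matrix_inv B ** (matrix_inv A ** A) ** B" by (simp only: matrix_mul_assoc)
  then show "matrix_inv B ** matrix_inv A ** (A ** B) = mat 1" using GL2_inverse[OF assms(1)] GL2_inverse[OF assms(2)] by simp
qed

lemma matrix_inv_2: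
  fixes A :: "'a::field^2^2"
  assumes "det A \<noteq> 0"
  shows "matrix_inv A = mat2 (A $ 2 $ 2 / det A) (- A $ 1 $ 2 / det A) (- A $ 2 $ 1 / det A) (A $ 1 $ 1 / det A)"
proof -
  define i where "i = inverse (det A)"
  have i: "(A $ 1 $ 1 * A $ 2 $ 2 - A $ 1 $ 2 * A $ 2 $ 1) * i = 1" using assms by (simp add: i_def flip: det_2)
  show ?thesis
    unfolding divide_inverse i_def[symmetric]
    by (rule matrix_inv_unique; simp add: mat2_calc; use i in \<open>simp add: algebra_simps\<close>)
qed

lemma det_mat2: "det (mat2 a b c d) = a * d - b * c" for a :: "'a::comm_ring_1"
  by (simp add: det_2)

context hecke_finite begin

lemma GL2_iff: "g \<in> GL2 \<longleftrightarrow> det g \<noteq> 0" by (simp add: GL2_def invertible_det_nz)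

lemma GL2_mult: "g \<in> GL2 \<Longrightarrow> h \<in> GL2 \<Longrightarrow> g ** h \<in> GL2" by (simp add: GL2_iff det_mul)

lemma GL2_inv: "g \<in> GL2 \<Longrightarrow> matrix_inv g \<in> GL2" using GL2_inverse(3)[of g] by (simp add: GL2_def)

lemma GL2_cancel: "g \<in> GL2 \<Longrightarrow> g ** (matrix_inv g ** h) = h" "g \<in> GL2 \<Longrightarrow> matrix_inv g ** (g ** h) = h"
  "g \<in> GL2 \<Longrightarrow> h ** g ** matrix_inv g = h" "g \<in> GL2 \<Longrightarrow> h ** matrix_inv g ** g = h"
  using GL2_inverse[of g] by (auto simp: GL2_def matrix_mul_assoc) (metis matrix_mul_assoc matrix_mul_rid)+

lemma ordF_eqI: "vF x = ereal (of_int n) \<Longrightarrow> ordF x = n"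
  unfolding ordF_def by (rule the_equality) auto

lemma vF_ordF: "x \<noteq> 0 \<Longrightarrow> vF x = ereal (of_int (ordF x))"
  using vF_int[of x] ordF_eqI by auto

lemma ordF_mult: "x \<noteq> 0 \<Longrightarrow> y \<noteq> 0 \<Longrightarrow> ordF (x * y) = ordF x + ordF y"
  by (intro ordF_eqI) (simp add: VF.v_mult vF_ordF)

lemma vF_varpi_powi: "vF (varpi powi n) = ereal (of_int n)"
proof (cases "0 \<le> n")
  case True
  then show ?thesis by (simp add: power_int_def vF_varpi_power)
next
  case False
  then show ?thesis using VF.v_inverse[OF vF_varpi_power[of "nat (- n)"]] by (simp add: power_int_def power_inverse)
qed

lemma sq_S: assumes "\<sigma> \<in> S" shows "(sq \<sigma>)\<^sup>2 = \<sigma> varpi" "sq \<sigma> \<noteq> 0" "vC (sq \<sigma>) = ereal (1 / 2)"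
proof -
  show 1: "(sq \<sigma>)\<^sup>2 = \<sigma> varpi" by (rule sq_square[OF S_hom[OF assms]])
  show 2: "sq \<sigma> \<noteq> 0" using 1 ring_hom_inverse(2)[OF S_hom(1)[OF assms]] by (metis varpi_nonzero zero_power2)
  then obtain s where s: "vC (sq \<sigma>) = ereal s" using VC.v_finite by blast
  have "ereal (2 * s) = 1" using VC.v_power[OF s, of 2] 1 vC_S[OF assms] vF_varpi by simp
  then show "vC (sq \<sigma>) = ereal (1 / 2)" using s by (simp add: one_ereal_def)
qed

lemma twist_mult: "g \<in> GL2 \<Longrightarrow> h \<in> GL2 \<Longrightarrow> twist k (g ** h) = twist k g * twist k h"
  unfolding twist_def prod.distrib[symmetric]
proof (intro prod.cong refl)
  fix \<sigma> assume *: "g \<in> GL2" "h \<in> GL2" "\<sigma> \<in> S"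
  have "- ordF (det (g ** h)) = - ordF (det g) + - ordF (det h)" using * by (simp add: GL2_iff det_mul ordF_mult)
  then have "sq \<sigma> powi (- ordF (det (g ** h))) = sq \<sigma> powi (- ordF (det g)) * sq \<sigma> powi (- ordF (det h))"
    using sq_S(2)[OF *(3)] by (simp only: power_int_add simp_thms)
  then show "(sq \<sigma> powi (- ordF (det (g ** h)))) ^ k \<sigma> = (sq \<sigma> powi (- ordF (det g))) ^ k \<sigma> * (sq \<sigma> powi (- ordF (det h))) ^ k \<sigma>"
    by (simp only: power_mult_distrib)
qed

lemma ordF_1: "ordF 1 = 0" by (rule ordF_eqI) (simp add: zero_ereal_def)

lemma twist_1: "twist k (mat 1) = 1" by (simp add: twist_def ordF_1)

lemma v_powi: "x \<noteq> 0 \<Longrightarrow> vC x = ereal s \<Longrightarrow> vC (x powi n) = ereal (of_int n * s)"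
  using VC.v_power[of x s "nat n"] VC.v_power[OF VC.v_inverse, of x s "nat (- n)"]
  by (cases "0 \<le> n") (auto simp: power_int_def)

lemma v_twist: "vC (twist k g) = ereal (- of_int (ordF (det g)) / 2 * real (\<Sum>\<sigma>\<in>S. k \<sigma>))"
proof -
  have "vC (\<Prod>\<sigma>\<in>A. (sq \<sigma> powi (- ordF (det g))) ^ k \<sigma>) = ereal (- of_int (ordF (det g)) / 2 * real (\<Sum>\<sigma>\<in>A. k \<sigma>))"
    if "finite A" "A \<subseteq> S" for A
    using that
  proof (induction A rule: finite_induct)
    case (insert \<sigma> A)
    then have "\<sigma> \<in> S" by simp
    from VC.v_power[OF v_powi[OF sq_S(2,3)[OF this]], of "- ordF (det g)" "k \<sigma>"] insert show ?case
      by (simp add: VC.v_mult algebra_simps)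
  qed (simp add: zero_ereal_def)
  then show ?thesis using finite_S by (simp add: twist_def)
qed

lemma \<rho>_mult: "P \<in> V k \<Longrightarrow> g \<in> GL2 \<Longrightarrow> h \<in> GL2 \<Longrightarrow> \<rho> k (g ** h) P = \<rho> k g (\<rho> k h P)"
  by (simp add: \<rho>_eq \<rho>0_mult twist_mult \<rho>0_const_mult const_poly_simps mult.assoc)

lemma \<rho>_1: assumes "P \<in> V k" shows "\<rho> k (mat 1) P = P"
proof -
  have "\<rho>0 (mat 1) P = insertion const_poly (\<lambda>z. const_poly 1 * var_poly z) P"
    unfolding \<rho>0_def
    by (rule insertion_cong_V[OF assms])
      (auto simp: vars_def mat_nth_2 ring_hom_facts[OF S_hom(1)] const_poly_simps)
  also have "\<dots> = (\<Sum>m\<in>Poly_Mapping.keys P. Poly_Mapping.single m (coef P m))"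
    unfolding insertion_def monev_scaled_var by (simp add: const_poly_def mult_single monev_def)
  finally show ?thesis using poly_mapping_sum_single[of P] by (simp add: \<rho>_eq twist_1 const_poly_simps)
qed

lemma \<rho>_inverse: "P \<in> V k \<Longrightarrow> g \<in> GL2 \<Longrightarrow> \<rho> k (matrix_inv g) (\<rho> k g P) = P"
  using \<rho>_mult[of P k "matrix_inv g" g] GL2_inverse[of g] by (simp add: GL2_inv \<rho>_1 GL2_def)

lemma mge_mult: "mge s g \<Longrightarrow> mge t h \<Longrightarrow> mge (s + t) (g ** h)"
  unfolding mge_def mat2_mult_nth by (intro allI VF.vge_add VF.vge_mult) auto

lemma mge_inv: assumes "mge s g" "vF (det g) = ereal t" shows "mge (s - t) (matrix_inv g)"
proof -
  have "det g \<noteq> 0" using assms(2) VF.v_eq_infinity_iff[of "det g"] by auto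
  have "VF.vge (s - t) (x / det g)" if "VF.vge s x" for x
    using VF.vge_mult[OF that, of "- t" "inverse (det g)"] VF.v_inverse[OF assms(2)]
    by (simp add: VF.vge_def divide_inverse)
  then show ?thesis using assms(1) unfolding matrix_inv_2[OF \<open>det g \<noteq> 0\<close>] mge_iff
    by (metis VF.vge_minus mat2_simps)
qed

lemma det_inv: fixes g :: "'f^2^2" assumes "vF (det g) = ereal t" shows "vF (det (matrix_inv g)) = ereal (- t)"
proof -
  have "det g \<noteq> 0" using assms VF.v_eq_infinity_iff[of "det g"] by auto
  then have "det g * det (matrix_inv g) = 1"
    using GL2_inverse(1)[of g] det_mul[of g "matrix_inv g"] by (simp add: invertible_det_nz)
  then have "det (matrix_inv g) = inverse (det g)" by (rule inverse_unique[symmetric])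
  then show ?thesis using VF.v_inverse[OF assms] by simp
qed

lemma mge_det: "mge s g \<Longrightarrow> VF.vge (2 * s) (det g)"
  unfolding det_2 using VF.vge_mult[of s _ s] by (auto simp: mge_def intro!: VF.vge_diff)

lemma K_iff: "g \<in> K \<longleftrightarrow> mge 0 g \<and> vF (det g) = 0"
proof
  assume g: "g \<in> K"
  then have m: "mge 0 g" "mge 0 (matrix_inv g)" and G: "g \<in> GL2" by (auto simp: K_def mge_def OF_iff)
  obtain t where t: "vF (det g) = ereal t" using G VF.v_finite by (auto simp: GL2_iff)
  show "mge 0 g \<and> vF (det g) = 0" using m mge_det[OF m(1)] mge_det[OF m(2)] t det_inv[OF t] by (simp add: VF.vge_def zero_ereal_def)
next
  assume g: "mge 0 g \<and> vF (det g) = 0"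
  then have "mge (0 - 0) (matrix_inv g)" by (intro mge_inv) (auto simp: zero_ereal_def)
  moreover have "det g \<noteq> 0" using g VF.v_eq_infinity_iff[of "det g"] by auto
  ultimately show "g \<in> K" using g by (simp add: K_def GL2_iff mge_def OF_iff)
qed

text \<open>Dividing by \<open>varpi ^ c\<close> leads back to \<open>K_iff\<close>. Membership
  becomes a numerical condition on entries and determinant, by which all coset questions on the tree
  are decided.\<close>

lemma KZ_iff: "g \<in> KZ \<longleftrightarrow> (\<exists>c::int. mge (of_int c) g \<and> vF (det g) = ereal (2 * of_int c))"
proof
  assume "g \<in> KZ"
  then obtain h z where h: "g = h ** mat z" "h \<in> K" "z \<noteq> 0" by (auto simp: KZ_def Z_def)
  define c where "c = ordF z"
  have z: "vF z = ereal (of_int c)" using h vF_ordF by (simp add: c_def)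
  have "mge (0 + of_int c) (h ** mat z)" using h z
    by (intro mge_mult) (auto simp: K_iff mge_iff mat_nth_2 VF.vge_def[of _ z])
  moreover have "vF (det (h ** mat z)) = ereal (2 * of_int c)"
    using h z by (simp add: det_mul K_iff VF.v_mult det_2[of "mat z"] mat_nth_2)
  ultimately show "\<exists>c::int. mge (of_int c) g \<and> vF (det g) = ereal (2 * of_int c)" using h by auto
next
  assume "\<exists>c::int. mge (of_int c) g \<and> vF (det g) = ereal (2 * of_int c)"
  then obtain c :: int where c: "mge (of_int c) g" "vF (det g) = ereal (2 * of_int c)" by blast
  define z where "z = varpi powi c"
  have z0: "z \<noteq> 0" by (simp add: z_def)
  have vz: "vF z = ereal (of_int c)" by (simp add: z_def vF_varpi_powi)
  have vz': "vF (inverse z) = ereal (- of_int c)" by (rule VF.v_inverse[OF vz])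
  define h where "h = g ** mat (inverse z)"
  have "mge (of_int c + - of_int c) h" unfolding h_def
    by (rule mge_mult[OF c(1)]) (auto simp: mge_iff mat_nth_2 VF.vge_def[of _ "inverse z"] vz')
  moreover have "vF (det h) = 0" unfolding h_def
    using c(2) vz' by (simp add: det_mul VF.v_mult det_2[of "mat (inverse z)"] mat_nth_2 zero_ereal_def)
  ultimately have "h \<in> K" by (simp add: K_iff)
  moreover have "g = h ** mat z" using z0 by (simp add: h_def mat2_calc)
  ultimately show "g \<in> KZ" using z0 by (auto simp: KZ_def Z_def)
qed

lemma KZ_GL2: "g \<in> KZ \<Longrightarrow> g \<in> GL2"
  using VF.v_eq_infinity_iff[of "det g"] by (auto simp: KZ_iff GL2_iff)

lemma KZ_mult: assumes "g \<in> KZ" "h \<in> KZ" shows "g ** h \<in> KZ"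
proof -
  obtain c :: int where c: "mge (of_int c) g" "vF (det g) = ereal (2 * of_int c)" using assms(1) KZ_iff by blast
  obtain d :: int where d: "mge (of_int d) h" "vF (det h) = ereal (2 * of_int d)" using assms(2) KZ_iff by blast
  show ?thesis unfolding KZ_iff using mge_mult[OF c(1) d(1)] c(2) d(2)
    by (intro exI[of _ "c + d"]) (simp add: det_mul VF.v_mult)
qed

lemma KZ_inv: assumes "g \<in> KZ" shows "matrix_inv g \<in> KZ"
proof -
  obtain c :: int where c: "mge (of_int c) g" "vF (det g) = ereal (2 * of_int c)" using assms KZ_iff by blast
  show ?thesis unfolding KZ_iff using mge_inv[OF c] det_inv[OF c(2)] by (intro exI[of _ "- c"]) simp
qed

lemma K_KZ: "g \<in> K \<Longrightarrow> g \<in> KZ"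
  unfolding KZ_iff K_iff by (intro exI[of _ 0]) (simp add: zero_ereal_def)

lemma KZ_1: "mat 1 \<in> KZ"
  by (rule K_KZ) (simp add: K_iff mge_iff mat_nth_2)

text \<open>The substitution gains \<open>c\<close> times the total degree, and
  \<open>twist\<close>, built from a determinant of valuation \<open>2 * c\<close> with square
  roots, loses the same amount. Hence \<open>KZ\<close> preserves \<open>V0 k\<close>.\<close>

lemma cge_\<rho>: assumes "g \<in> KZ" "P \<in> V k" "cge t P" shows "cge t (\<rho> k g P)"
proof -
  obtain c :: int where c: "mge (of_int c) g" "vF (det g) = ereal (2 * of_int c)" using assms(1) KZ_iff by blast
  have "ordF (det g) = 2 * c" by (rule ordF_eqI) (simp add: c)
  then have "VC.vge (- of_int c * real (\<Sum>\<sigma>\<in>S. k \<sigma>)) (twist k g)" using v_twist[of k g] by (simp add: VC.vge_def)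
  from cge_const_mult[OF this cge_\<rho>0[OF c(1) assms(2,3)]] show ?thesis by (simp add: \<rho>_eq)
qed

text \<open>The square root of \<open>\<Prod>\<sigma>\<in>S. \<sigma> varpi ^ k \<sigma>\<close>
  formed with the chosen roots; it is also the twist of \<open>matrix_inv \<alpha>\<close>.\<close>

definition c0 :: "(('f \<Rightarrow> 'c) \<Rightarrow> nat) \<Rightarrow> 'c" where "c0 k = (\<Prod>\<sigma>\<in>S. sq \<sigma> ^ k \<sigma>)"

lemma \<alpha>_inv: "matrix_inv \<alpha> = mat2 1 0 0 (inverse varpi)"
  by (rule matrix_inv_unique) (simp_all add: \<alpha>_def mat2_calc)

lemma \<alpha>_GL2: "\<alpha> \<in> GL2" "matrix_inv \<alpha> \<in> GL2"
  unfolding \<alpha>_inv by (simp_all add: GL2_iff \<alpha>_def det_mat2)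

text \<open>\<open>matrix_inv \<alpha>\<close> divides each variable \<open>Y \<sigma>\<close> by
  \<open>\<sigma> varpi\<close>, and its twist is another \<open>c0 k\<close>. In the product with
  \<open>c0 k * c0 k\<close> exactly the exponent of \<open>X \<sigma>\<close> remains. Hence
  \<open>\<psi>\<close> will be a scalar multiple of \<open>\<rho>\<close> on the double
  coset.\<close>

lemma U_eq: assumes "P \<in> V k" shows "U P = const_poly (c0 k) * \<rho> k (matrix_inv \<alpha>) P"
proof -
  define s where "s z = (case z of X \<sigma> \<Rightarrow> 1 | Y \<sigma> \<Rightarrow> \<sigma> (inverse varpi))" for z :: "('f \<Rightarrow> 'c) xy"
  have "\<rho>0 (matrix_inv \<alpha>) P = insertion const_poly (\<lambda>z. const_poly (s z) * var_poly z) P"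
    unfolding \<rho>0_def \<alpha>_inv
  proof (rule insertion_cong_V[OF assms])
    fix z assume "z \<in> vars"
    then obtain \<sigma> where \<sigma>: "\<sigma> \<in> S" "z = X \<sigma> \<or> z = Y \<sigma>" by (auto simp: vars_def)
    have "\<sigma> 0 = 0" "\<sigma> 1 = 1" using ring_hom_facts[OF S_hom(1)[OF \<sigma>(1)]] by auto
    then show "var_image (mat2 1 0 0 (inverse varpi)) z = const_poly (s z) * var_poly z"
      using \<sigma>(2) by (auto simp: s_def const_poly_simps)
  qed
  also have "\<dots> = (\<Sum>m\<in>Poly_Mapping.keys P. Poly_Mapping.single m (coef P m * monev s m))"
    unfolding insertion_def monev_scaled_var by (simp add: const_poly_def mult_single)
  finally have \<rho>0: "coef (\<rho>0 (matrix_inv \<alpha>) P) m = coef P m * monev s m" for m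
    by (auto simp: lookup_sum lookup_single when_def in_keys_iff)
  have "ordF (det (matrix_inv \<alpha>)) = - 1"
    using vF_varpi VF.v_inverse[of varpi 1] by (intro ordF_eqI) (simp add: \<alpha>_inv det_mat2 one_ereal_def)
  then have tw: "twist k (matrix_inv \<alpha>) = c0 k" by (simp add: twist_def c0_def)
  have c02: "c0 k * c0 k = (\<Prod>\<sigma>\<in>S. \<sigma> varpi ^ k \<sigma>)"
    unfolding c0_def prod.distrib[symmetric] by (intro prod.cong) (auto simp: sq_S(1)[symmetric] power_mult_distrib power2_eq_square)
  show ?thesis
  proof (rule poly_mapping_eqI)
    fix m
    show "coef (U P) m = coef (const_poly (c0 k) * \<rho> k (matrix_inv \<alpha>) P) m"
    proof (cases "m \<in> Poly_Mapping.keys P")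
      case False
      then show ?thesis by (simp add: U_def lookup_mapp \<rho>_eq coef_const_mult \<rho>0 in_keys_iff)
    next
      case True
      have "monev s m = (\<Prod>z\<in>vars. s z ^ coef m z)" by (rule monev_superset[OF finite_vars V_keys[OF assms True]])
      also have "\<dots> = (\<Prod>\<sigma>\<in>S. \<sigma> (inverse varpi) ^ coef m (Y \<sigma>))"
        unfolding vars_def using finite_S by (subst prod.union_disjoint) (auto simp: prod.reindex inj_on_def s_def)
      finally have ms: "monev s m = (\<Prod>\<sigma>\<in>S. \<sigma> (inverse varpi) ^ coef m (Y \<sigma>))" .
      have "(\<Prod>\<sigma>\<in>S. \<sigma> varpi ^ k \<sigma>) * monev s m = (\<Prod>\<sigma>\<in>S. \<sigma> varpi ^ coef m (X \<sigma>))"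
        unfolding ms prod.distrib[symmetric]
      proof (intro prod.cong refl)
        fix \<sigma> assume \<sigma>: "\<sigma> \<in> S"
        have "\<sigma> varpi \<noteq> 0" using ring_hom_inverse(2)[OF S_hom(1)[OF \<sigma>]] by simp
        then show "\<sigma> varpi ^ k \<sigma> * \<sigma> (inverse varpi) ^ coef m (Y \<sigma>) = \<sigma> varpi ^ coef m (X \<sigma>)"
          using V_degree[OF assms True \<sigma>, symmetric] by (simp add: ring_hom_inverse(1)[OF S_hom(1)[OF \<sigma>]] power_add power_inverse)
      qed
      then have "coef (U P) m = (c0 k * c0 k) * monev s m * coef P m"
        using True by (simp add: U_def lookup_mapp c02)
      also have "\<dots> = coef (const_poly (c0 k) * \<rho> k (matrix_inv \<alpha>) P) m"
        unfolding \<rho>_eq coef_const_mult \<rho>0 tw by (simp only: ac_simps)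
      finally show ?thesis .
    qed
  qed
qed

definition DC :: "('f^2^2) set" where
  "DC = {g. \<exists>\<kappa>\<^sub>1\<in>KZ. \<exists>\<kappa>\<^sub>2\<in>KZ. g = \<kappa>\<^sub>1 ** matrix_inv \<alpha> ** \<kappa>\<^sub>2}"

lemma DC_mult: assumes "\<kappa> \<in> KZ" "g \<in> DC" shows "\<kappa> ** g \<in> DC" "g ** \<kappa> \<in> DC"
proof -
  obtain k1 k2 where k: "k1 \<in> KZ" "k2 \<in> KZ" "g = k1 ** matrix_inv \<alpha> ** k2" using assms(2) by (auto simp: DC_def)
  have "\<kappa> ** g = (\<kappa> ** k1) ** matrix_inv \<alpha> ** k2" "g ** \<kappa> = k1 ** matrix_inv \<alpha> ** (k2 ** \<kappa>)"
    by (simp_all add: k(3) matrix_mul_assoc)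
  then show "\<kappa> ** g \<in> DC" "g ** \<kappa> \<in> DC" using k assms(1) KZ_mult unfolding DC_def by blast+
qed

lemma DC_cancel: assumes "\<kappa> \<in> KZ" shows "g ** \<kappa> \<in> DC \<longleftrightarrow> g \<in> DC"
  using DC_mult(2)[OF assms] DC_mult(2)[OF KZ_inv[OF assms], of "g ** \<kappa>"] GL2_cancel(3)[OF KZ_GL2[OF assms]] by auto

text \<open>The analogue of \<open>KZ_iff\<close> with odd determinant:
  \<open>matrix_inv \<alpha>\<close> lowers the valuations of entries by at most 1 and that of the
  determinant by exactly 1. This suffices to exclude pairs of vertices that are not
  neighbours.\<close>

lemma DC_det: assumes "g \<in> DC" shows "\<exists>c::int. mge (of_int c) g \<and> vF (det g) = ereal (2 * of_int c + 1)"
proof -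
  obtain k1 k2 where k: "k1 \<in> KZ" "k2 \<in> KZ" "g = k1 ** matrix_inv \<alpha> ** k2" using assms by (auto simp: DC_def)
  obtain c :: int where c: "mge (of_int c) k1" "vF (det k1) = ereal (2 * of_int c)" using k(1) KZ_iff by blast
  obtain d :: int where d: "mge (of_int d) k2" "vF (det k2) = ereal (2 * of_int d)" using k(2) KZ_iff by blast
  have v: "vF (inverse varpi) = ereal (- 1)" using VF.v_inverse[of varpi 1] vF_varpi by (simp add: one_ereal_def)
  have m: "mge (- 1) (matrix_inv \<alpha>)"
    unfolding \<alpha>_inv mge_iff by (auto simp: VF.vge_def[of _ "inverse varpi"] v intro: VF.vge_mono[OF VF.vge_1])
  have dt: "vF (det (matrix_inv \<alpha>)) = ereal (- 1)" using v by (simp add: \<alpha>_inv det_mat2)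
  show ?thesis
    using mge_mult[OF mge_mult[OF c(1) m] d(1)] c(2) d(2) dt
    by (intro exI[of _ "c + d - 1"]) (simp add: k(3) det_mul VF.v_mult algebra_simps)
qed

text \<open>By \<open>U_eq\<close> all factorizations of \<open>g\<close> give the same value, which
  settles the definite description.\<close>

lemma \<psi>_eq: assumes "P \<in> V k" shows "\<psi> k g P = (if g \<in> DC then const_poly (c0 k) * \<rho> k g P else 0)"
proof (cases "g \<in> DC")
  case False
  then show ?thesis by (simp add: \<psi>_def DC_def)
next
  case True
  have w: "\<rho> k k1 (U (\<rho> k k2 P)) = const_poly (c0 k) * \<rho> k g P"
    if "k1 \<in> KZ" "k2 \<in> KZ" "g = k1 ** matrix_inv \<alpha> ** k2" for k1 k2
  proof -
    have "U (\<rho> k k2 P) = const_poly (c0 k) * \<rho> k (matrix_inv \<alpha>) (\<rho> k k2 P)" by (rule U_eq[OF V_\<rho>[OF assms]])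
    then show ?thesis
      using that assms by (simp add: \<rho>_const_mult \<rho>_mult KZ_GL2 \<alpha>_GL2 GL2_mult V_\<rho>)
  qed
  have "(THE w. \<exists>k1\<in>KZ. \<exists>k2\<in>KZ. g = k1 ** matrix_inv \<alpha> ** k2 \<and> w = \<rho> k k1 (U (\<rho> k k2 P))) = const_poly (c0 k) * \<rho> k g P"
  proof (rule the_equality)
    show "\<exists>k1\<in>KZ. \<exists>k2\<in>KZ. g = k1 ** matrix_inv \<alpha> ** k2 \<and> const_poly (c0 k) * \<rho> k g P = \<rho> k k1 (U (\<rho> k k2 P))"
      using True w[symmetric] unfolding DC_def by blast
  qed (use w in blast)
  then show ?thesis using True by (simp add: \<psi>_def DC_def)
qed

lemma V_\<psi>: "P \<in> V k \<Longrightarrow> \<psi> k g P \<in> V k"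
  by (simp add: \<psi>_eq V_const_mult V_\<rho>)

lemma \<psi>_0 [simp]: "\<psi> k g 0 = 0" by (simp add: \<psi>_eq)

lemma \<psi>_left: "P \<in> V k \<Longrightarrow> \<kappa> \<in> KZ \<Longrightarrow> g \<in> GL2 \<Longrightarrow> \<psi> k (\<kappa> ** g) P = \<rho> k \<kappa> (\<psi> k g P)"
  using DC_mult(1)[of \<kappa> g] DC_mult(1)[of "matrix_inv \<kappa>" "\<kappa> ** g"]
  by (auto simp: \<psi>_eq \<rho>_mult \<rho>_const_mult KZ_GL2 KZ_inv GL2_cancel)

lemma \<psi>_right: "P \<in> V k \<Longrightarrow> \<kappa> \<in> KZ \<Longrightarrow> g \<in> GL2 \<Longrightarrow> \<psi> k (g ** \<kappa>) (\<rho> k (matrix_inv \<kappa>) P) = \<psi> k g P"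
proof -
  assume *: "P \<in> V k" "\<kappa> \<in> KZ" "g \<in> GL2"
  have "\<rho> k (g ** \<kappa>) (\<rho> k (matrix_inv \<kappa>) P) = \<rho> k g P"
    using * \<rho>_mult[of P k "g ** \<kappa>" "matrix_inv \<kappa>"] by (simp add: KZ_GL2 GL2_mult GL2_inv GL2_cancel)
  then show ?thesis using * by (simp add: \<psi>_eq V_\<rho> DC_cancel)
qed

definition coset :: "'f^2^2 \<Rightarrow> ('f^2^2) set" where "coset g = (\<lambda>\<kappa>. g ** \<kappa>) ` KZ"

lemma coset_in: "g \<in> GL2 \<Longrightarrow> coset g \<in> cosets" by (simp add: cosets_def coset_def)

lemma mem_coset_iff: "g \<in> GL2 \<Longrightarrow> x \<in> coset g \<longleftrightarrow> matrix_inv g ** x \<in> KZ"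
  by (auto simp: coset_def GL2_cancel) (metis GL2_cancel(1) imageI)

lemma coset_GL2: "g \<in> GL2 \<Longrightarrow> x \<in> coset g \<Longrightarrow> x \<in> GL2"
  by (auto simp: coset_def intro: GL2_mult KZ_GL2)

lemma coset_eq: assumes "g \<in> GL2" "x \<in> coset g" shows "coset x = coset g"
proof -
  obtain \<kappa> where \<kappa>: "\<kappa> \<in> KZ" "x = g ** \<kappa>" using assms(2) by (auto simp: coset_def)
  have 1: "g ** \<kappa>' = x ** (matrix_inv \<kappa> ** \<kappa>')" and 2: "x ** \<kappa>' = g ** (\<kappa> ** \<kappa>')" for \<kappa>' :: "'f^2^2"
    using \<kappa> by (simp_all add: matrix_mul_assoc GL2_cancel KZ_GL2)
  show ?thesis
  proof (intro equalityI subsetI)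
    fix y assume "y \<in> coset x"
    then obtain \<kappa>' where "\<kappa>' \<in> KZ" "y = x ** \<kappa>'" by (auto simp: coset_def)
    then show "y \<in> coset g" unfolding coset_def using KZ_mult[OF \<kappa>(1)] 2 by (intro image_eqI[of _ _ "\<kappa> ** \<kappa>'"]) auto
  next
    fix y assume "y \<in> coset g"
    then obtain \<kappa>' where "\<kappa>' \<in> KZ" "y = g ** \<kappa>'" by (auto simp: coset_def)
    then show "y \<in> coset x" unfolding coset_def using KZ_mult[OF KZ_inv[OF \<kappa>(1)]] 1
      by (intro image_eqI[of _ _ "matrix_inv \<kappa> ** \<kappa>'"]) auto
  qed
qed

lemma coset_rep: assumes "g \<in> GL2" shows "coset_rep (coset g) \<in> coset g" "coset (coset_rep (coset g)) = coset g"
proof -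
  have "g \<in> coset g" using KZ_1 by (auto simp: coset_def intro!: image_eqI[of _ _ "mat 1"])
  then show *: "coset_rep (coset g) \<in> coset g" unfolding coset_rep_def by (rule someI)
  show "coset (coset_rep (coset g)) = coset g" by (rule coset_eq[OF assms *])
qed

lemma cosetsE: "c \<in> cosets \<Longrightarrow> (\<And>g. g \<in> GL2 \<Longrightarrow> c = coset g \<Longrightarrow> P) \<Longrightarrow> P"
  by (auto simp: cosets_def coset_def)

text \<open>The coset \<open>\<kappa> \<alpha> KZ\<close> only depends on \<open>\<kappa> \<in> K\<close> modulo \<open>varpi\<close>.\<close>

lemma finite_neighbours: "finite {c \<in> cosets. matrix_inv (coset_rep c) \<in> DC}"
proof -
  define \<tau> where "\<tau> g = (residue_of (g $ 1 $ 1), residue_of (g $ 1 $ 2), residue_of (g $ 2 $ 1), residue_of (g $ 2 $ 2))" for g :: "'f^2^2"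
  have fin: "finite (\<tau> ` K)"
  proof (rule finite_subset)
    show "\<tau> ` K \<subseteq> residue_field \<times> residue_field \<times> residue_field \<times> residue_field"
      by (auto simp: \<tau>_def K_iff mge_iff residue_of_in)
  qed (use finite_residue in simp)
  have same: "coset (g ** \<alpha>) = coset (h ** \<alpha>)" if gh: "g \<in> K" "h \<in> K" "\<tau> g = \<tau> h" for g h
  proof -
    have G: "g \<in> GL2" "h \<in> GL2" using gh K_KZ KZ_GL2 by auto
    have "mge 1 (h - g)"
      using gh class_eq_iff by (auto simp: \<tau>_def residue_of_def K_iff mge_iff VF.vge_diff_commute)
    moreover have "mge 0 (matrix_inv g)" using gh(1) K_KZ KZ_inv by (auto simp: K_def mge_def OF_iff)
    ultimately have E: "mge (0 + 1) (matrix_inv g ** (h - g))" by (intro mge_mult)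
    define E where "E = matrix_inv g ** (h - g)"
    have gE: "matrix_inv g ** h = mat 1 + E"
    proof -
      have "E = matrix_inv g ** h - matrix_inv g ** g" by (simp add: E_def mat2_eq_iff mat2_mult_nth algebra_simps)
      then show ?thesis using GL2_inverse(2)[of g] G by (simp add: GL2_def)
    qed
    have E1: "VF.vge 1 (E $ i $ j)" for i j using E by (simp add: E_def mge_def)
    \<comment> \<open>Conjugation by \<open>\<alpha>\<close> divides the lower left entry by
      \<open>varpi\<close>; it stays integral because \<open>g\<close> and \<open>h\<close> agree
      modulo \<open>varpi\<close>.\<close>
    define M where "M = matrix_inv (g ** \<alpha>) ** (h ** \<alpha>)"
    have "M = matrix_inv \<alpha> ** (matrix_inv g ** h) ** \<alpha>"
      using G \<alpha>_GL2 by (simp add: M_def matrix_inv_mult GL2_def matrix_mul_assoc)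
    also have "\<dots> = mat2 (1 + E $ 1 $ 1) (varpi * E $ 1 $ 2) (inverse varpi * E $ 2 $ 1) (1 + E $ 2 $ 2)"
      unfolding gE \<alpha>_inv by (simp add: mat2_calc \<alpha>_def mult.commute)
    finally have M: "M = mat2 (1 + E $ 1 $ 1) (varpi * E $ 1 $ 2) (inverse varpi * E $ 2 $ 1) (1 + E $ 2 $ 2)" .
    have "VF.vge 0 (1 + E $ i $ j)" for i j by (intro VF.vge_add VF.vge_1 VF.vge_mono[OF E1]) simp
    moreover have "VF.vge 0 (varpi * E $ 1 $ 2)"
      using vF_varpi by (intro VF.vge_mult'[OF _ E1, of 1]) (auto simp: VF.vge_def one_ereal_def)
    moreover have "VF.vge 0 (inverse varpi * E $ 2 $ 1)"
      using vF_varpi VF.v_inverse[of varpi 1] by (intro VF.vge_mult'[OF _ E1, of "- 1"]) (auto simp: VF.vge_def one_ereal_def)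
    ultimately have "mge 0 M" by (simp add: M mge_iff)
    moreover have "vF (det M) = 0"
    proof -
      have "vF (det (g ** \<alpha>)) = ereal 1" "vF (det (h ** \<alpha>)) = ereal 1"
        using gh vF_varpi by (auto simp: det_mul VF.v_mult K_iff \<alpha>_def det_mat2 one_ereal_def)
      from det_inv[OF this(1)] this(2) show ?thesis by (simp add: M_def det_mul[of _ "h ** \<alpha>"] VF.v_mult zero_ereal_def)
    qed
    ultimately have "M \<in> KZ" using K_KZ K_iff by blast
    then have "h ** \<alpha> \<in> coset (g ** \<alpha>)" using G \<alpha>_GL2 GL2_mult by (simp add: mem_coset_iff M_def)
    then show ?thesis using coset_eq G \<alpha>_GL2 GL2_mult by metis
  qed
  have "(\<lambda>g. coset (g ** \<alpha>)) ` K \<subseteq> (\<lambda>t. coset (inv_into K \<tau> t ** \<alpha>)) ` \<tau> ` K"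
  proof
    fix c assume "c \<in> (\<lambda>g. coset (g ** \<alpha>)) ` K"
    then obtain g where g: "g \<in> K" "c = coset (g ** \<alpha>)" by blast
    have "coset (inv_into K \<tau> (\<tau> g) ** \<alpha>) = coset (g ** \<alpha>)"
      using g by (intro same inv_into_into f_inv_into_f) auto
    then show "c \<in> (\<lambda>t. coset (inv_into K \<tau> t ** \<alpha>)) ` \<tau> ` K" using g by blast
  qed
  then have "finite ((\<lambda>g. coset (g ** \<alpha>)) ` K)" using fin by (rule finite_subset[OF _ finite_imageI])
  moreover have "{c \<in> cosets. matrix_inv (coset_rep c) \<in> DC} \<subseteq> (\<lambda>g. coset (g ** \<alpha>)) ` K"
  proof safe
    fix c assume c: "c \<in> cosets" "matrix_inv (coset_rep c) \<in> DC"
    obtain g where g: "g \<in> GL2" "c = coset g" using c(1) cosetsE by blast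
    define x where "x = coset_rep c"
    have x: "x \<in> GL2" "coset x = c" using coset_rep[OF g(1)] coset_GL2[OF g(1)] g by (auto simp: x_def)
    obtain k1 k2 where k: "k1 \<in> KZ" "k2 \<in> KZ" "matrix_inv x = k1 ** matrix_inv \<alpha> ** k2" using c(2) by (auto simp: DC_def x_def)
    have G: "k1 \<in> GL2" "k2 \<in> GL2" using k KZ_GL2 by auto
    have "x = matrix_inv (k1 ** matrix_inv \<alpha> ** k2)" using k(3) x GL2_inverse(4)[of x] by (simp add: GL2_def)
    then have x': "x = matrix_inv k2 ** \<alpha> ** matrix_inv k1"
      using G \<alpha>_GL2 GL2_mult GL2_inverse(4)[of \<alpha>] by (simp add: matrix_inv_mult GL2_def invertible_mult matrix_mul_assoc)
    obtain h z where h: "matrix_inv k2 = h ** mat z" "h \<in> K" "z \<noteq> 0" using KZ_inv[OF k(2)] by (auto simp: KZ_def Z_def)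
    have zKZ: "mat z \<in> KZ"
    proof -
      have "mat 1 \<in> K" by (simp add: K_iff mge_iff mat_nth_2)
      then show ?thesis using h(3) unfolding KZ_def Z_def by force
    qed
    have "h ** mat z ** \<alpha> = h ** \<alpha> ** mat z" by (simp add: mat2_calc \<alpha>_def algebra_simps)
    then have "x = (h ** \<alpha>) ** (mat z ** matrix_inv k1)" using x' h(1) by (simp add: matrix_mul_assoc)
    then have "x \<in> coset (h ** \<alpha>)" using zKZ KZ_inv[OF k(1)] KZ_mult by (auto simp: coset_def)
    then have "c = coset (h ** \<alpha>)" using coset_eq[of "h ** \<alpha>" x] x h(2) K_KZ KZ_GL2 GL2_mult \<alpha>_GL2 by metis
    then show "c \<in> (\<lambda>g. coset (g ** \<alpha>)) ` K" using h(2) by blast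
  qed
  ultimately show ?thesis by (rule finite_subset[rotated])
qed

text \<open>At \<open>h\<close> only the coset of the inverse of \<open>h ** g\<close> can
  contribute, and by \<open>\<psi>_left\<close> its summand does not depend on the representative.
  Thus \<open>\<psi>\<close> is the kernel of the operator.\<close>

lemma hecke_elem_eq:
  assumes g: "g \<in> GL2" and h: "h \<in> GL2" and P: "P \<in> V k"
  shows "hecke_elem k g P h = \<psi> k (h ** g) P"
proof -
  define A where "A = {c \<in> cosets. \<psi> k (matrix_inv (coset_rep c)) P \<noteq> 0}"
  have "A \<subseteq> {c \<in> cosets. matrix_inv (coset_rep c) \<in> DC}" using P by (auto simp: A_def \<psi>_eq split: if_splits)
  then have finA: "finite A" using finite_neighbours by (rule finite_subset)
  define y where "y = matrix_inv (h ** g)"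
  have hg: "h ** g \<in> GL2" using g h by (rule GL2_mult[rotated])
  have y: "y \<in> GL2" "matrix_inv y = h ** g" using hg GL2_inv GL2_inverse(4) by (auto simp: y_def GL2_def)
  define x where "x = coset_rep (coset y)"
  have x: "x \<in> coset y" "coset x = coset y" "x \<in> GL2" using coset_rep[OF y(1)] coset_GL2[OF y(1)] by (auto simp: x_def)
  have \<kappa>: "h ** g ** x \<in> KZ" using x(1) y mem_coset_iff by simp
  have eqx: "\<rho> k (h ** g ** x) (\<psi> k (matrix_inv x) P) = \<psi> k (h ** g) P"
    using \<psi>_left[OF P \<kappa> GL2_inv[OF x(3)]] x(3) by (simp add: GL2_cancel)
  have "hecke_elem k g P h = (\<Sum>z\<in>coset_rep ` A. if z = x then \<psi> k (h ** g) P else 0)"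
    unfolding hecke_elem_def A_def[symmetric]
  proof (intro sum.cong refl)
    fix z assume "z \<in> coset_rep ` A"
    then obtain g' where g': "g' \<in> GL2" "z = coset_rep (coset g')" by (auto simp: A_def elim: cosetsE)
    have z: "z \<in> GL2" "coset z = coset g'" using coset_rep[OF g'(1)] coset_GL2[OF g'(1)] g' by auto
    show "elem k (g ** z) (\<psi> k (matrix_inv z) P) h = (if z = x then \<psi> k (h ** g) P else 0)"
    proof (cases "z = x")
      case True
      then show ?thesis using \<kappa> eqx by (simp add: elem_def matrix_mul_assoc)
    next
      case False
      have "h ** g ** z \<notin> KZ"
      proof
        assume "h ** g ** z \<in> KZ"
        then have "z \<in> coset y" using y mem_coset_iff by simp
        then have "coset g' = coset y" using coset_eq[OF y(1)] z by simp
        then show False using False g' by (simp add: x_def)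
      qed
      then show ?thesis using False by (simp add: elem_def matrix_mul_assoc)
    qed
  qed
  also have "\<dots> = \<psi> k (h ** g) P"
  proof (cases "\<psi> k (matrix_inv x) P = 0")
    case True
    then have "\<psi> k (h ** g) P = 0" using eqx by simp
    then show ?thesis by (simp cong: if_cong)
  next
    case False
    then have "x \<in> coset_rep ` A" using coset_in[OF y(1)] by (auto simp: A_def x_def)
    then show ?thesis using finA by simp
  qed
  finally show ?thesis .
qed

end

section \<open>The Hecke operator on the tree\<close>

context hecke_finite begin

lemma elem_const_mult: "elem k g (const_poly c * P) h = const_poly c * elem k g P h"
  by (simp add: elem_def \<rho>_const_mult)

text \<open>Stated for any \<open>KZ\<close>-stable \<open>W\<close>, as it is applied both to
  \<open>V k\<close> and to \<open>V0 k\<close>.\<close>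

lemma elem_ind:
  assumes g: "g \<in> GL2" and P: "P \<in> W" and W: "W \<subseteq> V k" "0 \<in> W" "\<And>\<kappa> R. \<kappa> \<in> KZ \<Longrightarrow> R \<in> W \<Longrightarrow> \<rho> k \<kappa> R \<in> W"
  shows "elem k g P \<in> ind k W"
proof -
  have hg: "h \<in> GL2" if "h ** g \<in> KZ" for h using KZ_GL2[OF that] by (auto simp: GL2_iff det_mul)
  have KZg: "\<kappa> ** h ** g \<in> KZ \<longleftrightarrow> h ** g \<in> KZ" if "\<kappa> \<in> KZ" for \<kappa> h
  proof
    assume "\<kappa> ** h ** g \<in> KZ"
    from KZ_mult[OF KZ_inv[OF that] this] show "h ** g \<in> KZ"
      using GL2_cancel(2)[OF KZ_GL2[OF that], of "h ** g"] by (simp add: matrix_mul_assoc)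
  next
    assume "h ** g \<in> KZ"
    from KZ_mult[OF that this] show "\<kappa> ** h ** g \<in> KZ" by (simp add: matrix_mul_assoc)
  qed
  have "elem k g P (\<kappa> ** h) = \<rho> k \<kappa> (elem k g P h)" if "\<kappa> \<in> KZ" for \<kappa> h
  proof (cases "h ** g \<in> KZ")
    case True
    have "\<rho> k (\<kappa> ** (h ** g)) P = \<rho> k \<kappa> (\<rho> k (h ** g) P)"
      by (rule \<rho>_mult) (use P W True that KZ_GL2 in auto)
    then show ?thesis using True KZg[OF that] by (simp add: elem_def matrix_mul_assoc)
  qed (simp add: elem_def KZg[OF that])
  moreover have "finite ((\<lambda>h. (\<lambda>\<kappa>. \<kappa> ** h) ` KZ) ` {h \<in> GL2. elem k g P h \<noteq> 0})"
  proof (rule finite_subset)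
    show "(\<lambda>h. (\<lambda>\<kappa>. \<kappa> ** h) ` KZ) ` {h \<in> GL2. elem k g P h \<noteq> 0} \<subseteq> {(\<lambda>\<kappa>. \<kappa> ** matrix_inv g) ` KZ}"
    proof (rule image_subsetI)
      fix h assume "h \<in> {h \<in> GL2. elem k g P h \<noteq> 0}"
      then have \<kappa>: "h ** g \<in> KZ" by (auto simp: elem_def split: if_splits)
      have h: "h = h ** g ** matrix_inv g" using g by (simp add: GL2_cancel)
      have "(\<lambda>\<kappa>. \<kappa> ** h) ` KZ = (\<lambda>\<kappa>. \<kappa> ** matrix_inv g) ` (\<lambda>\<kappa>. \<kappa> ** (h ** g)) ` KZ"
        unfolding image_image by (subst h) (simp add: matrix_mul_assoc)
      also have "(\<lambda>\<kappa>. \<kappa> ** (h ** g)) ` KZ = KZ"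
      proof (intro equalityI subsetI)
        fix y assume "y \<in> KZ"
        then have "y ** matrix_inv (h ** g) \<in> KZ" "y = y ** matrix_inv (h ** g) ** (h ** g)"
          using \<kappa> KZ_inv KZ_mult GL2_cancel(4)[OF KZ_GL2[OF \<kappa>]] by auto
        then show "y \<in> (\<lambda>\<kappa>. \<kappa> ** (h ** g)) ` KZ" by blast
      qed (use \<kappa> KZ_mult in auto)
      finally show "(\<lambda>\<kappa>. \<kappa> ** h) ` KZ \<in> {(\<lambda>\<kappa>. \<kappa> ** matrix_inv g) ` KZ}" by simp
    qed
  qed simp
  moreover have "elem k g P h \<in> W" for h using P W by (auto simp: elem_def)
  moreover have "elem k g P h = 0" if "h \<notin> GL2" for h using hg that by (auto simp: elem_def)
  ultimately show ?thesis unfolding ind_def by blast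
qed

lemma ind_sum:
  assumes W: "0 \<in> W" "\<And>P R. P \<in> W \<Longrightarrow> R \<in> W \<Longrightarrow> P + R \<in> W"
    and f: "\<And>i. i \<in> A \<Longrightarrow> f i \<in> ind k W" and A: "finite A"
  shows "(\<lambda>h. \<Sum>i\<in>A. f i h) \<in> ind k W"
  using A f
proof (induction A rule: finite_induct)
  case empty
  then show ?case using W(1) by (simp add: ind_def)
next
  case (insert i A)
  define g where "g h = (\<Sum>i\<in>A. f i h)" for h
  have g: "g \<in> ind k W" unfolding g_def using insert by simp
  have fi: "f i \<in> ind k W" using insert by simp
  have "{h \<in> GL2. f i h + g h \<noteq> 0} \<subseteq> {h \<in> GL2. f i h \<noteq> 0} \<union> {h \<in> GL2. g h \<noteq> 0}" by auto
  then have "finite ((\<lambda>h. (\<lambda>\<kappa>. \<kappa> ** h) ` KZ) ` {h \<in> GL2. f i h + g h \<noteq> 0})"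
    using fi g by (auto simp: ind_def image_Un intro: finite_subset[OF image_mono])
  then have "(\<lambda>h. f i h + g h) \<in> ind k W"
    using fi g W(2) by (auto simp: ind_def \<rho>_add)
  moreover have "(\<lambda>h. \<Sum>i\<in>insert i A. f i h) = (\<lambda>h. f i h + g h)" using insert by (simp add: g_def)
  ultimately show ?case by simp
qed

lemma V_ind_closed: "V k \<subseteq> V k" "0 \<in> V k" "\<And>\<kappa> R. \<kappa> \<in> KZ \<Longrightarrow> R \<in> V k \<Longrightarrow> \<rho> k \<kappa> R \<in> V k"
  "\<And>P R. P \<in> V k \<Longrightarrow> R \<in> V k \<Longrightarrow> P + R \<in> V k"
  by (auto intro: V_\<rho> V_add)

lemma V0_ind_closed: "V0 k \<subseteq> V k" "0 \<in> V0 k" "\<And>\<kappa> R. \<kappa> \<in> KZ \<Longrightarrow> R \<in> V0 k \<Longrightarrow> \<rho> k \<kappa> R \<in> V0 k"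
  "\<And>P R. P \<in> V0 k \<Longrightarrow> R \<in> V0 k \<Longrightarrow> P + R \<in> V0 k"
  by (auto simp: V0_iff intro: V_\<rho> V_add cge_\<rho> cge_add)

lemma g0_GL2: "g0 n \<mu> \<in> GL2" and g1_GL2: "g1 n \<mu> \<in> GL2"
  by (simp_all add: GL2_iff g0_def g1_def det_mat2)

lemma g0_inv: "matrix_inv (g0 m \<mu>) = mat2 (inverse (varpi ^ m)) (- \<mu> / varpi ^ m) 0 1"
  by (rule matrix_inv_unique) (simp_all add: g0_def mat2_calc field_simps)

lemma g0_g0: "matrix_inv (g0 m \<mu>) ** g0 n \<nu> = mat2 (varpi ^ n / varpi ^ m) ((\<nu> - \<mu>) / varpi ^ m) 0 1"
  unfolding g0_inv by (simp add: mat2_calc g0_def field_simps)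

lemma v_quot: "vF (varpi ^ n / varpi ^ m) = ereal (real n - real m)"
  unfolding divide_inverse VF.v_mult vF_varpi_power VF.v_inverse[OF vF_varpi_power] by simp

lemma vge_div_varpi: "VF.vge t (x / varpi ^ m) \<longleftrightarrow> VF.vge (t + real m) x"
  using vge_varpi_cancel[of "t + real m" m "x / varpi ^ m"] by simp

lemma vge_1_iff: "VF.vge t 1 \<longleftrightarrow> t \<le> 0" by (simp add: VF.vge_def zero_ereal_def)

text \<open>The entry 1 forces \<open>c \<le> 0\<close> and the upper left entry
  \<open>c \<le> n - m = 2 * c\<close>, so \<open>c = 0\<close> and \<open>m = n\<close>; the upper
  right entry then makes the parameters congruent, and \<open>I_unique\<close> applies.\<close>

lemma g0_KZ:
  assumes "\<mu> \<in> I m" "\<nu> \<in> I n"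
  shows "matrix_inv (g0 m \<mu>) ** g0 n \<nu> \<in> KZ \<longleftrightarrow> m = n \<and> \<mu> = \<nu>"
proof
  assume "matrix_inv (g0 m \<mu>) ** g0 n \<nu> \<in> KZ"
  then obtain c :: int where c: "mge (of_int c) (mat2 (varpi ^ n / varpi ^ m) ((\<nu> - \<mu>) / varpi ^ m) 0 1)"
    "real n - real m = 2 * of_int c"
    unfolding KZ_iff g0_g0 by (auto simp: det_mat2 v_quot)
  have le: "c \<le> 0" "real_of_int c \<le> real n - real m" and \<beta>: "VF.vge (of_int c + real m) (\<nu> - \<mu>)"
    using c(1) by (auto simp: mge_iff vge_div_varpi VF.vge_def[of _ "varpi ^ n"] vF_varpi_power vge_1_iff)
  have "c = 0" using le c(2) by linarith
  then have "m = n" using c(2) by simp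
  then show "m = n \<and> \<mu> = \<nu>" using I_unique[of \<nu> n \<mu>] assms \<beta> \<open>c = 0\<close> by simp
next
  assume "m = n \<and> \<mu> = \<nu>"
  then show "matrix_inv (g0 m \<mu>) ** g0 n \<nu> \<in> KZ" using GL2_inverse(2)[of "g0 m \<mu>"] g0_GL2 KZ_1 by (simp add: GL2_def)
qed

text \<open>The upper left entry is a unit divided by \<open>varpi ^ m\<close>, so
  \<open>c \<le> - m\<close>, which contradicts \<open>n + 1 - m = 2 * c\<close>.\<close>

lemma g1_not_KZ:
  assumes "\<mu> \<in> I m" "\<nu> \<in> I n"
  shows "matrix_inv (g0 m \<mu>) ** g1 n \<nu> \<notin> KZ"
proof
  assume "matrix_inv (g0 m \<mu>) ** g1 n \<nu> \<in> KZ"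
  then obtain c :: int where c: "mge (of_int c) (matrix_inv (g0 m \<mu>) ** g1 n \<nu>)"
    "vF (det (matrix_inv (g0 m \<mu>) ** g1 n \<nu>)) = ereal (2 * of_int c)" unfolding KZ_iff by blast
  have "det (matrix_inv (g0 m \<mu>) ** g1 n \<nu>) = varpi ^ (n + 1) / varpi ^ m"
    by (simp add: det_mul g0_inv g1_def det_mat2 field_simps)
  then have d: "real (n + 1) - real m = 2 * of_int c" using c(2) by (simp only: v_quot ereal.inject)
  have "(matrix_inv (g0 m \<mu>) ** g1 n \<nu>) $ 1 $ 1 = (1 - \<mu> * (varpi * \<nu>)) / varpi ^ m"
    by (simp add: g0_inv g1_def mat2_mult_nth field_simps)
  then have "VF.vge (of_int c + real m) (1 - \<mu> * (varpi * \<nu>))" using c(1) by (simp add: mge_iff vge_div_varpi)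
  moreover have "vF (1 + - (\<mu> * (varpi * \<nu>))) = ereal 0"
  proof (rule VF.v_add_eq[of _ _ 1])
    have "VF.vge 1 (varpi * \<nu>)" using vF_varpi I_int[OF assms(2)] VF.vge_mult[of 1 varpi 0 \<nu>] by (simp add: VF.vge_def one_ereal_def)
    then show "VF.vge 1 (- (\<mu> * (varpi * \<nu>)))" using VF.vge_mult_int[OF I_int[OF assms(1)]] by simp
  qed (auto simp: zero_ereal_def)
  ultimately have "of_int c + real m \<le> 0" by (simp add: VF.vge_def)
  then show False using d by linarith
qed

text \<open>The estimates of \<open>g0_KZ\<close> with determinant valuation
  \<open>2 * c + 1\<close> leave \<open>c = 0\<close>, a child, and \<open>c = - 1\<close>, the
  parent.\<close>

lemma g0_DC:
  assumes "\<mu> \<in> I m" "\<nu> \<in> I n" "matrix_inv (g0 m \<mu>) ** g0 n \<nu> \<in> DC"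
  shows "(n = Suc m \<and> VF.vge (real m) (\<nu> - \<mu>)) \<or> (m = Suc n \<and> VF.vge (real n) (\<nu> - \<mu>))"
proof -
  obtain c :: int where c: "mge (of_int c) (mat2 (varpi ^ n / varpi ^ m) ((\<nu> - \<mu>) / varpi ^ m) 0 1)"
    "real n - real m = 2 * of_int c + 1"
    using DC_det[OF assms(3)] unfolding g0_g0 by (auto simp: det_mat2 v_quot)
  have le: "c \<le> 0" "real_of_int c \<le> real n - real m" and \<beta>: "VF.vge (of_int c + real m) (\<nu> - \<mu>)"
    using c(1) by (auto simp: mge_iff vge_div_varpi VF.vge_def[of _ "varpi ^ n"] vF_varpi_power vge_1_iff)
  have "c = 0 \<or> c = -1" using le c(2) by linarith
  then show ?thesis
  proof
    assume "c = 0"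
    then have "real n = real (Suc m)" using c(2) by simp
    then have "n = Suc m" by (simp only: of_nat_eq_iff)
    then show ?thesis using \<beta> \<open>c = 0\<close> by simp
  next
    assume "c = -1"
    then have "real m = real (Suc n)" using c(2) by simp
    then have "m = Suc n" by (simp only: of_nat_eq_iff)
    then show ?thesis using \<beta> \<open>c = -1\<close> by simp
  qed
qed

lemma elem_at_g0:
  assumes "P \<in> V k" "\<mu> \<in> I m" "\<nu> \<in> I n"
  shows "elem k (g0 n \<nu>) P (matrix_inv (g0 m \<mu>)) = (if n = m \<and> \<nu> = \<mu> then P else 0)"
    and "elem k (g1 n \<nu>) P (matrix_inv (g0 m \<mu>)) = 0"
proof -
  show "elem k (g0 n \<nu>) P (matrix_inv (g0 m \<mu>)) = (if n = m \<and> \<nu> = \<mu> then P else 0)"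
    using g0_KZ[OF assms(2,3)] GL2_inverse(2)[of "g0 m \<mu>"] g0_GL2[of m \<mu>] \<rho>_1[OF assms(1)]
    by (auto simp: elem_def GL2_def)
  show "elem k (g1 n \<nu>) P (matrix_inv (g0 m \<mu>)) = 0"
    using g1_not_KZ[OF assms(2,3)] by (simp add: elem_def)
qed

text \<open>All other summands vanish at this matrix by \<open>elem_at_g0\<close>. The coefficients
  are values of \<open>f\<close>, so that equations between functions can be read off vertex by
  vertex.\<close>

lemma decomposition_at_g0:
  assumes dec: "decomposition k f v0 v1" and \<mu>: "\<mu> \<in> I m"
  shows "f (matrix_inv (g0 m \<mu>)) = v0 m \<mu>"
proof -
  define A where "A = {(n, \<nu>). v0 n \<nu> \<noteq> 0}"
  have V: "v0 n \<nu> \<in> V k" "v1 n \<nu> \<in> V k" for n \<nu> using dec by (auto simp: decomposition_def)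
  have I: "\<nu> \<in> I n" if "v0 n \<nu> \<noteq> 0 \<or> v1 n \<nu> \<noteq> 0" for n \<nu> using dec that by (auto simp: decomposition_def)
  have fin: "finite A" using dec by (simp add: decomposition_def A_def)
  have "(\<Sum>(n, \<nu>) \<in> {(n, \<nu>). v1 n \<nu> \<noteq> 0}. elem k (g1 n \<nu>) (v1 n \<nu>) (matrix_inv (g0 m \<mu>))) = 0"
    using I V \<mu> by (intro sum.neutral) (auto simp: elem_at_g0)
  then have "f (matrix_inv (g0 m \<mu>)) = (\<Sum>(n, \<nu>)\<in>A. elem k (g0 n \<nu>) (v0 n \<nu>) (matrix_inv (g0 m \<mu>)))"
    using dec by (simp add: decomposition_def A_def)
  also have "\<dots> = (\<Sum>x\<in>A. if x = (m, \<mu>) then v0 m \<mu> else 0)"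
  proof (intro sum.cong refl)
    fix x assume "x \<in> A"
    moreover obtain n \<nu> where x: "x = (n, \<nu>)" by force
    ultimately show "(case x of (n, \<nu>) \<Rightarrow> elem k (g0 n \<nu>) (v0 n \<nu>) (matrix_inv (g0 m \<mu>))) = (if x = (m, \<mu>) then v0 m \<mu> else 0)"
      using elem_at_g0(1)[OF V(1) \<mu> I, of n \<nu> n \<nu>] by (auto simp: A_def)
  qed
  also have "\<dots> = v0 m \<mu>" using fin by (auto simp: A_def)
  finally show ?thesis .
qed

text \<open>The definition of \<open>T\<close> sums over chosen representatives of the cosets where
  \<open>f\<close> does not vanish. They have the form \<open>g0 n \<nu> ** \<kappa>\<close> with
  \<open>(n, \<nu>)\<close> in the support of the decomposition, and \<open>\<psi>_right\<close>
  removes \<open>\<kappa>\<close>.\<close>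

lemma T_eq:
  assumes dec: "decomposition k f v0 v1" and v1: "\<And>n \<mu>. v1 n \<mu> = 0" and h: "h \<in> GL2"
  shows "T k f h = (\<Sum>(n, \<nu>) \<in> {(n, \<nu>). v0 n \<nu> \<noteq> 0}. \<psi> k (h ** g0 n \<nu>) (v0 n \<nu>))"
proof -
  define A where "A = {(n, \<nu>). v0 n \<nu> \<noteq> 0}"
  have V: "v0 n \<nu> \<in> V k" for n \<nu> using dec by (auto simp: decomposition_def)
  have I: "\<nu> \<in> I n" if "(n, \<nu>) \<in> A" for n \<nu> using dec that by (auto simp: decomposition_def A_def)
  have fin: "finite A" using dec by (simp add: decomposition_def A_def)
  have f: "f h = (\<Sum>(n, \<nu>)\<in>A. elem k (g0 n \<nu>) (v0 n \<nu>) h)" for h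
    using dec v1 by (simp add: decomposition_def A_def)
  define rep where "rep = (\<lambda>(n, \<nu>). coset_rep (coset (g0 n \<nu>)))"
  have rep: "rep (n, \<nu>) \<in> GL2" "\<exists>\<kappa>\<in>KZ. rep (n, \<nu>) = g0 n \<nu> ** \<kappa>" for n \<nu>
    using coset_rep(1)[OF g0_GL2, of n \<nu>] coset_GL2[OF g0_GL2] by (auto simp: rep_def coset_def)
  have val: "f (matrix_inv (g0 n \<nu> ** \<kappa>)) = \<rho> k (matrix_inv \<kappa>) (v0 n \<nu>)" if x: "(n, \<nu>) \<in> A" and \<kappa>: "\<kappa> \<in> KZ" for n \<nu> \<kappa>
  proof -
    have G: "g0 n \<nu> \<in> GL2" "\<kappa> \<in> GL2" using g0_GL2 KZ_GL2[OF \<kappa>] by auto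
    have inv: "matrix_inv (g0 n \<nu> ** \<kappa>) = matrix_inv \<kappa> ** matrix_inv (g0 n \<nu>)"
      using G by (simp add: matrix_inv_mult GL2_def)
    have "f \<in> ind k (V k)"
    proof -
      have "(\<lambda>h. \<Sum>x\<in>A. (\<lambda>(n, \<nu>). elem k (g0 n \<nu>) (v0 n \<nu>)) x h) \<in> ind k (V k)"
        using V_ind_closed V fin g0_GL2 by (intro ind_sum) (auto intro!: elem_ind)
      moreover have "f = (\<lambda>h. \<Sum>x\<in>A. (\<lambda>(n, \<nu>). elem k (g0 n \<nu>) (v0 n \<nu>)) x h)"
        by (rule ext) (simp add: f case_prod_unfold)
      ultimately show ?thesis by simp
    qed
    then have "f (matrix_inv \<kappa> ** matrix_inv (g0 n \<nu>)) = \<rho> k (matrix_inv \<kappa>) (f (matrix_inv (g0 n \<nu>)))"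
      using KZ_inv[OF \<kappa>] GL2_inv[OF G(1)] by (auto simp: ind_def)
    then show ?thesis using decomposition_at_g0[OF dec I[OF x]] by (simp add: inv)
  qed
  have idx: "coset_rep ` {c \<in> cosets. f (matrix_inv (coset_rep c)) \<noteq> 0} = rep ` A"
  proof (intro equalityI subsetI)
    fix g assume "g \<in> coset_rep ` {c \<in> cosets. f (matrix_inv (coset_rep c)) \<noteq> 0}"
    then obtain c g' where c: "g = coset_rep c" "f (matrix_inv g) \<noteq> 0" "g' \<in> GL2" "c = coset g'" by (auto elim: cosetsE)
    have gG: "g \<in> GL2" "coset g = c" using coset_rep[OF c(3)] coset_GL2[OF c(3)] c by auto
    obtain n \<nu> where x: "(n, \<nu>) \<in> A" "elem k (g0 n \<nu>) (v0 n \<nu>) (matrix_inv g) \<noteq> 0"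
      using c(2) unfolding f by (auto elim!: sum.not_neutral_contains_not_neutral)
    then have "matrix_inv g ** g0 n \<nu> \<in> KZ" by (auto simp: elem_def split: if_splits)
    then have "g0 n \<nu> \<in> coset g" by (simp only: mem_coset_iff[OF gG(1)])
    then have "coset (g0 n \<nu>) = c" using coset_eq[OF gG(1)] gG by simp
    then show "g \<in> rep ` A" using x(1) c(1) by (force simp: rep_def)
  next
    fix g assume "g \<in> rep ` A"
    then obtain n \<nu> where x: "(n, \<nu>) \<in> A" "g = rep (n, \<nu>)" by auto
    obtain \<kappa> where \<kappa>: "\<kappa> \<in> KZ" "g = g0 n \<nu> ** \<kappa>" using rep(2) x by blast
    have "f (matrix_inv g) \<noteq> 0"
    proof
      assume "f (matrix_inv g) = 0"
      then have "\<rho> k (matrix_inv \<kappa>) (v0 n \<nu>) = 0" using val[OF x(1) \<kappa>(1)] \<kappa>(2) by simp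
      then have "v0 n \<nu> = 0" using \<rho>_inverse[OF V GL2_inv[OF KZ_GL2[OF \<kappa>(1)]], of n \<nu>] by simp
      then show False using x(1) by (simp add: A_def)
    qed
    then show "g \<in> coset_rep ` {c \<in> cosets. f (matrix_inv (coset_rep c)) \<noteq> 0}"
      using x(2) coset_in[OF g0_GL2] by (auto simp: rep_def)
  qed
  have inj: "inj_on rep A"
  proof (rule inj_onI)
    fix x y assume "x \<in> A" "y \<in> A" "rep x = rep y"
    moreover obtain n \<nu> where x: "x = (n, \<nu>)" by (cases x)
    moreover obtain m \<mu> where y: "y = (m, \<mu>)" by (cases y)
    ultimately have *: "(n, \<nu>) \<in> A" "(m, \<mu>) \<in> A" "rep (n, \<nu>) = rep (m, \<mu>)" by (simp_all only:)
    then have "coset (g0 n \<nu>) = coset (g0 m \<mu>)"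
      using coset_rep(2)[OF g0_GL2, of n \<nu>] coset_rep(2)[OF g0_GL2, of m \<mu>] unfolding rep_def prod.case by metis
    moreover have "g0 n \<nu> \<in> coset (g0 n \<nu>)" using KZ_1 by (auto simp: coset_def intro!: image_eqI[of _ _ "mat 1"])
    ultimately have "matrix_inv (g0 m \<mu>) ** g0 n \<nu> \<in> KZ" using mem_coset_iff[OF g0_GL2] by blast
    then show "x = y" using g0_KZ[OF I[OF *(2)] I[OF *(1)]] by (simp add: x y)
  qed
  have "T k f h = (\<Sum>x\<in>A. hecke_elem k (rep x) (f (matrix_inv (rep x))) h)"
    unfolding T_def idx by (simp add: sum.reindex[OF inj])
  also have "\<dots> = (\<Sum>(n, \<nu>)\<in>A. \<psi> k (h ** g0 n \<nu>) (v0 n \<nu>))"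
  proof (intro sum.cong refl, clarify)
    fix n \<nu> assume x: "(n, \<nu>) \<in> A"
    obtain \<kappa> where \<kappa>: "\<kappa> \<in> KZ" "rep (n, \<nu>) = g0 n \<nu> ** \<kappa>" using rep(2) by blast
    have "hecke_elem k (rep (n, \<nu>)) (f (matrix_inv (rep (n, \<nu>)))) h = \<psi> k (h ** (g0 n \<nu> ** \<kappa>)) (\<rho> k (matrix_inv \<kappa>) (v0 n \<nu>))"
      using hecke_elem_eq[OF rep(1)[of n \<nu>] h, of "f (matrix_inv (rep (n, \<nu>)))" k] val[OF x \<kappa>(1)] V V_\<rho> by (simp add: \<kappa>(2))
    also have "\<dots> = \<psi> k (h ** g0 n \<nu>) (v0 n \<nu>)"
      using \<psi>_right[OF V \<kappa>(1) GL2_mult[OF h g0_GL2], of n \<nu>] by (simp add: matrix_mul_assoc)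
    finally show "hecke_elem k (rep (n, \<nu>)) (f (matrix_inv (rep (n, \<nu>)))) h = \<psi> k (h ** g0 n \<nu>) (v0 n \<nu>)" .
  qed
  finally show ?thesis by (simp add: A_def)
qed

lemma I_SucI: "\<mu> \<in> I m \<Longrightarrow> x \<in> digits \<Longrightarrow> \<mu> + varpi ^ m * x \<in> I (Suc m)"
  unfolding I_Suc by blast

text \<open>By \<open>g0_DC\<close> only the parent and the children survive in \<open>T_eq\<close>.
  The level is \<open>Suc m\<close> because the root has no parent among the
  \<open>g0\<close>.\<close>

lemma T_at_vertex:
  assumes dec: "decomposition k f v0 v1" and v1: "\<And>n \<mu>. v1 n \<mu> = 0" and \<mu>0: "\<mu>0 \<in> I m" and x: "x \<in> digits"
    and \<mu>_def: "\<mu> = \<mu>0 + varpi ^ m * x"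
  shows "T k f (matrix_inv (g0 (Suc m) \<mu>)) =
      \<psi> k (mat2 (inverse varpi) (- x / varpi) 0 1) (v0 m \<mu>0)
      + (\<Sum>y\<in>digits. \<psi> k (mat2 varpi y 0 1) (v0 (Suc (Suc m)) (\<mu> + varpi ^ Suc m * y)))"
proof -
  define A where "A = {(n, \<nu>). v0 n \<nu> \<noteq> 0}"
  define F where "F = (\<lambda>(n, \<nu>). \<psi> k (matrix_inv (g0 (Suc m) \<mu>) ** g0 n \<nu>) (v0 n \<nu>))"
  define ch where "ch y = (Suc (Suc m), \<mu> + varpi ^ Suc m * y)" for y
  define B where "B = insert (m, \<mu>0) (ch ` digits)"
  have V: "v0 n \<nu> \<in> V k" for n \<nu> using dec by (auto simp: decomposition_def)
  have I: "\<nu> \<in> I n" if "v0 n \<nu> \<noteq> 0" for n \<nu> using dec that by (auto simp: decomposition_def)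
  have fin: "finite A" "finite B" using dec finite_digits by (auto simp: decomposition_def A_def B_def)
  have \<mu>: "\<mu> \<in> I (Suc m)" unfolding \<mu>_def by (rule I_SucI[OF \<mu>0 x])
  have out: "F z = 0" if "z \<in> A - B" for z
  proof (rule ccontr)
    assume F: "F z \<noteq> 0"
    obtain n \<nu> where z: "z = (n, \<nu>)" by (cases z)
    have \<nu>: "\<nu> \<in> I n" using that I by (auto simp: z A_def)
    have "matrix_inv (g0 (Suc m) \<mu>) ** g0 n \<nu> \<in> DC" using F V by (auto simp: F_def z \<psi>_eq split: if_splits)
    from g0_DC[OF \<mu> \<nu> this] show False
    proof
      assume *: "n = Suc (Suc m) \<and> VF.vge (real (Suc m)) (\<nu> - \<mu>)"
      then obtain \<nu>' y where y: "\<nu> = \<nu>' + varpi ^ Suc m * y" "\<nu>' \<in> I (Suc m)" "y \<in> digits" using \<nu> I_Suc[of "Suc m"] by blast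
      have "VF.vge (real (Suc m)) (varpi ^ Suc m * y)" using digits_int[OF y(3)] unfolding vge_varpi_cancel by simp
      then have "VF.vge (real (Suc m)) ((\<nu> - \<mu>) - varpi ^ Suc m * y)" using * by (intro VF.vge_diff[of _ "\<nu> - \<mu>"]) auto
      then have "\<nu>' = \<mu>" using I_unique[OF y(2) \<mu>] by (simp add: y(1))
      then show False using that y * by (auto simp: z B_def ch_def)
    next
      assume *: "Suc m = Suc n \<and> VF.vge (real n) (\<nu> - \<mu>)"
      have "VF.vge (real m) (varpi ^ m * x)" using digits_int[OF x] unfolding vge_varpi_cancel by simp
      then have "VF.vge (real m) ((\<nu> - \<mu>) + varpi ^ m * x)" using * by (intro VF.vge_add) auto
      then have "\<nu> = \<mu>0" using I_unique[of \<nu> m \<mu>0] \<nu> * \<mu>0 by (simp add: \<mu>_def)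
      then show False using that * by (auto simp: z B_def)
    qed
  qed
  have zero: "F z = 0" if "z \<in> B - A" for z using that by (auto simp: F_def A_def)
  have "T k f (matrix_inv (g0 (Suc m) \<mu>)) = sum F A"
    using T_eq[OF dec v1 GL2_inv[OF g0_GL2]] by (simp add: A_def F_def)
  \<comment> \<open>\<open>A\<close> is the support of the decomposition and \<open>B\<close> the
    set of neighbours. Neither need contain the other, so the sum passes through the union.\<close>
  also have "\<dots> = sum F (A \<union> B)" using fin zero by (intro sum.mono_neutral_left) (auto simp del: Diff_iff simp: Un_Diff)
  also have "\<dots> = sum F B" using fin out by (intro sum.mono_neutral_right) auto
  also have "\<dots> = F (m, \<mu>0) + (\<Sum>y\<in>digits. F (ch y))"
  proof -
    have "inj_on ch digits" by (auto simp: ch_def inj_on_def)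
    moreover have "(m, \<mu>0) \<notin> ch ` digits" by (auto simp: ch_def)
    ultimately show ?thesis unfolding B_def using finite_digits by (simp add: sum.reindex)
  qed
  also have "F (m, \<mu>0) = \<psi> k (mat2 (inverse varpi) (- x / varpi) 0 1) (v0 m \<mu>0)"
  proof -
    have "varpi ^ m / varpi ^ Suc m = inverse varpi" "(\<mu>0 - \<mu>) / varpi ^ Suc m = - x / varpi"
      by (simp_all add: \<mu>_def field_simps)
    then show ?thesis unfolding F_def prod.case g0_g0 by (simp only:)
  qed
  also have "(\<Sum>y\<in>digits. F (ch y)) = (\<Sum>y\<in>digits. \<psi> k (mat2 varpi y 0 1) (v0 (Suc (Suc m)) (\<mu> + varpi ^ Suc m * y)))"
  proof (intro sum.cong refl)
    fix y
    have "varpi ^ Suc (Suc m) / varpi ^ Suc m = varpi" "(\<mu> + varpi ^ Suc m * y - \<mu>) / varpi ^ Suc m = y"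
      by simp_all
    then show "F (ch y) = \<psi> k (mat2 varpi y 0 1) (v0 (Suc (Suc m)) (\<mu> + varpi ^ Suc m * y))"
      unfolding F_def ch_def prod.case g0_g0 by (simp only:)
  qed
  finally show ?thesis .
qed

end

section \<open>Dehomogenization\<close>

lemma const_pCons_hom: "is_ring_hom (\<lambda>c::'c::field. [:c:])"
  by (simp add: is_ring_hom_def one_pCons)

lemma minus_X_power: "([:0, - 1:] :: 'c::field poly) ^ i = monom ((- 1) ^ i) i"
proof -
  have "[:0, - 1 :: 'c:] = monom (- 1) 1" by (simp add: monom_altdef)
  then show ?thesis by (simp only: monom_power mult_1)
qed

context hecke_finite begin

text \<open>Dehomogenization \<open>x = 1\<close>, \<open>y = - z\<close>; the sign turns the Hecke operator into \<open>P(z) \<mapsto> P(\<pi> z + \<xi>)\<close>.\<close>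

definition dehom :: "('f \<Rightarrow> 'c, 'c) xy_poly \<Rightarrow> 'c poly" where
  "dehom = insertion (\<lambda>c. [:c:]) (\<lambda>z. case z of X _ \<Rightarrow> 1 | Y _ \<Rightarrow> [:0, - 1:])"

lemma dehom_add: "dehom (P + R) = dehom P + dehom R"
  unfolding dehom_def by (rule insertion_add[OF const_pCons_hom])

lemma dehom_diff: "dehom (P - R) = dehom P - dehom R"
  using dehom_add[of "P - R" R] by simp

lemma dehom_0 [simp]: "dehom 0 = 0" by (simp add: dehom_def insertion_def)

lemma dehom_sum: "dehom (sum f A) = (\<Sum>i\<in>A. dehom (f i))"
  unfolding dehom_def by (rule insertion_sum[OF const_pCons_hom])

lemma dehom_const_mult: "dehom (const_poly c * P) = smult c (dehom P)"
  unfolding dehom_def by (simp add: insertion_mult[OF const_pCons_hom] insertion_const[OF const_pCons_hom])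

lemma V_diff: "P \<in> V k \<Longrightarrow> R \<in> V k \<Longrightarrow> P - R \<in> V k"
  unfolding V_def using keys_diff[of P R] by blast

text \<open>The parameter of the vertex reached from \<open>(m, \<mu>)\<close> along
  \<open>w\<close>. Lists carry digits in \<open>C\<close>, and \<open>\<delta>\<close> takes them
  back to \<open>F\<close>.\<close>

primrec node :: "('c \<Rightarrow> 'f) \<Rightarrow> nat \<Rightarrow> 'f \<Rightarrow> 'c list \<Rightarrow> 'f" where
  "node \<delta> m \<mu> [] = \<mu>"
| "node \<delta> m \<mu> (\<xi> # w) = node \<delta> m \<mu> w + varpi ^ (m + length w) * \<delta> \<xi>"

lemma node_in:
  assumes "\<mu> \<in> I m" "\<And>\<xi>. \<xi> \<in> D \<Longrightarrow> \<delta> \<xi> \<in> digits" "w \<in> lists D"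
  shows "node \<delta> m \<mu> w \<in> I (m + length w)"
  using assms(3) by (induction w) (auto simp: assms(1,2) intro!: I_SucI)

text \<open>The swap matrix moves the entry \<open>inverse varpi\<close> of
  \<open>matrix_inv \<alpha>\<close> to the upper left corner, where the parent's matrix has
  it.\<close>

lemma up_DC: assumes "x \<in> digits" shows "mat2 (inverse varpi) (- x / varpi) 0 1 \<in> DC"
proof -
  have "mat2 0 1 1 0 \<in> K" "mat2 0 1 1 (- x) \<in> K"
    using digits_int[OF assms] by (auto simp: K_iff mge_iff det_mat2)
  moreover have "mat2 (inverse varpi) (- x / varpi) 0 1 = mat2 0 1 1 0 ** matrix_inv \<alpha> ** mat2 0 1 1 (- x)"
    by (simp add: \<alpha>_inv mat2_calc field_simps)
  ultimately show ?thesis unfolding DC_def using K_KZ by blast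
qed

lemma down_DC: assumes "y \<in> digits" shows "mat2 varpi y 0 1 \<in> DC"
proof -
  have 1: "VF.vge 1 varpi" using vF_varpi by (simp add: VF.vge_def one_ereal_def)
  have "mge 1 (mat2 varpi (varpi * y) 0 varpi)"
    using 1 VF.vge_mult[OF 1 digits_int[OF assms]] by (simp add: mge_iff)
  moreover have "vF (det (mat2 varpi (varpi * y) 0 varpi)) = ereal 2"
    using vF_varpi by (simp add: det_mat2 VF.v_mult one_ereal_def)
  ultimately have "mat2 varpi (varpi * y) 0 varpi \<in> KZ" unfolding KZ_iff by (intro exI[of _ 1]) simp
  moreover have "mat2 varpi y 0 1 = mat2 varpi (varpi * y) 0 varpi ** matrix_inv \<alpha> ** mat 1"
    by (simp add: \<alpha>_inv mat2_calc field_simps)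
  ultimately show ?thesis unfolding DC_def using KZ_1 by blast
qed

section \<open>Weights concentrated in one embedding\<close>

context
  fixes \<sigma> :: "'f \<Rightarrow> 'c" and ks :: "('f \<Rightarrow> 'c) \<Rightarrow> nat" and k :: nat
  assumes \<sigma>: "\<sigma> \<in> S" and ks: "ks \<sigma> = k" "\<And>\<tau>. \<tau> \<in> S \<Longrightarrow> \<tau> \<noteq> \<sigma> \<Longrightarrow> ks \<tau> = 0"
begin

lemma prod_ks: "(\<Prod>\<tau>\<in>S. f \<tau> ^ ks \<tau>) = f \<sigma> ^ k" for f :: "_ \<Rightarrow> 'c"
proof -
  have "(\<Prod>\<tau>\<in>S. f \<tau> ^ ks \<tau>) = (\<Prod>\<tau>\<in>{\<sigma>}. f \<tau> ^ ks \<tau>)"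
    using finite_S \<sigma> ks(2) by (intro prod.mono_neutral_right) auto
  then show ?thesis by (simp add: ks(1))
qed

definition mon :: "nat \<Rightarrow> ('f \<Rightarrow> 'c) xy \<Rightarrow>\<^sub>0 nat" where
  "mon i = Poly_Mapping.single (X \<sigma>) (k - i) + Poly_Mapping.single (Y \<sigma>) i"

lemma keys_mon: assumes P: "P \<in> V ks" and m: "m \<in> Poly_Mapping.keys P" shows "m \<in> mon ` {..k}"
proof -
  have deg: "coef m (X \<sigma>) + coef m (Y \<sigma>) = k" using V_degree[OF P m \<sigma>] ks by simp
  have "coef m z = 0" if "z \<noteq> X \<sigma>" "z \<noteq> Y \<sigma>" for z
  proof (cases "z \<in> vars")
    case True
    then obtain \<tau> where \<tau>: "\<tau> \<in> S" "z = X \<tau> \<or> z = Y \<tau>" by (auto simp: vars_def)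
    then have "\<tau> \<noteq> \<sigma>" using that by auto
    then show ?thesis using V_degree[OF P m \<tau>(1)] ks(2)[OF \<tau>(1)] \<tau>(2) by auto
  next
    case False
    then show ?thesis using V_keys[OF P m] by (auto simp: in_keys_iff)
  qed
  then have "m = mon (coef m (Y \<sigma>))"
    using deg by (intro poly_mapping_eqI) (auto simp: mon_def lookup_add lookup_single when_def)
  then show ?thesis using deg by (metis atMost_iff imageI le_add2)
qed

lemma inj_mon: "inj_on mon A"
proof (rule inj_onI)
  fix i j assume "mon i = mon j"
  then have "coef (mon i) (Y \<sigma>) = coef (mon j) (Y \<sigma>)" by simp
  then show "i = j" by (simp add: mon_def lookup_add lookup_single when_def)
qed

lemma insertion_mon:
  assumes "is_ring_hom \<kappa>" "P \<in> V ks"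
  shows "insertion \<kappa> h P = (\<Sum>i\<le>k. \<kappa> (coef P (mon i)) * (h (X \<sigma>) ^ (k - i) * h (Y \<sigma>) ^ i))"
proof -
  have "insertion \<kappa> h P = (\<Sum>m\<in>mon ` {..k}. \<kappa> (coef P m) * monev h m)"
    using keys_mon[OF assms(2)] by (intro insertion_superset[OF assms(1)]) auto
  then show ?thesis by (simp add: sum.reindex[OF inj_mon]) (simp add: mon_def monev_add monev_single)
qed

lemma dehom_eq: "P \<in> V ks \<Longrightarrow> dehom P = (\<Sum>i\<le>k. smult (coef P (mon i)) ([:0, - 1:] ^ i))"
  unfolding dehom_def by (simp add: insertion_mon[OF const_pCons_hom])

lemma coeff_dehom: "P \<in> V ks \<Longrightarrow> coeff (dehom P) i = (if i \<le> k then (- 1) ^ i * coef P (mon i) else 0)"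
  by (simp add: dehom_eq coeff_sum minus_X_power mult.commute if_distrib[where f = "\<lambda>x. _ * x"] cong: if_cong)

lemma degree_dehom: "P \<in> V ks \<Longrightarrow> degree (dehom P) \<le> k"
  by (rule degree_le) (simp add: coeff_dehom)

lemma pge_dehom: assumes "P \<in> V ks" shows "VC.pge t (dehom P) \<longleftrightarrow> cge t P"
proof -
  have sign: "VC.vge t ((- 1) ^ i * x) \<longleftrightarrow> VC.vge t x" for i x by (cases "even i") auto
  have "cge t P \<longleftrightarrow> (\<forall>i\<le>k. VC.vge t (coef P (mon i)))"
  proof
    assume *: "\<forall>i\<le>k. VC.vge t (coef P (mon i))"
    have "VC.vge t (coef P m)" for m
      using keys_mon[OF assms, of m] * by (cases "m \<in> Poly_Mapping.keys P") (auto simp: in_keys_iff)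
    then show "cge t P" by (simp add: cge_def)
  qed (simp add: cge_def)
  then show ?thesis by (simp add: VC.pge_def coeff_dehom[OF assms] sign)
qed

text \<open>\<open>c0\<close> and \<open>twist\<close> combine to \<open>sq \<sigma>\<close> with
  exponent \<open>(1 - j) * k\<close>. This is \<open>\<sigma> varpi ^ k\<close> for the parent,
  where \<open>j = - 1\<close>, and 1 for the children, where \<open>j = 1\<close>; no square root
  survives.\<close>

lemma dehom_\<psi>:
  assumes "P \<in> V ks" "g \<in> DC" "vF (det g) = ereal (of_int j)"
  shows "dehom (\<psi> ks g P) = smult ((sq \<sigma> powi (1 - j)) ^ k) (\<Sum>i\<le>k. smult (coef P (mon i))
    ([:\<sigma> (g $ 1 $ 1), - \<sigma> (g $ 2 $ 1):] ^ (k - i) * [:\<sigma> (g $ 1 $ 2), - \<sigma> (g $ 2 $ 2):] ^ i))"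
proof -
  have "c0 ks * twist ks g = sq \<sigma> ^ k * (sq \<sigma> powi (- j)) ^ k"
    unfolding c0_def twist_def ordF_eqI[OF assms(3)] prod_ks ..
  also have "\<dots> = (sq \<sigma> powi (1 - j)) ^ k"
    using power_int_add[of "sq \<sigma>" 1 "- j"] sq_S(2)[OF \<sigma>] by (simp flip: power_mult_distrib)
  finally have c: "c0 ks * twist ks g = (sq \<sigma> powi (1 - j)) ^ k" .
  have im: "dehom (var_image g (X \<tau>)) = [:\<tau> (g $ 1 $ 1), - \<tau> (g $ 2 $ 1):]" "dehom (var_image g (Y \<tau>)) = [:\<tau> (g $ 1 $ 2), - \<tau> (g $ 2 $ 2):]" for \<tau>
    by (simp_all add: dehom_add dehom_const_mult) (simp_all add: dehom_def insertion_var[OF const_pCons_hom])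
  have "dehom (\<psi> ks g P) = smult (c0 ks * twist ks g) (dehom (\<rho>0 g P))"
    by (simp add: \<psi>_eq[OF assms(1)] assms(2) \<rho>_eq dehom_const_mult)
  also have "dehom (\<rho>0 g P) = insertion (\<lambda>c. [:c:]) (\<lambda>z. dehom (var_image g z)) P"
    unfolding \<rho>0_def dehom_def by (rule insertion_insertion[OF const_pCons_hom])
  also have "\<dots> = (\<Sum>i\<le>k. smult (coef P (mon i))
    ([:\<sigma> (g $ 1 $ 1), - \<sigma> (g $ 2 $ 1):] ^ (k - i) * [:\<sigma> (g $ 1 $ 2), - \<sigma> (g $ 2 $ 2):] ^ i))"
    unfolding insertion_mon[OF const_pCons_hom assms(1)] im by simp
  finally show ?thesis unfolding c .
qed

context
  fixes d r :: nat and a :: 'c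
  assumes k_eq: "k = d * q + r" and r_less: "r < q"
begin

interpretation HD: hecke_digits vC p q e "\<sigma> varpi" "\<sigma> ` digits" k d r a
  unfolding hecke_digits_def hecke_digits_axioms_def using digit_field_S[OF \<sigma>] k_eq r_less by blast

lemma dehom_up:
  assumes P: "P \<in> V ks" and x: "x \<in> digits"
  shows "dehom (\<psi> ks (mat2 (inverse varpi) (- x / varpi) 0 1) P) = HD.Tp (\<sigma> x) (dehom P)"
proof -
  note hom = ring_hom_facts[OF S_hom(1)[OF \<sigma>]] ring_hom_inverse[OF S_hom(1)[OF \<sigma>]]
  have nz: "\<sigma> varpi \<noteq> 0" by (simp add: hom)
  have j: "vF (det (mat2 (inverse varpi) (- x / varpi) 0 1)) = ereal (of_int (- 1))"
    using VF.v_inverse[of varpi 1] vF_varpi by (simp add: det_mat2 one_ereal_def)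
  have "sq \<sigma> powi (1 - (- 1)) = \<sigma> varpi" using sq_S(1)[OF \<sigma>] by simp
  then have "dehom (\<psi> ks (mat2 (inverse varpi) (- x / varpi) 0 1) P) = smult (\<sigma> varpi ^ k) (\<Sum>i\<le>k. smult (coef P (mon i))
    ([:inverse (\<sigma> varpi):] ^ (k - i) * [:- \<sigma> x / \<sigma> varpi, - 1:] ^ i))"
    unfolding dehom_\<psi>[OF P up_DC[OF x] j] by (simp add: hom divide_inverse)
  also have "\<dots> = (\<Sum>i\<le>k. smult (coef P (mon i)) ([:- \<sigma> x, - \<sigma> varpi:] ^ i))"
    unfolding smult_sum_right
  proof (intro sum.cong refl)
    fix i assume "i \<in> {..k}"
    then have "\<sigma> varpi ^ k = \<sigma> varpi ^ (k - i) * \<sigma> varpi ^ i" by (simp flip: power_add)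
    then have "\<sigma> varpi ^ k * inverse (\<sigma> varpi) ^ (k - i) = \<sigma> varpi ^ i" using nz by (simp add: power_inverse)
    moreover have "[:inverse (\<sigma> varpi):] ^ (k - i) = [:inverse (\<sigma> varpi) ^ (k - i):]" by (simp add: poly_const_pow)
    moreover have "smult (\<sigma> varpi ^ i) ([:- \<sigma> x / \<sigma> varpi, - 1:] ^ i) = [:- \<sigma> x, - \<sigma> varpi:] ^ i"
      using nz by (simp flip: smult_power)
    ultimately show "smult (\<sigma> varpi ^ k) (smult (coef P (mon i)) ([:inverse (\<sigma> varpi):] ^ (k - i) * [:- \<sigma> x / \<sigma> varpi, - 1:] ^ i))
        = smult (coef P (mon i)) ([:- \<sigma> x, - \<sigma> varpi:] ^ i)"
      by (simp add: mult.left_commute[of _ "coef P (mon i)"] mult.assoc) (metis smult_smult)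
  qed
  also have "\<dots> = HD.Tp (\<sigma> x) (dehom P)"
    by (simp add: dehom_eq[OF P] HD.Tp_sum HD.Tp_smult HD.Tp_power) (simp add: HD.Tp_def pcompose_pCons)
  finally show ?thesis .
qed

lemma dehom_down:
  assumes P: "P \<in> V ks" and y: "y \<in> digits"
  shows "dehom (\<psi> ks (mat2 varpi y 0 1) P) = HD.Tm (\<sigma> y) (dehom P)"
proof -
  note hom = ring_hom_facts[OF S_hom(1)[OF \<sigma>]] ring_hom_inverse[OF S_hom(1)[OF \<sigma>]]
  have j: "vF (det (mat2 varpi y 0 1)) = ereal (of_int 1)"
    using vF_varpi by (simp add: det_mat2 one_ereal_def)
  have "dehom (\<psi> ks (mat2 varpi y 0 1) P) = (\<Sum>i\<le>k. smult (coef P (mon i)) ([:\<sigma> varpi:] ^ (k - i) * [:\<sigma> y, - 1:] ^ i))"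
    unfolding dehom_\<psi>[OF P down_DC[OF y] j] by (simp add: hom)
  also have "\<dots> = (\<Sum>s\<le>k. smult (coef P (mon (k - s))) ([:\<sigma> varpi:] ^ s * [:\<sigma> y, - 1:] ^ (k - s)))"
    by (rule sum.reindex_bij_witness[of _ "\<lambda>i. k - i" "\<lambda>i. k - i"]) auto
  also have "\<dots> = HD.Tm (\<sigma> y) (dehom P)"
    unfolding HD.Tm_def
  proof (intro sum.cong refl)
    fix s assume "s \<in> {..k}"
    have "[:\<sigma> y, - 1:] ^ (k - s) = smult ((- 1) ^ (k - s)) ([:- \<sigma> y, 1:] ^ (k - s))"
      by (simp flip: smult_power)
    moreover have "[:\<sigma> varpi:] ^ s = [:\<sigma> varpi ^ s:]" by (simp add: poly_const_pow)
    ultimately show "smult (coef P (mon (k - s))) ([:\<sigma> varpi:] ^ s * [:\<sigma> y, - 1:] ^ (k - s))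
        = smult (\<sigma> varpi ^ s * coeff (dehom P) (k - s)) ([:- \<sigma> y, 1:] ^ (k - s))"
      by (simp add: coeff_dehom[OF P] mult.commute mult.left_commute)
  qed
  finally show ?thesis .
qed

text \<open>\<open>tree_bound\<close> is applied to the subtree with root \<open>(m, \<mu>)\<close>,
  whose equations live at levels greater than \<open>N\<close>, and is evaluated at that
  root.\<close>

lemma coefficient_bound:
  assumes dec: "decomposition ks f v0 v1" and v1: "\<And>n \<mu>. v1 n \<mu> = 0" and k0: "k \<noteq> 0"
    and cases: "(real k \<le> 1 / 2 * real q ^ 2 \<and> int r < int q - int d \<and> 0 \<le> vC a \<and> vC a \<le> 1)
       \<or> (real k \<le> 1 / 2 * real q ^ 2 \<and> 2 * vC a - 1 \<le> ereal (real r) \<and> int r < int q - int d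
            \<and> 1 \<le> vC a \<and> vC a \<le> ereal (real e))
       \<or> (real k \<le> min (real p * real q - 1) (1 / 2 * real q ^ 2) \<and> int d - 1 \<le> int r
            \<and> ereal (real d) \<le> vC a)"
    and T: "\<And>m \<mu>. N \<le> m \<Longrightarrow> \<mu> \<in> I (Suc m) \<Longrightarrow>
      cge t (T ks f (matrix_inv (g0 (Suc m) \<mu>)) - const_poly a * f (matrix_inv (g0 (Suc m) \<mu>)))"
    and m: "N \<le> m" "\<mu> \<in> I m"
  shows "cge (t - real (2 * k + 2)) (v0 m \<mu>)"
proof -
  have V: "v0 n \<nu> \<in> V ks" for n \<nu> using dec by (auto simp: decomposition_def)
  have inj: "inj_on \<sigma> digits"
    using ring_hom_inverse(2)[OF S_hom(1)[OF \<sigma>]] ring_hom_facts(6)[OF S_hom(1)[OF \<sigma>]] by (metis inj_onI right_minus_eq)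
  define nd where "nd = node (inv_into digits \<sigma>) m \<mu>"
  have nd: "nd w \<in> I (m + length w)" if "w \<in> lists (\<sigma> ` digits)" for w
    unfolding nd_def by (rule node_in[OF m(2) _ that]) (auto intro: inv_into_into)
  have nd_Cons: "nd (\<sigma> y # w) = nd w + varpi ^ (m + length w) * y" if "y \<in> digits" for y w
    using inj that by (simp add: nd_def)
  define x where "x w = dehom (v0 (m + length w) (nd w))" for w
  have "HD.tree_solution t x"
    unfolding HD.tree_solution_def
  proof (intro conjI ballI)
    fix w show "degree (x w) \<le> k" unfolding x_def by (rule degree_dehom[OF V])
  next
    have "finite (fst ` {(n, \<nu>). v0 n \<nu> \<noteq> 0})" using dec by (simp add: decomposition_def)
    then obtain M where M: "\<forall>n\<in>fst ` {(n, \<nu>). v0 n \<nu> \<noteq> 0}. n < M" using finite_nat_set_iff_bounded by blast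
    have "v0 n \<nu> = 0" if "M \<le> n" for n \<nu>
    proof (rule ccontr)
      assume "v0 n \<nu> \<noteq> 0"
      then have "n \<in> fst ` {(n, \<nu>). v0 n \<nu> \<noteq> 0}" by force
      then show False using M that by fastforce
    qed
    then show "\<exists>M. \<forall>w\<in>lists (\<sigma> ` digits). M \<le> length w \<longrightarrow> x w = 0" by (intro exI[of _ M]) (auto simp: x_def)
  next
    fix w \<xi> assume w: "w \<in> lists (\<sigma> ` digits)" and "\<xi> \<in> \<sigma> ` digits"
    then obtain y where y: "y \<in> digits" "\<xi> = \<sigma> y" by blast
    define l where "l = m + length w"
    define \<nu> where "\<nu> = nd w + varpi ^ l * y"
    have \<nu>: "\<nu> \<in> I (Suc l)" "nd (\<xi> # w) = \<nu>" "nd w \<in> I l"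
      using nd[OF w] y I_SucI[OF nd[OF w] y(1)] nd_Cons[OF y(1), of w] by (auto simp: \<nu>_def l_def)
    define R where "R = \<psi> ks (mat2 (inverse varpi) (- y / varpi) 0 1) (v0 l (nd w))
      + (\<Sum>z\<in>digits. \<psi> ks (mat2 varpi z 0 1) (v0 (Suc (Suc l)) (\<nu> + varpi ^ Suc l * z))) - const_poly a * v0 (Suc l) \<nu>"
    have RV: "R \<in> V ks" unfolding R_def by (intro V_diff V_add V_sum V_\<psi> V_const_mult V)
    have "cge t R"
      using T[OF _ \<nu>(1)] m(1) T_at_vertex[OF dec v1 \<nu>(3) y(1) \<nu>_def] decomposition_at_g0[OF dec \<nu>(1)]
      by (simp add: R_def l_def)
    then have "VC.pge t (dehom R)" using pge_dehom[OF RV] by simp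
    also have "dehom R = HD.Tp (\<sigma> y) (x w) + (\<Sum>z\<in>digits. HD.Tm (\<sigma> z) (x (\<sigma> z # \<xi> # w))) - smult a (x (\<xi> # w))"
      unfolding R_def dehom_diff dehom_add dehom_sum dehom_const_mult dehom_up[OF V y(1)]
      by (simp add: dehom_down[OF V] x_def nd_Cons \<nu>(2) l_def cong: sum.cong)
    also have "(\<Sum>z\<in>digits. HD.Tm (\<sigma> z) (x (\<sigma> z # \<xi> # w))) = (\<Sum>\<xi>'\<in>\<sigma> ` digits. HD.Tm \<xi>' (x (\<xi>' # \<xi> # w)))"
      by (simp add: sum.reindex[OF inj])
    finally show "HD.node_eq t \<xi> (x w) (x (\<xi> # w)) (\<lambda>\<xi>'. x (\<xi>' # \<xi> # w))" unfolding HD.node_eq_def y(2) .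
  qed
  from HD.tree_bound[OF this _ k0 cases, of "[]"] show ?thesis
    using pge_dehom[OF V] by (simp add: x_def nd_def)
qed

text \<open>\<open>f\<close> is cut at level \<open>N\<close>: the part at levels below
  \<open>N\<close> lies in \<open>B ks (N - 1)\<close>, and \<open>coefficient_bound\<close> puts
  the rest into the lattice. Thus \<open>\<epsilon> = 2 * k + 2\<close> serves for every
  \<open>N > 0\<close>.\<close>

theorem separated_single_weight:
  assumes k0: "k \<noteq> 0"
    and cases: "(real k \<le> 1 / 2 * real q ^ 2 \<and> int r < int q - int d \<and> 0 \<le> vC a \<and> vC a \<le> 1)
       \<or> (real k \<le> 1 / 2 * real q ^ 2 \<and> 2 * vC a - 1 \<le> ereal (real r) \<and> int r < int q - int d
            \<and> 1 \<le> vC a \<and> vC a \<le> ereal (real e))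
       \<or> (real k \<le> min (real p * real q - 1) (1 / 2 * real q ^ 2) \<and> int d - 1 \<le> int r
            \<and> ereal (real d) \<le> vC a)"
  shows "separated ks a"
proof -
  have \<sigma>\<^sub>0: "\<sigma>\<^sub>0 \<in> S" using \<sigma>\<^sub>0_hom by (simp add: S_def)
  define \<omega> where "\<omega> i = \<sigma>\<^sub>0 varpi powi i" for i
  have nz: "\<sigma>\<^sub>0 varpi \<noteq> 0" using ring_hom_inverse(2)[OF \<sigma>\<^sub>0_hom(1)] by simp
  have \<omega>: "vC (\<omega> i) = ereal (of_int i)" for i
    using v_powi[OF nz, of 1 i] vC_S[OF \<sigma>\<^sub>0, of varpi] vF_varpi by (simp add: \<omega>_def one_ereal_def)
  define \<epsilon> where "\<epsilon> = 2 * k + 2"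
  have "f \<in> B_plus_lattice ks (N - 1) (int n - int \<epsilon>)"
    if N: "0 < N" and f: "f \<in> B_zero ks" and lat: "(\<lambda>h. T ks f h - const_poly a * f h) \<in> B_plus_lattice ks N (int n)" for N n f
  proof -
    obtain v0 v1 where dec: "decomposition ks f v0 v1" and v1: "\<And>n \<mu>. v1 n \<mu> = 0" using f by (auto simp: B_zero_def)
    obtain f1 f2 where f': "(\<lambda>h. T ks f h - const_poly a * f h) = (\<lambda>h. f1 h + const_poly (\<omega> (int n)) * f2 h)"
      and f12: "f1 \<in> B ks N" "f2 \<in> ind ks (V0 ks)" using lat unfolding B_plus_lattice_def \<omega>_def by blast
    obtain w0 w1 where w: "decomposition ks f1 w0 w1" "\<And>n \<mu>. N < n \<Longrightarrow> w0 n \<mu> = 0" using f12(1) by (auto simp: B_def)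
    \<comment> \<open>\<open>f1\<close> has no component at levels greater than \<open>N\<close>, so
      only the lattice part is left there.\<close>
    have small: "cge (real n) (T ks f (matrix_inv (g0 (Suc m) \<mu>)) - const_poly a * f (matrix_inv (g0 (Suc m) \<mu>)))"
      if "N \<le> m" "\<mu> \<in> I (Suc m)" for m \<mu>
    proof -
      have "f1 (matrix_inv (g0 (Suc m) \<mu>)) = 0" using decomposition_at_g0[OF w(1) that(2)] w(2) that(1) by simp
      moreover have "cge 0 (f2 (matrix_inv (g0 (Suc m) \<mu>)))"
        using f12(2) GL2_inv[OF g0_GL2] by (auto simp: ind_def V0_iff)
      then have "cge (real n + 0) (const_poly (\<omega> (int n)) * f2 (matrix_inv (g0 (Suc m) \<mu>)))"
        by (rule cge_const_mult[rotated]) (simp add: VC.vge_def \<omega>)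
      ultimately show ?thesis by (simp add: fun_cong[OF f'])
    qed
    have bound: "cge (real n - real \<epsilon>) (v0 m \<mu>)" if "N \<le> m" "\<mu> \<in> I m" for m \<mu>
      unfolding \<epsilon>_def by (rule coefficient_bound[OF dec v1 k0 cases small that])
    define A where "A = {(m, \<mu>). v0 m \<mu> \<noteq> 0}"
    define A1 where "A1 = {x \<in> A. fst x < N}"
    define A2 where "A2 = {x \<in> A. N \<le> fst x}"
    have V: "v0 n \<nu> \<in> V ks" for n \<nu> using dec by (auto simp: decomposition_def)
    have I: "\<nu> \<in> I n" if "(n, \<nu>) \<in> A" for n \<nu> using dec that by (auto simp: decomposition_def A_def)
    have fin: "finite A" "finite A1" "finite A2" using dec by (auto simp: decomposition_def A_def A1_def A2_def)
    define F1 where "F1 h = (\<Sum>x\<in>A1. elem ks (g0 (fst x) (snd x)) (v0 (fst x) (snd x)) h)" for h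
    \<comment> \<open>The factor \<open>\<omega> (int \<epsilon> - int n)\<close> makes the
      coefficients integral; the factor \<open>\<omega> (int n - int \<epsilon>)\<close> of the
      lattice cancels it.\<close>
    define F2 where "F2 h = (\<Sum>x\<in>A2. elem ks (g0 (fst x) (snd x)) (const_poly (\<omega> (int \<epsilon> - int n)) * v0 (fst x) (snd x)) h)" for h
    have "F1 \<in> ind ks (V ks)"
      unfolding F1_def using V_ind_closed V fin g0_GL2 by (intro ind_sum) (auto intro!: elem_ind)
    moreover have "decomposition ks F1 (\<lambda>m \<mu>. if m < N then v0 m \<mu> else 0) (\<lambda>_ _. 0)"
    proof -
      have "{(m, \<mu>). (if m < N then v0 m \<mu> else 0) \<noteq> 0} = A1" by (auto simp: A1_def A_def split: if_splits)
      moreover have "F1 h = (\<Sum>(m, \<mu>)\<in>A1. elem ks (g0 m \<mu>) (if m < N then v0 m \<mu> else 0) h)" for h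
        unfolding F1_def by (intro sum.cong) (auto simp: A1_def)
      ultimately show ?thesis using dec fin V by (auto simp: decomposition_def)
    qed
    ultimately have B: "F1 \<in> B ks (N - 1)" unfolding B_def using N by force
    have F2: "F2 \<in> ind ks (V0 ks)"
      unfolding F2_def
    proof (rule ind_sum[OF V0_ind_closed(2,4)])
      fix x assume "x \<in> A2"
      then have "cge (real n - real \<epsilon>) (v0 (fst x) (snd x))" using bound I[of "fst x" "snd x"] by (simp add: A2_def)
      then have "cge (real \<epsilon> - real n + (real n - real \<epsilon>)) (const_poly (\<omega> (int \<epsilon> - int n)) * v0 (fst x) (snd x))"
        by (rule cge_const_mult[rotated]) (simp add: VC.vge_def \<omega>)
      then have "const_poly (\<omega> (int \<epsilon> - int n)) * v0 (fst x) (snd x) \<in> V0 ks" by (simp add: V0_iff V_const_mult V)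
      then show "elem ks (g0 (fst x) (snd x)) (const_poly (\<omega> (int \<epsilon> - int n)) * v0 (fst x) (snd x)) \<in> ind ks (V0 ks)"
        using V0_ind_closed by (intro elem_ind g0_GL2) auto
    qed (use fin in auto)
    have "f h = F1 h + const_poly (\<omega> (int n - int \<epsilon>)) * F2 h" for h
    proof -
      have "\<omega> (int n - int \<epsilon>) * \<omega> (int \<epsilon> - int n) = 1"
        using power_int_add[of "\<sigma>\<^sub>0 varpi" "int n - int \<epsilon>" "int \<epsilon> - int n"] nz by (simp add: \<omega>_def)
      then have "const_poly (\<omega> (int n - int \<epsilon>)) * (const_poly (\<omega> (int \<epsilon> - int n)) * P) = P" for P :: "('f \<Rightarrow> 'c, 'c) xy_poly"
        by (simp flip: mult.assoc const_poly_simps(3)) (simp add: const_poly_simps)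
      then have "const_poly (\<omega> (int n - int \<epsilon>)) * F2 h = (\<Sum>x\<in>A2. elem ks (g0 (fst x) (snd x)) (v0 (fst x) (snd x)) h)"
        by (simp add: F2_def sum_distrib_left elem_const_mult)
      moreover have "A = A1 \<union> A2" "A1 \<inter> A2 = {}" by (auto simp: A1_def A2_def)
      ultimately have "F1 h + const_poly (\<omega> (int n - int \<epsilon>)) * F2 h = (\<Sum>x\<in>A. elem ks (g0 (fst x) (snd x)) (v0 (fst x) (snd x)) h)"
        using fin by (simp add: F1_def sum.union_disjoint)
      then show ?thesis using dec v1 by (simp add: decomposition_def A_def case_prod_unfold)
    qed
    then show ?thesis using B F2 unfolding B_plus_lattice_def \<omega>_def by blast
  qed
  then show ?thesis unfolding separated_def by blast
qed

end

end

end

theorem theorem4p6: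
  fixes p :: nat and vp :: "'k::field_char_0 \<Rightarrow> ereal"
    and iF :: "'k \<Rightarrow> 'f::field" and iC :: "'k \<Rightarrow> 'c::field"
    and vF :: "'f \<Rightarrow> ereal" and varpi :: 'f and e :: nat and vC :: "'c \<Rightarrow> ereal"
    and sq :: "('f \<Rightarrow> 'c) \<Rightarrow> 'c" and \<sigma>\<^sub>0 \<sigma> :: "'f \<Rightarrow> 'c"
    and ks :: "('f \<Rightarrow> 'c) \<Rightarrow> nat" and a :: 'c and k d r q :: nat
  assumes "hecke_setting p vp iF iC vF varpi e vC sq \<sigma>\<^sub>0"
    and q: "q = hecke_setting.q vF"
    and "\<sigma> \<in> hecke_setting.S iF iC" and "ks \<sigma> = k" and "k \<noteq> 0"
    and "\<forall>\<tau> \<in> hecke_setting.S iF iC. \<tau> \<noteq> \<sigma> \<longrightarrow> ks \<tau> = 0"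
    and "k = d * q + r" and "r < q"
    and "a \<in> hecke_setting.OC vC"
    and "(real k \<le> 1 / 2 * real q ^ 2 \<and> int r < int q - int d \<and> 0 \<le> vC a \<and> vC a \<le> 1)
       \<or> (real k \<le> 1 / 2 * real q ^ 2 \<and> 2 * vC a - 1 \<le> ereal (real r) \<and> int r < int q - int d
            \<and> 1 \<le> vC a \<and> vC a \<le> ereal (real e))
       \<or> (real k \<le> min (real p * real q - 1) (1 / 2 * real q ^ 2) \<and> int d - 1 \<le> int r
            \<and> ereal (real d) \<le> vC a)"
  shows "hecke_setting.separated iF iC vF varpi vC sq \<sigma>\<^sub>0 ks a"
proof -
  interpret HS: hecke_setting p vp iF iC vF varpi e vC sq \<sigma>\<^sub>0 by fact
  have "finite HS.residue_field"
    using \<open>r < q\<close> by (intro card_ge_0_finite) (simp add: q HS.q_def)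
  then interpret hecke_finite p vp iF iC vF varpi e vC sq \<sigma>\<^sub>0 by unfold_locales
  show ?thesis
    by (rule separated_single_weight[of \<sigma> ks k d r a]) (use assms in \<open>auto simp: q\<close>)
qed

end
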